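(* Let $X$ be a Banach space and let $L$ be the infinitesimal generator of a uniformly bounded $C_0$-semigroup $\{e^{tL}\}_{t\ge 0}$ on $X$. Assume that $0\in\rho(L)$. Let $s>0$ be any noninteger and let $[s]$ be its integer part. Given any $u\in X$, define $$U(y)=U[u](y)=\frac{y^{2s}}{4^s\Gamma(s)}\int_0^\infty e^{-y^2/(4t)}e^{tL}u\,\frac{dt}{t^{1+s}},\qquad y>0.$$ The following statements hold. (a) For any $k\ge 0$, $U\in C^\infty((0,\infty);D(L^k))\cap C([0,\infty);X)$, and $U$ is a bounded classical solution to the higher order extension problem $$\begin{cases}\big(L+\frac{1-2(s-[s])}{y}\partial_y+\partial_{yy}\big)^{[s]+1}U=0 & \text{for } y>0\\ \lim_{y\to0}U(y)=u & \text{in } X\end{cases}$$ and to the second order extension problem $$\begin{cases}LU+\frac{1-2s}{y}\partial_yU+\partial_{yy}U=0 & \text{for } y>0\\ \lim_{y\to0}U(y)=u & \text{in } X.\end{cases}$$ (b) If $f\in X$ and $u\in D((-L)^s)$ is the unique solution to $(-L)^su=f$, then $$\begin{aligned}U(y)&=\sum_{k=0}^{[s]}\frac{y^{2k}\Gamma(s-k)}{4^kk!\,\Gamma(s)}L^ku+\frac{1}{\Gamma(s)}\int_0^\infty\bigg[e^{-y^2/(4t)}-\sum_{k=0}^{[s]}\frac{(-1)^ky^{2k}}{k!(4t)^k}\bigg]e^{tL}f\,\frac{dt}{t^{1-s}}\\&=\sum_{k=0}^{[s]}\frac{y^{2k}\Gamma(s-k)}{4^kk!\,\Gamma(s)}L^ku+\frac{y^{2s}}{4^s\Gamma(s)}\int_0^\infty\bigg[e^{-r}-\sum_{k=0}^{[s]}\frac{(-r)^k}{k!}\bigg]e^{\frac{y^2}{4r}L}f\,\frac{dr}{r^{1+s}}.\end{aligned}$$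 (c) $u\in D((-L)^s)$ if and only if the limit $$\lim_{y\to0}y^{1-2(s-[s])}\partial_y\big(L+\tfrac{1-2(s-[s])}{y}\partial_y+\partial_{yy}\big)^{[s]}U(y)$$ exists in $X$, and also if and only if the limit $$\lim_{y\to0}y^{1-2(s-[s])}\partial_y\big(\tfrac2y\partial_y\big)^{[s]}U(y)$$ exists in $X$; and, in these cases, $$\lim_{y\to0}y^{1-2(s-[s])}\partial_y\big(L+\tfrac{1-2(s-[s])}{y}\partial_y+\partial_{yy}\big)^{[s]}U(y)=c_s\,[s]!\,(-L)^su$$ and $$\lim_{y\to0}y^{1-2(s-[s])}\partial_y\big(\tfrac2y\partial_y\big)^{[s]}U(y)=c_s(-L)^su,$$ where $c_s=\dfrac{(-1)^{[s]+1}\Gamma([s]+1-s)}{4^{s-([s]+1/2)}\Gamma(s)}$. (d) If $u\in D((-L)^s)$ then $U$ is the unique classical solution to the higher order initial value extension problem $$\begin{cases}\big(L+\frac{1-2(s-[s])}{y}\partial_y+\partial_{yy}\big)^{[s]+1}U=0 & \text{for } y>0\\ \lim_{y\to0}\big(L+\frac{1-2(s-[s])}{y}\partial_y+\partial_{yy}\big)^mU=\frac{[s]!\,\Gamma(s-m)}{([s]-m)!\,\Gamma(s)}L^mu & \text{for } 0\le m\le[s]\\ \lim_{y\to0}y^{1-2(s-[s])}\partial_y\big(L+\frac{1-2(s-[s])}{y}\partial_y+\partial_{yy}\big)^mU=0 & \text{for } 0\le m<[s]\\ \lim_{y\to0}y^{1-2(s-[s])}\partial_y\big(L+\frac{1-2(s-[s])}{y}\partial_y+\partial_{yy}\big)^{[s]}U=c_s\,[s]!\,(-L)^su\end{cases}$$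 and $U$ is also the unique classical solution to the second order initial value extension problem $$\begin{cases}LU+\frac{1-2s}{y}\partial_yU+\partial_{yy}U=0 & \text{for } y>0\\ \lim_{y\to0}\big(\frac2y\partial_y\big)^mU(y)=\frac{\Gamma(s-m)}{\Gamma(s)}L^mu & \text{for } 0\le m\le[s]\\ \lim_{y\to0}y^{1-2(s-[s])}\partial_y\big(\frac2y\partial_y\big)^mU(y)=0 & \text{for } 0\le m<[s]\\ \lim_{y\to0}y^{1-2(s-[s])}\partial_y\big(\frac2y\partial_y\big)^{[s]}U(y)=c_s(-L)^su,\end{cases}$$ all limits being taken in $X$.
   Context: A $C_0$-semigroup $\{e^{tL}\}_{t\ge0}$ is uniformly bounded if there is $M\ge1$ with $\|e^{tL}\|\le M$ for all $t\ge0$. $\rho(L)$ is the resolvent set of $L$, $D(\cdot)$ denotes the domain of an operator, $L^0=I$, and $D(L^k)$ carries the graph norm. Integrals of $X$-valued functions are Bochner integrals. $U$ is extended to $y=0$ by its limit. Fractional powers. If $L$ generates a uniformly bounded $C_0$-semigroup, $A=-L$ is a nonnegative operator, i.e. $(-\infty,0)\subset\rho(A)$ and $\sup_{\mu>0}\|\mu(\mu I+A)^{-1}\|<\infty$. For a bounded nonnegative operator $B$ on $X$ and $0<\sigma<1$ put $B^\sigma u=\frac{\sin(\sigma\pi)}{\pi}\int_0^\infty\mu^{\sigma-1}(\mu I+B)^{-1}Bu\,d\mu$, and for $n<s<n+1$, $n\in\mathbb{N}$, $B^s=B^{s-n}B^n$. When $0\in\rho(A)$, $B=A^{-1}$ is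 bounded and nonnegative, $(A^{-1})^s$ is injective, and one defines $A^s=[(A^{-1})^s]^{-1}$ with domain $D(A^s)=R((A^{-1})^s)$ (the range). Thus $(-L)^s=A^s$ with $A=-L$. Classical solution. A classical solution is a function $U(y)$ that is as continuously differentiable in $(0,\infty)$ as the equation (and the expressions in the initial conditions) requires, with values in the corresponding domains of $L$ and integer powers of $L$, and whose initial conditions are satisfied with continuity up to $y=0$. Concretely, for the equation $(L+\frac ay\partial_y+\partial_{yy})^{N}U=0$ this means $U\in C^{2(N-k)}((0,\infty);D(L^k))$ for $0\le k\le N$, and the limits as $y\to0$ in the initial conditions exist in $X$ and have the prescribed values; if the initial conditions contain higher $y$-derivatives of $U$, these are assumed to exist and be continuous on $(0,\infty)$. *)

theory Defs
  imports "HOL-Analysis.Analysis"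
begin

text \<open>
  The library predicate \<open>has_bochner_integral\<close> is restricted to second countable (hence separable)
  target spaces, whereas the Banach space considered here is arbitrary. The definition below is the
  library one without that restriction. Existence of simple functions approximating \<open>f\<close> in mean
  forces \<open>f\<close> to be strongly measurable.
\<close>

definition bochner_has_integral :: "'m measure \<Rightarrow> ('m \<Rightarrow> 'a::banach) \<Rightarrow> 'a \<Rightarrow> bool" where
  "bochner_has_integral M f x \<longleftrightarrow>
     f \<in> borel_measurable M \<and>
     (\<exists>s. (\<forall>i. Bochner_Integration.simple_bochner_integrable M (s i)) \<and>
          (\<lambda>i. \<integral>\<^sup>+z. ennreal (norm (f z - s i z)) \<partial>M) \<longlonglongrightarrow> 0 \<and>
          (\<lambda>i. Bochner_Integration.simple_bochner_integral M (s i)) \<longlonglongrightarrow> x)"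

lemma bochner_has_integral_eq_library:
  fixes f :: "'m \<Rightarrow> 'a::{banach, second_countable_topology}"
  shows "bochner_has_integral M f x \<longleftrightarrow> has_bochner_integral M f x"
  by (auto simp: bochner_has_integral_def has_bochner_integral.simps)

definition bochner_integrable_on :: "(real \<Rightarrow> 'a::banach) \<Rightarrow> real set \<Rightarrow> bool" where
  "bochner_integrable_on f S \<longleftrightarrow>
     (\<exists>x. bochner_has_integral lborel (\<lambda>t. indicator S t *\<^sub>R f t) x)"

definition bochner_integral_on :: "real set \<Rightarrow> (real \<Rightarrow> 'a::banach) \<Rightarrow> 'a" where
  "bochner_integral_on S f =
     (if bochner_integrable_on f S
      then THE x. bochner_has_integral lborel (\<lambda>t. indicator S t *\<^sub>R f t) x else 0)"

text \<open>
  An unbounded operator is given by its domain \<open>D\<close> and a function \<open>L\<close> whose values outside \<open>D\<close>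
  are irrelevant.
\<close>

definition C0_semigroup :: "(real \<Rightarrow> 'a::banach \<Rightarrow>\<^sub>L 'a) \<Rightarrow> bool" where
  "C0_semigroup T \<longleftrightarrow>
     T 0 = id_blinfun \<and>
     (\<forall>t\<ge>0. \<forall>r\<ge>0. T (t + r) = T t o\<^sub>L T r) \<and>
     (\<forall>x. ((\<lambda>t. blinfun_apply (T t) x) \<longlongrightarrow> x) (at_right 0))"

definition uniformly_bounded_semigroup :: "(real \<Rightarrow> 'a::banach \<Rightarrow>\<^sub>L 'a) \<Rightarrow> bool" where
  "uniformly_bounded_semigroup T \<longleftrightarrow> (\<exists>M\<ge>1. \<forall>t\<ge>0. norm (T t) \<le> M)"

definition infinitesimal_generator ::
    "(real \<Rightarrow> 'a::banach \<Rightarrow>\<^sub>L 'a) \<Rightarrow> 'a set \<Rightarrow> ('a \<Rightarrow> 'a) \<Rightarrow> bool" where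
  "infinitesimal_generator T D L \<longleftrightarrow>
     D = {x. \<exists>z. ((\<lambda>h. (blinfun_apply (T h) x - x) /\<^sub>R h) \<longlongrightarrow> z) (at_right 0)} \<and>
     (\<forall>x\<in>D. ((\<lambda>h. (blinfun_apply (T h) x - x) /\<^sub>R h) \<longlongrightarrow> L x) (at_right 0))"

text \<open>
  \<open>'a\<close> is a real Banach space, so these are the real points of the resolvent set; a complex
  Banach space is covered through its underlying real one.
\<close>

definition resolvent_set :: "'a::banach set \<Rightarrow> ('a \<Rightarrow> 'a) \<Rightarrow> real set" where
  "resolvent_set D L =
     {\<mu>. bij_betw (\<lambda>x. \<mu> *\<^sub>R x - L x) D UNIV \<and>
         bounded_linear (inv_into D (\<lambda>x. \<mu> *\<^sub>R x - L x))}"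

text \<open>On its domain \<open>D(L\<^sup>k)\<close>, the power \<open>L\<^sup>k\<close> is the iterate \<open>L ^^ k\<close>.\<close>

primrec pow_dom :: "'a set \<Rightarrow> ('a \<Rightarrow> 'a) \<Rightarrow> nat \<Rightarrow> 'a set" where
  "pow_dom D L 0 = UNIV"
| "pow_dom D L (Suc k) = {x \<in> pow_dom D L k. (L ^^ k) x \<in> D}"

definition graph_norm :: "('a::banach \<Rightarrow> 'a) \<Rightarrow> nat \<Rightarrow> 'a \<Rightarrow> real" where
  "graph_norm L k x = norm x + norm ((L ^^ k) x)"

text \<open>\<open>B\<^sup>\<sigma>\<close> for a bounded nonnegative operator \<open>B\<close> and \<open>0 < \<sigma> < 1\<close>.\<close>

definition balakrishnan :: "('a::banach \<Rightarrow> 'a) \<Rightarrow> real \<Rightarrow> 'a \<Rightarrow> 'a" where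
  "balakrishnan B \<sigma> u =
     (sin (\<sigma> * pi) / pi) *\<^sub>R
       bochner_integral_on {0<..}
         (\<lambda>\<mu>. \<mu> powr (\<sigma> - 1) *\<^sub>R inv (\<lambda>x. \<mu> *\<^sub>R x + B x) (B u))"

definition bounded_frac_power :: "('a::banach \<Rightarrow> 'a) \<Rightarrow> real \<Rightarrow> 'a \<Rightarrow> 'a" where
  "bounded_frac_power B s u = balakrishnan B (s - of_int \<lfloor>s\<rfloor>) ((B ^^ nat \<lfloor>s\<rfloor>) u)"

text \<open>\<open>(- L)\<^sup>s\<close> for noninteger \<open>s > 0\<close> and \<open>0\<close> in the resolvent set of \<open>L\<close>.\<close>

definition neg_inverse :: "'a::banach set \<Rightarrow> ('a \<Rightarrow> 'a) \<Rightarrow> 'a \<Rightarrow> 'a" where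
  "neg_inverse D L = inv_into D (\<lambda>x. - L x)"

definition neg_frac_dom :: "'a::banach set \<Rightarrow> ('a \<Rightarrow> 'a) \<Rightarrow> real \<Rightarrow> 'a set" where
  "neg_frac_dom D L s = range (bounded_frac_power (neg_inverse D L) s)"

definition neg_frac_power :: "'a::banach set \<Rightarrow> ('a \<Rightarrow> 'a) \<Rightarrow> real \<Rightarrow> 'a \<Rightarrow> 'a" where
  "neg_frac_power D L s = inv (bounded_frac_power (neg_inverse D L) s)"

text \<open>
  \<open>C\<^sup>n(S; E)\<close> for a linear subspace \<open>E\<close> of \<open>'a\<close> carrying its own norm \<open>p\<close>: the function \<open>W i\<close> is
  the \<open>i\<close>-th derivative of \<open>V\<close>, and difference quotients and continuity are taken with respect
  to \<open>p\<close>.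
\<close>

definition Cn_into ::
    "nat \<Rightarrow> real set \<Rightarrow> 'a::banach set \<Rightarrow> ('a \<Rightarrow> real) \<Rightarrow> (real \<Rightarrow> 'a) \<Rightarrow> bool" where
  "Cn_into n S E p V \<longleftrightarrow>
     (\<exists>W. (\<forall>y\<in>S. W 0 y = V y) \<and>
          (\<forall>i\<le>n. \<forall>y\<in>S. W i y \<in> E \<and>
              ((\<lambda>z. p (W i z - W i y)) \<longlongrightarrow> 0) (at y within S)) \<and>
          (\<forall>i<n. \<forall>y\<in>S.
              ((\<lambda>z. p ((W i z - W i y) /\<^sub>R (z - y) - W (Suc i) y)) \<longlongrightarrow> 0) (at y within S)))"

abbreviation Cn_pow_dom ::
    "nat \<Rightarrow> 'a::banach set \<Rightarrow> ('a \<Rightarrow> 'a) \<Rightarrow> nat \<Rightarrow> (real \<Rightarrow> 'a) \<Rightarrow> bool" where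
  "Cn_pow_dom n D L k V \<equiv> Cn_into n {0<..} (pow_dom D L k) (graph_norm L k) V"

definition dy :: "(real \<Rightarrow> 'a::banach) \<Rightarrow> real \<Rightarrow> 'a" where
  "dy V y = vector_derivative V (at y)"

text \<open>
  Powers of \<open>L + (a/y) \<partial>\<^sub>y + \<partial>\<^sub>y\<^sub>y\<close> are iterates \<open>ext_op L a ^^ m\<close>. If \<open>V\<close> is of class
  \<open>C\<^bsup>2(N-k)\<^esup>\<close> into \<open>D(L\<^sup>k)\<close> for all \<open>k \<le> N\<close>, then \<open>ext_op L a V\<close> has the same property with
  \<open>N - 1\<close> in place of \<open>N\<close>, so that all iterates up to \<open>N\<close> evaluate \<open>L\<close> only on its domain and
  \<open>dy\<close> only at points of differentiability.
\<close>

definition ext_op :: "('a::banach \<Rightarrow> 'a) \<Rightarrow> real \<Rightarrow> (real \<Rightarrow> 'a) \<Rightarrow> real \<Rightarrow> 'a" where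
  "ext_op L a V y = L (V y) + (a / y) *\<^sub>R dy V y + dy (dy V) y"

definition two_over_y_dy :: "(real \<Rightarrow> 'a::banach) \<Rightarrow> real \<Rightarrow> 'a" where
  "two_over_y_dy V y = (2 / y) *\<^sub>R dy V y"

text \<open>Extension to \<open>y = 0\<close> by the limit.\<close>

definition extend0 :: "(real \<Rightarrow> 'a::banach) \<Rightarrow> real \<Rightarrow> 'a" where
  "extend0 V y = (if y = 0 then Lim (at_right 0) V else V y)"

text \<open>
  \<open>V\<close> solves \<open>(L + (a/y) \<partial>\<^sub>y + \<partial>\<^sub>y\<^sub>y)\<^sup>N V = 0\<close> classically on \<open>(0, \<infinity>)\<close>. The parameter \<open>j\<close> is
  the highest order of the \<open>y\<close>-derivatives of \<open>V\<close> occurring in the initial conditions which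
  accompany the equation.
\<close>

definition classical_eq ::
    "'a::banach set \<Rightarrow> ('a \<Rightarrow> 'a) \<Rightarrow> real \<Rightarrow> nat \<Rightarrow> nat \<Rightarrow> (real \<Rightarrow> 'a) \<Rightarrow> bool" where
  "classical_eq D L a N j V \<longleftrightarrow>
     (\<forall>k\<le>N. Cn_pow_dom (2 * (N - k)) D L k V) \<and>
     Cn_into j {0<..} UNIV norm V \<and>
     (\<forall>y>0. (ext_op L a ^^ N) V y = 0)"

definition extension_problem ::
    "'a::banach set \<Rightarrow> ('a \<Rightarrow> 'a) \<Rightarrow> real \<Rightarrow> nat \<Rightarrow> 'a \<Rightarrow> (real \<Rightarrow> 'a) \<Rightarrow> bool" where
  "extension_problem D L a N u V \<longleftrightarrow>
     classical_eq D L a N 0 V \<and> (V \<longlongrightarrow> u) (at_right 0)"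

definition c_const :: "real \<Rightarrow> real" where
  "c_const s = (let n = nat \<lfloor>s\<rfloor> in
     (-1) ^ (n + 1) * Gamma (real n + 1 - s) / (4 powr (s - (real n + 1/2)) * Gamma s))"

definition higher_order_ivp ::
    "'a::banach set \<Rightarrow> ('a \<Rightarrow> 'a) \<Rightarrow> real \<Rightarrow> 'a \<Rightarrow> (real \<Rightarrow> 'a) \<Rightarrow> bool" where
  "higher_order_ivp D L s u V \<longleftrightarrow> (let n = nat \<lfloor>s\<rfloor>; a = 1 - 2 * (s - real n) in
     classical_eq D L a (n + 1) (2 * n + 1) V \<and>
     (\<forall>m\<le>n. ((ext_op L a ^^ m) V \<longlongrightarrow>
         (fact n * Gamma (s - real m) / (fact (n - m) * Gamma s)) *\<^sub>R (L ^^ m) u) (at_right 0)) \<and>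
     (\<forall>m<n. ((\<lambda>y. y powr a *\<^sub>R dy ((ext_op L a ^^ m) V) y) \<longlongrightarrow> 0) (at_right 0)) \<and>
     ((\<lambda>y. y powr a *\<^sub>R dy ((ext_op L a ^^ n) V) y) \<longlongrightarrow>
         (c_const s * fact n) *\<^sub>R neg_frac_power D L s u) (at_right 0))"

definition second_order_ivp ::
    "'a::banach set \<Rightarrow> ('a \<Rightarrow> 'a) \<Rightarrow> real \<Rightarrow> 'a \<Rightarrow> (real \<Rightarrow> 'a) \<Rightarrow> bool" where
  "second_order_ivp D L s u V \<longleftrightarrow> (let n = nat \<lfloor>s\<rfloor>; a = 1 - 2 * (s - real n) in
     classical_eq D L (1 - 2 * s) 1 (n + 1) V \<and>
     (\<forall>m\<le>n. ((two_over_y_dy ^^ m) V \<longlongrightarrow>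
         (Gamma (s - real m) / Gamma s) *\<^sub>R (L ^^ m) u) (at_right 0)) \<and>
     (\<forall>m<n. ((\<lambda>y. y powr a *\<^sub>R dy ((two_over_y_dy ^^ m) V) y) \<longlongrightarrow> 0) (at_right 0)) \<and>
     ((\<lambda>y. y powr a *\<^sub>R dy ((two_over_y_dy ^^ n) V) y) \<longlongrightarrow>
         c_const s *\<^sub>R neg_frac_power D L s u) (at_right 0))"

end

theory Submission
  imports Defs "HOL-Real_Asymp.Real_Asymp"
begin

text \<open>
  For \<open>q > 0\<close> let \<open>U\<^sub>q(y)x\<close> be the average of \<open>T(t)x\<close> against the probability density
  \<open>y\<^bsup>2q\<^esup> e\<^bsup>-y\<^sup>2/4t\<^esup> / (4\<^sup>q \<Gamma>(q) t\<^bsup>1+q\<^esup>)\<close>. The kernels satisfy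
  \<open>\<partial>\<^sub>y U\<^sub>q = (2q/y) (U\<^sub>q - U\<^bsub>q+1\<^esub>)\<close> and \<open>L U\<^sub>q = (4q(q+1)/y\<^sup>2) (U\<^bsub>q+1\<^esub> - U\<^bsub>q+2\<^esub>)\<close>;
  hence the span of the \<open>y\<^sup>p U\<^sub>q(y)x\<close> is stable under \<open>\<partial>\<^sub>y\<close> and \<open>L\<close>, which gives
  smoothness, and \<open>(2/y) \<partial>\<^sub>y U\<^sub>q = L U\<^bsub>q-1\<^esub> / (q-1)\<close>, which reduces all iterated operators to
  \<open>0 < q < 1\<close>. There, with \<open>B = (-L)\<^sup>-\<^sup>1\<close>, \<open>y\<^bsup>1-2q\<^esup> \<partial>\<^sub>y U\<^sub>q(y) B x\<close> tends to a multiple of \<open>B\<^bsup>1-q\<^esup> x\<close>, and a Wronskian identity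
  between \<open>U\<^sub>q\<close> and \<open>U\<^bsub>1-q\<^esub>\<close> yields \<open>B\<^sup>q B\<^bsup>1-q\<^esup> = B\<close>; this identifies the range of \<open>B\<^sup>s\<close> by the
  existence of the limit. For uniqueness, integrating the equation twice from \<open>0\<close> shows that a solution \<open>W\<close>
  with vanishing initial data satisfies \<open>\<parallel>B\<^sup>k W(y)\<parallel> \<le> C y\<^bsup>2q+2k\<^esup> / (4\<^sup>k (k!)\<^sup>2)\<close>, and only \<open>W = 0\<close> decays that fast.
\<close>

section \<open>Improper integrals over the half-line\<close>

text \<open>A merely bounded semigroup need not decay, so the natural formula for B^\<sigma> x,
  namely 1/Gamma(\<sigma>) times the integral of t^(\<sigma>-1) T(t) x, need not converge
  absolutely. Since T(t) x is the derivative of B x - T(t) B x, which is O(min t 1), integration by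
  parts turns it into the absolutely convergent integral that defines \<open>bal\<close>. The same
  subtraction tames the weighted derivative of \<open>U\<close> near y = 0. No integrals are
  interchanged: where this would be expected, an explicit antiderivative is differentiated and its
  limits at 0 and infinity are found by dominated convergence. Identities involving the unbounded L
  are proved after applying the bounded injective B, or J = - B, the inverse of L; the operator is
  cancelled at the end, and D(L^k) becomes the range of J^k. The identity B^\<sigma> B^(1-\<sigma>)
  = B settles the converse in (c): for 0 < s < 1 an existing limit puts B^(1-\<sigma>) u into the
  range of B; applying B^\<sigma> and cancelling B puts u into the range of B^\<sigma>.\<close>

text \<open>Integrals are handled through antiderivatives, because the Bochner integral of the library requires a
  separable space. For continuous, absolutely integrable \<open>f\<close> the value is that of
  \<open>bochner_integral_on\<close>.\<close>

definition hl_has_integral :: "(real \<Rightarrow> 'a::real_normed_vector) \<Rightarrow> 'a \<Rightarrow> bool" where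
  "hl_has_integral f I \<longleftrightarrow>
     (\<exists>F A. (\<forall>t>0. (F has_vector_derivative f t) (at t)) \<and>
            (F \<longlongrightarrow> A) (at_right 0) \<and> (F \<longlongrightarrow> A + I) at_top)"

definition hl_integral :: "(real \<Rightarrow> 'a::real_normed_vector) \<Rightarrow> 'a" where
  "hl_integral f = (THE I. hl_has_integral f I)"

definition hl_absint :: "(real \<Rightarrow> 'a::real_normed_vector) \<Rightarrow> bool" where
  "hl_absint f \<longleftrightarrow> continuous_on {0<..} f \<and> set_integrable lborel {0<..} (\<lambda>t. norm (f t))"

lemma constant_on_pos:
  fixes F :: "real \<Rightarrow> 'a::real_normed_vector"
  assumes "\<And>t. t > 0 \<Longrightarrow> (F has_vector_derivative 0) (at t)" "a > 0" "b > 0"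
  shows "F a = F b"
proof -
  obtain c where "\<And>x. x \<in> {0<..} \<Longrightarrow> F x = c"
    by (rule has_vector_derivative_zero_constant[of "{0<..}" F])
      (auto intro: assms(1) has_vector_derivative_at_within)
  from this[of a] this[of b] assms(2,3) show ?thesis by simp
qed

text \<open>Two antiderivatives differ by a constant on the connected half-line, and this constant
  is seen by the limits at both ends.\<close>

lemma hl_has_integral_unique:
  assumes "hl_has_integral f I" "hl_has_integral f J"
  shows "I = J"
proof -
  from assms obtain F A G B where
    F: "\<And>t. t > 0 \<Longrightarrow> (F has_vector_derivative f t) (at t)" "(F \<longlongrightarrow> A) (at_right 0)" "(F \<longlongrightarrow> A + I) at_top" and
    G: "\<And>t. t > 0 \<Longrightarrow> (G has_vector_derivative f t) (at t)" "(G \<longlongrightarrow> B) (at_right 0)" "(G \<longlongrightarrow> B + J) at_top"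
    unfolding hl_has_integral_def by metis
  define c where "c = F 1 - G 1"
  have c: "F t - G t = c" if "t > 0" for t
    unfolding c_def
    by (rule constant_on_pos[of "\<lambda>t. F t - G t"])
      (use F(1) G(1) that in \<open>auto intro!: derivative_eq_intros\<close>)
  have "((\<lambda>t. F t - G t) \<longlongrightarrow> A - B) (at_right 0)" using F G by (intro tendsto_intros)
  moreover have "((\<lambda>t. F t - G t) \<longlongrightarrow> c) (at_right 0)"
    by (rule tendsto_eventually) (auto simp: eventually_at_filter c)
  ultimately have 1: "A - B = c" using tendsto_unique trivial_limit_at_right_real by blast
  have "((\<lambda>t. F t - G t) \<longlongrightarrow> (A + I) - (B + J)) at_top" using F G by (intro tendsto_intros)
  moreover have "((\<lambda>t. F t - G t) \<longlongrightarrow> c) at_top"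
    by (rule tendsto_eventually) (use eventually_gt_at_top[of 0] in eventually_elim, auto simp: c)
  ultimately have 2: "(A + I) - (B + J) = c" using tendsto_unique trivial_limit_at_top_linorder by blast
  from 1 2 show ?thesis by (simp add: algebra_simps)
qed

lemma hl_integral_eq: "hl_has_integral f I \<Longrightarrow> hl_integral f = I"
  unfolding hl_integral_def using hl_has_integral_unique by blast

lemma hl_has_integral_add:
  assumes "hl_has_integral f I" "hl_has_integral g J"
  shows "hl_has_integral (\<lambda>t. f t + g t) (I + J)"
proof -
  from assms obtain F A G B where
    F: "\<And>t. t > 0 \<Longrightarrow> (F has_vector_derivative f t) (at t)" "(F \<longlongrightarrow> A) (at_right 0)" "(F \<longlongrightarrow> A + I) at_top" and
    G: "\<And>t. t > 0 \<Longrightarrow> (G has_vector_derivative g t) (at t)" "(G \<longlongrightarrow> B) (at_right 0)" "(G \<longlongrightarrow> B + J) at_top"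
    unfolding hl_has_integral_def by metis
  have "((\<lambda>t. F t + G t) \<longlongrightarrow> (A + I) + (B + J)) at_top" using F G by (intro tendsto_intros)
  then have "((\<lambda>t. F t + G t) \<longlongrightarrow> (A + B) + (I + J)) at_top" by (simp add: algebra_simps)
  moreover have "((\<lambda>t. F t + G t) \<longlongrightarrow> A + B) (at_right 0)" using F G by (intro tendsto_intros)
  ultimately show ?thesis unfolding hl_has_integral_def using F(1) G(1)
    by (intro exI[of _ "\<lambda>t. F t + G t"] exI[of _ "A + B"]) (auto intro!: derivative_intros)
qed

lemma hl_has_integral_linear:
  assumes "hl_has_integral f I" "bounded_linear h"
  shows "hl_has_integral (\<lambda>t. h (f t)) (h I)"
proof -
  interpret bounded_linear h by fact
  from assms obtain F A where
    F: "\<And>t. t > 0 \<Longrightarrow> (F has_vector_derivative f t) (at t)" "(F \<longlongrightarrow> A) (at_right 0)" "(F \<longlongrightarrow> A + I) at_top"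
    unfolding hl_has_integral_def by metis
  have "((\<lambda>t. h (F t)) \<longlongrightarrow> h A + h I) at_top" using tendsto[OF F(3)] by (simp add: add)
  with tendsto[OF F(2)] show ?thesis unfolding hl_has_integral_def using F(1)
    by (intro exI[of _ "\<lambda>t. h (F t)"] exI[of _ "h A"]) (auto intro!: has_vector_derivative)
qed

lemma hl_has_integral_cong:
  fixes f g :: "real \<Rightarrow> 'a::real_normed_vector"
  assumes "\<And>t. t > 0 \<Longrightarrow> f t = g t"
  shows "hl_has_integral f I \<longleftrightarrow> hl_has_integral g I"
  unfolding hl_has_integral_def using assms by auto

lemma hl_integral_cong:
  fixes f g :: "real \<Rightarrow> 'a::real_normed_vector"
  assumes "\<And>t. t > 0 \<Longrightarrow> f t = g t"
  shows "hl_integral f = hl_integral g"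
  unfolding hl_integral_def using hl_has_integral_cong[of f g, OF assms] by presburger

text \<open>As \<open>g\<close> runs from infinity down to 0, \<open>- F (g t)\<close> is an
  antiderivative of the new integrand. The sign pays for the reversed orientation, and the two end
  limits exchange their roles. The substitution in use is always
  \<open>y\<^sup>2 / (4 * t)\<close>.\<close>

lemma hl_has_integral_substitution:
  assumes f: "hl_has_integral f I"
    and g: "\<And>t. t > 0 \<Longrightarrow> g t > 0" "\<And>t. t > 0 \<Longrightarrow> (g has_real_derivative g' t) (at t)"
    and lim: "filterlim g at_top (at_right 0)" "(g \<longlongrightarrow> 0) at_top"
  shows "hl_has_integral (\<lambda>t. - g' t *\<^sub>R f (g t)) I"
proof -
  from f obtain F A where
    F: "\<And>t. t > 0 \<Longrightarrow> (F has_vector_derivative f t) (at t)" "(F \<longlongrightarrow> A) (at_right 0)" "(F \<longlongrightarrow> A + I) at_top"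
    unfolding hl_has_integral_def by metis
  have lim': "filterlim g (at_right 0) at_top"
    unfolding filterlim_at using lim(2)
    by (auto intro!: eventually_mono[OF eventually_gt_at_top[of 0]] dest: g(1))
  have 1: "((\<lambda>t. - F (g t)) has_vector_derivative (- g' t *\<^sub>R f (g t))) (at t)" if "t > 0" for t
    using vector_diff_chain_at[OF g(2)[OF that, unfolded has_real_derivative_iff_has_vector_derivative] F(1)[OF g(1)[OF that]]]
    by (auto simp: o_def intro: derivative_eq_intros)
  have 2: "((\<lambda>t. - F (g t)) \<longlongrightarrow> - (A + I)) (at_right 0)"
    by (intro tendsto_minus filterlim_compose[OF F(3) lim(1)])
  have 3: "((\<lambda>t. - F (g t)) \<longlongrightarrow> - A) at_top"
    by (intro tendsto_minus filterlim_compose[OF F(2) lim'])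
  from 1 2 3 show ?thesis unfolding hl_has_integral_def
    by (intro exI[of _ "\<lambda>t. - F (g t)"] exI[of _ "- (A + I)"]) auto
qed

lemma continuous_pos_antiderivative:
  fixes f :: "real \<Rightarrow> 'a::banach"
  assumes "continuous_on {0<..} f"
  shows "\<exists>F. \<forall>t>0. (F has_vector_derivative f t) (at t)"
proof -
  \<comment> \<open>The oriented integral from 1 to \<open>t\<close>: one of the two terms is always
    0. The base point is 1 because \<open>f\<close> may fail to be integrable at 0.\<close>
  define F where "F t = integral {1..t} f - integral {t..1} f" for t
  have "(F has_vector_derivative f t) (at t)" if t: "t > 0" for t
  proof -
    define a b where "a = min t 1 / 2" and "b = max t 1 + 1"
    have ab: "0 < a" "a < t" "t < b" "a < 1" "1 < b" using t by (auto simp: a_def b_def min_def max_def)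
    have c: "continuous_on {x..y} f" if "a \<le> x" for x y
      by (rule continuous_on_subset[OF assms]) (use ab that in auto)
    have i: "f integrable_on {x..y}" if "a \<le> x" for x y using c[OF that] by (rule integrable_continuous_real)
    have "((\<lambda>u. integral {a..u} f) has_vector_derivative f t) (at t within {a..b})"
      by (rule integral_has_vector_derivative[OF c]) (use ab in auto)
    then have "((\<lambda>u. integral {a..u} f) has_vector_derivative f t) (at t)"
      using at_within_interior[of t "{a..b}"] ab by (simp add: interior_atLeastAtMost_real)
    then have d: "((\<lambda>u. integral {a..u} f - integral {a..1} f) has_vector_derivative f t) (at t)"
      by (auto intro!: derivative_eq_intros)
    have eq: "integral {a..u} f - integral {a..1} f = F u" if "u \<in> {a<..<b}" for u
    proof (cases "u \<le> 1")
      case True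
      then have "integral {a..u} f + integral {u..1} f = integral {a..1} f"
        using that by (intro Henstock_Kurzweil_Integration.integral_combine i) auto
      moreover have "integral {1..u} f = 0" using True by (cases "u = 1") auto
      ultimately show ?thesis by (simp add: F_def algebra_simps)
    next
      case False
      then have "integral {a..1} f + integral {1..u} f = integral {a..u} f"
        using that ab by (intro Henstock_Kurzweil_Integration.integral_combine i) auto
      moreover have "integral {u..1} f = 0" using False by auto
      ultimately show ?thesis by (simp add: F_def algebra_simps)
    qed
    show ?thesis
      by (rule has_vector_derivative_transform_within_open[OF d, of "{a<..<b}"]) (use ab eq in auto)
  qed
  then show ?thesis by blast
qed

lemma norm_increment_le:
  fixes F :: "real \<Rightarrow> 'a::real_normed_vector"
  assumes "\<And>t. t > 0 \<Longrightarrow> (F has_vector_derivative f t) (at t)"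
    and "\<And>t. t > 0 \<Longrightarrow> (G has_vector_derivative g t) (at t)"
    and "\<And>t. t > a \<Longrightarrow> t < b \<Longrightarrow> norm (f t) \<le> g t" "0 < a" "a \<le> b"
  shows "norm (F b - F a) \<le> G b - G a"
proof (cases "a = b")
  case False
 show ?thesis
  proof (rule differentiable_bound_general[of a b F G f g])
    show "a < b" using assms False by simp
    show "continuous_on {a..b} F" "continuous_on {a..b} G"
      by (rule continuous_at_imp_continuous_on, rule ballI,
          rule has_vector_derivative_continuous[OF assms(1)] has_vector_derivative_continuous[OF assms(2)],
          use assms(4) in force)+
  qed (use assms in auto)
qed auto

section \<open>Absolute integrability on the half-line\<close>

text \<open>For a nonnegative integrand the two limits of an antiderivative already force Lebesgue
  integrability, by the fundamental theorem on the open interval. For a signed integrand the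
  convergence could be merely conditional.\<close>

lemma hl_absint_real_integral:
  fixes f :: "real \<Rightarrow> real"
  assumes "\<And>t. t > 0 \<Longrightarrow> f t \<ge> 0" "continuous_on {0<..} f" "hl_has_integral f I"
  shows "set_integrable lborel {0<..} f" "(LBINT t:{0<..}. f t) = I"
proof -
  from assms obtain F A where
    F: "\<And>t. t > 0 \<Longrightarrow> (F has_vector_derivative f t) (at t)" "(F \<longlongrightarrow> A) (at_right 0)" "(F \<longlongrightarrow> A + I) at_top"
    unfolding hl_has_integral_def by metis
  have e: "einterval 0 \<infinity> = {0<..}" by (auto simp: einterval_def)
  have A: "((F \<circ> real_of_ereal) \<longlongrightarrow> A) (at_right 0)"
    using F(2) unfolding zero_ereal_def ereal_tendsto_simps .
  have B: "((F \<circ> real_of_ereal) \<longlongrightarrow> A + I) (at_left \<infinity>)"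
    using F(3) unfolding ereal_tendsto_simps .
  have c: "isCont f x" if "x > 0" for x
    using assms(2) that by (auto simp: continuous_on_eq_continuous_at)
  have *: "0 < (\<infinity>::ereal)" by simp
  note ftc = interval_integral_FTC_nonneg[of 0 \<infinity> F f A "A + I", OF * _ _ _ A B]
  have "set_integrable lborel (einterval 0 \<infinity>) f"
    by (rule ftc) (use F(1) c assms(1) in \<open>auto simp: has_real_derivative_iff_has_vector_derivative\<close>)
  moreover have "(LBINT x=0..\<infinity>. f x) = (A + I) - A"
    by (rule ftc) (use F(1) c assms(1) in \<open>auto simp: has_real_derivative_iff_has_vector_derivative\<close>)
  ultimately show "set_integrable lborel {0<..} f" "(LBINT t:{0<..}. f t) = I"
    by (simp_all add: interval_lebesgue_integral_def e)
qed

text \<open>An antiderivative of a nonnegative function is monotone, and integrability bounds its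
  increments by \<open>K\<close>; so it converges to its infimum at 0 and to its supremum at
  infinity.\<close>

lemma hl_has_integral_real_exists:
  fixes f :: "real \<Rightarrow> real"
  assumes "\<And>t. t > 0 \<Longrightarrow> f t \<ge> 0" "continuous_on {0<..} f" "set_integrable lborel {0<..} f"
  shows "\<exists>I. hl_has_integral f I"
proof -
  obtain F where F: "\<And>t. t > 0 \<Longrightarrow> (F has_vector_derivative f t) (at t)"
    using continuous_pos_antiderivative[OF assms(2)] by blast
  define K where "K = (LBINT t:{0<..}. f t)"
  have inc: "0 \<le> F b - F a" "F b - F a \<le> K" if "0 < a" "a \<le> b" for a b
  proof -
    have hi: "(f has_integral (F b - F a)) {a..b}"
      by (rule fundamental_theorem_of_calculus) (use that F in \<open>auto intro: has_vector_derivative_at_within\<close>)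
    then show "0 \<le> F b - F a" by (rule has_integral_nonneg) (use that assms in auto)
    have si: "set_integrable lborel {a..b} f"
      by (rule set_integrable_subset[OF assms(3)]) (use that in auto)
    have "F b - F a = (LBINT t:{a..b}. f t)"
      using set_borel_integral_eq_integral(2)[OF si] hi by (simp add: integral_unique)
    also have "\<dots> \<le> K" unfolding K_def
      using si assms(3) unfolding set_lebesgue_integral_def set_integrable_def
      by (rule integral_mono) (use that assms(1) in \<open>auto simp: indicator_def\<close>)
    finally show "F b - F a \<le> K" .
  qed
  define G where "G t = (if t \<le> 0 then F 1 - K else F t)" for t
  have Fge: "F t \<ge> F 1 - K" if "t > 0" for t
    using inc[of t 1] inc[of 1 t] inc[of 1 1] that by (cases "t \<le> 1") auto
  have Fle: "F t \<le> F 1 + K" if "t > 0" for t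
    using inc[of t 1] inc[of 1 t] inc[of 1 1] that by (cases "t \<le> 1") auto
  have ev: "eventually (\<lambda>t::real. t > 0) at_top" by (rule eventually_gt_at_top)
  define S where "S = (SUP t\<in>{0<..}. F t)"
  define A where "A = (INF t\<in>{0<..}. F t)"
  have bd: "bdd_above (F ` {0<..})" "bdd_below (F ` {0<..})"
    by (auto intro!: bdd_aboveI[of _ "F 1 + K"] bdd_belowI[of _ "F 1 - K"] Fge Fle)
  have "(F \<longlongrightarrow> S) at_top"
  proof (rule order_tendstoI)
    fix x assume "x < S"
    then obtain t where "t > 0" "F t > x" unfolding S_def using less_cSUP_iff[OF _ bd(1)] by auto
    moreover have "F t \<le> F r" if "r \<ge> t" for r using inc(1)[of t r] that \<open>t > 0\<close> by simp
    ultimately show "eventually (\<lambda>t. x < F t) at_top"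
      unfolding eventually_at_top_linorder by (meson less_le_trans)
  next
    fix x assume "S < x"
    show "eventually (\<lambda>t. F t < x) at_top"
      using ev
    proof eventually_elim
      case (elim t)
      then have "F t \<le> S" unfolding S_def using bd by (auto intro: cSUP_upper)
      with \<open>S < x\<close> show ?case by simp
    qed
  qed
  moreover have "(F \<longlongrightarrow> A) (at_right 0)"
  proof (rule order_tendstoI)
    fix x assume "A < x"
    then obtain t where t: "t > 0" "F t < x" unfolding A_def using cINF_less_iff[OF _ bd(2)] by auto
    moreover have "F r \<le> F t" if "r \<le> t" "r > 0" for r using inc(1)[of r t] that \<open>t > 0\<close> by simp
    ultimately show "eventually (\<lambda>t. F t < x) (at_right 0)"
      unfolding eventually_at_right_field by (intro exI[of _ t]) (meson le_less_trans less_imp_le)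
  next
    fix x assume "x < A"
    have "F t > x" if "t > 0" for t
    proof -
      have "F t \<ge> A" unfolding A_def using bd that by (auto intro: cINF_lower)
      with \<open>x < A\<close> show ?thesis by simp
    qed
    then show "eventually (\<lambda>t. F t > x) (at_right 0)"
      by (auto simp: eventually_at_filter)
  qed
  ultimately show ?thesis unfolding hl_has_integral_def using F
    by (intro exI[of _ "S - A"] exI[of _ F] exI[of _ A]) auto
qed

text \<open>Increments of an antiderivative of \<open>f\<close> are dominated by those of an
  antiderivative of \<open>norm (f t)\<close>. The latter converges at both ends, so the former is
  Cauchy there, and completeness gives the limits. The norm bound is the same domination in the
  limit.\<close>

lemma hl_absint_exists:
  fixes f :: "real \<Rightarrow> 'a::banach"
  assumes "hl_absint f"
  shows "hl_has_integral f (hl_integral f)" "norm (hl_integral f) \<le> (LBINT t:{0<..}. norm (f t))"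
proof -
  have c: "continuous_on {0<..} f" and i: "set_integrable lborel {0<..} (\<lambda>t. norm (f t))"
    using assms by (auto simp: hl_absint_def)
  have cn: "continuous_on {0<..} (\<lambda>t. norm (f t))" using c by (intro continuous_intros)
  obtain F where F: "\<And>t. t > 0 \<Longrightarrow> (F has_vector_derivative f t) (at t)"
    using continuous_pos_antiderivative[OF c] by blast
  obtain J where J: "hl_has_integral (\<lambda>t. norm (f t)) J"
    using hl_has_integral_real_exists[OF _ cn i] by auto
  then obtain G A where
    G: "\<And>t. t > 0 \<Longrightarrow> (G has_vector_derivative norm (f t)) (at t)" "(G \<longlongrightarrow> A) (at_right 0)" "(G \<longlongrightarrow> A + J) at_top"
    unfolding hl_has_integral_def by metis
  have JI: "J = (LBINT t:{0<..}. norm (f t))"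
    using hl_absint_real_integral(2)[OF _ cn J] by simp
  have le: "norm (F b - F a) \<le> \<bar>G b - G a\<bar>" if "0 < a" "0 < b" for a b
  proof (cases "a \<le> b")
    case True
    then show ?thesis using norm_increment_le[OF F G(1), where a=a and b=b] that by force
  next
    case False
    then have "norm (F a - F b) \<le> G a - G b" using norm_increment_le[OF F G(1), where a=b and b=a] that by force
    then show ?thesis by (simp add: norm_minus_commute)
  qed
  have conv: "\<exists>l. (F \<longlongrightarrow> l) X" if GX: "(G \<longlongrightarrow> g) X" and X: "eventually (\<lambda>t. t > 0) X" "X \<noteq> bot" for X g
  proof -
    have "cauchy_filter (filtermap F X)"
      unfolding cauchy_filter_metric eventually_filtermap
    proof (intro allI impI)
      fix e :: real assume "e > 0"
      \<comment> \<open>Two points at which \<open>G\<close> is within \<open>e / 2\<close> of its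
        limit have \<open>F\<close>-values less than \<open>e\<close> apart.\<close>
      let ?P = "\<lambda>t. t > 0 \<and> dist (G t) g < e / 2"
      have P: "eventually ?P X"
        using eventually_conj[OF X(1) tendstoD[OF GX, of "e/2"]] \<open>e > 0\<close> by simp
      show "\<exists>P. eventually (\<lambda>x. P (F x)) X \<and> (\<forall>x y. P x \<and> P y \<longrightarrow> dist x y < e)"
      proof (intro exI[of _ "\<lambda>x. \<exists>t. x = F t \<and> ?P t"] conjI allI impI)
        show "eventually (\<lambda>x. \<exists>t. F x = F t \<and> ?P t) X" using P by eventually_elim blast
      next
        fix x y assume "(\<exists>t. x = F t \<and> ?P t) \<and> (\<exists>t. y = F t \<and> ?P t)"
        then obtain t r where tr: "x = F t" "y = F r" "?P t" "?P r" by blast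
        then have "dist x y \<le> \<bar>G t - G r\<bar>" using le[of r t] by (auto simp: dist_norm)
        also have "\<dots> < e" using tr unfolding dist_real_def by linarith
        finally show "dist x y < e" .
      qed
    qed
    moreover have "filtermap F X \<noteq> bot" using X(2) by (simp add: filtermap_bot_iff)
    ultimately obtain l where "filtermap F X \<le> nhds l"
      using cauchy_filter_complete_converges[of "filtermap F X" UNIV] complete_UNIV by auto
    then show ?thesis by (auto simp: filterlim_def)
  qed
  obtain a where a: "(F \<longlongrightarrow> a) (at_right 0)"
    using conv[OF G(2)] by (auto simp: eventually_at_filter)
  obtain b where b: "(F \<longlongrightarrow> b) at_top"
    using conv[OF G(3)] eventually_gt_at_top[of 0] by auto
  have hi: "hl_has_integral f (b - a)"
    unfolding hl_has_integral_def using F a b by (intro exI[of _ F] exI[of _ a]) auto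
  then show "hl_has_integral f (hl_integral f)" by (simp add: hl_integral_eq)
  have "norm (b - F r) \<le> \<bar>A + J - G r\<bar>" if r: "r > 0" for r
  proof (rule tendsto_le[OF trivial_limit_at_top_linorder])
    show "((\<lambda>t. norm (F t - F r)) \<longlongrightarrow> norm (b - F r)) at_top" using b by (intro tendsto_intros)
    show "((\<lambda>t. \<bar>G t - G r\<bar>) \<longlongrightarrow> \<bar>A + J - G r\<bar>) at_top" using G by (intro tendsto_intros)
    show "\<forall>\<^sub>F x in at_top. norm (F x - F r) \<le> \<bar>G x - G r\<bar>"
      using eventually_gt_at_top[of 0] by eventually_elim (use r le in auto)
  qed
  then have ev: "eventually (\<lambda>r. norm (b - F r) \<le> \<bar>A + J - G r\<bar>) (at_right 0)"
    by (simp add: eventually_at_filter)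
  have "norm (b - a) \<le> \<bar>A + J - A\<bar>"
    by (rule tendsto_le[OF trivial_limit_at_right_real _ _ ev]) (intro tendsto_intros a G)+
  also have "J \<ge> 0" unfolding JI set_lebesgue_integral_def by (rule Bochner_Integration.integral_nonneg) auto
  then have "\<bar>A + J - A\<bar> = J" by simp
  finally show "norm (hl_integral f) \<le> (LBINT t:{0<..}. norm (f t))"
    using hi JI by (simp add: hl_integral_eq)
qed

lemma hl_absint_cont: "hl_absint f \<Longrightarrow> continuous_on {0<..} f"
  by (simp add: hl_absint_def)

lemma hl_absint_bound:
  assumes "continuous_on {0<..} f" "set_integrable lborel {0<..} g" "\<And>t. t > 0 \<Longrightarrow> norm (f t) \<le> g t"
  shows "hl_absint f"
proof -
  have c: "continuous_on {0<..} (\<lambda>t. norm (f t))" using assms(1) by (intro continuous_intros)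
  have "set_integrable lborel {0<..} (\<lambda>t. norm (f t))"
    unfolding set_integrable_def
    by (rule Bochner_Integration.integrable_bound[OF assms(2)[unfolded set_integrable_def]])
      (use borel_measurable_continuous_on_indicator[OF _ c] assms(3) in \<open>auto simp: indicator_def intro!: AE_I2 intro: order_trans[OF _ abs_ge_self]\<close>)
  with assms(1) show ?thesis by (simp add: hl_absint_def)
qed

lemma hl_absint_norm: "hl_absint f \<Longrightarrow> hl_absint (\<lambda>t. norm (f t))"
  by (auto simp: hl_absint_def intro: continuous_intros)

lemma hl_absint_cong: "(\<And>t. t > 0 \<Longrightarrow> f t = g t) \<Longrightarrow> hl_absint f \<longleftrightarrow> hl_absint g"
  unfolding hl_absint_def
  by (intro arg_cong2[of _ _ _ _ "(\<and>)"] continuous_on_cong set_integrable_cong) auto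

lemma set_integrable_powr_at_0:
  fixes a :: real assumes "a > -1" shows "set_integrable lborel {0<..<1} (\<lambda>t. t powr a)"
proof -
  have e: "einterval 0 1 = {0<..<1}" by (auto simp: einterval_def zero_ereal_def one_ereal_def)
  have l0: "((\<lambda>t. t powr (a + 1) / (a + 1)) \<longlongrightarrow> 0 / (a + 1)) (at_right 0)"
    using assms by real_asymp
  have l1: "((\<lambda>t. t powr (a + 1) / (a + 1)) \<longlongrightarrow> 1 / (a + 1)) (at_left 1)"
    using assms by (auto intro!: tendsto_eq_intros)
  have "set_integrable lborel (einterval 0 1) (\<lambda>t. t powr a)"
    by (rule interval_integral_FTC_nonneg[where F="\<lambda>t. t powr (a + 1) / (a + 1)" and A="0 / (a + 1)" and B="1 / (a + 1)"])
      (use l0 l1 assms in \<open>auto simp: zero_ereal_def one_ereal_def ereal_tendsto_simps intro!: derivative_eq_intros continuous_intros\<close>)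
  then show ?thesis by (simp add: e)
qed

lemma set_integrable_powr_at_top:
  fixes b :: real assumes "b < -1" shows "set_integrable lborel {1<..} (\<lambda>t. t powr b)"
proof -
  have e: "einterval 1 \<infinity> = {1<..}" by (auto simp: einterval_def one_ereal_def)
  have l0: "((\<lambda>t. t powr (b + 1) / (b + 1)) \<longlongrightarrow> 0 / (b + 1)) at_top"
    using assms by real_asymp
  have l1: "((\<lambda>t. t powr (b + 1) / (b + 1)) \<longlongrightarrow> 1 / (b + 1)) (at_right 1)"
    using assms by (auto intro!: tendsto_eq_intros)
  have "set_integrable lborel (einterval 1 \<infinity>) (\<lambda>t. t powr b)"
    by (rule interval_integral_FTC_nonneg[where F="\<lambda>t. t powr (b + 1) / (b + 1)" and A="1 / (b + 1)" and B="0 / (b + 1)"])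
      (use l0 l1 assms in \<open>auto simp: one_ereal_def ereal_tendsto_simps intro!: derivative_eq_intros continuous_intros\<close>)
  then show ?thesis by (simp add: e)
qed

lemma hl_absint_powr_bound:
  fixes f :: "real \<Rightarrow> 'a::real_normed_vector"
  assumes c: "continuous_on {0<..} f" and ab: "a > -1" "b < -1"
    and f: "\<And>t. 0 < t \<Longrightarrow> t < 1 \<Longrightarrow> norm (f t) \<le> C * t powr a"
      "\<And>t. t \<ge> 1 \<Longrightarrow> norm (f t) \<le> K * t powr b"
  shows "hl_absint f"
proof (rule hl_absint_bound[OF c])
  let ?g = "\<lambda>t. if t < 1 then C * t powr a else K * t powr b"
  have "set_integrable lborel {0<..<1} ?g"
    using set_integrable_mult_right[of C, OF set_integrable_powr_at_0[OF ab(1)]]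
    by (subst set_integrable_cong[OF refl refl]) auto
  moreover have "set_integrable lborel {1<..} ?g"
    using set_integrable_mult_right[of K, OF set_integrable_powr_at_top[OF ab(2)]]
    by (subst set_integrable_cong[OF refl refl]) auto
  moreover have "set_integrable lborel {1} ?g"
  proof -
    have "integrable lborel (\<lambda>t. indicator {1} t *\<^sub>R (K :: real))"
      by (intro integrable_scaleR_left integrable_real_indicator) auto
    then show ?thesis unfolding set_integrable_def
      by (rule Bochner_Integration.integrable_cong[THEN iffD1, rotated 2]) (auto simp: indicator_def)
  qed
  ultimately have "set_integrable lborel ({0<..<1} \<union> {1} \<union> {1<..}) ?g"
    by (intro set_integrable_Un) auto
  moreover have "{0<..<1} \<union> {1} \<union> {1<..} = {0<..} - ({} :: real set)" by auto
  ultimately show "set_integrable lborel {0<..} ?g" by simp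
qed (use f in auto)

lemma hl_has_integral_scaleR_left:
  fixes f :: "real \<Rightarrow> real"
  assumes "hl_has_integral f I"
  shows "hl_has_integral (\<lambda>t. f t *\<^sub>R x) (I *\<^sub>R x)"
  using hl_has_integral_linear[OF assms bounded_linear_scaleR_left] .

lemma hl_has_integral_scaleR:
  assumes "hl_has_integral f I"
  shows "hl_has_integral (\<lambda>t. c *\<^sub>R f t) (c *\<^sub>R I)"
  using hl_has_integral_linear[OF assms bounded_linear_scaleR_right] .

lemma hl_has_integral_diff:
  assumes "hl_has_integral f I" "hl_has_integral g J"
  shows "hl_has_integral (\<lambda>t. f t - g t) (I - J)"
  using hl_has_integral_add[OF assms(1) hl_has_integral_scaleR[OF assms(2), of "-1"]] by simp

lemma hl_absint_scaleR:
  assumes "hl_absint f" shows "hl_absint (\<lambda>t. c *\<^sub>R f t)"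
  using assms unfolding hl_absint_def
  by (auto intro!: continuous_intros set_integrable_mult_right)

lemma hl_absint_add:
  assumes "hl_absint f" "hl_absint g" shows "hl_absint (\<lambda>t. f t + g t)"
proof (rule hl_absint_bound)
  show "set_integrable lborel {0<..} (\<lambda>t. norm (f t) + norm (g t))"
    using assms unfolding hl_absint_def by (auto intro: set_integral_add)
qed (use assms in \<open>auto simp: hl_absint_def intro!: continuous_intros norm_triangle_ineq\<close>)

lemma hl_absint_diff:
  assumes "hl_absint f" "hl_absint g" shows "hl_absint (\<lambda>t. f t - g t)"
  using hl_absint_add[OF assms(1) hl_absint_scaleR[OF assms(2), of "-1"]] by simp

lemma hl_integral_diff:
  fixes f :: "real \<Rightarrow> 'a::banach"
  assumes "hl_absint f" "hl_absint g"
  shows "hl_integral (\<lambda>t. f t - g t) = hl_integral f - hl_integral g"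
  by (intro hl_integral_eq hl_has_integral_diff hl_absint_exists assms)

lemma hl_integral_add:
  fixes f :: "real \<Rightarrow> 'a::banach"
  assumes "hl_absint f" "hl_absint g"
  shows "hl_integral (\<lambda>t. f t + g t) = hl_integral f + hl_integral g"
  by (intro hl_integral_eq hl_has_integral_add hl_absint_exists assms)

lemma hl_integral_scaleR:
  fixes f :: "real \<Rightarrow> 'a::banach"
  assumes "hl_absint f"
  shows "hl_integral (\<lambda>t. c *\<^sub>R f t) = c *\<^sub>R hl_integral f"
  by (intro hl_integral_eq hl_has_integral_scaleR hl_absint_exists assms)

lemma hl_integral_linear:
  fixes f :: "real \<Rightarrow> 'a::banach"
  assumes "hl_absint f" "bounded_linear h"
  shows "hl_integral (\<lambda>t. h (f t)) = h (hl_integral f)"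
  by (rule hl_integral_eq[OF hl_has_integral_linear[OF hl_absint_exists(1)[OF assms(1)] assms(2)]])

lemma hl_integral_norm_bound:
  fixes f :: "real \<Rightarrow> 'a::banach"
  assumes "hl_absint f" "hl_absint g" "\<And>t. t > 0 \<Longrightarrow> norm (f t) \<le> g t"
  shows "norm (hl_integral f) \<le> hl_integral g"
proof -
  have g: "g t \<ge> 0" if "t > 0" for t using order_trans[OF norm_ge_zero assms(3)[OF that]] .
  note G = hl_absint_real_integral[OF g hl_absint_cont[OF assms(2)] hl_absint_exists(1)[OF assms(2)]]
  have "norm (hl_integral f) \<le> (LBINT t:{0<..}. norm (f t))" by (rule hl_absint_exists[OF assms(1)])
  also have "\<dots> \<le> (LBINT t:{0<..}. g t)"
  proof (rule set_integral_mono)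
    show "set_integrable lborel {0<..} (\<lambda>t. norm (f t))" using assms(1) by (simp add: hl_absint_def)
  qed (use assms(3) G(1) in simp_all)
  also have "\<dots> = hl_integral g" by (rule G(2))
  finally show ?thesis .
qed

section \<open>Dominated convergence and differentiation under the integral sign\<close>

text \<open>Dominated convergence is invoked only for the scalar functions
  \<open>norm (f i t - f0 t)\<close>, with majorant \<open>2 * g t\<close>; the norm estimate for
  the integral transfers the result to vectors.\<close>

lemma hl_integral_LIMSEQ:
  fixes f :: "nat \<Rightarrow> real \<Rightarrow> 'a::banach"
  assumes c: "\<And>i. continuous_on {0<..} (f i)" "continuous_on {0<..} f0"
    and bd: "\<And>i t. t > 0 \<Longrightarrow> norm (f i t) \<le> g t" and g: "set_integrable lborel {0<..} g"
    and lim: "\<And>t. t > 0 \<Longrightarrow> (\<lambda>i. f i t) \<longlonglongrightarrow> f0 t"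
  shows "(\<lambda>i. hl_integral (f i)) \<longlonglongrightarrow> hl_integral f0"
proof -
  have bd0: "norm (f0 t) \<le> g t" if "t > 0" for t
    by (rule LIMSEQ_le_const2[OF tendsto_norm[OF lim[OF that]]]) (use bd that in auto)
  have ai: "hl_absint (f i)" for i by (rule hl_absint_bound[OF c(1) g bd])
  have a0: "hl_absint f0" by (rule hl_absint_bound[OF c(2) g bd0])
  have m: "(\<lambda>t. indicator {0<..} t *\<^sub>R norm (f i t - f0 t)) \<in> borel_measurable lborel" for i
  proof -
    have "continuous_on {0<..} (\<lambda>t. norm (f i t - f0 t))" using c by (intro continuous_intros)
    from borel_measurable_continuous_on_indicator[OF _ this] show ?thesis by simp
  qed
  have "(\<lambda>i. LBINT t:{0<..}. norm (f i t - f0 t)) \<longlonglongrightarrow> (LBINT (t::real). (0::real))"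
    unfolding set_lebesgue_integral_def
  proof (rule Bochner_Integration.integral_dominated_convergence[where w="\<lambda>t. indicator {0<..} t *\<^sub>R (2 * g t)"])
    show "integrable lborel (\<lambda>t. indicator {0<..} t *\<^sub>R (2 * g t))"
      using set_integrable_mult_right[of 2, OF g] by (simp add: set_integrable_def)
    show "AE t in lborel. (\<lambda>i. indicator {0<..} t *\<^sub>R norm (f i t - f0 t)) \<longlonglongrightarrow> 0"
    proof (rule AE_I2)
      fix t :: real
      show "(\<lambda>i. indicator {0<..} t *\<^sub>R norm (f i t - f0 t)) \<longlonglongrightarrow> 0"
      proof (cases "t > 0")
        case True
        then show ?thesis using LIM_zero[OF lim[OF True]] by (simp add: tendsto_norm_zero)
      qed auto
    qed
    show "AE t in lborel. norm (indicator {0<..} t *\<^sub>R norm (f i t - f0 t)) \<le> indicator {0<..} t *\<^sub>R (2 * g t)" for i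
    proof (rule AE_I2)
      fix t :: real
      show "norm (indicator {0<..} t *\<^sub>R norm (f i t - f0 t)) \<le> indicator {0<..} t *\<^sub>R (2 * g t)"
        using norm_triangle_ineq4[of "f i t" "f0 t"] bd[of t i] bd0[of t] by (auto simp: indicator_def)
    qed
  qed (use m in auto)
  then have *: "(\<lambda>i. LBINT t:{0<..}. norm (f i t - f0 t)) \<longlonglongrightarrow> 0" by simp
  have "(\<lambda>i. hl_integral (f i) - hl_integral f0) \<longlonglongrightarrow> 0"
  proof (rule Lim_null_comparison[OF _ *])
    show "\<forall>\<^sub>F i in sequentially. norm (hl_integral (f i) - hl_integral f0) \<le> (LBINT t:{0<..}. norm (f i t - f0 t))"
      using hl_absint_exists(2)[OF hl_absint_diff[OF ai a0]] by (simp add: hl_integral_diff ai a0)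
  qed
  then show ?thesis by (rule LIM_zero_cancel)
qed

lemma hl_integral_tendsto:
  fixes f :: "real \<Rightarrow> real \<Rightarrow> 'a::banach"
  assumes ev: "eventually (\<lambda>z. continuous_on {0<..} (f z) \<and> (\<forall>t>0. norm (f z t) \<le> g t)) (at x within S)"
    and c: "continuous_on {0<..} f0" and g: "set_integrable lborel {0<..} g"
    and lim: "\<And>t. t > 0 \<Longrightarrow> ((\<lambda>z. f z t) \<longlongrightarrow> f0 t) (at x within S)"
  shows "((\<lambda>z. hl_integral (f z)) \<longlongrightarrow> hl_integral f0) (at x within S)"
  unfolding tendsto_at_iff_sequentially
proof (intro allI impI)
  fix X :: "nat \<Rightarrow> real" assume X: "\<forall>i. X i \<in> S - {x}" "X \<longlonglongrightarrow> x"
  have XF: "filterlim X (at x within S) sequentially"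
    using X by (auto simp: filterlim_at)
  \<comment> \<open>The domination holds only near \<open>x\<close>, so the first \<open>N\<close>
    terms of the sequence are dropped.\<close>
  then obtain N where N: "\<And>i. i \<ge> N \<Longrightarrow> continuous_on {0<..} (f (X i)) \<and> (\<forall>t>0. norm (f (X i) t) \<le> g t)"
    using eventually_compose_filterlim[OF ev XF] unfolding eventually_sequentially by blast
  have "(\<lambda>i. hl_integral (f (X (i + N)))) \<longlonglongrightarrow> hl_integral f0"
    by (rule hl_integral_LIMSEQ[OF _ c _ g])
      (use N in \<open>auto intro!: LIMSEQ_ignore_initial_segment filterlim_compose[OF lim XF]\<close>)
  then show "((\<lambda>z. hl_integral (f z)) \<circ> X) \<longlonglongrightarrow> hl_integral f0"
    unfolding o_def by (rule LIMSEQ_offset)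
qed

lemma hl_integral_tendsto_at_top:
  fixes f :: "real \<Rightarrow> real \<Rightarrow> 'a::banach"
  assumes ev: "eventually (\<lambda>z. continuous_on {0<..} (f z) \<and> (\<forall>t>0. norm (f z t) \<le> g t)) at_top"
    and c: "continuous_on {0<..} f0" and g: "set_integrable lborel {0<..} g"
    and lim: "\<And>t. t > 0 \<Longrightarrow> ((\<lambda>z. f z t) \<longlongrightarrow> f0 t) at_top"
  shows "((\<lambda>z. hl_integral (f z)) \<longlongrightarrow> hl_integral f0) at_top"
  using assms unfolding filterlim_at_top_to_right eventually_at_top_to_right
  by (intro hl_integral_tendsto) auto

lemma has_vector_derivative_iff_quotient:
  "(f has_vector_derivative D) (at x within S) \<longleftrightarrow>
     ((\<lambda>z. (f z - f x) /\<^sub>R (z - x)) \<longlongrightarrow> D) (at x within S)"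
proof -
  have "((\<lambda>z. (f z - f x) /\<^sub>R (z - x)) \<longlongrightarrow> D) (at x within S) \<longleftrightarrow>
      ((\<lambda>z. norm ((f z - f x) /\<^sub>R (z - x) - D)) \<longlongrightarrow> 0) (at x within S)"
    by (subst LIM_zero_iff[symmetric], subst tendsto_norm_zero_iff[symmetric]) (rule refl)
  also have "\<dots> \<longleftrightarrow> ((\<lambda>z. norm ((f z - f x) - (z - x) *\<^sub>R D) / norm (z - x)) \<longlongrightarrow> 0) (at x within S)"
  proof (rule filterlim_cong[OF refl refl])
    have *: "norm ((f z - f x) /\<^sub>R (z - x) - D) = norm ((f z - f x) - (z - x) *\<^sub>R D) / norm (z - x)" if "z \<noteq> x" for z
    proof -
      have "(f z - f x) /\<^sub>R (z - x) - D = ((f z - f x) - (z - x) *\<^sub>R D) /\<^sub>R (z - x)"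
        using that by (simp add: scaleR_diff_right)
      then show ?thesis by (simp add: divide_inverse mult.commute)
    qed
    show "\<forall>\<^sub>F z in at x within S. norm ((f z - f x) /\<^sub>R (z - x) - D) = norm ((f z - f x) - (z - x) *\<^sub>R D) / norm (z - x)"
      using * by (auto simp: eventually_at_filter)
  qed
  also have "\<dots> \<longleftrightarrow> (f has_vector_derivative D) (at x within S)"
    unfolding has_vector_derivative_def has_derivative_iff_norm by (simp add: bounded_linear_scaleR_left)
  finally show ?thesis ..
qed

lemma difference_quotient_bound:
  fixes f :: "real \<Rightarrow> 'a::real_normed_vector"
  assumes f: "\<And>y. y \<in> ball y0 d \<Longrightarrow> (f has_vector_derivative f' y) (at y)"
    and bd: "\<And>y. y \<in> ball y0 d \<Longrightarrow> norm (f' y) \<le> K" and z: "z \<in> ball y0 d" "z \<noteq> y0"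
  shows "norm ((f z - f y0) /\<^sub>R (z - y0)) \<le> K"
proof -
  have *: "norm (f b - f a) \<le> K * b - K * a" if "a < b" "{a..b} \<subseteq> ball y0 d" for a b
  proof (rule differentiable_bound_general[OF that(1)])
    show "continuous_on {a..b} f"
      by (intro continuous_at_imp_continuous_on ballI)
        (meson f has_vector_derivative_continuous subsetD that(2))
    show "continuous_on {a..b} (\<lambda>x. K * x)" by (intro continuous_intros)
  next
    fix x assume "a < x" "x < b"
    then have "x \<in> {a..b}" by simp
    then have "x \<in> ball y0 d" using that(2) by blast
    then show "(f has_vector_derivative f' x) (at x)" "norm (f' x) \<le> K" using f bd by auto
    show "((*) K has_vector_derivative K) (at x)"
      by (auto intro!: derivative_eq_intros simp flip: has_real_derivative_iff_has_vector_derivative)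
  qed
  have "norm (f z - f y0) \<le> K * \<bar>z - y0\<bar>"
  proof (cases "z < y0")
    case True
    then have "{z..y0} \<subseteq> ball y0 d" using z by (auto simp: dist_real_def)
    from *[OF True this] True show ?thesis by (simp add: norm_minus_commute algebra_simps)
  next
    case False
    then have "{y0..z} \<subseteq> ball y0 d" using z by (auto simp: dist_real_def)
    with *[of y0 z] False z show ?thesis by (simp add: algebra_simps)
  qed
  moreover have "norm ((f z - f y0) /\<^sub>R (z - y0)) = norm (f z - f y0) / \<bar>z - y0\<bar>"
    by (simp add: divide_inverse mult.commute)
  ultimately show ?thesis using z(2) by (simp add: pos_divide_le_eq)
qed

text \<open>The mean value inequality passes the bound on \<open>f'\<close> over the ball to the
  difference quotients, so dominated convergence applies to them.\<close>

lemma hl_integral_derivative: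
  fixes f :: "real \<Rightarrow> real \<Rightarrow> 'a::banach"
  assumes d: "d > 0" and ai: "\<And>y. y \<in> ball y0 d \<Longrightarrow> hl_absint (f y)"
    and f': "\<And>y t. y \<in> ball y0 d \<Longrightarrow> t > 0 \<Longrightarrow> ((\<lambda>y. f y t) has_vector_derivative f' y t) (at y)"
    and bd: "\<And>y t. y \<in> ball y0 d \<Longrightarrow> t > 0 \<Longrightarrow> norm (f' y t) \<le> g t"
    and g: "set_integrable lborel {0<..} g" and c: "continuous_on {0<..} (f' y0)"
  shows "((\<lambda>y. hl_integral (f y)) has_vector_derivative hl_integral (f' y0)) (at y0)"
  unfolding has_vector_derivative_iff_quotient
proof -
  have y0: "y0 \<in> ball y0 d" using d by simp
  have ev: "eventually (\<lambda>z. z \<in> ball y0 d \<and> z \<noteq> y0) (at y0)"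
    using d by (auto simp: eventually_at dist_commute)
  have "((\<lambda>z. hl_integral (\<lambda>t. (f z t - f y0 t) /\<^sub>R (z - y0))) \<longlongrightarrow> hl_integral (f' y0)) (at y0)"
  proof (rule hl_integral_tendsto[OF _ c g])
    show "\<forall>\<^sub>F z in at y0. continuous_on {0<..} (\<lambda>t. (f z t - f y0 t) /\<^sub>R (z - y0)) \<and>
        (\<forall>t>0. norm ((f z t - f y0 t) /\<^sub>R (z - y0)) \<le> g t)"
      using ev
    proof eventually_elim
      case (elim z)
      have "norm ((f z t - f y0 t) /\<^sub>R (z - y0)) \<le> g t" if "t > 0" for t
        by (rule difference_quotient_bound[of y0 d "\<lambda>y. f y t" "\<lambda>y. f' y t"]) (use elim that f' bd in auto)
      then show ?case using hl_absint_cont[OF ai] elim y0 by (auto intro!: continuous_intros)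
    qed
    show "((\<lambda>z. (f z t - f y0 t) /\<^sub>R (z - y0)) \<longlongrightarrow> f' y0 t) (at y0)" if "t > 0" for t
      using f'[OF y0 that] unfolding has_vector_derivative_iff_quotient .
  qed
  moreover have "\<forall>\<^sub>F z in at y0. hl_integral (\<lambda>t. (f z t - f y0 t) /\<^sub>R (z - y0)) =
      (hl_integral (f z) - hl_integral (f y0)) /\<^sub>R (z - y0)"
    using ev
  proof eventually_elim
    case (elim z)
    then have "hl_absint (f z)" "hl_absint (f y0)" using ai y0 by auto
    then show ?case by (simp add: hl_integral_scaleR[OF hl_absint_diff] hl_integral_diff del: scaleR_right_diff_distrib)
  qed
  ultimately show "((\<lambda>z. (hl_integral (f z) - hl_integral (f y0)) /\<^sub>R (z - y0)) \<longlongrightarrow> hl_integral (f' y0)) (at y0)"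
    by (rule Lim_transform_eventually)
qed

section \<open>Agreement with the Bochner integral\<close>

text \<open>The triangle inequality through \<open>f\<close>, integrated. It makes the value of the
  Bochner integral independent of the approximating simple functions, in an arbitrary Banach
  space.\<close>

lemma simple_bochner_integral_diff_bound:
  fixes f s t :: "'m \<Rightarrow> 'b::real_normed_vector"
  assumes f[measurable]: "f \<in> borel_measurable M"
    and s: "Bochner_Integration.simple_bochner_integrable M s"
    and t: "Bochner_Integration.simple_bochner_integrable M t"
  shows "ennreal (norm (Bochner_Integration.simple_bochner_integral M s - Bochner_Integration.simple_bochner_integral M t)) \<le>
    (\<integral>\<^sup>+ x. norm (f x - s x) \<partial>M) + (\<integral>\<^sup>+ x. norm (f x - t x) \<partial>M)"
    (is "ennreal (norm (?s - ?t)) \<le> ?S + ?T")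
proof -
  \<comment> \<open>In a nonseparable space a difference of measurable functions may fail to be
    measurable. Here \<open>r\<close> takes finitely many values, so it suffices to treat
    \<open>f x - v\<close> for each fixed value \<open>v\<close>.\<close>
  have meas: "(\<lambda>x. norm (f x - r x)) \<in> borel_measurable M"
    if r: "Bochner_Integration.simple_bochner_integrable M r" for r :: "'m \<Rightarrow> 'b"
  proof -
    have rs: "simple_function M r"
      using r by (auto elim: Bochner_Integration.simple_bochner_integrable.cases)
    let ?I = "r ` space M"
    have "(\<lambda>x. (\<lambda>v x. norm (f x - v)) (r x) x) \<in> borel_measurable M"
    proof (rule measurable_compose_countable'[where f="\<lambda>v x. norm (f x - v)" and g=r and I="?I"])
      show "(\<lambda>x. norm (f x - v)) \<in> borel_measurable M" for v
      proof (rule measurable_compose[OF f])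
        show "(\<lambda>y. norm (y - v)) \<in> borel_measurable borel"
          by (rule borel_measurable_continuous_onI) (intro continuous_intros)
      qed
      show "r \<in> measurable M (count_space ?I)" "countable ?I"
        using rs by (auto simp: simple_function_def measurable_count_space_eq2 countable_finite)
    qed
    then show ?thesis by simp
  qed
  note [measurable] = meas[OF s] meas[OF t]
  have "ennreal (norm (?s - ?t)) = norm (Bochner_Integration.simple_bochner_integral M (\<lambda>x. s x - t x))"
    using s t by (subst simple_bochner_integral_diff) auto
  also have "\<dots> \<le> Bochner_Integration.simple_bochner_integral M (\<lambda>x. norm (s x - t x))"
    using simple_bochner_integrable_compose2[of "(-)" M "s" "t"] s t
    by (auto intro!: simple_bochner_integral_norm_bound)
  also have "\<dots> = (\<integral>\<^sup>+x. norm (s x - t x) \<partial>M)"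
    using simple_bochner_integrable_compose2[of "\<lambda>x y. norm (x - y)" M "s" "t"] s t
    by (auto intro!: simple_bochner_integral_eq_nn_integral)
  also have "\<dots> \<le> (\<integral>\<^sup>+x. ennreal (norm (f x - s x)) + ennreal (norm (f x - t x)) \<partial>M)"
  proof (rule nn_integral_mono)
    fix x
    have "norm (s x - t x) \<le> norm (f x - s x) + norm (f x - t x)"
      using norm_triangle_ineq4[of "f x - t x" "f x - s x"] by (simp add: add.commute)
    then show "ennreal (norm (s x - t x)) \<le> ennreal (norm (f x - s x)) + ennreal (norm (f x - t x))"
      by (simp flip: ennreal_plus add: ennreal_leI)
  qed
  also have "\<dots> = ?S + ?T"
   by (rule nn_integral_add) auto
  finally show ?thesis .
qed

lemma bochner_has_integral_unique:
  assumes "bochner_has_integral M f x" "bochner_has_integral M f y"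
  shows "x = y"
proof -
  from assms obtain s t where
    f: "f \<in> borel_measurable M" and
    s: "\<And>i. Bochner_Integration.simple_bochner_integrable M (s i)"
      "(\<lambda>i. \<integral>\<^sup>+z. ennreal (norm (f z - s i z)) \<partial>M) \<longlonglongrightarrow> 0"
      "(\<lambda>i. Bochner_Integration.simple_bochner_integral M (s i)) \<longlonglongrightarrow> x" and
    t: "\<And>i. Bochner_Integration.simple_bochner_integrable M (t i)"
      "(\<lambda>i. \<integral>\<^sup>+z. ennreal (norm (f z - t i z)) \<partial>M) \<longlonglongrightarrow> 0"
      "(\<lambda>i. Bochner_Integration.simple_bochner_integral M (t i)) \<longlonglongrightarrow> y"
    unfolding bochner_has_integral_def by blast
  have "(\<lambda>i. ennreal (norm (Bochner_Integration.simple_bochner_integral M (s i) -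
      Bochner_Integration.simple_bochner_integral M (t i)))) \<longlonglongrightarrow> ennreal (norm (x - y))"
    using s(3) t(3) by (intro tendsto_intros)
  moreover have "(\<lambda>i. ennreal (norm (Bochner_Integration.simple_bochner_integral M (s i) -
      Bochner_Integration.simple_bochner_integral M (t i)))) \<longlonglongrightarrow> 0"
  proof (rule tendsto_sandwich[OF _ _ tendsto_const])
    show "(\<lambda>i. (\<integral>\<^sup>+z. ennreal (norm (f z - s i z)) \<partial>M) + (\<integral>\<^sup>+z. ennreal (norm (f z - t i z)) \<partial>M)) \<longlonglongrightarrow> 0"
      using tendsto_add[OF s(2) t(2)] by simp
  qed (use simple_bochner_integral_diff_bound[OF f s(1) t(1)] in auto)
  ultimately have "ennreal (norm (x - y)) = 0" by (rule LIMSEQ_unique)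
  then show ?thesis by (simp add: ennreal_eq_0_iff)
qed

text \<open>A step function with mesh below the modulus of uniform continuity belonging to
  \<open>e\<close>. Its integral is a Riemann sum, and it is compared with \<open>F b - F a\<close>
  cell by cell through the mean value inequality, so that no integral of \<open>f\<close> itself has
  to be known.\<close>

lemma simple_approx_interval:
  fixes f F :: "real \<Rightarrow> 'a::real_normed_vector"
  assumes ab: "a < b" and F: "\<And>x. x \<in> {a..b} \<Longrightarrow> (F has_vector_derivative f x) (at x)"
    and f: "continuous_on {a..b} f" and e: "e > 0"
  obtains s where "Bochner_Integration.simple_bochner_integrable lborel s"
    "\<And>x. x \<notin> {a..<b} \<Longrightarrow> s x = 0" "\<And>x. x \<in> {a..<b} \<Longrightarrow> norm (f x - s x) \<le> e"
    "norm (Bochner_Integration.simple_bochner_integral lborel s - (F b - F a)) \<le> e * (b - a)"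
proof -
  have "uniformly_continuous_on {a..b} f"
    using f by (rule compact_uniformly_continuous) simp
  then obtain d where d: "d > 0" "\<And>x y. x \<in> {a..b} \<Longrightarrow> y \<in> {a..b} \<Longrightarrow> dist y x < d \<Longrightarrow> dist (f y) (f x) < e"
    unfolding uniformly_continuous_on_def using e by metis
  obtain N :: nat where N: "(b - a) / d < real N" using reals_Archimedean2 by blast
  have N0: "N > 0" using N ab d(1) by (cases N) (auto simp: field_simps)
  define h where "h = (b - a) / real N"
  have h: "h > 0" "h < d" "real N * h = b - a"
    using N N0 ab d(1) by (auto simp: h_def field_simps)
  define p where "p j = a + real j * h" for j
  have p0: "p 0 = a" "p N = b" using h by (auto simp: p_def)
  have pS: "p (Suc j) = p j + h" for j by (simp add: p_def algebra_simps)
  have pin: "p j \<in> {a..b}" if "j \<le> N" for j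
  proof -
    have "real j * h \<le> real N * h" using that h(1) by (intro mult_right_mono) auto
    then show ?thesis using h by (simp add: p_def)
  qed
  \<comment> \<open>The number of the cell containing \<open>x\<close>. The extra value
    \<open>N\<close> labels the complement of \<open>{a..<b}\<close>, where the step function is 0;
    thus \<open>idx\<close> has finite range and is itself simple.\<close>
  define idx where "idx x = (if x \<in> {a..<b} then nat \<lfloor>(x - a) / h\<rfloor> else N)" for x
  have idx: "idx x = j \<longleftrightarrow> x \<in> {p j..<p (Suc j)}" if j: "j < N" for x j
  proof -
    have sub: "{p j..<p (Suc j)} \<subseteq> {a..<b}" using pin[of j] pin[of "Suc j"] j by auto
    have "nat \<lfloor>(x - a) / h\<rfloor> = j \<longleftrightarrow> x \<in> {p j..<p (Suc j)}" if x: "x \<in> {a..<b}"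
    proof -
      have nn: "\<lfloor>(x - a) / h\<rfloor> \<ge> 0" using x h by simp
      have "nat \<lfloor>(x - a) / h\<rfloor> = j \<longleftrightarrow> \<lfloor>(x - a) / h\<rfloor> = int j" using nn by auto
      also have "\<dots> \<longleftrightarrow> real j \<le> (x - a) / h \<and> (x - a) / h < real j + 1"
        by (auto simp: floor_eq_iff)
      also have "\<dots> \<longleftrightarrow> x \<in> {p j..<p (Suc j)}"
        using h by (auto simp: p_def field_simps)
      finally show ?thesis .
    qed
    then show ?thesis using sub j by (auto simp: idx_def)
  qed
  have idxN: "idx x = N \<longleftrightarrow> x \<notin> {a..<b}" and idx_le: "idx x \<le> N" for x
  proof -
    have "nat \<lfloor>(x - a) / h\<rfloor> < N" if "x \<in> {a..<b}"
    proof -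
      have "(x - a) / h < real N" using that h by (simp add: divide_less_eq)
      then have "\<lfloor>(x - a) / h\<rfloor> < int N" by (simp add: floor_less_iff)
      then show ?thesis using N0 by linarith
    qed
    then show "idx x = N \<longleftrightarrow> x \<notin> {a..<b}" "idx x \<le> N" by (auto simp: idx_def less_imp_le)
  qed
  define v where "v j = (if j < N then f (p j) else 0)" for j
  define s where "s x = v (idx x)" for x
  have rng: "idx ` space lborel \<subseteq> {..N}" using idx_le by auto
  have sf: "simple_function lborel idx"
    unfolding simple_function_def
  proof (intro conjI ballI)
    show "finite (idx ` space lborel)" using rng by (rule finite_subset) simp
    fix j assume "j \<in> idx ` space lborel"
    then have "j < N \<or> j = N" using rng by auto
    moreover have "idx -` {j} = {p j..<p (Suc j)}" if "j < N"
      by (rule set_eqI) (simp only: vimage_singleton_eq idx[OF that])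
    moreover have "idx -` {N} = - {a..<b}"
      by (rule set_eqI) (simp only: vimage_singleton_eq idxN Compl_iff)
    ultimately show "idx -` {j} \<inter> space lborel \<in> sets lborel" by auto
  qed
  have s0: "s x = 0" if "x \<notin> {a..<b}" for x using that by (simp add: s_def v_def idxN[THEN iffD2])
  have sbi: "Bochner_Integration.simple_bochner_integrable lborel s"
  proof
    show "simple_function lborel s" unfolding s_def by (rule simple_function_compose1[OF sf])
    have "emeasure lborel {y \<in> space lborel. s y \<noteq> 0} \<le> emeasure lborel {a..b}"
    proof (rule emeasure_mono)
      have "y \<in> {a..<b}" if "s y \<noteq> 0" for y using s0[of y] that by blast
      then show "{y \<in> space lborel. s y \<noteq> 0} \<subseteq> {a..b}" by force
    qed simp
    also have "\<dots> < \<infinity>" using ab by simp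
    finally show "emeasure lborel {y \<in> space lborel. s y \<noteq> 0} \<noteq> \<infinity>" by simp
  qed
  have close: "norm (f x - f (p j)) \<le> e" if "j < N" "x \<in> {p j..p (Suc j)}" for x j
  proof -
    have "dist x (p j) < d" using that h pS[of j] by (auto simp: dist_real_def)
    then have "dist (f x) (f (p j)) < e"
      using pin[of j] pin[of "Suc j"] that by (intro d(2)) auto
    then show ?thesis by (simp add: dist_norm)
  qed
  have sclose: "norm (f x - s x) \<le> e" if "x \<in> {a..<b}" for x
  proof -
    have "idx x < N" using idxN[of x] idx_le[of x] that by auto
    moreover from this have "x \<in> {p (idx x)..<p (Suc (idx x))}" by (simp only: idx[OF \<open>idx x < N\<close>, symmetric])
    ultimately show ?thesis using close[of "idx x" x] by (simp add: s_def v_def)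
  qed
  have "Bochner_Integration.simple_bochner_integral lborel s =
      (\<Sum>j\<in>idx ` space lborel. measure lborel {x \<in> space lborel. idx x = j} *\<^sub>R v j)"
    by (rule simple_bochner_integral_partition[OF sbi sf]) (auto simp: s_def)
  also have "\<dots> = (\<Sum>j\<in>{..N}. measure lborel {x \<in> space lborel. idx x = j} *\<^sub>R v j)"
  proof (rule sum.mono_neutral_left[OF _ rng])
    show "\<forall>i\<in>{..N} - idx ` space lborel. measure lborel {x \<in> space lborel. idx x = i} *\<^sub>R v i = 0"
    proof
      fix i assume "i \<in> {..N} - idx ` space lborel"
      then have "{x \<in> space lborel. idx x = i} = {}" by auto
      then show "measure lborel {x \<in> space lborel. idx x = i} *\<^sub>R v i = 0" by (simp only: measure_empty scaleR_zero_left)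
    qed
  qed auto
  also have "\<dots> = (\<Sum>j<N. h *\<^sub>R f (p j))"
  proof -
    have "measure lborel {x \<in> space lborel. idx x = j} = h" if "j < N" for j
    proof -
      have "{x \<in> space lborel. idx x = j} = {p j..<p (Suc j)}"
        by (rule set_eqI) (simp only: mem_Collect_eq idx[OF that] space_lborel space_borel UNIV_I simp_thms)
      then show ?thesis using pS[of j] h by simp
    qed
    then show ?thesis by (simp add: v_def lessThan_Suc_atMost[symmetric])
  qed
  finally have si: "Bochner_Integration.simple_bochner_integral lborel s = (\<Sum>j<N. h *\<^sub>R f (p j))" .
  have "F b - F a = (\<Sum>j<N. F (p (Suc j)) - F (p j))"
    by (subst sum_lessThan_telescope) (simp add: p0)
  then have "norm (Bochner_Integration.simple_bochner_integral lborel s - (F b - F a)) =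
      norm (\<Sum>j<N. (h *\<^sub>R f (p j) - (F (p (Suc j)) - F (p j))))"
    unfolding si by (simp add: sum_subtractf)
  also have "\<dots> \<le> (\<Sum>j<N. e * h)"
  proof (rule sum_norm_le)
    fix j assume "j \<in> {..<N}"
    then have j: "j < N" by simp
    have sub: "{p j..p (Suc j)} \<subseteq> {a..b}" using pin[of j] pin[of "Suc j"] j by auto
    \<comment> \<open>On cell \<open>j\<close> this function has derivative
      \<open>f x - f (p j)\<close>, of norm at most \<open>e\<close>; its increment is the local
      error of the Riemann sum.\<close>
    let ?G = "\<lambda>x. F x - x *\<^sub>R f (p j)"
    have dG: "(?G has_vector_derivative (f x - f (p j))) (at x)" if "x \<in> {p j..p (Suc j)}" for x
      using that sub by (auto intro!: derivative_eq_intros F)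
    have "norm (?G (p (Suc j)) - ?G (p j)) \<le> e * p (Suc j) - e * p j"
    proof (rule differentiable_bound_general)
      show "p j < p (Suc j)" using pS h by simp
      show "continuous_on {p j..p (Suc j)} ?G"
        by (intro continuous_at_imp_continuous_on ballI has_vector_derivative_continuous[OF dG])
      show "continuous_on {p j..p (Suc j)} (\<lambda>x. e * x)" by (intro continuous_intros)
    next
      fix x assume x: "p j < x" "x < p (Suc j)"
      show "(?G has_vector_derivative (f x - f (p j))) (at x)" "norm (f x - f (p j)) \<le> e"
        using x by (auto intro!: dG close j)
      show "((*) e has_vector_derivative e) (at x)"
        by (auto intro!: derivative_eq_intros simp flip: has_real_derivative_iff_has_vector_derivative)
    qed
    also have "?G (p (Suc j)) - ?G (p j) = - (h *\<^sub>R f (p j) - (F (p (Suc j)) - F (p j)))"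
      by (simp add: pS algebra_simps)
    finally show "norm (h *\<^sub>R f (p j) - (F (p (Suc j)) - F (p j))) \<le> e * h"
      by (simp only: norm_minus_cancel) (simp add: pS algebra_simps)
  qed
  also have "\<dots> = e * (b - a)" using h(3) by simp
  finally show thesis using that sbi s0 sclose by blast
qed

text \<open>Step functions on windows exhausting the half-line: inside the window the mean error is
  at most \<open>e i * (k i - a i)\<close>, and outside it is the tail of the integral of the
  norm.\<close>

lemma hl_absint_bochner:
  fixes f :: "real \<Rightarrow> 'a::banach"
  assumes f: "hl_absint f"
  shows "bochner_has_integral lborel (\<lambda>t. indicator {0<..} t *\<^sub>R f t) (hl_integral f)"
proof -
  have c: "continuous_on {0<..} f" and fi: "set_integrable lborel {0<..} (\<lambda>t. norm (f t))"
    using f by (auto simp: hl_absint_def)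
  from hl_absint_exists(1)[OF f] obtain F A where
    F: "\<And>t. t > 0 \<Longrightarrow> (F has_vector_derivative f t) (at t)" "(F \<longlongrightarrow> A) (at_right 0)"
      "(F \<longlongrightarrow> A + hl_integral f) at_top"
    unfolding hl_has_integral_def by metis
  define k :: "nat \<Rightarrow> real" where "k i = real i + 2" for i
  define a where "a i = 1 / k i" for i
  \<comment> \<open>The accuracy \<open>1 / (k i)\<^sup>2\<close> beats the window length, which is
    below \<open>k i\<close>.\<close>
  define e where "e i = 1 / (k i)\<^sup>2" for i
  have k: "k i \<ge> 2" for i by (simp add: k_def)
  have kt: "filterlim k at_top sequentially" unfolding k_def by real_asymp
  have ak: "0 < a i" "a i < k i" "e i > 0" for i
  proof -
    show "0 < a i" "e i > 0" using k[of i] by (simp_all add: a_def e_def)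
    have "a i \<le> 1 / 2" unfolding a_def using k[of i] by (intro divide_left_mono) auto
    then show "a i < k i" using k[of i] by linarith
  qed
  have "\<exists>s. \<forall>i. Bochner_Integration.simple_bochner_integrable lborel (s i) \<and>
    (\<forall>x. x \<notin> {a i..<k i} \<longrightarrow> s i x = 0) \<and> (\<forall>x \<in> {a i..<k i}. norm (f x - s i x) \<le> e i) \<and>
    norm (Bochner_Integration.simple_bochner_integral lborel (s i) - (F (k i) - F (a i))) \<le> e i * (k i - a i)"
  proof (rule choice, rule allI)
    fix i
    obtain s where "Bochner_Integration.simple_bochner_integrable lborel s"
      "\<And>x. x \<notin> {a i..<k i} \<Longrightarrow> s x = 0" "\<And>x. x \<in> {a i..<k i} \<Longrightarrow> norm (f x - s x) \<le> e i"
      "norm (Bochner_Integration.simple_bochner_integral lborel s - (F (k i) - F (a i))) \<le> e i * (k i - a i)"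
    proof (rule simple_approx_interval[of "a i" "k i" F f "e i"])
      show "(F has_vector_derivative f x) (at x)" if "x \<in> {a i..k i}" for x
        using that ak[of i] by (intro F(1)) auto
      show "continuous_on {a i..k i} f"
        by (rule continuous_on_subset[OF c]) (use ak(1)[of i] in auto)
    qed (use ak in auto)
    then show "\<exists>s. Bochner_Integration.simple_bochner_integrable lborel s \<and>
      (\<forall>x. x \<notin> {a i..<k i} \<longrightarrow> s x = 0) \<and> (\<forall>x \<in> {a i..<k i}. norm (f x - s x) \<le> e i) \<and>
      norm (Bochner_Integration.simple_bochner_integral lborel s - (F (k i) - F (a i))) \<le> e i * (k i - a i)"
      by blast
  qed
  then obtain s where s: "\<And>i. Bochner_Integration.simple_bochner_integrable lborel (s i)"
    "\<And>i x. x \<notin> {a i..<k i} \<Longrightarrow> s i x = 0" "\<And>i x. x \<in> {a i..<k i} \<Longrightarrow> norm (f x - s i x) \<le> e i"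
    "\<And>i. norm (Bochner_Integration.simple_bochner_integral lborel (s i) - (F (k i) - F (a i))) \<le> e i * (k i - a i)"
    by blast
  have ek: "(\<lambda>i. e i * (k i - a i)) \<longlonglongrightarrow> 0"
    unfolding e_def a_def k_def by real_asymp
  have at0: "filterlim a (at_right 0) sequentially"
    unfolding a_def k_def by real_asymp
  have "(\<lambda>i. F (k i) - F (a i)) \<longlonglongrightarrow> (A + hl_integral f) - A"
    by (intro tendsto_diff filterlim_compose[OF F(3) kt] filterlim_compose[OF F(2) at0])
  moreover have "(\<lambda>i. Bochner_Integration.simple_bochner_integral lborel (s i) - (F (k i) - F (a i))) \<longlonglongrightarrow> 0"
    by (rule Lim_null_comparison[OF _ ek]) (use s(4) in auto)
  ultimately have 1: "(\<lambda>i. Bochner_Integration.simple_bochner_integral lborel (s i)) \<longlonglongrightarrow> hl_integral f"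
    using tendsto_add by fastforce
  \<comment> \<open>The norm of \<open>f\<close> off the \<open>i\<close>-th window. It is dominated
    by the integrable norm and vanishes at each point as soon as the window contains it.\<close>
  let ?w = "\<lambda>i t. indicator ({0<..} - {a i..<k i}) t *\<^sub>R norm (f t)"
  have wi: "integrable lborel (?w i)" for i
    using set_integrable_subset[OF fi, of "{0<..} - {a i..<k i}"] by (auto simp: set_integrable_def)
  have wl: "(\<lambda>i. LBINT t. ?w i t) \<longlonglongrightarrow> (LBINT (t::real). (0::real))"
  proof (rule Bochner_Integration.integral_dominated_convergence[where w="\<lambda>t. indicator {0<..} t *\<^sub>R norm (f t)"])
    show "integrable lborel (\<lambda>t. indicat_real {0<..} t *\<^sub>R norm (f t))"
      using fi by (simp add: set_integrable_def)
    show "AE t in lborel. (\<lambda>i. ?w i t) \<longlonglongrightarrow> 0"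
    proof (rule AE_I2)
      fix t :: real
      show "(\<lambda>i. ?w i t) \<longlonglongrightarrow> 0"
      proof (cases "t > 0")
        case True
        have "eventually (\<lambda>i. a i < t \<and> a i > 0) sequentially"
          using at0 True by (auto simp: filterlim_at dest!: order_tendstoD(2)[of a 0] elim: eventually_elim2)
        moreover have "eventually (\<lambda>i. t < k i) sequentially"
          using kt by (simp add: filterlim_at_top_dense)
        ultimately have "eventually (\<lambda>i. ?w i t = 0) sequentially"
          by eventually_elim (simp add: indicator_def)
        then show ?thesis by (rule tendsto_eventually)
      qed auto
    qed
    show "AE t in lborel. norm (?w i t) \<le> indicator {0<..} t *\<^sub>R norm (f t)" for i
      by (rule AE_I2) (auto simp: indicator_def)
  qed (use wi in \<open>auto intro: borel_measurable_integrable\<close>)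
  have 2: "(\<lambda>i. \<integral>\<^sup>+t. ennreal (norm (indicator {0<..} t *\<^sub>R f t - s i t)) \<partial>lborel) \<longlonglongrightarrow> 0"
  proof (rule tendsto_sandwich[OF _ _ tendsto_const])
    show "\<forall>\<^sub>F i in sequentially. (\<integral>\<^sup>+t. ennreal (norm (indicator {0<..} t *\<^sub>R f t - s i t)) \<partial>lborel)
        \<le> ennreal (e i * (k i - a i)) + ennreal (LBINT t. ?w i t)"
    proof (rule always_eventually, rule allI)
      fix i
      have "(\<integral>\<^sup>+t. ennreal (norm (indicator {0<..} t *\<^sub>R f t - s i t)) \<partial>lborel) \<le>
          (\<integral>\<^sup>+t. ennreal (e i) * indicator {a i..<k i} t + ennreal (?w i t) \<partial>lborel)"
      proof (rule nn_integral_mono)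
        fix t :: real
        show "ennreal (norm (indicator {0<..} t *\<^sub>R f t - s i t)) \<le> ennreal (e i) * indicator {a i..<k i} t + ennreal (?w i t)"
        proof (cases "t \<in> {a i..<k i}")
          case True
          moreover from True have "t > 0" using ak(1)[of i] by auto
          ultimately show ?thesis using s(3)[OF True] by (simp add: ennreal_leI)
        next
          case False
          then show ?thesis using s(2)[OF False] by (auto simp: indicator_def)
        qed
      qed
      also have "\<dots> = (\<integral>\<^sup>+t. ennreal (e i) * indicator {a i..<k i} t \<partial>lborel) + (\<integral>\<^sup>+t. ennreal (?w i t) \<partial>lborel)"
        by (rule nn_integral_add) (use borel_measurable_integrable[OF wi[of i]] in auto)
      also have "(\<integral>\<^sup>+t. ennreal (e i) * indicator {a i..<k i} t \<partial>lborel) = ennreal (e i * (k i - a i))"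
        using ak[of i] by (subst nn_integral_cmult_indicator) (auto simp: ennreal_mult' less_imp_le)
      also have "(\<integral>\<^sup>+t. ennreal (?w i t) \<partial>lborel) = ennreal (LBINT t. ?w i t)"
        by (rule nn_integral_eq_integral[OF wi]) auto
      finally show "(\<integral>\<^sup>+t. ennreal (norm (indicator {0<..} t *\<^sub>R f t - s i t)) \<partial>lborel)
        \<le> ennreal (e i * (k i - a i)) + ennreal (LBINT t. ?w i t)" .
    qed
    show "(\<lambda>i. ennreal (e i * (k i - a i)) + ennreal (LBINT t. ?w i t)) \<longlonglongrightarrow> 0"
      using tendsto_add[OF tendsto_ennrealI[OF ek] tendsto_ennrealI[OF wl]] by simp
  qed auto
  have 3: "(\<lambda>t. indicator {0<..} t *\<^sub>R f t) \<in> borel_measurable lborel"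
    using borel_measurable_continuous_on_indicator[OF _ c] by simp
  show ?thesis unfolding bochner_has_integral_def
    using 1 2 3 s(1) by blast
qed

lemma bochner_integral_on_pos:
  fixes f :: "real \<Rightarrow> 'a::banach"
  assumes "hl_absint f"
  shows "bochner_integrable_on f {0<..}" "bochner_integral_on {0<..} f = hl_integral f"
proof -
  show "bochner_integrable_on f {0<..}"
    unfolding bochner_integrable_on_def using hl_absint_bochner[OF assms] by blast
  then show "bochner_integral_on {0<..} f = hl_integral f"
    unfolding bochner_integral_on_def
    using hl_absint_bochner[OF assms] bochner_has_integral_unique by (auto intro!: the_equality)
qed

section \<open>The kernel of the extension\<close>

lemma hl_absint_nonneg:
  fixes f :: "real \<Rightarrow> real"
  assumes "\<And>t. t > 0 \<Longrightarrow> f t \<ge> 0" "continuous_on {0<..} f" "hl_has_integral f I"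
  shows "hl_absint f"
  by (rule hl_absint_bound[OF assms(2) hl_absint_real_integral(1)[OF assms]]) (use assms in auto)

lemma hl_has_integral_exp:
  fixes \<mu> :: real assumes "\<mu> > 0"
  shows "hl_has_integral (\<lambda>t. exp (- \<mu> * t)) (1 / \<mu>)"
  unfolding hl_has_integral_def
proof (intro exI conjI allI impI)
  show "((\<lambda>t. - exp (- \<mu> * t) / \<mu>) has_vector_derivative exp (- \<mu> * t)) (at t)" for t
    using assms unfolding has_real_derivative_iff_has_vector_derivative[symmetric]
    by (auto intro!: derivative_eq_intros)
  show "((\<lambda>t. - exp (- \<mu> * t) / \<mu>) \<longlongrightarrow> - 1 / \<mu>) (at_right 0)"
    using assms by (auto intro!: tendsto_eq_intros)
  have "((\<lambda>t. - exp (- \<mu> * t) / \<mu>) \<longlongrightarrow> 0) at_top"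
    using assms by real_asymp
  then show "((\<lambda>t. - exp (- \<mu> * t) / \<mu>) \<longlongrightarrow> - 1 / \<mu> + 1 / \<mu>) at_top"
    by simp
qed

lemma hl_absint_exp:
  fixes \<mu> :: real assumes "\<mu> > 0"
  shows "hl_absint (\<lambda>t. exp (- \<mu> * t))"
  by (rule hl_absint_nonneg[OF _ _ hl_has_integral_exp[OF assms]]) (auto intro!: continuous_intros)

lemma hl_has_integral_Gamma:
  fixes q :: real assumes "q > 0"
  shows "hl_has_integral (\<lambda>r. r powr (q - 1) * exp (- r)) (Gamma q)"
proof -
  let ?f = "\<lambda>r::real. r powr (q - 1) * exp (- r)"
  have "(?f has_integral Gamma q) {0..}"
    using Gamma_integral_real[OF assms] by (simp add: exp_minus divide_inverse)
  then have hi: "(?f has_integral Gamma q) {0<..}"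
    by (subst has_integral_spike_set_eq[where T="{0..}"]) (auto intro: negligible_subset[of "{0}"])
  have c: "continuous_on {0<..} ?f" by (auto intro!: continuous_intros)
  have "?f absolutely_integrable_on {0<..}"
    using hi by (intro nonnegative_absolutely_integrable_1) auto
  then have "integrable lborel (\<lambda>r. indicator {0<..} r *\<^sub>R ?f r)"
    unfolding set_integrable_def
    by (subst (asm) integrable_completion) (use borel_measurable_continuous_on_indicator[OF _ c] in auto)
  then have si: "set_integrable lborel {0<..} ?f" by (simp add: set_integrable_def)
  obtain I where I: "hl_has_integral ?f I"
    using hl_has_integral_real_exists[OF _ c si] by auto
  have "I = (LBINT t:{0<..}. ?f t)"
    using hl_absint_real_integral(2)[OF _ c I] by simp
  also have "\<dots> = Gamma q"
    using set_borel_integral_eq_integral(2)[OF si] hi by (simp add: integral_unique)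
  finally show ?thesis using I by simp
qed

text \<open>For fixed \<open>y\<close> this is the inverse gamma density in \<open>t\<close> with
  shape \<open>q\<close> and scale \<open>y\<^sup>2 / 4\<close>: the law of
  \<open>y\<^sup>2 / (4 * r)\<close> when \<open>r\<close> has the Gamma distribution of shape
  \<open>q\<close>.\<close>

definition ext_kernel :: "real \<Rightarrow> real \<Rightarrow> real \<Rightarrow> real" where
  "ext_kernel q y t = y powr (2 * q) / (4 powr q * Gamma q) * (exp (- y\<^sup>2 / (4 * t)) / t powr (1 + q))"

lemma ext_kernel_nonneg: "q > 0 \<Longrightarrow> ext_kernel q y t \<ge> 0"
  by (simp add: ext_kernel_def)

lemma ext_kernel_cont: "continuous_on {0<..} (ext_kernel q y)"
  unfolding ext_kernel_def
  by (intro continuous_on_mult continuous_on_const continuous_on_divide) (auto intro!: continuous_intros)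

text \<open>Each derivative of the kernel brings down powers of \<open>1 / t\<close>. This identity
  absorbs every such power into a unit shift of \<open>q\<close>, and all recursions for
  \<open>U\<close> come from it.\<close>

lemma ext_kernel_plus1:
  assumes "q > 0" "y > 0" "t > 0"
  shows "ext_kernel (q + 1) y t = ext_kernel q y t * (y\<^sup>2 / (4 * q * t))"
proof -
  have "y powr (2 * (q + 1)) = y powr (2 * q) * y\<^sup>2"
    using assms powr_add[of y "2 * q" 2] by (simp add: algebra_simps)
  moreover have "Gamma (q + 1) = q * Gamma q" using assms by (intro Gamma_plus1) auto
  moreover have "(4::real) powr (q + 1) = 4 * 4 powr q" by (simp add: powr_add)
  moreover have "t powr (1 + (q + 1)) = t powr (1 + q) * t"
    using assms powr_add[of t "1 + q" 1] by (simp add: algebra_simps)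
  ultimately show ?thesis unfolding ext_kernel_def using assms by (simp only: times_divide_times_eq times_divide_eq_right times_divide_eq_left divide_divide_eq_left) (simp only: ac_simps)
qed

text \<open>The substitution \<open>r = y\<^sup>2 / (4 * t)\<close> in the Gamma integral.\<close>

lemma ext_kernel_has_integral:
  assumes "q > 0" "y > 0"
  shows "hl_has_integral (ext_kernel q y) 1"
proof -
  have "hl_has_integral (\<lambda>t. - (- y\<^sup>2 / (4 * t\<^sup>2)) *\<^sub>R ((y\<^sup>2 / (4 * t)) powr (q - 1) * exp (- (y\<^sup>2 / (4 * t))))) (Gamma q)"
  proof (rule hl_has_integral_substitution[OF hl_has_integral_Gamma[OF assms(1)]])
    show "y\<^sup>2 / (4 * t) > 0" if "t > 0" for t using assms that by simp
    show "((\<lambda>t. y\<^sup>2 / (4 * t)) has_real_derivative - y\<^sup>2 / (4 * t\<^sup>2)) (at t)" if "t > 0" for t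
      using that by (auto intro!: derivative_eq_intros simp: field_simps power2_eq_square)
    show "filterlim (\<lambda>t. y\<^sup>2 / (4 * t)) at_top (at_right 0)" "((\<lambda>t. y\<^sup>2 / (4 * t)) \<longlongrightarrow> 0) at_top"
      using assms by real_asymp+
  qed
  from hl_has_integral_scaleR[OF this, of "1 / Gamma q"]
  have "hl_has_integral (\<lambda>t. (1 / Gamma q) *\<^sub>R (- (- y\<^sup>2 / (4 * t\<^sup>2)) *\<^sub>R ((y\<^sup>2 / (4 * t)) powr (q - 1) * exp (- (y\<^sup>2 / (4 * t)))))) 1"
    using Gamma_real_pos[OF assms(1)] by (simp del: mult_minus_left)
  also have "?this \<longleftrightarrow> ?thesis"
  proof (rule hl_has_integral_cong)
    fix t :: real assume t: "t > 0"
    have "y powr (2 * q) = (y\<^sup>2) powr q" using assms by (simp add: powr_powr flip: powr_numeral)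
    moreover have "(y\<^sup>2 / (4 * t)) powr (q - 1) = (y\<^sup>2) powr q / (4 powr q * t powr q) * (4 * t / y\<^sup>2)"
      using assms t by (simp add: powr_diff powr_divide powr_mult)
    moreover have "t powr (1 + q) = t * t powr q" using t by (simp add: powr_add)
    moreover have "Gamma q \<noteq> 0" "(4::real) powr q > 0" "t powr q > 0"
      using Gamma_real_pos[OF assms(1)] t by auto
    ultimately show "(1 / Gamma q) *\<^sub>R (- (- y\<^sup>2 / (4 * t\<^sup>2)) *\<^sub>R ((y\<^sup>2 / (4 * t)) powr (q - 1) * exp (- (y\<^sup>2 / (4 * t))))) = ext_kernel q y t"
      using assms t by (simp only: ext_kernel_def) (simp add: power2_eq_square)
  qed
  finally show ?thesis .
qed

lemma ext_kernel_absint: "q > 0 \<Longrightarrow> y > 0 \<Longrightarrow> hl_absint (ext_kernel q y)"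
  by (rule hl_absint_nonneg[OF _ ext_kernel_cont ext_kernel_has_integral]) (simp_all add: ext_kernel_nonneg)

text \<open>The logarithmic derivative is \<open>2 * q / y - y / (2 * t)\<close>, and
  \<open>y / (2 * t)\<close> is \<open>2 * q / y\<close> times the factor
  \<open>y\<^sup>2 / (4 * q * t)\<close> of the index shift.\<close>

lemma ext_kernel_deriv_y:
  assumes "q > 0" "y > 0" "t > 0"
  shows "((\<lambda>y. ext_kernel q y t) has_real_derivative (2 * q / y) * (ext_kernel q y t - ext_kernel (q + 1) y t)) (at y)"
proof -
  have 1: "((\<lambda>y. y powr (2 * q)) has_real_derivative (2 * q / y) * y powr (2 * q)) (at y)"
    using assms by (auto intro!: derivative_eq_intros simp: powr_diff)
  have 2: "((\<lambda>y. exp (- y\<^sup>2 / (4 * t))) has_real_derivative - (y / (2 * t)) * exp (- y\<^sup>2 / (4 * t))) (at y)"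
    using assms by (auto intro!: derivative_eq_intros)
  have "((\<lambda>y. (y powr (2 * q) * exp (- y\<^sup>2 / (4 * t))) * (1 / (4 powr q * Gamma q * t powr (1 + q)))) has_real_derivative
      ((2 * q / y) * y powr (2 * q) * exp (- y\<^sup>2 / (4 * t)) + (- (y / (2 * t)) * exp (- y\<^sup>2 / (4 * t))) * y powr (2 * q))
       * (1 / (4 powr q * Gamma q * t powr (1 + q)))) (at y)"
    by (rule DERIV_cmult_right[OF DERIV_mult[OF 1 2]])
  also have "(\<lambda>y. (y powr (2 * q) * exp (- y\<^sup>2 / (4 * t))) * (1 / (4 powr q * Gamma q * t powr (1 + q)))) = (\<lambda>y. ext_kernel q y t)"
    by (simp add: ext_kernel_def)
  also have "((2 * q / y) * y powr (2 * q) * exp (- y\<^sup>2 / (4 * t)) + (- (y / (2 * t)) * exp (- y\<^sup>2 / (4 * t))) * y powr (2 * q))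
       * (1 / (4 powr q * Gamma q * t powr (1 + q))) = ext_kernel q y t * (2 * q / y - y / (2 * t))"
  proof -
    have "(p * A * e + (- r * e) * A) * c = (A * e * c) * (p - r)" for p A e r c :: real
      by (simp add: algebra_simps)
    moreover have "ext_kernel q y t = y powr (2 * q) * exp (- y\<^sup>2 / (4 * t)) * (1 / (4 powr q * Gamma q * t powr (1 + q)))"
      by (simp add: ext_kernel_def)
    ultimately show ?thesis by (simp only:)
  qed
  also have "\<dots> = (2 * q / y) * (ext_kernel q y t - ext_kernel (q + 1) y t)"
    unfolding ext_kernel_plus1[OF assms] using assms by (simp add: field_simps power2_eq_square)
  finally show ?thesis .
qed

text \<open>The logarithmic derivative is \<open>y\<^sup>2 / (4 * t\<^sup>2) - (1 + q) / t\<close>: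
  the first term costs two index shifts, the second one.\<close>

lemma ext_kernel_deriv_t:
  assumes "q > 0" "y > 0" "t > 0"
  shows "(ext_kernel q y has_real_derivative
    - (4 * q * (q + 1) / y\<^sup>2) * (ext_kernel (q + 1) y t - ext_kernel (q + 2) y t)) (at t)"
proof -
  have 1: "ext_kernel (q + 2) y t = ext_kernel q y t * (y\<^sup>2 / (4 * q * t)) * (y\<^sup>2 / (4 * (q + 1) * t))"
    using ext_kernel_plus1[of "q + 1" y t] ext_kernel_plus1[of q y t] assms by (simp add: add.assoc)
  have 2: "((\<lambda>t. t powr (- (1 + q))) has_real_derivative - ((1 + q) / t) * t powr (- (1 + q))) (at t)"
    using assms by (intro DERIV_cong[OF has_real_derivative_powr]) (simp_all only: powr_diff[of t "- (1 + q)" 1], simp add: field_simps)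
  have 3: "((\<lambda>t. exp (- y\<^sup>2 / (4 * t))) has_real_derivative (y\<^sup>2 / (4 * t\<^sup>2)) * exp (- y\<^sup>2 / (4 * t))) (at t)"
    using assms by (auto intro!: derivative_eq_intros simp: field_simps power2_eq_square)
  have "((\<lambda>t. exp (- y\<^sup>2 / (4 * t)) * t powr (- (1 + q))) has_real_derivative
      (exp (- y\<^sup>2 / (4 * t)) * t powr (- (1 + q))) * (y\<^sup>2 / (4 * t\<^sup>2) - (1 + q) / t)) (at t)"
    by (rule DERIV_cong[OF DERIV_mult[OF 3 2]]) (simp add: algebra_simps)
  then have "((\<lambda>t. exp (- y\<^sup>2 / (4 * t)) / t powr (1 + q)) has_real_derivative
      (exp (- y\<^sup>2 / (4 * t)) / t powr (1 + q)) * (y\<^sup>2 / (4 * t\<^sup>2) - (1 + q) / t)) (at t)"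
    by (simp only: powr_minus_divide) simp
  from DERIV_cmult[OF this, of "y powr (2 * q) / (4 powr q * Gamma q)"]
  have "(ext_kernel q y has_real_derivative ext_kernel q y t * (y\<^sup>2 / (4 * t\<^sup>2) - (1 + q) / t)) (at t)"
    unfolding ext_kernel_def by (simp add: mult.assoc)
  also have "ext_kernel q y t * (y\<^sup>2 / (4 * t\<^sup>2) - (1 + q) / t) =
      - (4 * q * (q + 1) / y\<^sup>2) * (ext_kernel (q + 1) y t - ext_kernel (q + 2) y t)"
  proof -
    have "- (4 * q * (q + 1) / y\<^sup>2) * (k * (y\<^sup>2 / (4 * q * t)) - k * (y\<^sup>2 / (4 * q * t)) * (y\<^sup>2 / (4 * (q + 1) * t)))
        = k * (y\<^sup>2 / (4 * t\<^sup>2) - (1 + q) / t)" for k :: real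
      using assms by (simp add: divide_simps) (simp add: algebra_simps power2_eq_square)
    then show ?thesis unfolding 1 ext_kernel_plus1[OF assms] by simp
  qed
  finally show ?thesis .
qed

lemma ext_kernel_tendsto_0:
  assumes "q > 0" "y > 0"
  shows "(ext_kernel q y \<longlongrightarrow> 0) (at_right 0)" "(ext_kernel q y \<longlongrightarrow> 0) at_top"
proof -
  have "((\<lambda>t. exp (- y\<^sup>2 / (4 * t)) / t powr (1 + q)) \<longlongrightarrow> 0) (at_right 0)"
    "((\<lambda>t. exp (- y\<^sup>2 / (4 * t)) / t powr (1 + q)) \<longlongrightarrow> 0) at_top"
    using assms by real_asymp+
  then show "(ext_kernel q y \<longlongrightarrow> 0) (at_right 0)" "(ext_kernel q y \<longlongrightarrow> 0) at_top"
    unfolding ext_kernel_def by (auto intro!: tendsto_mult_right_zero simp del: times_divide_eq_right times_divide_eq_left times_divide_times_eq)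
qed

text \<open>On the ball the power is at most its value at \<open>3 * (y0 / 2)\<close> and the
  exponential at most its value at \<open>y0 / 2\<close>. The majorant is again a kernel, hence
  integrable.\<close>

lemma ext_kernel_local_bound:
  assumes "q > 0" "y0 > 0" "y \<in> ball y0 (y0 / 2)" "t > 0"
  shows "ext_kernel q y t \<le> 3 powr (2 * q) * ext_kernel q (y0 / 2) t"
proof -
  have y: "y0 / 2 < y" "y < 3 * (y0 / 2)" using assms(3) unfolding mem_ball dist_real_def by linarith+
  have "y powr (2 * q) \<le> (3 * (y0 / 2)) powr (2 * q)"
    using y assms by (intro powr_mono2) auto
  also have "\<dots> = 3 powr (2 * q) * (y0 / 2) powr (2 * q)" by (rule powr_mult)
  finally have 1: "y powr (2 * q) \<le> 3 powr (2 * q) * (y0 / 2) powr (2 * q)" .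
  have "(y0 / 2)\<^sup>2 \<le> y\<^sup>2" using y assms by (intro power_mono) auto
  then have "(y0 / 2)\<^sup>2 / (4 * t) \<le> y\<^sup>2 / (4 * t)" using assms by (intro divide_right_mono) auto
  then have 2: "exp (- y\<^sup>2 / (4 * t)) \<le> exp (- (y0 / 2)\<^sup>2 / (4 * t))" by simp
  have "y powr (2 * q) * exp (- y\<^sup>2 / (4 * t)) \<le> (3 powr (2 * q) * (y0 / 2) powr (2 * q)) * exp (- (y0 / 2)\<^sup>2 / (4 * t))"
    by (rule mult_mono[OF 1 2]) auto
  then have "y powr (2 * q) * exp (- y\<^sup>2 / (4 * t)) / (4 powr q * Gamma q * t powr (1 + q)) \<le>
     (3 powr (2 * q) * (y0 / 2) powr (2 * q)) * exp (- (y0 / 2)\<^sup>2 / (4 * t)) / (4 powr q * Gamma q * t powr (1 + q))"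
    using assms by (intro divide_right_mono) auto
  then show ?thesis by (simp add: ext_kernel_def field_simps)
qed

section \<open>Bounded semigroups with invertible generator\<close>

locale bounded_semigroup =
  fixes T :: "real \<Rightarrow> 'a::banach \<Rightarrow>\<^sub>L 'a" and D :: "'a set" and L :: "'a \<Rightarrow> 'a" and M :: real
  assumes semigroup: "C0_semigroup T"
    and M: "M \<ge> 1" "\<And>t. t \<ge> 0 \<Longrightarrow> norm (T t) \<le> M"
    and generator: "infinitesimal_generator T D L"
    and resolvent: "0 \<in> resolvent_set D L"
begin

abbreviation B :: "'a \<Rightarrow> 'a" where "B \<equiv> neg_inverse D L"

lemma T_0: "T 0 x = x"
  using semigroup by (simp add: C0_semigroup_def)

lemma T_add: "t \<ge> 0 \<Longrightarrow> r \<ge> 0 \<Longrightarrow> T (t + r) x = T t (T r x)"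
  using semigroup by (simp add: C0_semigroup_def)

lemma T_norm: "t \<ge> 0 \<Longrightarrow> norm (T t x) \<le> M * norm x"
  using norm_blinfun[of "T t" x] M(2)[of t] mult_right_mono[of "norm (T t)" M "norm x"] by force

lemma T_tendsto: "((\<lambda>t. T t x) \<longlongrightarrow> x) (at_right 0)"
  using semigroup by (simp add: C0_semigroup_def)

text \<open>Pulling out the semigroup at the smaller of two times reduces continuity everywhere, up
  to the factor \<open>M\<close>, to right continuity at 0.\<close>

lemma T_continuous: "continuous_on {0..} (\<lambda>t. T t x)"
proof -
  have le: "norm (T b x - T a x) \<le> M * norm (T \<bar>b - a\<bar> x - x)" if "a \<ge> 0" "b \<ge> 0" for a b
  proof -
    have *: "norm (T b x - T a x) \<le> M * norm (T (b - a) x - x)" if "0 \<le> a" "a \<le> b" for a b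
      using T_norm[of a "T (b - a) x - x"] T_add[of a "b - a" x] that by (simp add: blinfun.diff_right)
    show ?thesis
    proof (cases "a \<le> b")
      case True with *[of a b] that show ?thesis by simp
    next
      case False with *[of b a] that show ?thesis by (simp add: norm_minus_commute)
    qed
  qed
  show ?thesis
    unfolding continuous_on_iff
  proof (intro ballI allI impI)
    fix a e :: real assume a: "a \<in> {0..}" and e: "e > 0"
    have "eventually (\<lambda>t. dist (T t x) x < e / M) (at_right 0)"
      using T_tendsto[of x] e M(1) by (intro tendstoD) auto
    then obtain d where d: "d > 0" "\<And>t. 0 < t \<Longrightarrow> t < d \<Longrightarrow> dist (T t x) x < e / M"
      unfolding eventually_at_right_field by auto
    show "\<exists>d>0. \<forall>b\<in>{0..}. dist b a < d \<longrightarrow> dist (T b x) (T a x) < e"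
    proof (intro exI[of _ d] conjI ballI impI d(1))
      fix b assume b: "b \<in> {0..}" "dist b a < d"
      have "norm (T \<bar>b - a\<bar> x - x) < e / M"
      proof (cases "a = b")
        case False
        then have "dist (T \<bar>b - a\<bar> x) x < e / M" using b by (intro d(2)) (auto simp: dist_real_def)
        then show ?thesis by (simp add: dist_norm)
      qed (use e M(1) in \<open>simp add: T_0\<close>)
      then have "M * norm (T \<bar>b - a\<bar> x - x) < e" using M(1) by (simp add: field_simps)
      then show "dist (T b x) (T a x) < e" using le[of a b] a b by (auto simp: dist_norm)
    qed
  qed
qed

section \<open>The bounded inverse of - L\<close>

lemma B_bij: "bij_betw (\<lambda>x. - L x) D UNIV" and B_linear: "bounded_linear B"
  using resolvent unfolding resolvent_set_def neg_inverse_def by simp_all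

lemma B_in_D: "B x \<in> D"
  unfolding neg_inverse_def using B_bij by (intro inv_into_into) (auto simp: bij_betw_def)

lemma L_B: "L (B x) = - x"
proof -
  have "x \<in> (\<lambda>x. - L x) ` D" using B_bij by (simp add: bij_betw_def)
  from f_inv_into_f[OF this] have "- L (B x) = x" by (simp add: neg_inverse_def)
  then show ?thesis by (simp add: minus_equation_iff)
qed

lemma B_L: "x \<in> D \<Longrightarrow> B (L x) = - x"
proof -
  assume x: "x \<in> D"
  have "B (- L x) = x" unfolding neg_inverse_def
    by (rule inv_into_f_f[of "\<lambda>x. - L x" D x]) (use B_bij x in \<open>auto simp: bij_betw_def\<close>)
  then show ?thesis using linear_neg[OF bounded_linear.linear[OF B_linear], of "L x"] by (simp add: minus_equation_iff)
qed

lemma B_inj: assumes "B x = B y" shows "x = y"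
proof -
  have "- x = L (B x)" by (rule L_B[symmetric])
  also have "\<dots> = - y" unfolding assms by (rule L_B)
  finally show ?thesis by (simp only: neg_equal_iff_equal)
qed

lemmas B_simps = linear_add[OF bounded_linear.linear[OF B_linear]]
  linear_diff[OF bounded_linear.linear[OF B_linear]] linear_neg[OF bounded_linear.linear[OF B_linear]]
  linear_scale[OF bounded_linear.linear[OF B_linear]] linear_0[OF bounded_linear.linear[OF B_linear]]

lemma in_D_iff: "x \<in> D \<longleftrightarrow> (\<exists>w. x = B w)"
proof
  assume "x \<in> D"
  then have "x = B (- L x)" using B_L by (simp add: B_simps)
  then show "\<exists>w. x = B w" ..
qed (auto simp: B_in_D)

lemma L_eqI: "x = B w \<Longrightarrow> L x = - w"
  using L_B by simp

lemma L_linear: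
  assumes "x \<in> D" "y \<in> D"
  shows "x + y \<in> D" "L (x + y) = L x + L y" "x - y \<in> D" "L (x - y) = L x - L y"
    "c *\<^sub>R x \<in> D" "L (c *\<^sub>R x) = c *\<^sub>R L x"
proof -
  obtain v w where vw: "x = B v" "y = B w" using assms in_D_iff by auto
  then have "x + y = B (v + w)" "x - y = B (v - w)" "c *\<^sub>R x = B (c *\<^sub>R v)" by (simp_all add: B_simps)
  then show "x + y \<in> D" "L (x + y) = L x + L y" "x - y \<in> D" "L (x - y) = L x - L y"
    "c *\<^sub>R x \<in> D" "L (c *\<^sub>R x) = c *\<^sub>R L x"
    using L_eqI B_in_D vw by (simp_all add: L_B)
qed

lemma generator_right: "((\<lambda>h. (T h (B x) - B x) /\<^sub>R h) \<longlongrightarrow> - x) (at_right 0)"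
  using generator B_in_D[of x] L_B[of x] unfolding infinitesimal_generator_def by fastforce

text \<open>Applying \<open>T t\<close> to the difference quotient at \<open>B x\<close> shows that
  \<open>T t (B x)\<close> lies in \<open>D\<close> and is mapped by \<open>L\<close> to
  \<open>- T t x\<close>; then \<open>B\<close> is applied.\<close>

lemma T_B: assumes "t \<ge> 0" shows "T t (B x) = B (T t x)"
proof -
  have "((\<lambda>h. T t ((T h (B x) - B x) /\<^sub>R h)) \<longlongrightarrow> T t (- x)) (at_right 0)"
    by (rule blinfun.tendsto[OF tendsto_const generator_right])
  moreover have "\<forall>\<^sub>F h in at_right 0. T t ((T h (B x) - B x) /\<^sub>R h) = (T h (T t (B x)) - T t (B x)) /\<^sub>R h"
    unfolding eventually_at_right_field
  proof (intro exI[of _ 1] conjI allI impI)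
    fix h :: real assume "0 < h"
    then show "T t ((T h (B x) - B x) /\<^sub>R h) = (T h (T t (B x)) - T t (B x)) /\<^sub>R h"
      using T_add[of t h "B x"] T_add[of h t "B x"] assms
      by (simp add: blinfun.scaleR_right blinfun.diff_right add.commute)
  qed simp
  ultimately have l: "((\<lambda>h. (T h (T t (B x)) - T t (B x)) /\<^sub>R h) \<longlongrightarrow> - T t x) (at_right 0)"
    by (auto intro: Lim_transform_eventually simp: blinfun.minus_right)
  then have d: "T t (B x) \<in> D" using generator unfolding infinitesimal_generator_def by blast
  then have "((\<lambda>h. (T h (T t (B x)) - T t (B x)) /\<^sub>R h) \<longlongrightarrow> L (T t (B x))) (at_right 0)"
    using generator unfolding infinitesimal_generator_def by blast
  with l have "L (T t (B x)) = - T t x" using tendsto_unique trivial_limit_at_right_real by blast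
  then show ?thesis using B_L[OF d] by (simp add: B_simps)
qed

text \<open>The generator gives only a right derivative at 0. To the right of \<open>t\<close> the
  fixed operator \<open>T t\<close> is pulled out. To the left the factor \<open>T (t - h)\<close>
  moves with \<open>h\<close>; the uniform bound \<open>M\<close> and strong continuity make up for
  this.\<close>

lemma T_B_deriv:
  assumes "t > 0"
  shows "((\<lambda>t. T t (B x)) has_vector_derivative - T t x) (at t)"
proof -
  have R: "((\<lambda>z. (T z (B x) - T t (B x)) /\<^sub>R (z - t)) \<longlongrightarrow> - T t x) (at_right t)"
  proof -
    have "((\<lambda>h. T t ((T h (B x) - B x) /\<^sub>R h)) \<longlongrightarrow> T t (- x)) (at_right 0)"
      by (rule blinfun.tendsto[OF tendsto_const generator_right])
    then have l: "((\<lambda>z. T t ((T (z - t) (B x) - B x) /\<^sub>R (z - t))) \<longlongrightarrow> - T t x) (at_right t)"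
      by (subst filterlim_at_right_to_0) (simp add: blinfun.minus_right)
    moreover have "\<forall>\<^sub>F z in at_right t. T t ((T (z - t) (B x) - B x) /\<^sub>R (z - t)) = (T z (B x) - T t (B x)) /\<^sub>R (z - t)"
      unfolding eventually_at_right_field
    proof (intro exI[of _ "t + 1"] conjI allI impI)
      fix z assume "t < z"
      then show "T t ((T (z - t) (B x) - B x) /\<^sub>R (z - t)) = (T z (B x) - T t (B x)) /\<^sub>R (z - t)"
        using T_add[of t "z - t" "B x"] assms by (simp add: blinfun.scaleR_right blinfun.diff_right)
    qed simp
    ultimately show ?thesis by (rule Lim_transform_eventually)
  qed
  have Lf: "((\<lambda>z. (T z (B x) - T t (B x)) /\<^sub>R (z - t)) \<longlongrightarrow> - T t x) (at_left t)"
  proof -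
    have 1: "((\<lambda>h. T (t - h) ((T h (B x) - B x) /\<^sub>R h + x)) \<longlongrightarrow> 0) (at_right 0)"
    proof (rule Lim_null_comparison)
      have ev: "eventually (\<lambda>h. 0 < h \<and> h < t) (at_right 0)"
        using assms unfolding eventually_at_right_field by blast
      show "\<forall>\<^sub>F h in at_right 0. norm (T (t - h) ((T h (B x) - B x) /\<^sub>R h + x)) \<le> M * norm ((T h (B x) - B x) /\<^sub>R h + x)"
        using ev by eventually_elim (simp add: T_norm)
      have "((\<lambda>h. M * norm ((T h (B x) - B x) /\<^sub>R h + x)) \<longlongrightarrow> M * norm (- x + x)) (at_right 0)"
        by (intro tendsto_intros generator_right)
      then show "((\<lambda>h. M * norm ((T h (B x) - B x) /\<^sub>R h + x)) \<longlongrightarrow> 0) (at_right 0)" by simp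
    qed
    have 2: "((\<lambda>h. T (t - h) x) \<longlongrightarrow> T t x) (at_right 0)"
    proof -
      have "isCont (\<lambda>t. T t x) t"
        using continuous_on_interior[OF T_continuous, of t x] assms by (simp add: interior_Ici)
      moreover have "((\<lambda>h. t - h) \<longlongrightarrow> t) (at_right (0::real))" by (auto intro!: tendsto_eq_intros)
      ultimately show ?thesis by (rule isCont_tendsto_compose)
    qed
    have "((\<lambda>h. T (t - h) ((T h (B x) - B x) /\<^sub>R h)) \<longlongrightarrow> - T t x) (at_right 0)"
      using tendsto_diff[OF 1 2] by (simp add: blinfun.add_right)
    then have l: "((\<lambda>z. T z ((T (t - z) (B x) - B x) /\<^sub>R (t - z))) \<longlongrightarrow> - T t x) (at_left t)"
      by (subst filterlim_at_left_to_right, subst filterlim_at_right_to_0) simp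
    moreover have "\<forall>\<^sub>F z in at_left t. T z ((T (t - z) (B x) - B x) /\<^sub>R (t - z)) = (T z (B x) - T t (B x)) /\<^sub>R (z - t)"
      unfolding eventually_at_left_field
    proof (intro exI[of _ 0] conjI allI impI)
      fix z assume z: "0 < z" "z < t"
      have "T z ((T (t - z) (B x) - B x) /\<^sub>R (t - z)) = (T t (B x) - T z (B x)) /\<^sub>R (t - z)"
        using T_add[of z "t - z" "B x"] z by (simp add: blinfun.scaleR_right blinfun.diff_right)
      also have "\<dots> = (T z (B x) - T t (B x)) /\<^sub>R (z - t)"
      proof -
        have "inverse (t - z) = - inverse (z - t)" by (simp flip: inverse_minus_eq)
        then show ?thesis by (simp add: algebra_simps)
      qed
      finally show "T z ((T (t - z) (B x) - B x) /\<^sub>R (t - z)) = (T z (B x) - T t (B x)) /\<^sub>R (z - t)" .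
    qed (use assms in simp)
    ultimately show ?thesis by (rule Lim_transform_eventually)
  qed
  from R Lf show ?thesis
    unfolding has_vector_derivative_iff_quotient by (simp add: filterlim_split_at_real)
qed

lemma T_continuous_pos: "continuous_on {0<..} (\<lambda>t. T t x)"
  by (rule continuous_on_subset[OF T_continuous]) auto

lemma kernel_T_absint:
  assumes "hl_absint k" shows "hl_absint (\<lambda>t. k t *\<^sub>R T t x)"
proof (rule hl_absint_bound)
  show "continuous_on {0<..} (\<lambda>t. k t *\<^sub>R T t x)"
    by (intro continuous_intros hl_absint_cont assms T_continuous_pos)
  show "set_integrable lborel {0<..} (\<lambda>t. (M * norm x) * norm (k t))"
    using assms by (intro set_integrable_mult_right) (simp add: hl_absint_def)
  show "norm (k t *\<^sub>R T t x) \<le> (M * norm x) * norm (k t)" if "t > 0" for t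
    using mult_left_mono[OF T_norm[of t x], of "\<bar>k t\<bar>"] that by (simp add: mult.commute)
qed

section \<open>The averaged semigroup\<close>

definition U :: "real \<Rightarrow> real \<Rightarrow> 'a \<Rightarrow> 'a" where
  "U q y x = hl_integral (\<lambda>t. ext_kernel q y t *\<^sub>R T t x)"

lemma U_absint: "q > 0 \<Longrightarrow> y > 0 \<Longrightarrow> hl_absint (\<lambda>t. ext_kernel q y t *\<^sub>R T t x)"
  by (intro kernel_T_absint ext_kernel_absint)

lemma U_add: "q > 0 \<Longrightarrow> y > 0 \<Longrightarrow> U q y (x + z) = U q y x + U q y z"
  unfolding U_def
  by (subst hl_integral_add[symmetric]) (auto simp: U_absint blinfun.add_right scaleR_add_right)

lemma U_scaleR: "q > 0 \<Longrightarrow> y > 0 \<Longrightarrow> U q y (c *\<^sub>R x) = c *\<^sub>R U q y x"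
  unfolding U_def
  by (subst hl_integral_scaleR[symmetric]) (auto simp: U_absint blinfun.scaleR_right mult.commute)

lemma U_diff: "q > 0 \<Longrightarrow> y > 0 \<Longrightarrow> U q y (x - z) = U q y x - U q y z"
  using U_add[of q y x "- z"] U_scaleR[of q y "-1" z] by simp

lemma U_norm:
  assumes "q > 0" "y > 0" shows "norm (U q y x) \<le> M * norm x"
proof -
  have "norm (U q y x) \<le> hl_integral (\<lambda>t. (M * norm x) *\<^sub>R ext_kernel q y t)"
    unfolding U_def
  proof (rule hl_integral_norm_bound)
    show "hl_absint (\<lambda>t. (M * norm x) *\<^sub>R ext_kernel q y t)" by (intro hl_absint_scaleR ext_kernel_absint assms)
    show "norm (ext_kernel q y t *\<^sub>R T t x) \<le> (M * norm x) *\<^sub>R ext_kernel q y t" if "t > 0" for t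
      using mult_left_mono[OF T_norm[of t x] ext_kernel_nonneg[OF assms(1), of y t]] that
        ext_kernel_nonneg[OF assms(1), of y t] by (simp add: mult.commute)
  qed (rule U_absint[OF assms])
  also have "\<dots> = M * norm x"
    using hl_integral_eq[OF hl_has_integral_scaleR[OF ext_kernel_has_integral[OF assms]]] by simp
  finally show ?thesis .
qed

lemma U_commute:
  assumes "bounded_linear h" "\<And>t x. t \<ge> 0 \<Longrightarrow> T t (h x) = h (T t x)" "q > 0" "y > 0"
  shows "U q y (h x) = h (U q y x)"
proof -
  interpret bounded_linear h by fact
  have "U q y (h x) = hl_integral (\<lambda>t. h (ext_kernel q y t *\<^sub>R T t x))"
    unfolding U_def by (rule hl_integral_cong) (simp add: assms(2) scaleR)
  also have "\<dots> = h (U q y x)" unfolding U_def by (rule hl_integral_linear[OF U_absint assms(1)]) fact+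
  finally show ?thesis .
qed

lemma U_B: "q > 0 \<Longrightarrow> y > 0 \<Longrightarrow> U q y (B x) = B (U q y x)"
  by (rule U_commute[OF B_linear T_B])

lemma U_deriv:
  assumes "q > 0" "y > 0"
  shows "((\<lambda>y. U q y x) has_vector_derivative (2 * q / y) *\<^sub>R (U q y x - U (q + 1) y x)) (at y)"
proof -
  let ?f' = "\<lambda>z t. ((2 * q / z) * (ext_kernel q z t - ext_kernel (q + 1) z t)) *\<^sub>R T t x"
  have pos: "z > y / 2" if "z \<in> ball y (y / 2)" for z
    using that unfolding mem_ball dist_real_def by linarith
  \<comment> \<open>On the ball of radius \<open>y / 2\<close> the factor \<open>2 * q / z\<close>
    is at most \<open>4 * q / y\<close>, and both kernels are dominated by kernels at
    \<open>y / 2\<close>.\<close>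
  let ?g = "\<lambda>t. (M * norm x * (4 * q / y)) * (3 powr (2 * q) * ext_kernel q (y / 2) t + 3 powr (2 * (q + 1)) * ext_kernel (q + 1) (y / 2) t)"
  have "((\<lambda>y. U q y x) has_vector_derivative hl_integral (?f' y)) (at y)"
    unfolding U_def
  proof (rule hl_integral_derivative[where d="y / 2" and g="?g"])
    show "y / 2 > 0" using assms by simp
    fix z assume z: "z \<in> ball y (y / 2)"
    then have z0: "z > 0" using pos[OF z] assms by simp
    show "hl_absint (\<lambda>t. ext_kernel q z t *\<^sub>R T t x)" by (rule U_absint[OF assms(1) z0])
    fix t :: real assume t: "t > 0"
    show "((\<lambda>y. ext_kernel q y t *\<^sub>R T t x) has_vector_derivative ?f' z t) (at z)"
      using ext_kernel_deriv_y[OF assms(1) z0 t, unfolded has_real_derivative_iff_has_vector_derivative]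
      by (rule bounded_linear.has_vector_derivative[OF bounded_linear_scaleR_left])
    have "\<bar>(2 * q / z) * (ext_kernel q z t - ext_kernel (q + 1) z t)\<bar> \<le>
        (4 * q / y) * (3 powr (2 * q) * ext_kernel q (y / 2) t + 3 powr (2 * (q + 1)) * ext_kernel (q + 1) (y / 2) t)"
      unfolding abs_mult
    proof (rule mult_mono)
      show "\<bar>2 * q / z\<bar> \<le> 4 * q / y" using pos[OF z] z0 assms by (simp add: field_simps)
      show "\<bar>ext_kernel q z t - ext_kernel (q + 1) z t\<bar> \<le> 3 powr (2 * q) * ext_kernel q (y / 2) t + 3 powr (2 * (q + 1)) * ext_kernel (q + 1) (y / 2) t"
        using ext_kernel_local_bound[OF assms(1) assms(2) z t] ext_kernel_local_bound[OF _ assms(2) z t, of "q + 1"]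
          ext_kernel_nonneg[of q z t] ext_kernel_nonneg[of "q + 1" z t] assms by linarith
    qed (use assms in auto)
    from mult_mono[OF this T_norm[of t x]] t assms
    show "norm (?f' z t) \<le> ?g t"
      by (simp add: ext_kernel_nonneg mult_ac)
  next
    show "set_integrable lborel {0<..} ?g"
      using ext_kernel_absint[of q "y / 2"] ext_kernel_absint[of "q + 1" "y / 2"] assms
      unfolding hl_absint_def by (intro set_integrable_mult_right set_integral_add) (auto simp: ext_kernel_nonneg)
    show "continuous_on {0<..} (?f' y)"
      by (intro continuous_intros T_continuous_pos ext_kernel_cont)
  qed
  also have "hl_integral (?f' y) = hl_integral (\<lambda>t. (2 * q / y) *\<^sub>R (ext_kernel q y t *\<^sub>R T t x - ext_kernel (q + 1) y t *\<^sub>R T t x))"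
    by (rule hl_integral_cong) (simp only: scaleR_scaleR[symmetric] scaleR_diff_left)
  also have "\<dots> = (2 * q / y) *\<^sub>R (U q y x - U (q + 1) y x)"
    unfolding U_def using assms by (subst hl_integral_scaleR, intro hl_absint_diff U_absint) (auto simp: hl_integral_diff U_absint)
  finally show ?thesis .
qed

text \<open>Integrate the \<open>t\<close>-derivative of
  \<open>ext_kernel q y t *\<^sub>R T t (B x)\<close>; the boundary terms vanish because the kernel
  tends to 0 at both ends. The result puts \<open>U q y x\<close> into \<open>D\<close> for every
  \<open>x\<close>, with an explicit preimage of the same kind, so the argument can be
  iterated.\<close>

lemma U_eq_B:
  assumes "q > 0" "y > 0"
  shows "U q y x = B (- (4 * q * (q + 1) / y\<^sup>2) *\<^sub>R (U (q + 1) y x - U (q + 2) y x))"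
proof -
  let ?k' = "\<lambda>t. - (4 * q * (q + 1) / y\<^sup>2) * (ext_kernel (q + 1) y t - ext_kernel (q + 2) y t)"
  let ?f = "\<lambda>t. ?k' t *\<^sub>R T t (B x) - ext_kernel q y t *\<^sub>R T t x"
  have z: "((\<lambda>t. ext_kernel q y t *\<^sub>R T t (B x)) \<longlongrightarrow> 0) F" if "(ext_kernel q y \<longlongrightarrow> 0) F" "eventually (\<lambda>t. t > 0) F" for F
  proof (rule Lim_null_comparison)
    show "\<forall>\<^sub>F t in F. norm (ext_kernel q y t *\<^sub>R T t (B x)) \<le> ext_kernel q y t * (M * norm (B x))"
      using that(2)
    proof eventually_elim
      case (elim t)
      then show ?case using mult_left_mono[OF T_norm[of t "B x"] ext_kernel_nonneg[OF assms(1), of y t]]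
          ext_kernel_nonneg[OF assms(1), of y t] by simp
    qed
    show "((\<lambda>t. ext_kernel q y t * (M * norm (B x))) \<longlongrightarrow> 0) F"
      using that(1) by (rule tendsto_mult_left_zero)
  qed
  have "hl_has_integral ?f 0"
    unfolding hl_has_integral_def
  proof (intro exI conjI allI impI)
    show "((\<lambda>t. ext_kernel q y t *\<^sub>R T t (B x)) has_vector_derivative ?f t) (at t)" if "t > 0" for t
      using has_vector_derivative_scaleR[OF ext_kernel_deriv_t[OF assms that] T_B_deriv[OF that, of x]]
      by (rule has_vector_derivative_eq_rhs) simp
    show "((\<lambda>t. ext_kernel q y t *\<^sub>R T t (B x)) \<longlongrightarrow> 0) (at_right 0)"
      by (rule z[OF ext_kernel_tendsto_0(1)[OF assms]]) (simp add: eventually_at_filter)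
    show "((\<lambda>t. ext_kernel q y t *\<^sub>R T t (B x)) \<longlongrightarrow> 0 + 0) at_top"
      using z[OF ext_kernel_tendsto_0(2)[OF assms]] eventually_gt_at_top[of 0] by simp
  qed
  moreover have "hl_has_integral ?f (- (4 * q * (q + 1) / y\<^sup>2) *\<^sub>R (U (q + 1) y (B x) - U (q + 2) y (B x)) - U q y x)"
  proof (intro hl_has_integral_diff)
    have "hl_has_integral (\<lambda>t. - (4 * q * (q + 1) / y\<^sup>2) *\<^sub>R (ext_kernel (q + 1) y t *\<^sub>R T t (B x) - ext_kernel (q + 2) y t *\<^sub>R T t (B x)))
        (- (4 * q * (q + 1) / y\<^sup>2) *\<^sub>R (U (q + 1) y (B x) - U (q + 2) y (B x)))"
      unfolding U_def using assms
      by (intro hl_has_integral_scaleR hl_has_integral_diff hl_absint_exists U_absint) auto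
    then show "hl_has_integral (\<lambda>t. ?k' t *\<^sub>R T t (B x)) (- (4 * q * (q + 1) / y\<^sup>2) *\<^sub>R (U (q + 1) y (B x) - U (q + 2) y (B x)))"
      by (simp only: scaleR_scaleR[symmetric] scaleR_diff_left)
    show "hl_has_integral (\<lambda>t. ext_kernel q y t *\<^sub>R T t x) (U q y x)"
      unfolding U_def by (rule hl_absint_exists[OF U_absint[OF assms]])
  qed
  ultimately have "- (4 * q * (q + 1) / y\<^sup>2) *\<^sub>R (U (q + 1) y (B x) - U (q + 2) y (B x)) - U q y x = 0"
    using hl_has_integral_unique by blast
  then have "U q y x = - (4 * q * (q + 1) / y\<^sup>2) *\<^sub>R (U (q + 1) y (B x) - U (q + 2) y (B x))" by simp
  also have "\<dots> = B (- (4 * q * (q + 1) / y\<^sup>2) *\<^sub>R (U (q + 1) y x - U (q + 2) y x))"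
    using assms by (simp add: U_B B_simps)
  finally show ?thesis .
qed

text \<open>An approximate identity. For \<open>t < d\<close> the orbit is close to \<open>x\<close>
  and the kernel has mass 1; for larger \<open>t\<close> the orbit is bounded and the kernel is at
  most a constant times \<open>y powr (2 * q) * t powr (- (1 + q))\<close>, which vanishes with
  \<open>y\<close>.\<close>

lemma U_tendsto:
  assumes "q > 0" shows "((\<lambda>y. U q y x) \<longlongrightarrow> x) (at_right 0)"
proof (rule tendstoI)
  fix e :: real assume e: "e > 0"
  have "eventually (\<lambda>t. dist (T t x) x < e / 2) (at_right 0)"
    using T_tendsto[of x] e by (intro tendstoD) auto
  then obtain d where d: "d > 0" "\<And>t. 0 < t \<Longrightarrow> t < d \<Longrightarrow> dist (T t x) x < e / 2"
    unfolding eventually_at_right_field by auto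
  define C where "C = (M + 1) * norm x"
  define K where "K = C / (4 powr q * Gamma q)"
  have K0: "K \<ge> 0" using M(1) Gamma_real_pos[OF assms] by (simp add: K_def C_def)
  \<comment> \<open>Capping the tail at its value at \<open>d\<close> makes it continuous and
    integrable on the whole half-line without changing it beyond \<open>d\<close>.\<close>
  have ai: "hl_absint (\<lambda>t. min (t powr (- (1 + q))) (d powr (- (1 + q))))"
    by (rule hl_absint_powr_bound[where a=0 and b="- (1 + q)" and C="d powr (- (1 + q))" and K=1])
      (use assms in \<open>auto intro!: continuous_intros\<close>)
  define J where "J = hl_integral (\<lambda>t. min (t powr (- (1 + q))) (d powr (- (1 + q))))"
  have bd: "dist (U q y x) x \<le> e / 2 + (K * y powr (2 * q)) * J" if y: "y > 0" for y
  proof -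
    note a = assms y
    have "hl_has_integral (\<lambda>t. ext_kernel q y t *\<^sub>R T t x - ext_kernel q y t *\<^sub>R x) (U q y x - 1 *\<^sub>R x)"
      unfolding U_def
      by (intro hl_has_integral_diff hl_absint_exists U_absint hl_has_integral_scaleR_left ext_kernel_has_integral a)
    then have eq: "U q y x - x = hl_integral (\<lambda>t. ext_kernel q y t *\<^sub>R T t x - ext_kernel q y t *\<^sub>R x)"
      by (simp add: hl_integral_eq)
    have ax: "hl_absint (\<lambda>t. ext_kernel q y t *\<^sub>R x)"
      by (rule hl_absint_bound[of _ "\<lambda>t. norm x * norm (ext_kernel q y t)"])
        (use ext_kernel_absint[OF a] in \<open>auto simp: hl_absint_def mult.commute intro!: continuous_intros set_integrable_mult_right\<close>)
    have "norm (U q y x - x) \<le> hl_integral (\<lambda>t. (e / 2) *\<^sub>R ext_kernel q y t + (K * y powr (2 * q)) *\<^sub>R (min (t powr (- (1 + q))) (d powr (- (1 + q)))))"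
      unfolding eq
    proof (rule hl_integral_norm_bound)
      show "hl_absint (\<lambda>t. ext_kernel q y t *\<^sub>R T t x - ext_kernel q y t *\<^sub>R x)"
        by (intro hl_absint_diff U_absint ax a)
      show "hl_absint (\<lambda>t. (e / 2) *\<^sub>R ext_kernel q y t + (K * y powr (2 * q)) *\<^sub>R (min (t powr (- (1 + q))) (d powr (- (1 + q)))))"
        by (intro hl_absint_add hl_absint_scaleR ext_kernel_absint ai a)
      fix t :: real assume t: "t > 0"
      have k0: "ext_kernel q y t \<ge> 0" by (rule ext_kernel_nonneg[OF assms])
      have eqn: "norm (ext_kernel q y t *\<^sub>R T t x - ext_kernel q y t *\<^sub>R x) = ext_kernel q y t * norm (T t x - x)"
        using k0 by (simp flip: scaleR_diff_right)
      show "norm (ext_kernel q y t *\<^sub>R T t x - ext_kernel q y t *\<^sub>R x) \<le>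
        (e / 2) *\<^sub>R ext_kernel q y t + (K * y powr (2 * q)) *\<^sub>R (min (t powr (- (1 + q))) (d powr (- (1 + q))))"
      proof (cases "t < d")
        case True
        then have "ext_kernel q y t * norm (T t x - x) \<le> ext_kernel q y t * (e / 2)"
          using d(2)[OF t True] k0 by (intro mult_left_mono) (auto simp: dist_norm)
        then show ?thesis unfolding eqn using K0 by (simp add: mult.commute add_increasing2)
      next
        case False
        have "norm (T t x - x) \<le> C"
          using norm_triangle_ineq4[of "T t x" x] T_norm[of t x] t by (simp add: C_def algebra_simps)
        moreover have "ext_kernel q y t \<le> y powr (2 * q) / (4 powr q * Gamma q) * t powr (- (1 + q))"
        proof -
          have "exp (- y\<^sup>2 / (4 * t)) / t powr (1 + q) \<le> 1 / t powr (1 + q)" using t by (intro divide_right_mono) auto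
          then have "ext_kernel q y t \<le> y powr (2 * q) / (4 powr q * Gamma q) * (1 / t powr (1 + q))"
            unfolding ext_kernel_def using Gamma_real_pos[OF assms] by (intro mult_left_mono) auto
          then show ?thesis by (simp only: powr_minus_divide)
        qed
        ultimately have "ext_kernel q y t * norm (T t x - x) \<le> (y powr (2 * q) / (4 powr q * Gamma q) * t powr (- (1 + q))) * C"
          using k0 by (intro mult_mono) (auto intro: order_trans)
        also have "\<dots> = (K * y powr (2 * q)) * (t powr (- (1 + q)))" by (simp add: K_def)
        also have "t powr (- (1 + q)) \<le> d powr (- (1 + q))" using False d(1) assms by (intro powr_mono2') auto
        then have "(K * y powr (2 * q)) * (t powr (- (1 + q))) = (K * y powr (2 * q)) *\<^sub>R (min (t powr (- (1 + q))) (d powr (- (1 + q))))" by simp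
        finally show ?thesis unfolding eqn using k0 e by (simp add: add_increasing)
      qed
    qed
    also have "\<dots> = (e / 2) *\<^sub>R 1 + (K * y powr (2 * q)) *\<^sub>R J"
      unfolding J_def
      by (intro hl_integral_eq hl_has_integral_add hl_has_integral_scaleR ext_kernel_has_integral a hl_absint_exists(1) ai)
    finally show ?thesis by (simp add: dist_norm)
  qed
  have "((\<lambda>y. e / 2 + (K * y powr (2 * q)) * J) \<longlongrightarrow> e / 2 + (K * 0) * J) (at_right 0)"
    using assms by (intro tendsto_intros) real_asymp
  then have "eventually (\<lambda>y. e / 2 + (K * y powr (2 * q)) * J < e) (at_right 0)"
    by (rule order_tendstoD(2)) (use e in simp)
  moreover have "eventually (\<lambda>y. y > 0) (at_right (0::real))" by (simp add: eventually_at_filter)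
  ultimately show "eventually (\<lambda>y. dist (U q y x) x < e) (at_right 0)"
  proof eventually_elim
    case (elim y)
    then show ?case using bd[of y] by linarith
  qed
qed

end

section \<open>Uniqueness for the singular initial value problem\<close>

text \<open>One term of the exponential series. With \<open>x = n\<close> this bounds the ratio of
  \<open>n ^ n\<close> to \<open>fact n\<close> by the \<open>n\<close>-th power of e.\<close>

lemma power_le_exp_fact:
  fixes x :: real assumes "x \<ge> 0" shows "x ^ n \<le> exp x * fact n"
proof -
  have "x ^ n /\<^sub>R fact n = (\<Sum>i\<in>{n}. x ^ i /\<^sub>R fact i)" by simp
  also have "\<dots> \<le> (\<Sum>i. x ^ i /\<^sub>R fact i)"
    using assms by (intro sum_le_suminf summable_exp_generic) auto
  also have "\<dots> = exp x" by (simp add: exp_def)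
  finally show ?thesis by (simp add: field_simps)
qed

text \<open>The mean value inequality on \<open>{a..t}\<close> as \<open>a\<close> tends to 0, where
  \<open>F\<close> vanishes in the limit.\<close>

lemma norm_le_from_0:
  fixes F :: "real \<Rightarrow> 'a::real_normed_vector"
  assumes F: "\<And>t. t > 0 \<Longrightarrow> (F has_vector_derivative f t) (at t)" "(F \<longlongrightarrow> 0) (at_right 0)"
    and bd: "\<And>t. 0 < t \<Longrightarrow> t \<le> Y \<Longrightarrow> norm (f t) \<le> c * t powr p" and p: "p > -1" and t: "0 < t" "t \<le> Y"
  shows "norm (F t) \<le> c * t powr (p + 1) / (p + 1)"
proof -
  let ?G = "\<lambda>t. c * t powr (p + 1) / (p + 1)"
  have G: "(?G has_vector_derivative c * t powr p) (at t)" if "t > 0" for t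
    unfolding has_real_derivative_iff_has_vector_derivative[symmetric]
    using that p by (auto intro!: derivative_eq_intros)
  have ev: "eventually (\<lambda>a. norm (F t - F a) \<le> ?G t - ?G a) (at_right 0)"
    unfolding eventually_at_right_field
  proof (intro exI[of _ t] conjI allI impI t(1))
    fix a assume "0 < a" "a < t"
    then show "norm (F t - F a) \<le> ?G t - ?G a"
      using t(2) by (intro norm_increment_le[OF F(1) G]) (auto intro: bd)
  qed
  have "((\<lambda>t. t powr (p + 1)) \<longlongrightarrow> 0) (at_right 0)" using p by real_asymp
  then have "((\<lambda>a. ?G t - ?G a) \<longlongrightarrow> ?G t - c * 0 / (p + 1)) (at_right 0)"
    using p by (intro tendsto_intros) auto
  moreover have "((\<lambda>a. norm (F t - F a)) \<longlongrightarrow> norm (F t - 0)) (at_right 0)"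
    by (intro tendsto_intros F(2))
  ultimately have "norm (F t - 0) \<le> ?G t - c * 0 / (p + 1)"
    by (rule tendsto_le[OF trivial_limit_at_right_real _ _ ev])
  then show ?thesis by simp
qed

lemma funpow_commute:
  assumes "\<And>x. f (g x) = g (f x)"
  shows "(f ^^ n) (g x) = g ((f ^^ n) x)"
  by (induction n) (simp_all add: assms)

lemma bounded_linear_funpow:
  fixes h :: "'a::real_normed_vector \<Rightarrow> 'a"
  assumes "bounded_linear h" shows "bounded_linear (h ^^ n)"
proof (induction n)
  case (Suc n)
  then show ?case using bounded_linear_compose[OF assms Suc] by (simp add: o_def)
qed (simp add: bounded_linear_ident id_def)

context bounded_semigroup
begin

section \<open>Resolvents as Laplace transforms\<close>

definition R :: "real \<Rightarrow> 'a \<Rightarrow> 'a" where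
  "R \<mu> x = hl_integral (\<lambda>t. exp (- \<mu> * t) *\<^sub>R T t x)"

lemma R_absint: "\<mu> > 0 \<Longrightarrow> hl_absint (\<lambda>t. exp (- \<mu> * t) *\<^sub>R T t x)"
  by (intro kernel_T_absint hl_absint_exp)

lemma R_bound:
  assumes "\<mu> > 0" "\<And>t. t > 0 \<Longrightarrow> norm (T t x) \<le> C"
  shows "norm (\<mu> *\<^sub>R R \<mu> x) \<le> C"
proof -
  have "norm (R \<mu> x) \<le> hl_integral (\<lambda>t. C *\<^sub>R exp (- \<mu> * t))"
    unfolding R_def
    by (rule hl_integral_norm_bound[OF R_absint[OF assms(1)] hl_absint_scaleR[OF hl_absint_exp[OF assms(1)]]])
      (use assms(2) in \<open>simp add: mult.commute\<close>)
  also have "\<dots> = C / \<mu>"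
    using hl_integral_eq[OF hl_has_integral_scaleR[OF hl_has_integral_exp[OF assms(1)]]] by simp
  finally show ?thesis using assms(1) by (simp add: field_simps)
qed

lemma R_norm: "\<mu> > 0 \<Longrightarrow> norm (\<mu> *\<^sub>R R \<mu> x) \<le> M * norm x"
  by (rule R_bound) (auto intro: T_norm)

lemma R_linear: assumes "\<mu> > 0" shows "bounded_linear (R \<mu>)"
proof (rule bounded_linear_intro[where K="M / \<mu>"])
  show "R \<mu> (x + y) = R \<mu> x + R \<mu> y" for x y
    unfolding R_def by (subst hl_integral_add[symmetric]) (use assms in \<open>auto simp only: R_absint blinfun.add_right scaleR_add_right\<close>)
  show "R \<mu> (c *\<^sub>R x) = c *\<^sub>R R \<mu> x" for c x
    unfolding R_def hl_integral_scaleR[OF R_absint[OF assms], symmetric]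
    by (rule hl_integral_cong) (simp add: blinfun.scaleR_right mult.commute)
  show "norm (R \<mu> x) \<le> norm x * (M / \<mu>)" for x
    using R_norm[OF assms, of x] assms by (simp add: field_simps)
qed

lemma R_commute:
  assumes "bounded_linear h" "\<And>t x. t \<ge> 0 \<Longrightarrow> T t (h x) = h (T t x)" "\<mu> > 0"
  shows "R \<mu> (h x) = h (R \<mu> x)"
proof -
  interpret bounded_linear h by fact
  have "R \<mu> (h x) = hl_integral (\<lambda>t. h (exp (- \<mu> * t) *\<^sub>R T t x))"
    unfolding R_def by (rule hl_integral_cong) (simp add: assms(2) scaleR)
  also have "\<dots> = h (R \<mu> x)" unfolding R_def by (rule hl_integral_linear[OF R_absint assms(1)]) fact
  finally show ?thesis .
qed

lemma R_B: "\<mu> > 0 \<Longrightarrow> R \<mu> (B x) = B (R \<mu> x)"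
  by (rule R_commute[OF B_linear T_B])

lemma T_commute: "t \<ge> 0 \<Longrightarrow> r \<ge> 0 \<Longrightarrow> T t (T r x) = T r (T t x)"
  using T_add[of t r x] T_add[of r t x] by (simp add: add.commute)

lemma R_T: "\<mu> > 0 \<Longrightarrow> r \<ge> 0 \<Longrightarrow> R \<mu> (T r x) = T r (R \<mu> x)"
  by (rule R_commute[OF blinfun.bounded_linear_right T_commute])

text \<open>The fundamental theorem for \<open>exp (- \<mu> * t) *\<^sub>R T t (B x)\<close>.
  Applying \<open>- L\<close> to the identity gives
  \<open>\<mu> *\<^sub>R R \<mu> x - L (R \<mu> x) = x\<close>, so \<open>R \<mu>\<close> is the
  resolvent of \<open>L\<close> at \<open>\<mu>\<close>; the form with \<open>B\<close> mentions no
  domain.\<close>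

lemma R_eq: assumes "\<mu> > 0" shows "R \<mu> x + \<mu> *\<^sub>R B (R \<mu> x) = B x"
proof -
  let ?f = "\<lambda>t. - \<mu> *\<^sub>R (exp (- \<mu> * t) *\<^sub>R T t (B x)) - exp (- \<mu> * t) *\<^sub>R T t x"
  have "hl_has_integral ?f (- B x)"
    unfolding hl_has_integral_def
  proof (intro exI conjI allI impI)
    fix t :: real assume t: "t > 0"
    have "((\<lambda>t. exp (- \<mu> * t)) has_real_derivative - \<mu> * exp (- \<mu> * t)) (at t)"
      by (auto intro!: derivative_eq_intros)
    from has_vector_derivative_scaleR[OF this T_B_deriv[OF t, of x]]
    show "((\<lambda>t. exp (- \<mu> * t) *\<^sub>R T t (B x)) has_vector_derivative ?f t) (at t)"
      by (rule has_vector_derivative_eq_rhs) simp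
  next
    have "((\<lambda>t. exp (- \<mu> * t)) \<longlongrightarrow> exp (- \<mu> * 0)) (at_right 0)" by (intro tendsto_intros)
    from tendsto_scaleR[OF this T_tendsto[of "B x"]]
    show "((\<lambda>t. exp (- \<mu> * t) *\<^sub>R T t (B x)) \<longlongrightarrow> B x) (at_right 0)" by simp
    have "((\<lambda>t. exp (- \<mu> * t) *\<^sub>R T t (B x)) \<longlongrightarrow> 0) at_top"
    proof (rule Lim_null_comparison)
      show "\<forall>\<^sub>F t in at_top. norm (exp (- \<mu> * t) *\<^sub>R T t (B x)) \<le> exp (- \<mu> * t) * (M * norm (B x))"
        using eventually_ge_at_top[of 0] by eventually_elim (simp add: T_norm)
      have "((\<lambda>t. exp (- \<mu> * t)) \<longlongrightarrow> 0) at_top" using assms by real_asymp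
      then show "((\<lambda>t. exp (- \<mu> * t) * (M * norm (B x))) \<longlongrightarrow> 0) at_top" by (rule tendsto_mult_left_zero)
    qed
    then show "((\<lambda>t. exp (- \<mu> * t) *\<^sub>R T t (B x)) \<longlongrightarrow> B x + - B x) at_top" by simp
  qed
  moreover have "hl_has_integral ?f (- \<mu> *\<^sub>R R \<mu> (B x) - R \<mu> x)"
    unfolding R_def by (intro hl_has_integral_diff hl_has_integral_scaleR hl_absint_exists R_absint assms)
  ultimately have "- B x = - \<mu> *\<^sub>R R \<mu> (B x) - R \<mu> x" by (rule hl_has_integral_unique)
  then show ?thesis by (simp add: R_B assms algebra_simps)
qed

text \<open>Multiplying operator norms would give a power of \<open>M\<close> growing with
  \<open>j\<close>. With \<open>T t\<close> carried through the induction the constant stays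
  \<open>M\<close>: averaging an orbit against the probability density
  \<open>\<mu> * exp (- \<mu> * t)\<close> cannot enlarge its supremum.\<close>

lemma R_power_bound:
  assumes "\<mu> > 0" "t \<ge> 0"
  shows "norm (T t (((\<lambda>x. \<mu> *\<^sub>R R \<mu> x) ^^ j) x)) \<le> M * norm x"
  using assms(2)
proof (induction j arbitrary: t)
  case 0
  then show ?case by (simp add: T_norm)
next
  case (Suc j)
  let ?y = "((\<lambda>x. \<mu> *\<^sub>R R \<mu> x) ^^ j) x"
  have "norm (\<mu> *\<^sub>R R \<mu> (T t ?y)) \<le> M * norm x"
  proof (rule R_bound[OF assms(1)])
    show "norm (T r (T t ?y)) \<le> M * norm x" if "r > 0" for r
      using Suc.IH[of "r + t"] T_add[of r t ?y] that Suc.prems by simp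
  qed
  then show ?case using Suc.prems by (simp add: R_T assms(1) blinfun.scaleR_right)
qed

text \<open>\<open>B\<close> has no nonzero vector whose \<open>B\<close>-orbit decays like \<open>1 / (k!)\<^sup>2\<close>:
  \<open>(\<mu> R(\<mu>))\<^sup>m w = \<mu>\<^sup>m (I - \<mu> R(\<mu>))\<^sup>m B\<^sup>m w\<close> is small for \<open>\<mu>\<close> of order \<open>m\<^sup>2\<close>, whereas
  \<open>(\<mu> R(\<mu>))\<^sup>m\<close> converges strongly to the identity as soon as \<open>m / \<mu>\<close> tends to \<open>0\<close>.\<close>

lemma B_powers_decay_imp_0:
  assumes bd: "\<And>k. norm ((B ^^ k) w) \<le> C * q ^ k / (fact k)\<^sup>2" and q: "q > 0"
  shows "w = 0"
proof -
  have C: "C \<ge> 0" using order_trans[OF norm_ge_zero bd[of 0]] by simp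
  obtain K where K: "K > 0" "\<And>x. norm (B x) \<le> norm x * K"
    using bounded_linear.pos_bounded[OF B_linear] by blast
  \<comment> \<open>For \<open>z = B w\<close> the error \<open>N z - z\<close> equals
    \<open>- R \<mu> w\<close>, which is of order \<open>1 / \<mu>\<close>; a general vector offers
    no such rate. It suffices to show \<open>z = 0\<close>.\<close>
  define z where "z = B w"
  have zb: "norm ((B ^^ k) z) \<le> C * K * q ^ k / (fact k)\<^sup>2" for k
  proof -
    have "(B ^^ k) z = B ((B ^^ k) w)" unfolding z_def by (rule funpow_commute) simp
    then have "norm ((B ^^ k) z) \<le> norm ((B ^^ k) w) * K" using K(2) by simp
    also have "\<dots> \<le> (C * q ^ k / (fact k)\<^sup>2) * K" using bd K(1) by (intro mult_right_mono) auto
    finally show ?thesis by (simp add: mult_ac)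
  qed
  \<comment> \<open>Chosen so that \<open>\<delta> * (1 + M) * q * (exp 1)\<^sup>2 = 1/2\<close>,
    the ratio of the geometric bound; each of the two factorials costs one factor
    \<open>exp 1\<close> per power.\<close>
  define \<delta> where "\<delta> = 1 / (2 * (1 + M) * q * (exp 1)\<^sup>2)"
  have \<delta>: "\<delta> > 0" using M(1) q by (simp add: \<delta>_def)
  have main: "norm z \<le> C * K * (1/2) ^ m + M * M * norm w / (\<delta> * real m)" if m: "m > 0" for m :: nat
  proof -
    \<comment> \<open>The square lets \<open>\<mu> ^ m\<close> be balanced by
      \<open>(fact m)\<^sup>2\<close>, while \<open>m / \<mu>\<close> still tends to 0.\<close>
    define \<mu> where "\<mu> = \<delta> * (real m)\<^sup>2"
    have \<mu>: "\<mu> > 0" using \<delta> m by (simp add: \<mu>_def)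
    interpret Rl: bounded_linear "R \<mu>" by (rule R_linear[OF \<mu>])
    define N where "N = (\<lambda>x. \<mu> *\<^sub>R R \<mu> x)"
    define Q where "Q = (\<lambda>x. x - \<mu> *\<^sub>R R \<mu> x)"
    have QB: "Q (B x) = B (Q x)" for x by (simp add: Q_def R_B \<mu> B_simps)
    have NQ: "N (Q x) = Q (N x)" for x by (simp add: Q_def N_def Rl.diff Rl.scaleR algebra_simps)
    have RQ: "N x = \<mu> *\<^sub>R Q (B x)" for x
    proof -
      have "R \<mu> x = B x - \<mu> *\<^sub>R R \<mu> (B x)" using R_eq[OF \<mu>, of x] by (simp add: R_B \<mu> algebra_simps)
      then show ?thesis by (simp add: Q_def N_def)
    qed
    have Qs: "Q (c *\<^sub>R x) = c *\<^sub>R Q x" for c x by (simp add: Q_def Rl.scaleR algebra_simps)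
    have N_pow: "(N ^^ k) x = \<mu> ^ k *\<^sub>R (Q ^^ k) ((B ^^ k) x)" for k x
    proof (induction k)
      case (Suc k)
      have "(N ^^ Suc k) x = \<mu> ^ k *\<^sub>R N ((Q ^^ k) ((B ^^ k) x))"
        using Suc by (simp add: N_def Rl.scaleR)
      also have "N ((Q ^^ k) ((B ^^ k) x)) = \<mu> *\<^sub>R Q (B ((Q ^^ k) ((B ^^ k) x)))" by (rule RQ)
      also have "B ((Q ^^ k) ((B ^^ k) x)) = (Q ^^ k) (B ((B ^^ k) x))"
        using funpow_commute[of Q B k] QB by simp
      finally show ?case by simp
    qed simp
    have Qn: "norm (Q x) \<le> (1 + M) * norm x" for x
      using norm_triangle_ineq4[of x "\<mu> *\<^sub>R R \<mu> x"] R_norm[OF \<mu>, of x] by (simp add: Q_def algebra_simps)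
    have Q_pow: "norm ((Q ^^ k) x) \<le> (1 + M) ^ k * norm x" for k x
    proof (induction k)
      case (Suc k)
      have "norm ((Q ^^ Suc k) x) \<le> (1 + M) * norm ((Q ^^ k) x)" using Qn by simp
      also have "\<dots> \<le> (1 + M) * ((1 + M) ^ k * norm x)" using Suc M(1) by (intro mult_left_mono) auto
      finally show ?case by (simp add: mult.assoc)
    qed simp
    have N_bound: "norm ((N ^^ j) x) \<le> M * norm x" for j x
      using R_power_bound[OF \<mu>, of 0 j x] by (simp add: T_0 N_def)
    have 1: "norm ((N ^^ m) z) \<le> C * K * (1/2) ^ m"
    proof -
      have "norm ((N ^^ m) z) = \<mu> ^ m * norm ((Q ^^ m) ((B ^^ m) z))" using \<mu> by (simp add: N_pow)
      also have "\<dots> \<le> \<mu> ^ m * ((1 + M) ^ m * (C * K * q ^ m / (fact m)\<^sup>2))"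
        using \<mu> M(1) by (intro mult_left_mono order_trans[OF Q_pow] zb) auto
      also have "\<dots> = C * K * (\<delta> * (1 + M) * q) ^ m * (real m ^ m / fact m)\<^sup>2"
        by (simp add: \<mu>_def power_mult_distrib power_divide power_mult[symmetric] mult.commute[of 2 m] mult_ac)
      also have "\<dots> \<le> C * K * (\<delta> * (1 + M) * q) ^ m * (exp (real m))\<^sup>2"
        using power_le_exp_fact[of "real m" m] C K \<delta> M(1) q
        by (intro mult_left_mono power_mono) (auto simp: field_simps)
      also have "\<dots> = C * K * (\<delta> * (1 + M) * q * (exp 1)\<^sup>2) ^ m"
        using exp_of_nat_mult[of m "1::real"]
        by (simp add: power_mult_distrib power_mult[symmetric] mult.commute[of 2 m] mult_ac)
      also have "\<delta> * (1 + M) * q * (exp 1)\<^sup>2 = 1/2" using M(1) q by (simp add: \<delta>_def)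
      finally show ?thesis .
    qed
    have Rw: "norm (R \<mu> w) \<le> M * norm w / \<mu>" using R_norm[OF \<mu>, of w] \<mu> by (simp add: field_simps)
    interpret Nl: bounded_linear N unfolding N_def by (intro bounded_linear_intros Rl.bounded_linear_axioms)
    \<comment> \<open>Telescoping: each further power of \<open>N\<close> moves \<open>z\<close> by
      at most \<open>M * norm (R \<mu> w)\<close>.\<close>
    have N_sub: "norm ((N ^^ k) z - z) \<le> real k * (M * norm (R \<mu> w))" for k
    proof (induction k)
      case (Suc k)
      have Nz: "N z - z = - R \<mu> w"
        using R_eq[OF \<mu>, of w] by (simp add: N_def z_def R_B \<mu> algebra_simps)
      interpret Nk: bounded_linear "N ^^ k" by (rule bounded_linear_funpow) unfold_locales
      have "(N ^^ Suc k) z - z = (N ^^ k) (N z - z) + ((N ^^ k) z - z)"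
        by (simp only: funpow_Suc_right o_apply Nk.diff) simp
      also have "norm \<dots> \<le> M * norm (R \<mu> w) + real k * (M * norm (R \<mu> w))"
        using norm_triangle_mono[OF N_bound[of k "N z - z"] Suc] by (simp add: Nz)
      finally show ?case by (simp add: algebra_simps)
    qed simp
    have "norm ((N ^^ m) z - z) \<le> real m * (M * (M * norm w / \<mu>))"
      using Rw M(1) by (intro order_trans[OF N_sub] mult_left_mono) auto
    also have "\<dots> = M * M * norm w / (\<delta> * real m)"
      using m \<delta> by (simp add: \<mu>_def power2_eq_square)
    finally show ?thesis using 1 norm_triangle_ineq3[of "(N ^^ m) z" z] norm_triangle_sub[of z "(N ^^ m) z"]
      by (simp add: norm_minus_commute)
  qed
  have "(\<lambda>m. C * K * (1/2) ^ m + M * M * norm w / (\<delta> * real m)) \<longlonglongrightarrow> 0"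
    using \<delta> by real_asymp
  then have "norm z \<le> 0"
    by (rule tendsto_lowerbound) (use main in \<open>auto intro!: eventually_sequentiallyI[of 1]\<close>)
  then have "B w = B 0" by (simp add: z_def B_simps)
  then show ?thesis by (rule B_inj)
qed

text \<open>In divergence form the equation says that
  \<open>y powr (1 - 2 * q) *\<^sub>R W' y\<close> has derivative
  \<open>- (y powr (1 - 2 * q)) *\<^sub>R L (W y)\<close>. Applying \<open>B\<close> first replaces
  \<open>- L (W y)\<close> by \<open>W y\<close>, so each double integration costs one power of
  \<open>B\<close> and gains two powers of \<open>y\<close>.\<close>

lemma singular_ivp_unique:
  assumes q: "q > 0"
    and W: "\<And>y. y > 0 \<Longrightarrow> W y \<in> D" "\<And>y. y > 0 \<Longrightarrow> (W has_vector_derivative W' y) (at y)"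
      "\<And>y. y > 0 \<Longrightarrow> (W' has_vector_derivative W'' y) (at y)"
    and eq: "\<And>y. y > 0 \<Longrightarrow> L (W y) + ((1 - 2 * q) / y) *\<^sub>R W' y + W'' y = 0"
    and lim: "(W \<longlongrightarrow> 0) (at_right 0)" "((\<lambda>y. y powr (1 - 2 * q) *\<^sub>R W' y) \<longlongrightarrow> 0) (at_right 0)"
    and Y: "Y > 0"
  shows "W Y = 0"
proof -
  let ?G = "\<lambda>y. y powr (1 - 2 * q) *\<^sub>R W' y"
  \<comment> \<open>Near 0 the bound comes from the limit, on the remaining compact interval from
    continuity.\<close>
  have "\<exists>C\<ge>0. \<forall>y. 0 < y \<longrightarrow> y \<le> Y \<longrightarrow> norm (?G y) \<le> C"
  proof -
    have "eventually (\<lambda>y. norm (?G y) < 1) (at_right 0)"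
      using tendstoD[OF lim(2), of 1] by simp
    then obtain d where d: "d > 0" "\<And>y. 0 < y \<Longrightarrow> y < d \<Longrightarrow> norm (?G y) < 1"
      unfolding eventually_at_right_field by auto
    have "continuous_on {d..Y} W'"
      by (intro continuous_at_imp_continuous_on ballI has_vector_derivative_continuous[OF W(3)]) (use d in auto)
    then have "continuous_on {d..Y} ?G" using d by (auto intro!: continuous_intros)
    then have "bounded (?G ` {d..Y})" by (intro compact_imp_bounded compact_continuous_image) auto
    then obtain C where "\<forall>x\<in>?G ` {d..Y}. norm x \<le> C" unfolding bounded_iff by blast
    then have C: "\<And>y. y \<in> {d..Y} \<Longrightarrow> norm (?G y) \<le> C" by blast
    show ?thesis
    proof (intro exI[of _ "max 1 C"] conjI allI impI)
      fix y assume "0 < y" "y \<le> Y"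
      then show "norm (?G y) \<le> max 1 C" using d(2)[of y] C[of y] by (cases "y < d") auto
    qed auto
  qed
  then obtain C where C: "C \<ge> 0" "\<And>y. 0 < y \<Longrightarrow> y \<le> Y \<Longrightarrow> norm (?G y) \<le> C" by blast
  define C1 where "C1 = C / (2 * q)"
  have C1: "C1 \<ge> 0" using C q by (simp add: C1_def)
  have claim: "norm ((B ^^ k) (W y)) \<le> C1 / (4 ^ k * (fact k)\<^sup>2) * y powr (2 * q + 2 * real k)"
    if "0 < y" "y \<le> Y" for k y
    using that
  proof (induction k arbitrary: y)
    case 0
    have "norm (W y) \<le> C * y powr (2 * q - 1 + 1) / (2 * q - 1 + 1)"
    proof (rule norm_le_from_0[OF W(2) lim(1)])
      fix t assume t: "0 < t" "t \<le> Y"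
      have "norm (W' t) = t powr (1 - 2 * q) * t powr (2 * q - 1) * norm (W' t)"
        using t by (simp add: powr_add[symmetric])
      also have "\<dots> = norm (?G t) * t powr (2 * q - 1)"
        by (simp add: mult_ac)
      also have "\<dots> \<le> C * t powr (2 * q - 1)" using C(2)[OF t] by (rule mult_right_mono) simp
      finally show "norm (W' t) \<le> C * t powr (2 * q - 1)" .
    qed (use q 0 in auto)
    then show ?case by (simp add: C1_def)
  next
    case (Suc k)
    define c where "c = C1 / (4 ^ k * (fact k)\<^sup>2)"
    have c0: "c \<ge> 0" using C1 by (simp add: c_def)
    interpret Bk: bounded_linear "B ^^ Suc k" by (rule bounded_linear_funpow[OF B_linear])
    have 1: "norm (t powr (1 - 2 * q) *\<^sub>R (B ^^ Suc k) (W' t)) \<le> c * t powr (2 * real k + 1 + 1) / (2 * real k + 1 + 1)"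
      if t: "0 < t" "t \<le> Y" for t
    proof (rule norm_le_from_0[where f="\<lambda>t. t powr (1 - 2 * q) *\<^sub>R (B ^^ k) (W t)"])
      fix t :: real assume t: "0 < t"
      have "((\<lambda>t. t powr (1 - 2 * q)) has_real_derivative (1 - 2 * q) / t * t powr (1 - 2 * q)) (at t)"
        using t by (intro DERIV_cong[OF has_real_derivative_powr]) (simp_all only: powr_diff[of t "1 - 2 * q" 1], simp add: field_simps)
      from has_vector_derivative_scaleR[OF this Bk.has_vector_derivative[OF W(3)[OF t]]]
      have "((\<lambda>t. t powr (1 - 2 * q) *\<^sub>R (B ^^ Suc k) (W' t)) has_vector_derivative
          t powr (1 - 2 * q) *\<^sub>R (B ^^ Suc k) (((1 - 2 * q) / t) *\<^sub>R W' t + W'' t)) (at t)"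
        by (rule has_vector_derivative_eq_rhs) (simp add: Bk.add Bk.scaleR scaleR_add_right mult.commute del: funpow.simps)
      also have "((1 - 2 * q) / t) *\<^sub>R W' t + W'' t = - L (W t)"
        unfolding eq_neg_iff_add_eq_0 using eq[OF t] by (simp only: ac_simps)
      also have "(B ^^ Suc k) (- L (W t)) = (B ^^ k) (W t)"
        using B_L[OF W(1)[OF t]] by (simp only: funpow_Suc_right o_apply B_simps) simp
      finally show "((\<lambda>t. t powr (1 - 2 * q) *\<^sub>R (B ^^ Suc k) (W' t)) has_vector_derivative
          t powr (1 - 2 * q) *\<^sub>R (B ^^ k) (W t)) (at t)" .
    next
      have "((\<lambda>y. (B ^^ Suc k) (?G y)) \<longlongrightarrow> (B ^^ Suc k) 0) (at_right 0)" by (rule Bk.tendsto[OF lim(2)])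
      then show "((\<lambda>t. t powr (1 - 2 * q) *\<^sub>R (B ^^ Suc k) (W' t)) \<longlongrightarrow> 0) (at_right 0)"
        by (simp add: Bk.scaleR Bk.zero del: funpow.simps)
    next
      fix t assume t: "0 < t" "t \<le> Y"
      have "norm (t powr (1 - 2 * q) *\<^sub>R (B ^^ k) (W t)) \<le> t powr (1 - 2 * q) * (c * t powr (2 * q + 2 * real k))"
        using mult_left_mono[OF Suc.IH[OF t], of "t powr (1 - 2 * q)"] by (simp only: c_def norm_scaleR) simp
      also have "\<dots> = c * t powr (2 * real k + 1)" using t by (simp add: powr_add[symmetric] algebra_simps)
      finally show "norm (t powr (1 - 2 * q) *\<^sub>R (B ^^ k) (W t)) \<le> c * t powr (2 * real k + 1)" .
    qed (use t in auto)
    have "norm ((B ^^ Suc k) (W y)) \<le> (c / (2 * real k + 2)) * y powr (2 * q + 2 * real k + 1 + 1) / (2 * q + 2 * real k + 1 + 1)"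
    proof (rule norm_le_from_0[where f="\<lambda>t. (B ^^ Suc k) (W' t)"])
      show "((\<lambda>t. (B ^^ Suc k) (W t)) has_vector_derivative (B ^^ Suc k) (W' t)) (at t)" if "t > 0" for t
        by (rule Bk.has_vector_derivative[OF W(2)[OF that]])
      show "((\<lambda>t. (B ^^ Suc k) (W t)) \<longlongrightarrow> 0) (at_right 0)"
        using Bk.tendsto[OF lim(1)] by (simp only: Bk.zero)
      fix t assume t: "0 < t" "t \<le> Y"
      have "norm ((B ^^ Suc k) (W' t)) = t powr (2 * q - 1) * norm (t powr (1 - 2 * q) *\<^sub>R (B ^^ Suc k) (W' t))"
        using t by (simp add: powr_diff)
      also have "\<dots> \<le> t powr (2 * q - 1) * (c * t powr (2 * real k + 1 + 1) / (2 * real k + 1 + 1))"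
        by (intro mult_left_mono 1 t) auto
      also have "\<dots> = (c / (2 * real k + 2)) * (t powr (2 * q - 1) * t powr (2 * real k + 2))"
        by (simp add: add.assoc)
      also have "t powr (2 * q - 1) * t powr (2 * real k + 2) = t powr (2 * q + 2 * real k + 1)"
        by (simp add: powr_add[symmetric] algebra_simps)
      finally show "norm ((B ^^ Suc k) (W' t)) \<le> (c / (2 * real k + 2)) * t powr (2 * q + 2 * real k + 1)" .
    qed (use q Suc.prems in auto)
    also have "\<dots> = (c / ((2 * real k + 2) * (2 * q + 2 * real k + 2))) * y powr (2 * q + 2 * real (Suc k))"
      by (simp add: algebra_simps)
    \<comment> \<open>Dropping \<open>2 * q\<close> from the second factor makes step
      \<open>k\<close> contribute \<open>4 * (k + 1)\<^sup>2\<close>, whence the total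
      \<open>4 ^ k * (fact k)\<^sup>2\<close>.\<close>
    also have "\<dots> \<le> (c / ((2 * real k + 2) * (2 * real k + 2))) * y powr (2 * q + 2 * real (Suc k))"
      using c0 q by (intro mult_right_mono divide_left_mono mult_mono) auto
    also have "c / ((2 * real k + 2) * (2 * real k + 2)) = C1 / (4 ^ Suc k * (fact (Suc k))\<^sup>2)"
    proof -
      have "(2 * real k + 2) * (2 * real k + 2) = 4 * (1 + real k)\<^sup>2" by (simp add: power2_eq_square algebra_simps)
      then show ?thesis by (simp add: c_def power_mult_distrib)
    qed
    finally show ?case .
  qed
  show ?thesis
  proof (rule B_powers_decay_imp_0[where C="C1 * Y powr (2 * q)" and q="Y\<^sup>2 / 4"])
    fix k
    have "Y powr (2 * q + 2 * real k) = Y powr (2 * q) * (Y\<^sup>2) ^ k"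
      using Y powr_realpow[of Y "2 * k"] by (simp add: powr_add power_mult)
    then show "norm ((B ^^ k) (W Y)) \<le> C1 * Y powr (2 * q) * (Y\<^sup>2 / 4) ^ k / (fact k)\<^sup>2"
      using claim[OF Y order_refl, of k] by (simp add: power_divide mult_ac)
  qed (use Y in simp)
qed

end

section \<open>Fractional powers\<close>

lemma Gamma_reflection_real: "Gamma x * Gamma (1 - x) = pi / sin (x * pi)" for x :: real
proof -
  have "Gamma (complex_of_real x) * Gamma (complex_of_real (1 - x)) = of_real pi / sin (of_real (pi * x))"
    using Gamma_reflection_complex[of "of_real x"] by simp
  then have "complex_of_real (Gamma x * Gamma (1 - x)) = of_real (pi / sin (pi * x))"
    by (simp only: Gamma_complex_of_real sin_of_real[symmetric] of_real_mult of_real_divide)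
  then show ?thesis by (simp only: of_real_eq_iff mult.commute)
qed

lemma quotient_eq_of_prod:
  fixes s p c G G' :: real
  assumes "G * G' = p / s" "s > 0" "p > 0" "G > 0"
  shows "s / p * (c * G') = c / G"
proof -
  have "G' = p / s / G" using assms by (simp add: field_simps)
  then show ?thesis using assms by simp
qed

text \<open>\<open>\<phi> m\<close> is the integral of
  \<open>r powr (\<sigma> - 3) * exp (- 1 / r)\<close> from 0 to \<open>m\<close>. Up to the factor
  \<open>Gamma (2 - \<sigma>)\<close> the integrand is the kernel of index
  \<open>2 - \<sigma>\<close> at \<open>y = 2\<close>, where \<open>y\<^sup>2 / 4 = 1\<close>; so
  its total mass is known.\<close>

lemma balakrishnan_scalar:
  fixes \<sigma> :: real assumes "\<sigma> < 2"
  shows "\<exists>\<phi>. (\<forall>m>0. (\<phi> has_real_derivative m powr (\<sigma> - 3) * exp (- 1 / m)) (at m)) \<and>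
    (\<phi> \<longlongrightarrow> 0) (at_right 0) \<and> (\<phi> \<longlongrightarrow> Gamma (2 - \<sigma>)) at_top \<and>
    (\<forall>m>0. 0 \<le> \<phi> m \<and> \<phi> m \<le> Gamma (2 - \<sigma>))"
proof -
  have "hl_has_integral (\<lambda>m. Gamma (2 - \<sigma>) *\<^sub>R ext_kernel (2 - \<sigma>) 2 m) (Gamma (2 - \<sigma>) *\<^sub>R 1)"
    by (intro hl_has_integral_scaleR ext_kernel_has_integral) (use assms in auto)
  also have "?this \<longleftrightarrow> hl_has_integral (\<lambda>m. m powr (\<sigma> - 3) * exp (- 1 / m)) (Gamma (2 - \<sigma>) *\<^sub>R 1)"
  proof (rule hl_has_integral_cong)
    fix m :: real assume m: "m > 0"
    have "(2::real) powr (2 * (2 - \<sigma>)) = 4 powr (2 - \<sigma>)"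
      using powr_powr[of 2 2 "2 - \<sigma>"] by simp
    moreover have "m powr (\<sigma> - 3) = 1 / m powr (1 + (2 - \<sigma>))" by (simp flip: powr_minus_divide)
    moreover have "Gamma (2 - \<sigma>) > 0" by (rule Gamma_real_pos) (use assms in simp)
    ultimately show "Gamma (2 - \<sigma>) *\<^sub>R ext_kernel (2 - \<sigma>) 2 m = m powr (\<sigma> - 3) * exp (- 1 / m)"
      by (simp add: ext_kernel_def)
  qed
  finally obtain F A where
    F: "\<And>t. t > 0 \<Longrightarrow> (F has_vector_derivative t powr (\<sigma> - 3) * exp (- 1 / t)) (at t)" "(F \<longlongrightarrow> A) (at_right 0)" "(F \<longlongrightarrow> A + Gamma (2 - \<sigma>)) at_top"
    unfolding hl_has_integral_def by auto
  define \<phi> where "\<phi> m = F m - A" for m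
  have 1: "(\<phi> has_real_derivative m powr (\<sigma> - 3) * exp (- 1 / m)) (at m)" if "m > 0" for m
    unfolding \<phi>_def has_real_derivative_iff_has_vector_derivative
    using F(1)[OF that] by (auto intro!: derivative_eq_intros)
  have 2: "(\<phi> \<longlongrightarrow> 0) (at_right 0)" unfolding \<phi>_def using tendsto_diff[OF F(2) tendsto_const[of A]] by simp
  have 3: "(\<phi> \<longlongrightarrow> Gamma (2 - \<sigma>)) at_top" unfolding \<phi>_def using tendsto_diff[OF F(3) tendsto_const[of A]] by simp
  have mono: "\<phi> a \<le> \<phi> b" if "0 < a" "a \<le> b" for a b
  proof (rule DERIV_nonneg_imp_nondecreasing[OF that(2)])
    fix x assume "a \<le> x" "x \<le> b"
    with that have "x > 0" by simp
    from 1[OF this] show "\<exists>y. (\<phi> has_real_derivative y) (at x) \<and> 0 \<le> y"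
      by (intro exI[of _ "x powr (\<sigma> - 3) * exp (- 1 / x)"]) simp
  qed
  have 4: "0 \<le> \<phi> m \<and> \<phi> m \<le> Gamma (2 - \<sigma>)" if m: "m > 0" for m
  proof
    have "eventually (\<lambda>a. \<phi> a \<le> \<phi> m) (at_right 0)"
      unfolding eventually_at_right_field using m mono by (intro exI[of _ m]) auto
    then show "0 \<le> \<phi> m" by (rule tendsto_upperbound[OF 2]) simp
    have "eventually (\<lambda>a. \<phi> m \<le> \<phi> a) at_top"
      using eventually_ge_at_top[of m] by eventually_elim (use m mono in auto)
    then show "\<phi> m \<le> Gamma (2 - \<sigma>)" by (rule tendsto_lowerbound[OF 3]) simp
  qed
  show ?thesis using 1 2 3 4 by (intro exI[of _ \<phi>]) simp
qed

lemma min_powr_absint: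
  assumes "0 < \<sigma>" "\<sigma> < (1::real)"
  shows "hl_absint (\<lambda>t. t powr (\<sigma> - 2) * min t 1)"
  by (rule hl_absint_powr_bound[where a="\<sigma> - 1" and b="\<sigma> - 2" and C=1 and K=1])
    (use assms in \<open>auto intro!: continuous_intros simp: powr_mult_base mult.commute\<close>)

context bounded_semigroup
begin

section \<open>Powers of order below one through the semigroup\<close>

text \<open>For small \<open>t\<close> the orbit of \<open>B x\<close> has derivative
  \<open>- T r x\<close>, bounded by \<open>M * norm x\<close>; for large \<open>t\<close>
  boundedness of \<open>T\<close> and \<open>B\<close> suffices. The factor \<open>min t 1\<close>
  makes the weight \<open>t powr (\<sigma> - 2)\<close> integrable at both ends.\<close>

lemma B_minus_T_B: "\<exists>E>0. \<forall>t>0. \<forall>x. norm (B x - T t (B x)) \<le> E * norm x * min t 1"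
proof -
  obtain K where K: "K > 0" "\<And>x. norm (B x) \<le> norm x * K"
    using bounded_linear.pos_bounded[OF B_linear] by blast
  define E where "E = max M ((1 + M) * K)"
  have "norm (B x - T t (B x)) \<le> E * norm x * min t 1" if t: "t > 0" for t x
  proof -
    have "norm (T t (B x) - T 0 (B x)) \<le> (M * norm x) * t - (M * norm x) * 0"
    proof (rule differentiable_bound_general[OF t])
      show "continuous_on {0..t} (\<lambda>t. T t (B x))" by (rule continuous_on_subset[OF T_continuous]) auto
      show "continuous_on {0..t} (\<lambda>t. (M * norm x) * t)" by (intro continuous_intros)
      fix r :: real assume r: "0 < r" "r < t"
      show "((\<lambda>t. T t (B x)) has_vector_derivative - T r x) (at r)" by (rule T_B_deriv[OF r(1)])
      show "((*) (M * norm x) has_vector_derivative (M * norm x)) (at r)"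
        by (auto intro!: derivative_eq_intros simp flip: has_real_derivative_iff_has_vector_derivative)
      show "norm (- T r x) \<le> M * norm x" using T_norm[of r x] r by simp
    qed
    then have 1: "norm (B x - T t (B x)) \<le> M * norm x * t" by (simp add: T_0 norm_minus_commute)
    have "norm (B x - T t (B x)) \<le> (1 + M) * norm (B x)"
      using norm_triangle_ineq4[of "B x" "T t (B x)"] T_norm[of t "B x"] t by (simp add: algebra_simps)
    also have "\<dots> \<le> (1 + M) * (norm x * K)" using K(2) M(1) by (intro mult_left_mono) auto
    finally have 2: "norm (B x - T t (B x)) \<le> ((1 + M) * K) * norm x" by (simp add: mult_ac)
    have 3: "M * norm x * t \<le> E * norm x * t" "((1 + M) * K) * norm x \<le> E * norm x"
      unfolding E_def using t by (intro mult_right_mono; simp)+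
    from 1 2 3 show ?thesis by (cases "t \<le> 1") (auto simp: min_def)
  qed
  moreover have "E > 0" using M(1) unfolding E_def by simp
  ultimately show ?thesis by blast
qed

text \<open>The power \<open>B\<^sup>\<sigma>\<close> expressed through the semigroup; this form commutes with everything that commutes
  with \<open>T\<close> and avoids resolvents.\<close>

definition bal :: "real \<Rightarrow> 'a \<Rightarrow> 'a" where
  "bal \<sigma> x = ((1 - \<sigma>) / Gamma \<sigma>) *\<^sub>R hl_integral (\<lambda>t. t powr (\<sigma> - 2) *\<^sub>R (B x - T t (B x)))"

lemma bal_cont: "continuous_on {0<..} (\<lambda>t. k t *\<^sub>R (B x - T t (B x)))" if "continuous_on {0<..} k"
  by (intro continuous_intros that T_continuous_pos)

text \<open>The second claim provides a majorant that sees \<open>k\<close> only through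
  \<open>C\<close>, as dominated convergence over a family of kernels requires.\<close>

lemma bal_absint:
  assumes \<sigma>: "0 < \<sigma>" "\<sigma> < 1" and k: "continuous_on {0<..} k" "\<And>t. t > 0 \<Longrightarrow> \<bar>k t\<bar> \<le> C * t powr (\<sigma> - 2)"
  shows "hl_absint (\<lambda>t. k t *\<^sub>R (B x - T t (B x)))"
    "\<exists>g. set_integrable lborel {0<..} g \<and> (\<forall>t>0. C * t powr (\<sigma> - 2) * norm (B x - T t (B x)) \<le> g t)"
proof -
  obtain E where E: "E > 0" "\<And>t x. t > 0 \<Longrightarrow> norm (B x - T t (B x)) \<le> E * norm x * min t 1"
    using B_minus_T_B by auto
  have C: "C \<ge> 0" using k(2)[of 1] by simp
  let ?g = "\<lambda>t. (C * E * norm x) * (t powr (\<sigma> - 2) * min t 1)"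
  have g: "C * t powr (\<sigma> - 2) * norm (B x - T t (B x)) \<le> ?g t" if t: "t > 0" for t
    using mult_left_mono[OF E(2)[OF t, of x], of "C * t powr (\<sigma> - 2)"] C by (simp add: mult_ac)
  have gi: "set_integrable lborel {0<..} ?g"
    using hl_absint_scaleR[OF min_powr_absint[OF \<sigma>], of "C * E * norm x"] C E
    unfolding hl_absint_def by (subst (asm) set_integrable_cong[OF refl refl]) (auto simp: abs_mult)
  show "\<exists>g. set_integrable lborel {0<..} g \<and> (\<forall>t>0. C * t powr (\<sigma> - 2) * norm (B x - T t (B x)) \<le> g t)"
    using g gi by blast
  show "hl_absint (\<lambda>t. k t *\<^sub>R (B x - T t (B x)))"
  proof (rule hl_absint_bound[OF bal_cont[OF k(1)] gi])
    fix t :: real assume t: "t > 0"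
    show "norm (k t *\<^sub>R (B x - T t (B x))) \<le> ?g t"
      using mult_right_mono[OF k(2)[OF t] norm_ge_zero[of "B x - T t (B x)"]] g[OF t] by simp
  qed
qed

lemma bal_absint': 
  assumes \<sigma>: "0 < \<sigma>" "\<sigma> < 1" shows "hl_absint (\<lambda>t. t powr (\<sigma> - 2) *\<^sub>R (B x - T t (B x)))"
  by (rule bal_absint(1)[OF \<sigma>, where C=1]) (auto intro!: continuous_intros)

text \<open>\<open>K\<close> depends on none of \<open>k\<close>, \<open>C\<close> and
  \<open>x\<close>. The single kernel \<open>t powr (\<sigma> - 2)\<close> yields boundedness of
  \<open>bal\<close>; a family of kernels indexed by \<open>y\<close> yields a bound of
  \<open>QU\<close> uniform in \<open>y\<close>.\<close>

lemma kernel_bal_bound: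
  assumes \<sigma>: "0 < \<sigma>" "\<sigma> < 1"
  shows "\<exists>K>0. \<forall>k C x. continuous_on {0<..} k \<longrightarrow> (\<forall>t>0. \<bar>k t\<bar> \<le> C * t powr (\<sigma> - 2)) \<longrightarrow>
    norm (hl_integral (\<lambda>t. k t *\<^sub>R (B x - T t (B x)))) \<le> C * K * norm x"
proof -
  obtain E where E: "E > 0" "\<And>t x. t > 0 \<Longrightarrow> norm (B x - T t (B x)) \<le> E * norm x * min t 1"
    using B_minus_T_B by auto
  define I where "I = hl_integral (\<lambda>t. t powr (\<sigma> - 2) * min t 1)"
  have "0 \<le> norm (hl_integral (\<lambda>t::real. 0::real))" by simp
  also have "\<dots> \<le> I" unfolding I_def
    by (rule hl_integral_norm_bound[OF _ min_powr_absint[OF \<sigma>]]) (auto simp: hl_absint_def set_integrable_def)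
  finally have I: "I \<ge> 0" .
  have "norm (hl_integral (\<lambda>t. k t *\<^sub>R (B x - T t (B x)))) \<le> C * (E * (I + 1)) * norm x"
    if k: "continuous_on {0<..} k" "\<And>t. t > 0 \<Longrightarrow> \<bar>k t\<bar> \<le> C * t powr (\<sigma> - 2)" for k C x
  proof -
    have C: "C \<ge> 0" using k(2)[of 1] by simp
    have "norm (hl_integral (\<lambda>t. k t *\<^sub>R (B x - T t (B x)))) \<le>
        hl_integral (\<lambda>t. (C * E * norm x) *\<^sub>R (t powr (\<sigma> - 2) * min t 1))"
    proof (rule hl_integral_norm_bound[OF bal_absint(1)[OF \<sigma> k] hl_absint_scaleR[OF min_powr_absint[OF \<sigma>]]])
      fix t :: real assume t: "t > 0"
      have "\<bar>k t\<bar> * norm (B x - T t (B x)) \<le> (C * t powr (\<sigma> - 2)) * (E * norm x * min t 1)"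
        using k(2)[OF t] E(2)[OF t, of x] C by (intro mult_mono) auto
      then show "norm (k t *\<^sub>R (B x - T t (B x))) \<le> (C * E * norm x) *\<^sub>R (t powr (\<sigma> - 2) * min t 1)"
        by (simp add: mult_ac)
    qed
    also have "\<dots> = C * E * norm x * I"
      unfolding I_def by (subst hl_integral_scaleR[OF min_powr_absint[OF \<sigma>]]) simp
    also have "\<dots> \<le> C * E * norm x * (I + 1)" using C E by (intro mult_left_mono) auto
    finally show ?thesis by (simp add: mult_ac)
  qed
  moreover have "E * (I + 1) > 0" using E I by simp
  ultimately show ?thesis by (intro exI[of _ "E * (I + 1)"] conjI allI impI) auto
qed

lemma bal_linear: assumes \<sigma>: "0 < \<sigma>" "\<sigma> < 1" shows "bounded_linear (bal \<sigma>)"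
proof -
  obtain K where K: "K > 0" "\<And>k C x. continuous_on {0<..} k \<Longrightarrow> (\<And>t. t > 0 \<Longrightarrow> \<bar>k t\<bar> \<le> C * t powr (\<sigma> - 2)) \<Longrightarrow>
    norm (hl_integral (\<lambda>t. k t *\<^sub>R (B x - T t (B x)))) \<le> C * K * norm x"
    using kernel_bal_bound[OF \<sigma>] by auto
  note ai = bal_absint'[OF \<sigma>]
  have G: "Gamma \<sigma> > 0" using \<sigma> by simp
  show ?thesis
  proof (rule bounded_linear_intro[where K="(1 - \<sigma>) / Gamma \<sigma> * K"])
    show "bal \<sigma> (x + y) = bal \<sigma> x + bal \<sigma> y" for x y
      unfolding bal_def scaleR_add_right[symmetric] hl_integral_add[OF ai ai, symmetric]
      by (intro arg_cong[where f="\<lambda>z. ((1 - \<sigma>) / Gamma \<sigma>) *\<^sub>R z"] hl_integral_cong)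
        (simp add: B_simps blinfun.add_right algebra_simps)
    show "bal \<sigma> (c *\<^sub>R x) = c *\<^sub>R bal \<sigma> x" for c x
    proof -
      have "hl_integral (\<lambda>t. t powr (\<sigma> - 2) *\<^sub>R (B (c *\<^sub>R x) - T t (B (c *\<^sub>R x)))) =
          hl_integral (\<lambda>t. c *\<^sub>R (t powr (\<sigma> - 2) *\<^sub>R (B x - T t (B x))))"
        by (rule hl_integral_cong) (simp add: B_simps blinfun.scaleR_right algebra_simps)
      then show ?thesis unfolding bal_def hl_integral_scaleR[OF ai] by simp
    qed
    have "norm (hl_integral (\<lambda>t. t powr (\<sigma> - 2) *\<^sub>R (B x - T t (B x)))) \<le> 1 * K * norm x" for x
      by (rule K(2)) (auto intro!: continuous_intros)
    from mult_left_mono[OF this, of "(1 - \<sigma>) / Gamma \<sigma>"]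
    show "norm (bal \<sigma> x) \<le> norm x * ((1 - \<sigma>) / Gamma \<sigma> * K)" for x
      using \<sigma> G by (simp add: bal_def mult_ac)
  qed
qed

lemma bal_commute:
  assumes \<sigma>: "0 < \<sigma>" "\<sigma> < 1" and h: "bounded_linear h" "\<And>t x. t \<ge> 0 \<Longrightarrow> T t (h x) = h (T t x)" "\<And>x. B (h x) = h (B x)"
  shows "bal \<sigma> (h x) = h (bal \<sigma> x)"
proof -
  interpret bounded_linear h by fact
  have "hl_integral (\<lambda>t. t powr (\<sigma> - 2) *\<^sub>R (B (h x) - T t (B (h x)))) = hl_integral (\<lambda>t. h (t powr (\<sigma> - 2) *\<^sub>R (B x - T t (B x))))"
    by (rule hl_integral_cong) (simp add: h scaleR diff)
  also have "\<dots> = h (hl_integral (\<lambda>t. t powr (\<sigma> - 2) *\<^sub>R (B x - T t (B x))))"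
    by (rule hl_integral_linear[OF bal_absint'[OF \<sigma>] h(1)])
  finally show ?thesis by (simp add: bal_def scaleR)
qed

lemma bal_B: "0 < \<sigma> \<Longrightarrow> \<sigma> < 1 \<Longrightarrow> bal \<sigma> (B x) = B (bal \<sigma> x)"
  by (rule bal_commute[OF _ _ B_linear T_B]) auto

lemma bal_T: "0 < \<sigma> \<Longrightarrow> \<sigma> < 1 \<Longrightarrow> t \<ge> 0 \<Longrightarrow> T t (bal \<sigma> x) = bal \<sigma> (T t x)"
  by (rule bal_commute[OF _ _ blinfun.bounded_linear_right T_commute T_B[symmetric], symmetric])

section \<open>Agreement with the Balakrishnan integral\<close>

text \<open>The Laplace transform integrated by parts: both terms integrate explicitly and
  \<open>R_eq\<close> recombines them. The resolvent is now expressed through the same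
  \<open>B x - T t (B x)\<close> as \<open>bal\<close>.\<close>

lemma R_alt:
  assumes "\<mu> > 0"
  shows "R \<mu> x = \<mu> *\<^sub>R hl_integral (\<lambda>t. exp (- \<mu> * t) *\<^sub>R (B x - T t (B x)))"
    "hl_absint (\<lambda>t. exp (- \<mu> * t) *\<^sub>R (B x - T t (B x)))"
proof -
  have ax: "hl_absint (\<lambda>t. exp (- \<mu> * t) *\<^sub>R B x)"
    by (rule hl_absint_bound[of _ "\<lambda>t. norm (B x) * norm (exp (- \<mu> * t))"])
      (use hl_absint_exp[OF assms] in \<open>auto simp: hl_absint_def mult.commute intro!: continuous_intros set_integrable_mult_right\<close>)
  show "hl_absint (\<lambda>t. exp (- \<mu> * t) *\<^sub>R (B x - T t (B x)))"
    unfolding scaleR_diff_right by (intro hl_absint_diff ax R_absint assms)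
  have H: "hl_integral (\<lambda>t. exp (- \<mu> * t) *\<^sub>R (B x - T t (B x))) = (1 / \<mu>) *\<^sub>R B x - R \<mu> (B x)"
    unfolding scaleR_diff_right R_def
    by (intro hl_integral_eq hl_has_integral_diff hl_has_integral_scaleR_left hl_has_integral_exp assms
        hl_absint_exists R_absint)
  then show "R \<mu> x = \<mu> *\<^sub>R hl_integral (\<lambda>t. exp (- \<mu> * t) *\<^sub>R (B x - T t (B x)))"
    unfolding H using R_eq[OF assms, of x] assms by (simp add: scaleR_diff_right R_B eq_diff_eq)
qed

text \<open>In contrast to \<open>R_norm\<close> this stays finite as \<open>\<mu>\<close> tends to
  0. It controls the Balakrishnan integrand at infinity, where the resolvent is evaluated at
  \<open>1 / \<mu>\<close>.\<close>

lemma R_norm': "\<mu> > 0 \<Longrightarrow> norm (R \<mu> x) \<le> (1 + M) * norm (B x)"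
proof -
  assume \<mu>: "\<mu> > 0"
  have "R \<mu> x = B x - \<mu> *\<^sub>R R \<mu> (B x)" using R_eq[OF \<mu>, of x] by (simp add: R_B \<mu> algebra_simps)
  then have "norm (R \<mu> x) \<le> norm (B x) + norm (\<mu> *\<^sub>R R \<mu> (B x))" by (simp only: norm_triangle_ineq4)
  also have "\<dots> \<le> norm (B x) + M * norm (B x)" using R_norm[OF \<mu>, of "B x"] by linarith
  finally show ?thesis by (simp add: algebra_simps)
qed

lemma R_continuous: "continuous_on {0<..} (\<lambda>\<mu>. R \<mu> x)"
proof (rule continuous_at_imp_continuous_on, rule ballI)
  fix \<mu> :: real assume "\<mu> \<in> {0<..}"
  then have \<mu>: "\<mu> > 0" by simp
  show "isCont (\<lambda>\<mu>. R \<mu> x) \<mu>"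
    unfolding isCont_def R_def
  proof (rule hl_integral_tendsto[where g="\<lambda>t. (M * norm x) * norm (exp (- (\<mu> / 2) * t))"])
    have "eventually (\<lambda>z. z > \<mu> / 2) (at \<mu>)"
      by (rule order_tendstoD(1)[OF tendsto_ident_at]) (use \<mu> in simp)
    then show "\<forall>\<^sub>F z in at \<mu>. continuous_on {0<..} (\<lambda>t. exp (- z * t) *\<^sub>R T t x) \<and>
        (\<forall>t>0. norm (exp (- z * t) *\<^sub>R T t x) \<le> (M * norm x) * norm (exp (- (\<mu> / 2) * t)))"
    proof eventually_elim
      case (elim z)
      have "norm (exp (- z * t) *\<^sub>R T t x) \<le> (M * norm x) * norm (exp (- (\<mu> / 2) * t))" if t: "t > 0" for t
      proof -
        have "exp (- z * t) \<le> exp (- (\<mu> / 2) * t)" using elim t by simp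
        from mult_mono[OF this T_norm[of t x]] t show ?thesis by (simp add: mult.commute)
      qed
      then show ?case by (auto intro!: continuous_intros T_continuous_pos)
    qed
    show "continuous_on {0<..} (\<lambda>t. exp (- \<mu> * t) *\<^sub>R T t x)" by (intro continuous_intros T_continuous_pos)
    show "set_integrable lborel {0<..} (\<lambda>t. (M * norm x) * norm (exp (- (\<mu> / 2) * t)))"
      using hl_absint_exp[of "\<mu> / 2"] \<mu> by (intro set_integrable_mult_right) (simp add: hl_absint_def)
    show "(\<lambda>z. exp (- z * t) *\<^sub>R T t x) \<midarrow>\<mu>\<rightarrow> exp (- \<mu> * t) *\<^sub>R T t x" for t
      by (intro tendsto_intros)
  qed
qed

text \<open>\<open>R_eq\<close> at \<open>1 / \<mu>\<close> says that the right-hand side solves the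
  shifted equation. For injectivity, \<open>R_eq\<close> applied to a null vector \<open>z\<close>
  of the shift expresses \<open>B z\<close> as the resolvent of 0.\<close>

lemma inv_shift: assumes "\<mu> > 0" shows "inv (\<lambda>x. \<mu> *\<^sub>R x + B x) (B u) = (1 / \<mu>) *\<^sub>R R (1 / \<mu>) u"
proof (rule inv_f_eq)
  have \<mu>: "1 / \<mu> > 0" using assms by simp
  show "\<mu> *\<^sub>R ((1 / \<mu>) *\<^sub>R R (1 / \<mu>) u) + B ((1 / \<mu>) *\<^sub>R R (1 / \<mu>) u) = B u"
    using R_eq[OF \<mu>, of u] assms by (simp add: B_simps)
  show "inj (\<lambda>x. \<mu> *\<^sub>R x + B x)"
  proof (rule injI)
    fix x y assume "\<mu> *\<^sub>R x + B x = \<mu> *\<^sub>R y + B y"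
    then have "(1 / \<mu>) *\<^sub>R (\<mu> *\<^sub>R (x - y) + B (x - y)) = 0" by (simp add: B_simps algebra_simps)
    then have z: "(x - y) + (1 / \<mu>) *\<^sub>R B (x - y) = 0" using assms by (simp add: scaleR_add_right)
    interpret Rl: bounded_linear "R (1 / \<mu>)" by (rule R_linear[OF \<mu>])
    have "B (x - y) = R (1 / \<mu>) ((x - y) + (1 / \<mu>) *\<^sub>R B (x - y))"
      using R_eq[OF \<mu>, of "x - y"] by (simp only: Rl.add Rl.scaleR R_B[OF \<mu>])
    then have "B (x - y) = B 0" using z by (simp add: Rl.zero B_simps)
    from B_inj[OF this] show "x = y" by simp
  qed
qed

text \<open>With resolvents as Laplace transforms the Balakrishnan formula is a double integral. In
  place of an interchange, \<open>F m\<close> is the \<open>t\<close>-integral whose kernel is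
  already integrated up to \<open>m\<close> in the other variable: its derivative is the
  Balakrishnan integrand, and its limits at 0 and infinity give the value.\<close>

lemma balakrishnan_eq_bal:
  assumes \<sigma>: "0 < \<sigma>" "\<sigma> < 1"
  shows "balakrishnan B \<sigma> u = bal \<sigma> u"
proof -
  define g where "g t = B u - T t (B u)" for t
  obtain E where E: "E > 0" "\<And>t x. t > 0 \<Longrightarrow> norm (B x - T t (B x)) \<le> E * norm x * min t 1"
    using B_minus_T_B by auto
  from \<sigma> have "\<sigma> < 2" by simp
  from balakrishnan_scalar[OF this]
  obtain \<phi> where \<phi>: "\<And>m. m > 0 \<Longrightarrow> (\<phi> has_real_derivative m powr (\<sigma> - 3) * exp (- 1 / m)) (at m)"
    "(\<phi> \<longlongrightarrow> 0) (at_right 0)" "(\<phi> \<longlongrightarrow> Gamma (2 - \<sigma>)) at_top"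
    "\<And>m. m > 0 \<Longrightarrow> 0 \<le> \<phi> m \<and> \<phi> m \<le> Gamma (2 - \<sigma>)"
    by blast
  \<comment> \<open>By the scaling \<open>r = t * \<rho>\<close> this is the integral of
    \<open>r powr (\<sigma> - 3) * exp (- t / r)\<close> from 0 to \<open>m\<close>.\<close>
  define \<kappa> where "\<kappa> m t = t powr (\<sigma> - 2) * \<phi> (m / t)" for m t
  have \<phi>c: "isCont \<phi> m" if "m > 0" for m using DERIV_isCont[OF \<phi>(1)[OF that]] .
  have \<kappa>c: "continuous_on {0<..} (\<kappa> m)" if "m > 0" for m
    unfolding \<kappa>_def
  proof (intro continuous_on_mult)
    show "continuous_on {0<..} (\<lambda>t. \<phi> (m / t))"
    proof (intro continuous_at_imp_continuous_on ballI)
      fix t :: real assume "t \<in> {0<..}"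
      then have t: "t > 0" by simp
      show "isCont (\<lambda>t. \<phi> (m / t)) t"
        by (rule isCont_o2[where f="\<lambda>t. m / t"]) (use t that in \<open>simp_all add: \<phi>c\<close>)
    qed
  qed (auto intro!: continuous_intros)
  have \<kappa>b: "\<bar>\<kappa> m t\<bar> \<le> Gamma (2 - \<sigma>) * t powr (\<sigma> - 2)" if "m > 0" "t > 0" for m t
    using \<phi>(4)[of "m / t"] that by (simp add: \<kappa>_def abs_mult mult.commute mult_right_mono)
  have \<kappa>d: "((\<lambda>m. \<kappa> m t) has_real_derivative m powr (\<sigma> - 3) * exp (- t / m)) (at m)" if "m > 0" "t > 0" for m t
  proof -
    have "((\<lambda>m. \<phi> (m / t)) has_real_derivative ((m / t) powr (\<sigma> - 3) * exp (- 1 / (m / t))) * (1 / t)) (at m)"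
      by (rule DERIV_chain2[where f=\<phi>, OF \<phi>(1)]) (use that in \<open>auto intro!: derivative_eq_intros\<close>)
    from DERIV_cmult[OF this, of "t powr (\<sigma> - 2)"]
    show ?thesis unfolding \<kappa>_def
    proof (rule DERIV_cong)
      have "t powr (\<sigma> - 2) = t * t powr (\<sigma> - 3)" using that powr_mult_base[of t "\<sigma> - 3"] by simp
      then show "t powr (\<sigma> - 2) * ((m / t) powr (\<sigma> - 3) * exp (- 1 / (m / t)) * (1 / t)) = m powr (\<sigma> - 3) * exp (- t / m)"
        using that by (simp add: powr_divide)
    qed
  qed
  define F where "F m = hl_integral (\<lambda>t. \<kappa> m t *\<^sub>R g t)" for m
  obtain G where G: "set_integrable lborel {0<..} G" "\<And>t. t > 0 \<Longrightarrow> Gamma (2 - \<sigma>) * t powr (\<sigma> - 2) * norm (g t) \<le> G t"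
    using bal_absint(2)[OF \<sigma> \<kappa>c \<kappa>b, of 1 u] unfolding g_def by auto
  have \<kappa>G: "norm (\<kappa> m t *\<^sub>R g t) \<le> G t" if "m > 0" "t > 0" for m t
    using mult_right_mono[OF \<kappa>b[OF that] norm_ge_zero[of "g t"]] G(2)[OF that(2)] by simp
  have \<kappa>gc: "continuous_on {0<..} (\<lambda>t. \<kappa> m t *\<^sub>R g t)" if "m > 0" for m
    unfolding g_def by (rule bal_cont[OF \<kappa>c[OF that]])
  have dF: "(F has_vector_derivative m powr (\<sigma> - 2) *\<^sub>R R (1 / m) u) (at m)" if m: "m > 0" for m
  proof -
    have "(F has_vector_derivative hl_integral (\<lambda>t. (m powr (\<sigma> - 3) * exp (- t / m)) *\<^sub>R g t)) (at m)"
      unfolding F_def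
    proof (rule hl_integral_derivative[where d="m / 2" and g="\<lambda>t. ((m / 2) powr (\<sigma> - 3) * (E * norm u)) * norm (exp (- (1 / (2 * m)) * t))"])
      show "m / 2 > 0" using m by simp
      fix z assume z: "z \<in> ball m (m / 2)"
      then have z': "m / 2 < z" "z < 2 * m" using m unfolding mem_ball dist_real_def by linarith+
      then have z0: "z > 0" using m by simp
      show "hl_absint (\<lambda>t. \<kappa> z t *\<^sub>R g t)" unfolding g_def by (rule bal_absint(1)[OF \<sigma> \<kappa>c[OF z0] \<kappa>b[OF z0]])
      fix t :: real assume t: "t > 0"
      show "((\<lambda>y. \<kappa> y t *\<^sub>R g t) has_vector_derivative (z powr (\<sigma> - 3) * exp (- t / z)) *\<^sub>R g t) (at z)"
        using \<kappa>d[OF z0 t, unfolded has_real_derivative_iff_has_vector_derivative]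
        by (rule bounded_linear.has_vector_derivative[OF bounded_linear_scaleR_left])
      have "z powr (\<sigma> - 3) \<le> (m / 2) powr (\<sigma> - 3)" using z' m \<sigma> by (intro powr_mono2') auto
      moreover have "exp (- t / z) \<le> exp (- (1 / (2 * m)) * t)"
      proof -
        have "t / (2 * m) \<le> t / z" using z' m t by (intro divide_left_mono) auto
        then show ?thesis by simp
      qed
      moreover have "norm (g t) \<le> E * norm u"
        unfolding g_def using order_trans[OF E(2)[OF t, of u] mult_left_mono[of "min t 1" 1 "E * norm u"]] E(1) by simp
      ultimately have "(z powr (\<sigma> - 3) * exp (- t / z)) * norm (g t) \<le> ((m / 2) powr (\<sigma> - 3) * exp (- (1 / (2 * m)) * t)) * (E * norm u)"
        by (intro mult_mono) auto
      then show "norm ((z powr (\<sigma> - 3) * exp (- t / z)) *\<^sub>R g t) \<le> ((m / 2) powr (\<sigma> - 3) * (E * norm u)) * norm (exp (- (1 / (2 * m)) * t))"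
        by (simp add: mult_ac)
    next
      show "set_integrable lborel {0<..} (\<lambda>t. ((m / 2) powr (\<sigma> - 3) * (E * norm u)) * norm (exp (- (1 / (2 * m)) * t)))"
        using hl_absint_exp[of "1 / (2 * m)"] m by (intro set_integrable_mult_right) (simp add: hl_absint_def)
      show "continuous_on {0<..} (\<lambda>t. (m powr (\<sigma> - 3) * exp (- t / m)) *\<^sub>R g t)"
        unfolding g_def using m by (intro bal_cont continuous_intros) auto
    qed
    also have "hl_integral (\<lambda>t. (m powr (\<sigma> - 3) * exp (- t / m)) *\<^sub>R g t) =
        hl_integral (\<lambda>t. m powr (\<sigma> - 3) *\<^sub>R (exp (- (1 / m) * t) *\<^sub>R (B u - T t (B u))))"
      by (rule hl_integral_cong) (simp add: g_def)
    also have "\<dots> = m powr (\<sigma> - 3) *\<^sub>R hl_integral (\<lambda>t. exp (- (1 / m) * t) *\<^sub>R (B u - T t (B u)))"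
      by (rule hl_integral_scaleR[OF R_alt(2)]) (use m in simp)
    also have "\<dots> = m powr (\<sigma> - 2) *\<^sub>R R (1 / m) u"
    proof -
      have "m powr (\<sigma> - 2) = m * m powr (\<sigma> - 3)" using m powr_mult_base[of m "\<sigma> - 3"] by simp
      then have "m powr (\<sigma> - 2) * (1 / m) = m powr (\<sigma> - 3)" using m by simp
      then show ?thesis using R_alt(1)[of "1 / m" u] m by simp
    qed
    finally show ?thesis .
  qed
  have F0: "(F \<longlongrightarrow> hl_integral (\<lambda>t. 0 *\<^sub>R g t)) (at_right 0)"
    unfolding F_def
  proof (rule hl_integral_tendsto[OF _ _ G(1)])
    show "\<forall>\<^sub>F z in at_right 0. continuous_on {0<..} (\<lambda>t. \<kappa> z t *\<^sub>R g t) \<and> (\<forall>t>0. norm (\<kappa> z t *\<^sub>R g t) \<le> G t)"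
      using \<kappa>gc \<kappa>G by (auto simp: eventually_at_filter)
    fix t :: real assume t: "t > 0"
    have "filterlim (\<lambda>z. z / t) (at_right 0) (at_right 0)" using t by real_asymp
    from filterlim_compose[OF \<phi>(2) this] have "((\<lambda>z. t powr (\<sigma> - 2) * \<phi> (z / t)) \<longlongrightarrow> 0) (at_right 0)"
      by (rule tendsto_mult_right_zero)
    then show "((\<lambda>z. \<kappa> z t *\<^sub>R g t) \<longlongrightarrow> 0 *\<^sub>R g t) (at_right 0)"
      unfolding \<kappa>_def by (intro tendsto_intros)
  qed auto
  have Finf: "(F \<longlongrightarrow> hl_integral (\<lambda>t. (t powr (\<sigma> - 2) * Gamma (2 - \<sigma>)) *\<^sub>R g t)) at_top"
    unfolding F_def
  proof (rule hl_integral_tendsto_at_top[OF _ _ G(1)])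
    show "\<forall>\<^sub>F z in at_top. continuous_on {0<..} (\<lambda>t. \<kappa> z t *\<^sub>R g t) \<and> (\<forall>t>0. norm (\<kappa> z t *\<^sub>R g t) \<le> G t)"
      using eventually_gt_at_top[of 0] by eventually_elim (use \<kappa>gc \<kappa>G in auto)
    show "continuous_on {0<..} (\<lambda>t. (t powr (\<sigma> - 2) * Gamma (2 - \<sigma>)) *\<^sub>R g t)"
      unfolding g_def by (auto intro!: bal_cont continuous_intros)
    fix t :: real assume t: "t > 0"
    have "filterlim (\<lambda>z. z / t) at_top at_top" using t by real_asymp
    from filterlim_compose[OF \<phi>(3) this]
    show "((\<lambda>z. \<kappa> z t *\<^sub>R g t) \<longlongrightarrow> (t powr (\<sigma> - 2) * Gamma (2 - \<sigma>)) *\<^sub>R g t) at_top"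
      unfolding \<kappa>_def by (intro tendsto_intros)
  qed
  have hl0: "hl_integral (\<lambda>t. 0 *\<^sub>R g t) = 0"
    by (rule hl_integral_eq) (auto simp: hl_has_integral_def intro!: exI[of _ "\<lambda>_. 0"] exI[of _ 0])
  have hlG: "hl_integral (\<lambda>t. (t powr (\<sigma> - 2) * Gamma (2 - \<sigma>)) *\<^sub>R g t) = Gamma (2 - \<sigma>) *\<^sub>R hl_integral (\<lambda>t. t powr (\<sigma> - 2) *\<^sub>R g t)"
    unfolding g_def by (subst hl_integral_scaleR[OF bal_absint'[OF \<sigma>], symmetric]) (simp add: mult.commute)
  have I: "hl_has_integral (\<lambda>m. m powr (\<sigma> - 2) *\<^sub>R R (1 / m) u) (Gamma (2 - \<sigma>) *\<^sub>R hl_integral (\<lambda>t. t powr (\<sigma> - 2) *\<^sub>R g t))"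
    unfolding hl_has_integral_def using dF F0 Finf unfolding hl0 hlG
    by (intro exI[of _ F] exI[of _ 0]) simp
  let ?h = "\<lambda>\<mu>. \<mu> powr (\<sigma> - 1) *\<^sub>R inv (\<lambda>x. \<mu> *\<^sub>R x + B x) (B u)"
  have h: "?h \<mu> = \<mu> powr (\<sigma> - 2) *\<^sub>R R (1 / \<mu>) u" if "\<mu> > 0" for \<mu>
  proof -
    have "\<mu> powr (\<sigma> - 1) = \<mu> * \<mu> powr (\<sigma> - 2)" using that powr_mult_base[of \<mu> "\<sigma> - 2"] by simp
    then show ?thesis using that by (simp add: inv_shift)
  qed
  \<comment> \<open>Near 0 the norm of \<open>R (1 / \<mu>) u\<close> is O(\<open>\<mu>\<close>),
    leaving the power \<open>\<sigma> - 1\<close>; at infinity it is bounded, leaving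
    \<open>\<sigma> - 2\<close>.\<close>
  have "hl_absint (\<lambda>\<mu>. \<mu> powr (\<sigma> - 2) *\<^sub>R R (1 / \<mu>) u)"
  proof (rule hl_absint_powr_bound[where a="\<sigma> - 1" and b="\<sigma> - 2" and C="M * norm u" and K="(1 + M) * norm (B u)"])
    show "continuous_on {0<..} (\<lambda>\<mu>. \<mu> powr (\<sigma> - 2) *\<^sub>R R (1 / \<mu>) u)"
      by (intro continuous_intros continuous_on_compose2[OF R_continuous]) auto
    show "norm (\<mu> powr (\<sigma> - 2) *\<^sub>R R (1 / \<mu>) u) \<le> M * norm u * \<mu> powr (\<sigma> - 1)" if "0 < \<mu>" "\<mu> < 1" for \<mu>
    proof -
      have "norm (R (1 / \<mu>) u) \<le> M * norm u * \<mu>" using R_norm[of "1 / \<mu>" u] that by (simp add: field_simps)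
      then have "norm (\<mu> powr (\<sigma> - 2) *\<^sub>R R (1 / \<mu>) u) \<le> \<mu> powr (\<sigma> - 2) * (M * norm u * \<mu>)"
        by (simp add: mult_left_mono)
      also have "\<dots> = M * norm u * (\<mu> * \<mu> powr (\<sigma> - 2))" by (simp only: mult_ac)
      also have "\<mu> * \<mu> powr (\<sigma> - 2) = \<mu> powr (\<sigma> - 1)" using powr_mult_base[of \<mu> "\<sigma> - 2"] that by simp
      finally show ?thesis .
    qed
    show "norm (\<mu> powr (\<sigma> - 2) *\<^sub>R R (1 / \<mu>) u) \<le> (1 + M) * norm (B u) * \<mu> powr (\<sigma> - 2)" if "1 \<le> \<mu>" for \<mu>
      using mult_left_mono[OF R_norm'[of "1 / \<mu>" u], of "\<mu> powr (\<sigma> - 2)"] that by (simp add: mult_ac)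
  qed (use \<sigma> in auto)
  moreover have "hl_absint ?h \<longleftrightarrow> hl_absint (\<lambda>\<mu>. \<mu> powr (\<sigma> - 2) *\<^sub>R R (1 / \<mu>) u)"
    by (rule hl_absint_cong) (rule h)
  ultimately have hai: "hl_absint ?h" by simp
  have hic: "hl_integral ?h = hl_integral (\<lambda>m. m powr (\<sigma> - 2) *\<^sub>R R (1 / m) u)"
    by (rule hl_integral_cong) (rule h)
  have "bochner_integral_on {0<..} ?h = Gamma (2 - \<sigma>) *\<^sub>R hl_integral (\<lambda>t. t powr (\<sigma> - 2) *\<^sub>R g t)"
    by (rule trans[OF bochner_integral_on_pos(2)[OF hai] trans[OF hic hl_integral_eq[OF I]]])
  then have 1: "balakrishnan B \<sigma> u = (sin (\<sigma> * pi) / pi * Gamma (2 - \<sigma>)) *\<^sub>R hl_integral (\<lambda>t. t powr (\<sigma> - 2) *\<^sub>R g t)"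
    unfolding balakrishnan_def by (simp only: scaleR_scaleR)
  \<comment> \<open>Since
    \<open>Gamma (2 - \<sigma>) = (1 - \<sigma>) * Gamma (1 - \<sigma>)\<close>, the reflection
    formula turns the Balakrishnan constant into that of \<open>bal\<close>.\<close>
  have "1 - \<sigma> \<notin> \<int>\<^sub>\<le>\<^sub>0" using nonpos_Ints_nonpos[of "1 - \<sigma>"] \<sigma> by auto
  from Gamma_plus1[OF this] have "Gamma (2 - \<sigma>) = (1 - \<sigma>) * Gamma (1 - \<sigma>)"
    by simp
  moreover have "sin (\<sigma> * pi) > 0"
    by (rule sin_gt_zero) (use \<sigma> in simp_all)
  moreover have "Gamma \<sigma> > 0" by (rule Gamma_real_pos[OF \<sigma>(1)])
  ultimately have "sin (\<sigma> * pi) / pi * Gamma (2 - \<sigma>) = (1 - \<sigma>) / Gamma \<sigma>"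
    using quotient_eq_of_prod[OF Gamma_reflection_real[of \<sigma>]] pi_gt_zero by (simp only:)
  with 1 show ?thesis by (simp add: bal_def g_def)
qed

end

section \<open>The weighted derivative at y = 0\<close>

text \<open>The value of \<open>c_const\<close> for orders between 0 and 1: the factor between the
  fractional power of order \<open>\<sigma>\<close> and the boundary limit of
  \<open>y powr (1 - 2 * \<sigma>)\<close> times the derivative of the extension.\<close>

definition neumann_const :: "real \<Rightarrow> real" where
  "neumann_const \<sigma> = - 2 * Gamma (1 - \<sigma>) / (4 powr \<sigma> * Gamma \<sigma>)"

text \<open>The Gamma quotients of \<open>\<sigma>\<close> and \<open>1 - \<sigma>\<close> are
  reciprocal, and the two powers of 4 multiply to 4, the product of the two factors - 2. Hence no
  constant survives in \<open>bal_bal\<close>.\<close>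

lemma neumann_const_prod:
  assumes "0 < \<sigma>" "\<sigma> < 1" shows "neumann_const \<sigma> * neumann_const (1 - \<sigma>) = 1"
proof -
  have G: "Gamma \<sigma> > 0" "Gamma (1 - \<sigma>) > 0" by (rule Gamma_real_pos, use assms in simp)+
  have "(4::real) powr \<sigma> * 4 powr (1 - \<sigma>) = 4" by (simp add: powr_add[symmetric])
  then have "4 powr (1 - \<sigma>) = 4 / (4::real) powr \<sigma>" by (simp add: eq_divide_eq mult.commute)
  then show ?thesis using G by (simp add: neumann_const_def)
qed

lemma z_exp_le_1: "\<bar>exp (- z) * (1 - z / \<sigma>)\<bar> \<le> 1 + 1 / \<sigma>" if "z \<ge> 0" "\<sigma> > 0" for z \<sigma> :: real
proof -
  have "z \<le> exp z" using exp_ge_add_one_self[of z] by linarith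
  then have "exp (- z) * z \<le> 1" by (simp add: exp_minus field_simps)
  then have "exp (- z) * z / \<sigma> \<le> 1 / \<sigma>" using that by (intro divide_right_mono) auto
  moreover have "exp (- z) \<le> 1" "exp (- z) \<ge> 0" "exp (- z) * z / \<sigma> \<ge> 0" "1 / \<sigma> \<ge> 0" using that by auto
  moreover have "exp (- z) * (1 - z / \<sigma>) = exp (- z) - exp (- z) * z / \<sigma>" by (simp add: algebra_simps)
  ultimately show ?thesis by linarith
qed

text \<open>Up to a constant this is the kernel of the weighted derivative of
  \<open>U \<sigma>\<close>. The point is that the bound does not depend on
  \<open>y\<close>.\<close>

lemma z_exp_kernel:
  fixes \<sigma> y :: real assumes "\<sigma> > 0"
  shows "continuous_on {0<..} (\<lambda>t. exp (- (y\<^sup>2 / (4 * t))) * (1 - (y\<^sup>2 / (4 * t)) / \<sigma>) * t powr (1 - \<sigma> - 2))"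
    "t > 0 \<Longrightarrow> \<bar>exp (- (y\<^sup>2 / (4 * t))) * (1 - (y\<^sup>2 / (4 * t)) / \<sigma>) * t powr (1 - \<sigma> - 2)\<bar> \<le> (1 + 1 / \<sigma>) * t powr (1 - \<sigma> - 2)"
proof -
  show "continuous_on {0<..} (\<lambda>t. exp (- (y\<^sup>2 / (4 * t))) * (1 - (y\<^sup>2 / (4 * t)) / \<sigma>) * t powr (1 - \<sigma> - 2))"
    using assms by (auto intro!: continuous_intros)
  assume "t > 0"
  then have "\<bar>exp (- (y\<^sup>2 / (4 * t))) * (1 - (y\<^sup>2 / (4 * t)) / \<sigma>)\<bar> \<le> 1 + 1 / \<sigma>"
    using assms by (intro z_exp_le_1) auto
  from mult_right_mono[OF this powr_ge_zero[of t "1 - \<sigma> - 2"]]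
  show "\<bar>exp (- (y\<^sup>2 / (4 * t))) * (1 - (y\<^sup>2 / (4 * t)) / \<sigma>) * t powr (1 - \<sigma> - 2)\<bar> \<le> (1 + 1 / \<sigma>) * t powr (1 - \<sigma> - 2)"
    by (simp only: abs_mult abs_of_nonneg[OF powr_ge_zero])
qed

context bounded_semigroup
begin

definition DU :: "real \<Rightarrow> real \<Rightarrow> 'a \<Rightarrow> 'a" where
  "DU q y x = (2 * q / y) *\<^sub>R (U q y x - U (q + 1) y x)"

lemma U_has_deriv: "q > 0 \<Longrightarrow> y > 0 \<Longrightarrow> ((\<lambda>y. U q y x) has_vector_derivative DU q y x) (at y)"
  unfolding DU_def by (rule U_deriv)

lemma DU_B: "q > 0 \<Longrightarrow> y > 0 \<Longrightarrow> DU q y (B x) = B (DU q y x)"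
  by (simp add: DU_def U_B B_simps)

lemma DU_diff: "q > 0 \<Longrightarrow> y > 0 \<Longrightarrow> DU q y (x - z) = DU q y x - DU q y z"
  by (simp add: DU_def U_diff algebra_simps)

lemma DU_scaleR: "q > 0 \<Longrightarrow> y > 0 \<Longrightarrow> DU q y (c *\<^sub>R x) = c *\<^sub>R DU q y x"
  by (simp add: DU_def U_scaleR algebra_simps)

lemma DU_norm:
  assumes "q > 0" "y > 0" shows "norm (DU q y x) \<le> (4 * q * M / y) * norm x"
proof -
  have "norm (U q y x - U (q + 1) y x) \<le> 2 * M * norm x"
    using norm_triangle_ineq4[of "U q y x" "U (q + 1) y x"] U_norm[of q y x] U_norm[of "q + 1" y x] assms by simp
  then have "(2 * q / y) * norm (U q y x - U (q + 1) y x) \<le> (2 * q / y) * (2 * M * norm x)"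
    using assms by (intro mult_left_mono) auto
  then show ?thesis using assms by (simp add: DU_def)
qed

text \<open>The extension equation for \<open>U q y (B x)\<close>, with
  \<open>- L (U q y (B x))\<close> replaced by \<open>U q y x\<close>. Differentiating the two
  factors of \<open>DU\<close> shifts the index once more, and \<open>U_eq_B\<close> collapses the
  difference of the shifted terms.\<close>

lemma DU_has_deriv:
  assumes "q > 0" "y > 0"
  shows "((\<lambda>y. DU q y (B x)) has_vector_derivative U q y x - ((1 - 2 * q) / y) *\<^sub>R DU q y (B x)) (at y)"
proof -
  have d: "((\<lambda>y. 2 * q / y) has_real_derivative - (2 * q / y\<^sup>2)) (at y)"
    using assms by (auto intro!: derivative_eq_intros simp: field_simps power2_eq_square)
  have "((\<lambda>y. U q y (B x) - U (q + 1) y (B x)) has_vector_derivative DU q y (B x) - DU (q + 1) y (B x)) (at y)"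
    using assms by (intro has_vector_derivative_diff U_has_deriv) auto
  from has_vector_derivative_scaleR[OF d this]
  have "((\<lambda>y. DU q y (B x)) has_vector_derivative
     (2 * q / y) *\<^sub>R (DU q y (B x) - DU (q + 1) y (B x)) + (- (2 * q / y\<^sup>2)) *\<^sub>R (U q y (B x) - U (q + 1) y (B x))) (at y)"
    unfolding DU_def .
  also have "U q y x = - (4 * q * (q + 1) / y\<^sup>2) *\<^sub>R (U (q + 1) y (B x) - U (q + 2) y (B x))"
    using U_eq_B[OF assms, of x] assms by (simp add: U_B B_simps)
  then have "(2 * q / y) *\<^sub>R (DU q y (B x) - DU (q + 1) y (B x)) + (- (2 * q / y\<^sup>2)) *\<^sub>R (U q y (B x) - U (q + 1) y (B x)) =
      U q y x - ((1 - 2 * q) / y) *\<^sub>R DU q y (B x)"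
  proof -
    assume u: "U q y x = - (4 * q * (q + 1) / y\<^sup>2) *\<^sub>R (U (q + 1) y (B x) - U (q + 2) y (B x))"
    have id: "(2 * q / y) *\<^sub>R ((2 * q / y) *\<^sub>R a - (2 * (q + 1) / y) *\<^sub>R b) + (- (2 * q / y\<^sup>2)) *\<^sub>R a =
        - (4 * q * (q + 1) / y\<^sup>2) *\<^sub>R b - ((1 - 2 * q) / y) *\<^sub>R ((2 * q / y) *\<^sub>R a)" for a b :: 'a
    proof -
      have "(2 * q / y) *\<^sub>R ((2 * q / y) *\<^sub>R a - (2 * (q + 1) / y) *\<^sub>R b) + (- (2 * q / y\<^sup>2)) *\<^sub>R a =
          ((2 * q / y) * (2 * q / y) - 2 * q / y\<^sup>2) *\<^sub>R a - ((2 * q / y) * (2 * (q + 1) / y)) *\<^sub>R b"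
        by (simp add: scaleR_diff_right scaleR_diff_left)
      moreover have "(2 * q / y) * (2 * q / y) - 2 * q / y\<^sup>2 = - (((1 - 2 * q) / y) * (2 * q / y))"
        using assms by (simp add: field_simps power2_eq_square)
      moreover have "(2 * q / y) * (2 * (q + 1) / y) = 4 * q * (q + 1) / y\<^sup>2"
        by (simp add: power2_eq_square)
      ultimately show ?thesis by (simp add: scaleR_minus_left)
    qed
    have "q + 1 + 1 = q + 2" by simp
    then show ?thesis unfolding u DU_def using id by metis
  qed
  finally show ?thesis .
qed

definition QU :: "real \<Rightarrow> real \<Rightarrow> 'a \<Rightarrow> 'a" where
  "QU q y x = y powr (1 - 2 * q) *\<^sub>R DU q y x"

lemma QU_B: "q > 0 \<Longrightarrow> y > 0 \<Longrightarrow> QU q y (B x) = B (QU q y x)"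
  by (simp add: QU_def DU_B B_simps)

text \<open>Both kernels in \<open>DU\<close> have mass 1, so \<open>B x\<close> can be subtracted
  without changing the value. Afterwards the singularity that remains as \<open>y\<close> tends to 0
  is integrable against \<open>B x - T t (B x)\<close>. The exponent is written
  \<open>1 - \<sigma> - 2\<close> to match \<open>bal (1 - \<sigma>)\<close>.\<close>

lemma QU_kernel:
  assumes \<sigma>: "0 < \<sigma>" "\<sigma> < 1" and y: "y > 0"
  shows "QU \<sigma> y (B x) = (- 2 * \<sigma> / (4 powr \<sigma> * Gamma \<sigma>)) *\<^sub>R
    hl_integral (\<lambda>t. (exp (- (y\<^sup>2 / (4 * t))) * (1 - (y\<^sup>2 / (4 * t)) / \<sigma>) * t powr (1 - \<sigma> - 2)) *\<^sub>R (B x - T t (B x)))"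
proof -
  let ?c = "- 2 * \<sigma> / (4 powr \<sigma> * Gamma \<sigma>)"
  let ?k = "\<lambda>t. exp (- (y\<^sup>2 / (4 * t))) * (1 - (y\<^sup>2 / (4 * t)) / \<sigma>) * t powr (1 - \<sigma> - 2)"
  have \<sigma>1: "0 < 1 - \<sigma>" "1 - \<sigma> < 1" using \<sigma> by auto
  have ai: "hl_absint (\<lambda>t. ?k t *\<^sub>R (B x - T t (B x)))"
    by (rule bal_absint(1)[OF \<sigma>1 z_exp_kernel[OF \<sigma>(1)]])
  have k: "(y powr (1 - 2 * \<sigma>) * (2 * \<sigma> / y)) * (ext_kernel \<sigma> y t - ext_kernel (\<sigma> + 1) y t) = - ?c * ?k t" if t: "t > 0" for t
  proof -
    have "y powr (1 - 2 * \<sigma>) * (2 * \<sigma> / y) * y powr (2 * \<sigma>) = 2 * \<sigma>"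
      using y by (simp add: powr_diff)
    moreover have "t powr (1 - \<sigma> - 2) = 1 / t powr (1 + \<sigma>)" by (simp flip: powr_minus_divide)
    moreover have "ext_kernel \<sigma> y t - ext_kernel (\<sigma> + 1) y t = y powr (2 * \<sigma>) * (exp (- (y\<^sup>2 / (4 * t))) * (1 - (y\<^sup>2 / (4 * t)) / \<sigma>) / t powr (1 + \<sigma>) / (4 powr \<sigma> * Gamma \<sigma>))"
    proof -
      have "y\<^sup>2 / (4 * \<sigma> * t) = (y\<^sup>2 / (4 * t)) / \<sigma>" by simp
      then have "ext_kernel \<sigma> y t - ext_kernel (\<sigma> + 1) y t = ext_kernel \<sigma> y t * (1 - (y\<^sup>2 / (4 * t)) / \<sigma>)"
        unfolding ext_kernel_plus1[OF \<sigma>(1) y t] by (simp only: right_diff_distrib mult_1_right)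
      also have "\<dots> = y powr (2 * \<sigma>) * (exp (- (y\<^sup>2 / (4 * t))) * (1 - (y\<^sup>2 / (4 * t)) / \<sigma>) / t powr (1 + \<sigma>) / (4 powr \<sigma> * Gamma \<sigma>))"
        by (simp add: ext_kernel_def mult_ac)
      finally show ?thesis .
    qed
    ultimately have "(y powr (1 - 2 * \<sigma>) * (2 * \<sigma> / y)) * (ext_kernel \<sigma> y t - ext_kernel (\<sigma> + 1) y t) =
       (2 * \<sigma>) * (?k t / (4 powr \<sigma> * Gamma \<sigma>))"
      by (simp only: mult.assoc[symmetric]) (simp add: mult.assoc)
    then show ?thesis by simp
  qed
  have "U \<sigma> y (B x) - U (\<sigma> + 1) y (B x) = hl_integral (\<lambda>t. (ext_kernel \<sigma> y t - ext_kernel (\<sigma> + 1) y t) *\<^sub>R (T t (B x) - B x))"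
  proof -
    have s: "\<sigma> + 1 > 0" using \<sigma> by simp
    have 0: "hl_has_integral (\<lambda>t. (ext_kernel \<sigma> y t *\<^sub>R T t (B x) - ext_kernel (\<sigma> + 1) y t *\<^sub>R T t (B x)) - (ext_kernel \<sigma> y t *\<^sub>R B x - ext_kernel (\<sigma> + 1) y t *\<^sub>R B x))
       ((U \<sigma> y (B x) - U (\<sigma> + 1) y (B x)) - (1 *\<^sub>R B x - 1 *\<^sub>R B x))"
      unfolding U_def
      by (rule hl_has_integral_diff[OF hl_has_integral_diff[OF hl_absint_exists(1)[OF U_absint[OF \<sigma>(1) y]] hl_absint_exists(1)[OF U_absint[OF s y]]]
          hl_has_integral_diff[OF hl_has_integral_scaleR_left[OF ext_kernel_has_integral[OF \<sigma>(1) y]] hl_has_integral_scaleR_left[OF ext_kernel_has_integral[OF s y]]]])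
    have "(\<lambda>t. (ext_kernel \<sigma> y t *\<^sub>R T t (B x) - ext_kernel (\<sigma> + 1) y t *\<^sub>R T t (B x)) - (ext_kernel \<sigma> y t *\<^sub>R B x - ext_kernel (\<sigma> + 1) y t *\<^sub>R B x))
       = (\<lambda>t. (ext_kernel \<sigma> y t - ext_kernel (\<sigma> + 1) y t) *\<^sub>R (T t (B x) - B x))"
      by (rule ext) (simp add: algebra_simps)
    with hl_integral_eq[OF 0] show ?thesis by simp
  qed
  then have "QU \<sigma> y (B x) = (y powr (1 - 2 * \<sigma>) * (2 * \<sigma> / y)) *\<^sub>R hl_integral (\<lambda>t. (ext_kernel \<sigma> y t - ext_kernel (\<sigma> + 1) y t) *\<^sub>R (T t (B x) - B x))"
    by (simp only: QU_def DU_def scaleR_scaleR)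
  also have "\<dots> = hl_integral (\<lambda>t. (y powr (1 - 2 * \<sigma>) * (2 * \<sigma> / y)) *\<^sub>R ((ext_kernel \<sigma> y t - ext_kernel (\<sigma> + 1) y t) *\<^sub>R (T t (B x) - B x)))"
  proof (rule hl_integral_scaleR[symmetric])
    have e: "(ext_kernel \<sigma> y t - ext_kernel (\<sigma> + 1) y t) *\<^sub>R (T t (B x) - B x) =
        (1 / (y powr (1 - 2 * \<sigma>) * (2 * \<sigma> / y)) * ?c) *\<^sub>R (?k t *\<^sub>R (B x - T t (B x)))" if "t > 0" for t
    proof -
      have "y powr (1 - 2 * \<sigma>) * (2 * \<sigma> / y) \<noteq> 0" using \<sigma> y by simp
      moreover have "d = 1 / \<kappa> * e" if "\<kappa> * d = e" "\<kappa> \<noteq> 0" for \<kappa> d e :: real using that by auto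
      ultimately have "ext_kernel \<sigma> y t - ext_kernel (\<sigma> + 1) y t = 1 / (y powr (1 - 2 * \<sigma>) * (2 * \<sigma> / y)) * (- ?c * ?k t)"
        using k[OF that] by blast
      then have "(ext_kernel \<sigma> y t - ext_kernel (\<sigma> + 1) y t) *\<^sub>R (T t (B x) - B x) = (1 / (y powr (1 - 2 * \<sigma>) * (2 * \<sigma> / y)) * (- ?c * ?k t)) *\<^sub>R (T t (B x) - B x)"
        by (simp only:)
      also have "\<dots> = (1 / (y powr (1 - 2 * \<sigma>) * (2 * \<sigma> / y)) * ?c * ?k t) *\<^sub>R (B x - T t (B x))"
        by (simp add: algebra_simps)
      finally show ?thesis by (simp only: scaleR_scaleR)
    qed
    have "hl_absint (\<lambda>t. (ext_kernel \<sigma> y t - ext_kernel (\<sigma> + 1) y t) *\<^sub>R (T t (B x) - B x)) \<longleftrightarrow>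
       hl_absint (\<lambda>t. (1 / (y powr (1 - 2 * \<sigma>) * (2 * \<sigma> / y)) * ?c) *\<^sub>R (?k t *\<^sub>R (B x - T t (B x))))"
      by (rule hl_absint_cong) (rule e)
    then show "hl_absint (\<lambda>t. (ext_kernel \<sigma> y t - ext_kernel (\<sigma> + 1) y t) *\<^sub>R (T t (B x) - B x))"
      using hl_absint_scaleR[OF ai] by blast
  qed
  also have "\<dots> = hl_integral (\<lambda>t. ?c *\<^sub>R (?k t *\<^sub>R (B x - T t (B x))))"
  proof (rule hl_integral_cong)
    fix t :: real assume t: "t > 0"
    have "(y powr (1 - 2 * \<sigma>) * (2 * \<sigma> / y)) *\<^sub>R ((ext_kernel \<sigma> y t - ext_kernel (\<sigma> + 1) y t) *\<^sub>R (T t (B x) - B x)) = (- ?c * ?k t) *\<^sub>R (T t (B x) - B x)"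
      by (simp only: scaleR_scaleR k[OF t])
    also have "\<dots> = ?c *\<^sub>R (?k t *\<^sub>R (B x - T t (B x)))"
      by (simp only: scaleR_scaleR[symmetric] scaleR_minus_left) (simp add: scaleR_diff_right)
    finally show "(y powr (1 - 2 * \<sigma>) * (2 * \<sigma> / y)) *\<^sub>R ((ext_kernel \<sigma> y t - ext_kernel (\<sigma> + 1) y t) *\<^sub>R (T t (B x) - B x)) = ?c *\<^sub>R (?k t *\<^sub>R (B x - T t (B x)))" .
  qed
  also have "\<dots> = ?c *\<^sub>R hl_integral (\<lambda>t. ?k t *\<^sub>R (B x - T t (B x)))"
    by (rule hl_integral_scaleR[OF ai])
  finally show ?thesis .
qed

lemma QU_bounded:
  assumes \<sigma>: "0 < \<sigma>" "\<sigma> < 1"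
  shows "\<exists>K>0. \<forall>y>0. \<forall>x. norm (QU \<sigma> y (B x)) \<le> K * norm x"
proof -
  have \<sigma>1: "0 < 1 - \<sigma>" "1 - \<sigma> < 1" using \<sigma> by auto
  from kernel_bal_bound[OF \<sigma>1] obtain K where K: "K > 0" "\<forall>k C x. continuous_on {0<..} k \<longrightarrow> (\<forall>t>0. \<bar>k t\<bar> \<le> C * t powr (1 - \<sigma> - 2)) \<longrightarrow>
    norm (hl_integral (\<lambda>t. k t *\<^sub>R (B x - T t (B x)))) \<le> C * K * norm x" by blast
  let ?c = "2 * \<sigma> / (4 powr \<sigma> * Gamma \<sigma>)"
  have c: "?c > 0" using \<sigma> Gamma_real_pos[of \<sigma>] by simp
  have "norm (QU \<sigma> y (B x)) \<le> (?c * ((1 + 1 / \<sigma>) * K)) * norm x" if y: "y > 0" for y x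
  proof -
    let ?k = "\<lambda>t. exp (- (y\<^sup>2 / (4 * t))) * (1 - (y\<^sup>2 / (4 * t)) / \<sigma>) * t powr (1 - \<sigma> - 2)"
    have "norm (hl_integral (\<lambda>t. ?k t *\<^sub>R (B x - T t (B x)))) \<le> (1 + 1 / \<sigma>) * K * norm x"
      using K(2) z_exp_kernel[OF \<sigma>(1)] by blast
    from mult_left_mono[OF this, of ?c] c
    have "?c * norm (hl_integral (\<lambda>t. ?k t *\<^sub>R (B x - T t (B x)))) \<le> ?c * ((1 + 1 / \<sigma>) * K * norm x)" by simp
    moreover have "norm (QU \<sigma> y (B x)) = ?c * norm (hl_integral (\<lambda>t. ?k t *\<^sub>R (B x - T t (B x))))"
      unfolding QU_kernel[OF \<sigma> y] norm_scaleR using \<sigma> Gamma_real_pos[of \<sigma>] by (simp add: abs_mult)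
    ultimately show ?thesis by (simp only: mult.assoc)
  qed
  moreover have "?c * ((1 + 1 / \<sigma>) * K) > 0" using c K \<sigma> by (intro mult_pos_pos add_pos_pos) auto
  ultimately show ?thesis by blast
qed

text \<open>Dominated convergence in \<open>QU_kernel\<close>: as \<open>y\<close> tends to 0 the
  profile tends to 1 and the kernel of \<open>bal (1 - \<sigma>)\<close> is left.\<close>

lemma QU_tendsto:
  assumes \<sigma>: "0 < \<sigma>" "\<sigma> < 1"
  shows "((\<lambda>y. QU \<sigma> y (B x)) \<longlongrightarrow> neumann_const \<sigma> *\<^sub>R bal (1 - \<sigma>) x) (at_right 0)"
proof -
  have \<sigma>1: "0 < 1 - \<sigma>" "1 - \<sigma> < 1" using \<sigma> by auto
  let ?c = "- 2 * \<sigma> / (4 powr \<sigma> * Gamma \<sigma>)"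
  let ?k = "\<lambda>y t. exp (- (y\<^sup>2 / (4 * t))) * (1 - (y\<^sup>2 / (4 * t)) / \<sigma>) * t powr (1 - \<sigma> - 2)"
  note kc = z_exp_kernel(1)[OF \<sigma>(1)] and kb = z_exp_kernel(2)[OF \<sigma>(1)]
  obtain g where g: "set_integrable lborel {0<..} g" "\<forall>t>0. (1 + 1 / \<sigma>) * t powr (1 - \<sigma> - 2) * norm (B x - T t (B x)) \<le> g t"
    using bal_absint(2)[OF \<sigma>1 kc[of 1] kb[of _ 1], of x] by blast
  have "((\<lambda>y. hl_integral (\<lambda>t. ?k y t *\<^sub>R (B x - T t (B x)))) \<longlongrightarrow> hl_integral (\<lambda>t. t powr (1 - \<sigma> - 2) *\<^sub>R (B x - T t (B x)))) (at_right 0)"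
  proof (rule hl_integral_tendsto[OF _ _ g(1)])
    have "norm (?k y t *\<^sub>R (B x - T t (B x))) \<le> g t" if "t > 0" for y t
      using mult_right_mono[OF kb[OF that, of y] norm_ge_zero[of "B x - T t (B x)"]] g(2)[rule_format, OF that] by simp
    moreover have "continuous_on {0<..} (\<lambda>t. ?k y t *\<^sub>R (B x - T t (B x)))" for y by (rule bal_cont[OF kc])
    ultimately show "\<forall>\<^sub>F y in at_right 0. continuous_on {0<..} (\<lambda>t. ?k y t *\<^sub>R (B x - T t (B x))) \<and> (\<forall>t>0. norm (?k y t *\<^sub>R (B x - T t (B x))) \<le> g t)"
      by (intro always_eventually) blast
    show "continuous_on {0<..} (\<lambda>t. t powr (1 - \<sigma> - 2) *\<^sub>R (B x - T t (B x)))"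
      by (intro bal_cont continuous_intros) auto
    fix t :: real assume t: "t > 0"
    have "((\<lambda>y. ?k y t) \<longlongrightarrow> exp (- (0\<^sup>2 / (4 * t))) * (1 - (0\<^sup>2 / (4 * t)) / \<sigma>) * t powr (1 - \<sigma> - 2)) (at_right 0)"
      using t \<sigma> by (intro tendsto_intros) auto
    then have "((\<lambda>y. ?k y t) \<longlongrightarrow> t powr (1 - \<sigma> - 2)) (at_right 0)" by simp
    then show "((\<lambda>y. ?k y t *\<^sub>R (B x - T t (B x))) \<longlongrightarrow> t powr (1 - \<sigma> - 2) *\<^sub>R (B x - T t (B x))) (at_right 0)"
      by (rule tendsto_scaleR[OF _ tendsto_const])
  qed
  from tendsto_scaleR[OF tendsto_const[of ?c] this]
  have "((\<lambda>y. ?c *\<^sub>R hl_integral (\<lambda>t. ?k y t *\<^sub>R (B x - T t (B x)))) \<longlongrightarrow> ?c *\<^sub>R hl_integral (\<lambda>t. t powr (1 - \<sigma> - 2) *\<^sub>R (B x - T t (B x)))) (at_right 0)" .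
  moreover have "\<forall>\<^sub>F y in at_right 0. ?c *\<^sub>R hl_integral (\<lambda>t. ?k y t *\<^sub>R (B x - T t (B x))) = QU \<sigma> y (B x)"
    using QU_kernel[OF \<sigma>, of _ x] by (simp add: eventually_at_filter)
  ultimately have "((\<lambda>y. QU \<sigma> y (B x)) \<longlongrightarrow> ?c *\<^sub>R hl_integral (\<lambda>t. t powr (1 - \<sigma> - 2) *\<^sub>R (B x - T t (B x)))) (at_right 0)"
    by (rule Lim_transform_eventually)
  moreover have "neumann_const \<sigma> *\<^sub>R bal (1 - \<sigma>) x = ?c *\<^sub>R hl_integral (\<lambda>t. t powr (1 - \<sigma> - 2) *\<^sub>R (B x - T t (B x)))"
  proof -
    have "Gamma (1 - \<sigma>) > 0" by (rule Gamma_real_pos[OF \<sigma>1(1)])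
    then have "neumann_const \<sigma> * ((1 - (1 - \<sigma>)) / Gamma (1 - \<sigma>)) = ?c" by (simp add: neumann_const_def)
    then show ?thesis by (simp only: bal_def scaleR_scaleR)
  qed
  ultimately show ?thesis by simp
qed

section \<open>The Wronskian identity and the factorization of B\<close>

text \<open>The operators \<open>K z\<close> are differentiable in \<open>z\<close> only on fixed
  vectors. Their uniform bound near \<open>y\<close> is what lets the difference quotient of
  \<open>v\<close> pass through the moving \<open>K z\<close>.\<close>

lemma strong_product_rule:
  fixes K :: "real \<Rightarrow> 'a \<Rightarrow> 'a"
  assumes add: "\<And>z x w. z > 0 \<Longrightarrow> K z (x - w) = K z x - K z w" and sc: "\<And>z c x. z > 0 \<Longrightarrow> K z (c *\<^sub>R x) = c *\<^sub>R K z x"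
    and bd: "\<And>z x. z > y / 2 \<Longrightarrow> norm (K z x) \<le> C * norm x" and y: "y > 0"
    and K: "((\<lambda>z. K z (v y)) has_vector_derivative d) (at y)" and Kc: "((\<lambda>z. K z v') \<longlongrightarrow> K y v') (at y)"
    and v: "(v has_vector_derivative v') (at y)"
  shows "((\<lambda>z. K z (v z)) has_vector_derivative (K y v' + d)) (at y)"
  unfolding has_vector_derivative_iff_quotient
proof -
  have ev: "eventually (\<lambda>z. z > y / 2) (at y)"
    by (rule order_tendstoD(1)[OF tendsto_ident_at]) (use y in simp)
  have "((\<lambda>z. C * norm ((v z - v y) /\<^sub>R (z - y) - v')) \<longlongrightarrow> C * norm (v' - v')) (at y)"
    using v unfolding has_vector_derivative_iff_quotient by (intro tendsto_intros)
  then have c0: "((\<lambda>z. C * norm ((v z - v y) /\<^sub>R (z - y) - v')) \<longlongrightarrow> 0) (at y)" by simp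
  have "((\<lambda>z. K z ((v z - v y) /\<^sub>R (z - y) - v')) \<longlongrightarrow> 0) (at y)"
    by (rule Lim_null_comparison[OF _ c0]) (use ev bd in \<open>auto elim!: eventually_mono\<close>)
  from tendsto_add[OF tendsto_add[OF this Kc] K[unfolded has_vector_derivative_iff_quotient]]
  have "((\<lambda>z. K z ((v z - v y) /\<^sub>R (z - y) - v') + K z v' + (K z (v y) - K y (v y)) /\<^sub>R (z - y)) \<longlongrightarrow> K y v' + d) (at y)" by simp
  moreover have "\<forall>\<^sub>F z in at y. K z ((v z - v y) /\<^sub>R (z - y) - v') + K z v' + (K z (v y) - K y (v y)) /\<^sub>R (z - y)
      = (K z (v z) - K y (v y)) /\<^sub>R (z - y)"
    using ev
  proof eventually_elim
    case (elim z)
    then have z: "z > 0" using y by linarith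
    have "K z ((v z - v y) /\<^sub>R (z - y) - v') = (K z (v z) - K z (v y)) /\<^sub>R (z - y) - K z v'"
      by (simp only: add[OF z] sc[OF z])
    then show ?case by (simp add: scaleR_diff_right)
  qed
  ultimately show "((\<lambda>z. (K z (v z) - K y (v y)) /\<^sub>R (z - y)) \<longlongrightarrow> K y v' + d) (at y)"
    by (rule Lim_transform_eventually)
qed

text \<open>A Wronskian identity: \<open>U\<^sub>p' U\<^sub>q' - A U\<^sub>p U\<^sub>q\<close> with \<open>p + q = 1\<close> and \<open>A = - L\<close> is constant in \<open>y\<close> and
  tends to \<open>0\<close> at infinity.\<close>

lemma DU_DU:
  assumes \<sigma>: "0 < \<sigma>" "\<sigma> < 1" and y: "y > 0"
  shows "DU (1 - \<sigma>) y (DU \<sigma> y (B x)) = U (1 - \<sigma>) y (U \<sigma> y x)"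
proof -
  define p where "p = 1 - \<sigma>"
  have p: "p > 0" using \<sigma> by (simp add: p_def)
  let ?w = "\<lambda>y. DU p y (DU \<sigma> y (B (B x))) - U p y (U \<sigma> y (B x))"
  have Ucont: "((\<lambda>z. U r z v) \<longlongrightarrow> U r y v) (at y)" if "r > 0" "y > 0" for r y v
    using has_vector_derivative_continuous[OF U_has_deriv[OF that, of v]] by (simp add: isCont_def continuous_at)
  have dw: "(?w has_vector_derivative 0) (at y)" if y: "y > 0" for y
  proof -
    define x1 where "x1 = B x"
    have 1: "((\<lambda>z. DU p z (DU \<sigma> z (B x1))) has_vector_derivative
        (DU p y (U \<sigma> y x1 - ((1 - 2 * \<sigma>) / y) *\<^sub>R DU \<sigma> y (B x1)) + (U p y (DU \<sigma> y x1) - ((1 - 2 * p) / y) *\<^sub>R DU p y (B (DU \<sigma> y x1))))) (at y)"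
    proof (rule strong_product_rule[where K="DU p" and v="\<lambda>z. DU \<sigma> z (B x1)" and C="4 * p * M / (y / 2)"])
      show "DU p z (v - w) = DU p z v - DU p z w" "DU p z (c *\<^sub>R v) = c *\<^sub>R DU p z v" if "z > 0" for z v w c
        using p that by (simp_all add: DU_diff DU_scaleR)
      show "norm (DU p z v) \<le> 4 * p * M / (y / 2) * norm v" if "z > y / 2" for z v
      proof -
        have z: "z > 0" "y / 2 \<le> z" using that y by linarith+
        have "norm (DU p z v) \<le> (4 * p * M / z) * norm v" by (rule DU_norm[OF p z(1)])
        also have "\<dots> \<le> 4 * p * M / (y / 2) * norm v"
          using z y p M(1) by (intro mult_right_mono divide_left_mono mult_pos_pos mult_nonneg_nonneg) simp_all
        finally show ?thesis .
      qed
      show "((\<lambda>z. DU p z (DU \<sigma> y (B x1))) has_vector_derivative U p y (DU \<sigma> y x1) - ((1 - 2 * p) / y) *\<^sub>R DU p y (B (DU \<sigma> y x1))) (at y)"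
        unfolding DU_B[OF \<sigma>(1) y] by (rule DU_has_deriv[OF p y])
      show "((\<lambda>z. DU p z (U \<sigma> y x1 - ((1 - 2 * \<sigma>) / y) *\<^sub>R DU \<sigma> y (B x1))) \<longlongrightarrow> DU p y (U \<sigma> y x1 - ((1 - 2 * \<sigma>) / y) *\<^sub>R DU \<sigma> y (B x1))) (at y)"
        unfolding DU_def using p y by (intro tendsto_intros Ucont) auto
      show "((\<lambda>y. DU \<sigma> y (B x1)) has_vector_derivative U \<sigma> y x1 - ((1 - 2 * \<sigma>) / y) *\<^sub>R DU \<sigma> y (B x1)) (at y)"
        by (rule DU_has_deriv[OF \<sigma>(1) y])
    qed (use y in simp)
    have 2: "((\<lambda>z. U p z (U \<sigma> z x1)) has_vector_derivative (U p y (DU \<sigma> y x1) + DU p y (U \<sigma> y x1))) (at y)"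
    proof (rule strong_product_rule[where K="U p" and v="\<lambda>z. U \<sigma> z x1" and C=M])
      show "U p z (v - w) = U p z v - U p z w" "U p z (c *\<^sub>R v) = c *\<^sub>R U p z v" if "z > 0" for z v w c
        using p that by (simp_all add: U_diff U_scaleR)
      show "norm (U p z v) \<le> M * norm v" if "z > y / 2" for z v
      proof -
        have "z > 0" using that y by linarith
        then show ?thesis by (rule U_norm[OF p])
      qed
      show "((\<lambda>z. U p z (U \<sigma> y x1)) has_vector_derivative DU p y (U \<sigma> y x1)) (at y)"
        by (rule U_has_deriv[OF p y])
      show "((\<lambda>z. U p z (DU \<sigma> y x1)) \<longlongrightarrow> U p y (DU \<sigma> y x1)) (at y)" by (rule Ucont[OF p y])
      show "((\<lambda>y. U \<sigma> y x1) has_vector_derivative DU \<sigma> y x1) (at y)" by (rule U_has_deriv[OF \<sigma>(1) y])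
    qed (use y in simp)
    \<comment> \<open>Because \<open>p + \<sigma> = 1\<close>, the first order coefficients of the
      two equations are opposite, and the mixed terms cancel.\<close>
    have "(1 - 2 * p) / y = - ((1 - 2 * \<sigma>) / y)" using y by (simp add: p_def field_simps)
    then have "(DU p y (U \<sigma> y x1 - ((1 - 2 * \<sigma>) / y) *\<^sub>R DU \<sigma> y (B x1)) + (U p y (DU \<sigma> y x1) - ((1 - 2 * p) / y) *\<^sub>R DU p y (B (DU \<sigma> y x1)))) -
        (U p y (DU \<sigma> y x1) + DU p y (U \<sigma> y x1)) = 0"
      using p y \<sigma> by (simp add: DU_diff DU_scaleR DU_B)
    with has_vector_derivative_diff[OF 1 2] show ?thesis by (simp add: x1_def)
  qed
  obtain K where K: "K > 0" "\<And>x. norm (B x) \<le> norm x * K"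
    using bounded_linear.pos_bounded[OF B_linear] by blast
  define E where "E = (4 * p * M) * ((4 * \<sigma> * M) * norm (B (B x))) + (4 * p * (p + 1)) * ((2 * M) * (M * norm x * K * K))"
  \<comment> \<open>Each \<open>DU\<close> contributes a factor \<open>1 / z\<close>, and
    \<open>U_eq_B\<close> gives \<open>U p\<close> the factor \<open>1 / z\<^sup>2\<close>; so both
    terms decay at the same rate.\<close>
  have bw: "norm (?w z) \<le> E / z\<^sup>2" if z: "z > 0" for z
  proof -
    have "norm (DU p z (DU \<sigma> z (B (B x)))) \<le> (4 * p * M / z) * ((4 * \<sigma> * M / z) * norm (B (B x)))"
      using p \<sigma> z M(1) by (intro order_trans[OF DU_norm[OF p z]] mult_left_mono DU_norm) auto
    also have "\<dots> = (4 * p * M) * ((4 * \<sigma> * M) * norm (B (B x))) / z\<^sup>2" by (simp add: power2_eq_square)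
    finally have 1: "norm (DU p z (DU \<sigma> z (B (B x)))) \<le> (4 * p * M) * ((4 * \<sigma> * M) * norm (B (B x))) / z\<^sup>2" .
    define v where "v = U \<sigma> z x"
    have "U p z (B v) = B (U p z v)" using p z by (rule U_B)
    also have "U p z v = B (- (4 * p * (p + 1) / z\<^sup>2) *\<^sub>R (U (p + 1) z v - U (p + 2) z v))" by (rule U_eq_B[OF p z])
    finally have UB: "U p z (B v) = B (B (- (4 * p * (p + 1) / z\<^sup>2) *\<^sub>R (U (p + 1) z v - U (p + 2) z v)))" .
    have "norm (U p z (B v)) \<le> (norm (- (4 * p * (p + 1) / z\<^sup>2) *\<^sub>R (U (p + 1) z v - U (p + 2) z v)) * K) * K"
      unfolding UB by (rule order_trans[OF K(2) mult_right_mono[OF K(2) less_imp_le[OF K(1)]]])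
    also have "norm (- (4 * p * (p + 1) / z\<^sup>2) *\<^sub>R (U (p + 1) z v - U (p + 2) z v)) = (4 * p * (p + 1) / z\<^sup>2) * norm (U (p + 1) z v - U (p + 2) z v)"
      using p by simp
    also have "\<dots> \<le> (4 * p * (p + 1) / z\<^sup>2) * (2 * M * norm v)"
    proof (rule mult_left_mono)
      show "norm (U (p + 1) z v - U (p + 2) z v) \<le> 2 * M * norm v"
        using norm_triangle_ineq4[of "U (p + 1) z v" "U (p + 2) z v"] U_norm[of "p + 1" z v] U_norm[of "p + 2" z v] p z by simp
    qed (use p in simp)
    also have "\<dots> \<le> (4 * p * (p + 1) / z\<^sup>2) * (2 * M * (M * norm x))"
      unfolding v_def using p \<sigma> z M(1) by (intro mult_left_mono U_norm) auto
    finally have 2: "norm (U p z (B v)) \<le> (4 * p * (p + 1) / z\<^sup>2) * (2 * M * (M * norm x)) * K * K"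
      using K(1) by (simp add: mult_right_mono)
    have "U p z (U \<sigma> z (B x)) = U p z (B v)" unfolding v_def using \<sigma> z by (simp add: U_B)
    then have "norm (?w z) \<le> (4 * p * M) * ((4 * \<sigma> * M) * norm (B (B x))) / z\<^sup>2 + (4 * p * (p + 1) / z\<^sup>2) * (2 * M * (M * norm x)) * K * K"
      using norm_triangle_ineq4[of "DU p z (DU \<sigma> z (B (B x)))" "U p z (U \<sigma> z (B x))"] 1 2 by simp
    also have "\<dots> = E / z\<^sup>2" by (simp add: E_def add_divide_distrib mult_ac)
    finally show ?thesis .
  qed
  have "(?w \<longlongrightarrow> 0) at_top"
  proof (rule Lim_null_comparison)
    show "\<forall>\<^sub>F z in at_top. norm (?w z) \<le> E / z\<^sup>2"
      using eventually_gt_at_top[of 0] by eventually_elim (rule bw)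
    show "((\<lambda>z. E / z\<^sup>2) \<longlongrightarrow> 0) at_top" by real_asymp
  qed
  moreover have "(?w \<longlongrightarrow> ?w y) at_top"
    using eventually_gt_at_top[of 0]
    by (intro tendsto_eventually, eventually_elim) (rule constant_on_pos[of ?w, OF dw _ y])
  ultimately have "?w y = 0" using tendsto_unique trivial_limit_at_top_linorder by blast
  then have "B (DU p y (DU \<sigma> y (B x))) = B (U p y (U \<sigma> y x))"
    using \<sigma> p y by (simp add: U_B DU_B)
  from B_inj[OF this] show ?thesis by (simp add: p_def)
qed

text \<open>Multiply \<open>DU_DU\<close> by the weights of \<open>\<sigma>\<close> and
  \<open>1 - \<sigma>\<close>, whose product is 1, apply \<open>B\<close> and let \<open>y\<close>
  tend to 0. One side becomes the composition of the two boundary limits, the other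
  \<open>B x\<close>. This is the only instance of the law of exponents that the proof
  needs.\<close>

lemma bal_bal:
  assumes \<sigma>: "0 < \<sigma>" "\<sigma> < 1"
  shows "bal \<sigma> (bal (1 - \<sigma>) x) = B x"
proof -
  have \<sigma>1: "0 < 1 - \<sigma>" "1 - \<sigma> < 1" using \<sigma> by auto
  obtain K where K: "K > 0" "\<forall>y>0. \<forall>x. norm (QU (1 - \<sigma>) y (B x)) \<le> K * norm x"
    using QU_bounded[OF \<sigma>1] by blast
  let ?h = "neumann_const \<sigma> *\<^sub>R bal (1 - \<sigma>) x"
  have pos: "eventually (\<lambda>y::real. y > 0) (at_right 0)" by (simp add: eventually_at_filter)
  have "((\<lambda>y. K * norm (QU \<sigma> y (B x) - ?h)) \<longlongrightarrow> K * norm (?h - ?h)) (at_right 0)"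
    by (intro tendsto_intros QU_tendsto[OF \<sigma>])
  then have n0: "((\<lambda>y. K * norm (QU \<sigma> y (B x) - ?h)) \<longlongrightarrow> 0) (at_right 0)" by simp
  \<comment> \<open>The argument \<open>QU \<sigma> y (B x)\<close> moves with \<open>y\<close>; the
    bound of \<open>QU (1 - \<sigma>)\<close>, uniform in \<open>y\<close>, allows its replacement
    by its limit \<open>?h\<close>.\<close>
  have "((\<lambda>y. QU (1 - \<sigma>) y (B (QU \<sigma> y (B x) - ?h))) \<longlongrightarrow> 0) (at_right 0)"
    by (rule Lim_null_comparison[OF _ n0]) (use pos K in \<open>auto elim!: eventually_mono\<close>)
  from tendsto_add[OF this QU_tendsto[OF \<sigma>1, of ?h]]
  have 1: "((\<lambda>y. QU (1 - \<sigma>) y (B (QU \<sigma> y (B x) - ?h)) + QU (1 - \<sigma>) y (B ?h)) \<longlongrightarrow> neumann_const (1 - \<sigma>) *\<^sub>R bal \<sigma> ?h) (at_right 0)" by simp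
  have 2: "((\<lambda>y. B (U (1 - \<sigma>) y (U \<sigma> y x))) \<longlongrightarrow> neumann_const (1 - \<sigma>) *\<^sub>R bal \<sigma> ?h) (at_right 0)"
  proof (rule Lim_transform_eventually[OF 1])
    show "\<forall>\<^sub>F y in at_right 0. QU (1 - \<sigma>) y (B (QU \<sigma> y (B x) - ?h)) + QU (1 - \<sigma>) y (B ?h) = B (U (1 - \<sigma>) y (U \<sigma> y x))"
      using pos
    proof eventually_elim
      case (elim y)
      have "QU (1 - \<sigma>) y (B (QU \<sigma> y (B x) - ?h)) + QU (1 - \<sigma>) y (B ?h) = QU (1 - \<sigma>) y (B (QU \<sigma> y (B x)))"
        using elim \<sigma>1 by (simp add: QU_def B_simps DU_diff scaleR_diff_right)
      also have "\<dots> = (y powr (1 - 2 * (1 - \<sigma>)) * y powr (1 - 2 * \<sigma>)) *\<^sub>R DU (1 - \<sigma>) y (B (DU \<sigma> y (B x)))"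
        using elim \<sigma>1 by (simp add: QU_def B_simps DU_scaleR)
      also have "y powr (1 - 2 * (1 - \<sigma>)) * y powr (1 - 2 * \<sigma>) = 1"
        using elim by (simp add: powr_add[symmetric])
      also have "DU (1 - \<sigma>) y (B (DU \<sigma> y (B x))) = B (U (1 - \<sigma>) y (U \<sigma> y x))"
        using elim \<sigma>1 \<sigma> by (simp add: DU_B DU_DU[OF \<sigma> elim, symmetric])
      finally show ?case by simp
    qed
  qed
  have "((\<lambda>y. U (1 - \<sigma>) y (U \<sigma> y x)) \<longlongrightarrow> x) (at_right 0)"
  proof -
    have "((\<lambda>y. M * norm (U \<sigma> y x - x)) \<longlongrightarrow> M * norm (x - x)) (at_right 0)"
      by (intro tendsto_intros U_tendsto[OF \<sigma>(1)])
    then have n0: "((\<lambda>y. M * norm (U \<sigma> y x - x)) \<longlongrightarrow> 0) (at_right 0)" by simp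
    have "((\<lambda>y. U (1 - \<sigma>) y (U \<sigma> y x - x)) \<longlongrightarrow> 0) (at_right 0)"
      by (rule Lim_null_comparison[OF _ n0]) (use pos U_norm \<sigma>1 in \<open>auto elim!: eventually_mono\<close>)
    from tendsto_add[OF this U_tendsto[OF \<sigma>1(1), of x]]
    have "((\<lambda>y. U (1 - \<sigma>) y (U \<sigma> y x - x) + U (1 - \<sigma>) y x) \<longlongrightarrow> x) (at_right 0)" by simp
    then show ?thesis
      by (rule Lim_transform_eventually) (use pos \<sigma>1 in \<open>auto elim!: eventually_mono simp: U_diff\<close>)
  qed
  from bounded_linear.tendsto[OF B_linear this]
  have "((\<lambda>y. B (U (1 - \<sigma>) y (U \<sigma> y x))) \<longlongrightarrow> B x) (at_right 0)" .
  with 2 have "neumann_const (1 - \<sigma>) *\<^sub>R bal \<sigma> ?h = B x"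
    using tendsto_unique trivial_limit_at_right_real by blast
  moreover have "bal \<sigma> ?h = neumann_const \<sigma> *\<^sub>R bal \<sigma> (bal (1 - \<sigma>) x)"
    by (rule linear_scale[OF bounded_linear.linear[OF bal_linear[OF \<sigma>]]])
  ultimately show ?thesis using neumann_const_prod[OF \<sigma>] by (simp add: mult.commute)
qed

text \<open>The weighted derivative of a solution with parameter \<open>\<sigma>\<close> solves the
  conjugate equation with parameter \<open>1 - \<sigma>\<close>, as does
  \<open>U (1 - \<sigma>)\<close>. By \<open>bal_bal\<close> the initial data agree, so uniqueness
  turns a statement about limits at 0 into an identity for every \<open>y\<close>.\<close>

lemma QU_bal:
  assumes \<sigma>: "0 < \<sigma>" "\<sigma> < 1" and y: "y > 0"
  shows "QU \<sigma> y (bal \<sigma> x) = neumann_const \<sigma> *\<^sub>R U (1 - \<sigma>) y x"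
proof -
  have \<sigma>1: "0 < 1 - \<sigma>" "1 - \<sigma> < 1" using \<sigma> by auto
  define w c where "w = bal \<sigma> x" and "c = neumann_const \<sigma>"
  \<comment> \<open>The difference of the two sides with one \<open>B\<close> applied, which places
    it in \<open>D\<close>; injectivity of \<open>B\<close> removes it at the end.\<close>
  let ?W = "\<lambda>y. QU \<sigma> y (B w) - c *\<^sub>R U (1 - \<sigma>) y (B x)"
  let ?W' = "\<lambda>y. y powr (1 - 2 * \<sigma>) *\<^sub>R U \<sigma> y w - c *\<^sub>R DU (1 - \<sigma>) y (B x)"
  let ?W'' = "\<lambda>y. (y powr (1 - 2 * \<sigma>) *\<^sub>R DU \<sigma> y w + ((1 - 2 * \<sigma>) / y * y powr (1 - 2 * \<sigma>)) *\<^sub>R U \<sigma> y w)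
     - c *\<^sub>R (U (1 - \<sigma>) y x - ((1 - 2 * (1 - \<sigma>)) / y) *\<^sub>R DU (1 - \<sigma>) y (B x))"
  have dp: "((\<lambda>y. y powr (1 - 2 * \<sigma>)) has_real_derivative (1 - 2 * \<sigma>) / y * y powr (1 - 2 * \<sigma>)) (at y)" if "y > 0" for y :: real
    using that by (intro DERIV_cong[OF has_real_derivative_powr]) (simp_all only: powr_diff[of y "1 - 2 * \<sigma>" 1], simp add: field_simps)
  have pos: "eventually (\<lambda>y::real. y > 0) (at_right 0)" by (simp add: eventually_at_filter)
  have "?W y = 0"
  proof (rule singular_ivp_unique[OF \<sigma>1(1), where W'="?W'" and W''="?W''"])
    fix y :: real assume y: "y > 0"
    have Wy: "?W y = B (QU \<sigma> y w - c *\<^sub>R U (1 - \<sigma>) y x)" using y \<sigma> \<sigma>1 by (simp add: QU_B U_B B_simps)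
    show "?W y \<in> D" unfolding Wy by (rule B_in_D)
    show "(?W has_vector_derivative ?W' y) (at y)"
    proof (intro has_vector_derivative_diff)
      show "((\<lambda>y. c *\<^sub>R U (1 - \<sigma>) y (B x)) has_vector_derivative c *\<^sub>R DU (1 - \<sigma>) y (B x)) (at y)"
        by (rule bounded_linear.has_vector_derivative[OF bounded_linear_scaleR_right U_has_deriv[OF \<sigma>1(1) y]])
      have "((\<lambda>y. QU \<sigma> y (B w)) has_vector_derivative y powr (1 - 2 * \<sigma>) *\<^sub>R (U \<sigma> y w - ((1 - 2 * \<sigma>) / y) *\<^sub>R DU \<sigma> y (B w)) +
          ((1 - 2 * \<sigma>) / y * y powr (1 - 2 * \<sigma>)) *\<^sub>R DU \<sigma> y (B w)) (at y)"
        unfolding QU_def by (rule has_vector_derivative_scaleR[OF dp[OF y] DU_has_deriv[OF \<sigma>(1) y]])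
      then show "((\<lambda>y. QU \<sigma> y (B w)) has_vector_derivative y powr (1 - 2 * \<sigma>) *\<^sub>R U \<sigma> y w) (at y)"
        by (rule has_vector_derivative_eq_rhs) (simp add: scaleR_diff_right mult.commute)
    qed
    show "(?W' has_vector_derivative ?W'' y) (at y)"
      by (intro has_vector_derivative_diff bounded_linear.has_vector_derivative[OF bounded_linear_scaleR_right]
          has_vector_derivative_scaleR[OF dp[OF y] U_has_deriv[OF \<sigma>(1) y]] DU_has_deriv[OF \<sigma>1(1) y])
    have LW: "L (?W y) = - (QU \<sigma> y w - c *\<^sub>R U (1 - \<sigma>) y x)" by (rule L_eqI[OF Wy])
    have s: "(1 - 2 * (1 - \<sigma>)) / y = - ((1 - 2 * \<sigma>) / y)" using y by (simp add: field_simps)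
    show "L (?W y) + ((1 - 2 * (1 - \<sigma>)) / y) *\<^sub>R ?W' y + ?W'' y = 0"
      unfolding LW s unfolding QU_def by (simp add: scaleR_diff_right scaleR_add_right mult.commute)
  next
    have 1: "((\<lambda>y. QU \<sigma> y (B w) - c *\<^sub>R U (1 - \<sigma>) y (B x)) \<longlongrightarrow> c *\<^sub>R bal (1 - \<sigma>) w - c *\<^sub>R B x) (at_right 0)"
      unfolding c_def by (intro tendsto_intros QU_tendsto U_tendsto \<sigma> \<sigma>1)
    have "bal (1 - \<sigma>) w = B x" using bal_bal[OF \<sigma>1, of x] by (simp add: w_def)
    then show "(?W \<longlongrightarrow> 0) (at_right 0)" using 1 by simp
    have "((\<lambda>y. U \<sigma> y w - c *\<^sub>R QU (1 - \<sigma>) y (B x)) \<longlongrightarrow> w - c *\<^sub>R (neumann_const (1 - \<sigma>) *\<^sub>R bal (1 - (1 - \<sigma>)) x)) (at_right 0)"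
      by (intro tendsto_intros QU_tendsto U_tendsto \<sigma> \<sigma>1)
    moreover have "c *\<^sub>R (neumann_const (1 - \<sigma>) *\<^sub>R bal (1 - (1 - \<sigma>)) x) = w"
      using neumann_const_prod[OF \<sigma>] by (simp add: c_def w_def)
    ultimately have 2: "((\<lambda>y. U \<sigma> y w - c *\<^sub>R QU (1 - \<sigma>) y (B x)) \<longlongrightarrow> 0) (at_right 0)" by simp
    have "\<forall>\<^sub>F y in at_right 0. U \<sigma> y w - c *\<^sub>R QU (1 - \<sigma>) y (B x) = y powr (1 - 2 * (1 - \<sigma>)) *\<^sub>R ?W' y"
      using pos
    proof eventually_elim
      case (elim y)
      have "y powr (1 - 2 * (1 - \<sigma>)) * y powr (1 - 2 * \<sigma>) = 1"
        using elim by (simp add: powr_add[symmetric])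
      then have "y powr (1 - 2 * (1 - \<sigma>)) *\<^sub>R (y powr (1 - 2 * \<sigma>) *\<^sub>R U \<sigma> y w) = U \<sigma> y w" by (simp only: scaleR_scaleR scaleR_one)
      then show ?case by (simp only: scaleR_diff_right QU_def scaleR_left_commute)
    qed
    from Lim_transform_eventually[OF 2 this]
    show "((\<lambda>y. y powr (1 - 2 * (1 - \<sigma>)) *\<^sub>R ?W' y) \<longlongrightarrow> 0) (at_right 0)" .
  qed (rule y)
  then have "B (QU \<sigma> y w) = B (c *\<^sub>R U (1 - \<sigma>) y x)" using y \<sigma> \<sigma>1 by (simp add: QU_B U_B B_simps)
  from B_inj[OF this] show ?thesis by (simp add: w_def c_def)
qed

text \<open>\<open>bal (1 - \<sigma>)\<close> after \<open>bal \<sigma>\<close> is the injective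
  \<open>B\<close>.\<close>

lemma bal_inj: assumes \<sigma>: "0 < \<sigma>" "\<sigma> < 1" and "bal \<sigma> x = bal \<sigma> y" shows "x = y"
proof (rule B_inj)
  show "B x = B y" using bal_bal[of "1 - \<sigma>" x] bal_bal[of "1 - \<sigma>" y] assms by simp
qed

end

section \<open>Differentiability classes\<close>

text \<open>Continuous differentiability on the open half-line in recursive form, which suits
  induction better than the sequence of derivatives in \<open>Cn_into\<close>;
  \<open>Cj_iff_seq\<close> connects the two.\<close>

primrec Cj :: "nat \<Rightarrow> (real \<Rightarrow> 'a::banach) \<Rightarrow> bool" where
  "Cj 0 g \<longleftrightarrow> continuous_on {0<..} g"
| "Cj (Suc n) g \<longleftrightarrow> (\<exists>g'. (\<forall>y>0. (g has_vector_derivative g' y) (at y)) \<and> Cj n g')"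

lemma has_vector_derivative_cong_pos:
  assumes "\<And>z. z > 0 \<Longrightarrow> f z = g z" "y > 0"
  shows "(f has_vector_derivative d) (at y) \<longleftrightarrow> (g has_vector_derivative d) (at y)"
proof
  assume "(f has_vector_derivative d) (at y)"
  then show "(g has_vector_derivative d) (at y)"
    by (rule has_vector_derivative_transform_within_open[where S="{0<..}"]) (use assms in auto)
next
  assume "(g has_vector_derivative d) (at y)"
  then show "(f has_vector_derivative d) (at y)"
    by (rule has_vector_derivative_transform_within_open[where S="{0<..}"]) (use assms in auto)
qed

lemma Cj_Suc_imp: "Cj (Suc n) g \<Longrightarrow> Cj n g"
proof (induction n arbitrary: g)
  case 0
  then obtain g' where "\<And>y. y > 0 \<Longrightarrow> (g has_vector_derivative g' y) (at y)" by auto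
  then show ?case
    by (auto intro!: continuous_at_imp_continuous_on has_vector_derivative_continuous)
next
  case (Suc n)
  then obtain g' where g': "\<forall>y>0. (g has_vector_derivative g' y) (at y)" "Cj (Suc n) g'" using Cj.simps(2)[of "Suc n" g] by blast
  from Suc.IH[OF g'(2)] g'(1) show ?case by auto
qed

lemma Cj_mono: "m \<le> n \<Longrightarrow> Cj n g \<Longrightarrow> Cj m g"
  by (induction n rule: dec_induct) (blast dest: Cj_Suc_imp)+

lemma Cj_cong: "(\<And>y. y > 0 \<Longrightarrow> f y = g y) \<Longrightarrow> Cj n f \<longleftrightarrow> Cj n g"
proof (cases n)
  case 0
  assume "\<And>y. y > 0 \<Longrightarrow> f y = g y"
  then have "continuous_on {0<..} f \<longleftrightarrow> continuous_on {0<..} g" by (intro continuous_on_cong) auto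
  then show ?thesis by (simp add: 0)
next
  case (Suc k)
  assume "\<And>y. y > 0 \<Longrightarrow> f y = g y"
  from has_vector_derivative_cong_pos[of f g, OF this] show ?thesis by (simp add: Suc)
qed

lemma Cj_add: "Cj n f \<Longrightarrow> Cj n g \<Longrightarrow> Cj n (\<lambda>y. f y + g y)"
proof (induction n arbitrary: f g)
  case (Suc n)
  then obtain f' g' where *: "\<forall>y>0. (f has_vector_derivative f' y) (at y)" "Cj n f'"
    "\<forall>y>0. (g has_vector_derivative g' y) (at y)" "Cj n g'" by auto
  from Suc.IH[OF *(2,4)] *(1,3) show ?case
    by (auto intro!: exI[of _ "\<lambda>y. f' y + g' y"] has_vector_derivative_add)
qed (auto intro!: continuous_intros)

lemma Cj_linear: "bounded_linear h \<Longrightarrow> Cj n f \<Longrightarrow> Cj n (\<lambda>y. h (f y))"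
proof (induction n arbitrary: f)
  case (Suc n)
  then obtain f' where *: "\<forall>y>0. (f has_vector_derivative f' y) (at y)" "Cj n f'" by auto
  have "((\<lambda>y. h (f y)) has_vector_derivative h (f' y)) (at y)" if "y > 0" for y
    by (rule bounded_linear.has_vector_derivative[OF Suc.prems(1)]) (use *(1) that in simp)
  then have "\<forall>y>0. ((\<lambda>y. h (f y)) has_vector_derivative h (f' y)) (at y)" by simp
  then show ?case unfolding Cj.simps using Suc.IH[OF Suc.prems(1) *(2)] by (intro exI conjI)
next
  case 0
  then show ?case unfolding Cj.simps by (intro bounded_linear.continuous_on[OF 0(1)])
qed

lemma powr_has_vector_derivative_scaleR:
  assumes "(f has_vector_derivative f') (at y)" "y > 0"
  shows "((\<lambda>y. y powr p *\<^sub>R f y) has_vector_derivative y powr p *\<^sub>R f' + (p * y powr (p - 1)) *\<^sub>R f y) (at y)"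
  by (rule has_vector_derivative_scaleR[OF has_real_derivative_powr[OF assms(2)] assms(1)])

lemma Cj_powr: "Cj n f \<Longrightarrow> Cj n (\<lambda>y. y powr p *\<^sub>R f y)"
proof (induction n arbitrary: f p)
  case 0
  then show ?case by (auto intro!: continuous_intros)
next
  case (Suc n)
  then obtain f' where *: "\<forall>y>0. (f has_vector_derivative f' y) (at y)" "Cj n f'" by auto
  have "Cj n (\<lambda>y. y powr p *\<^sub>R f' y + p *\<^sub>R (y powr (p - 1) *\<^sub>R f y))"
    by (rule Cj_add[OF Suc.IH[OF *(2)] Cj_linear[OF bounded_linear_scaleR_right Suc.IH[OF Cj_Suc_imp[OF Suc.prems]]]])
  moreover have "\<forall>y>0. ((\<lambda>y. y powr p *\<^sub>R f y) has_vector_derivative y powr p *\<^sub>R f' y + p *\<^sub>R (y powr (p - 1) *\<^sub>R f y)) (at y)"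
    unfolding scaleR_scaleR
    by (intro allI impI, rule powr_has_vector_derivative_scaleR) (use *(1) in simp_all)
  ultimately show ?case unfolding Cj.simps by (intro exI conjI)
qed

lemma dy_eq: "(f has_vector_derivative d) (at y) \<Longrightarrow> dy f y = d"
  unfolding dy_def by (rule vector_derivative_at)

lemma dy_cong: "(\<And>z. z > 0 \<Longrightarrow> f z = g z) \<Longrightarrow> y > 0 \<Longrightarrow> dy f y = dy g y"
  unfolding dy_def vector_derivative_def using has_vector_derivative_cong_pos[of f g y] by simp

lemma Cj_dy:
  assumes "Cj (Suc n) g"
  shows "Cj n (dy g)" "y > 0 \<Longrightarrow> (g has_vector_derivative dy g y) (at y)"
proof -
  obtain g' where g': "\<And>y. y > 0 \<Longrightarrow> (g has_vector_derivative g' y) (at y)" "Cj n g'"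
    using assms by auto
  have "dy g y = g' y" if "y > 0" for y by (rule dy_eq[OF g'(1)[OF that]])
  then show "Cj n (dy g)" "y > 0 \<Longrightarrow> (g has_vector_derivative dy g y) (at y)"
    using Cj_cong[of "dy g" g' n] g' by auto
qed

lemma Cj_iff_seq:
  "Cj n g \<longleftrightarrow> (\<exists>W. (\<forall>y>0. W 0 y = g y) \<and> (\<forall>i\<le>n. continuous_on {0<..} (W i)) \<and>
     (\<forall>i<n. \<forall>y>0. (W i has_vector_derivative W (Suc i) y) (at y)))"
proof (induction n arbitrary: g)
  case 0
  have "continuous_on {0<..} (W 0) \<longleftrightarrow> continuous_on {0<..} g" if "\<forall>y>0. W 0 y = g y" for W :: "nat \<Rightarrow> real \<Rightarrow> 'a"
    by (rule continuous_on_cong) (use that in auto)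
  then show ?case by (auto intro!: exI[of _ "\<lambda>_. g"])
next
  case (Suc n)
  show ?case
  proof
    assume g: "Cj (Suc n) g"
    then obtain g' where g': "\<forall>y>0. (g has_vector_derivative g' y) (at y)" "Cj n g'" by auto
    then obtain W where W: "\<forall>y>0. W 0 y = g' y" "\<forall>i\<le>n. continuous_on {0<..} (W i)"
      "\<forall>i<n. \<forall>y>0. (W i has_vector_derivative W (Suc i) y) (at y)" using Suc.IH[of g'] by blast
    have c: "continuous_on {0<..} g" using Cj_mono[of 0 "Suc n" g] g by simp
    show "\<exists>W. (\<forall>y>0. W 0 y = g y) \<and> (\<forall>i\<le>Suc n. continuous_on {0<..} (W i)) \<and>
       (\<forall>i<Suc n. \<forall>y>0. (W i has_vector_derivative W (Suc i) y) (at y))"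
    proof (intro exI[of _ "case_nat g W"] conjI allI impI)
      fix i assume "i \<le> Suc n"
      then show "continuous_on {0<..} (case_nat g W i)" using W(2) c by (cases i) auto
    next
      fix i and y :: real assume "i < Suc n" "y > 0"
      then show "(case_nat g W i has_vector_derivative case_nat g W (Suc i) y) (at y)"
        using W(1,3) g'(1) by (cases i) auto
    qed simp
  next
    assume "\<exists>W. (\<forall>y>0. W 0 y = g y) \<and> (\<forall>i\<le>Suc n. continuous_on {0<..} (W i)) \<and>
       (\<forall>i<Suc n. \<forall>y>0. (W i has_vector_derivative W (Suc i) y) (at y))"
    then obtain W where W: "\<forall>y>0. W 0 y = g y" "\<forall>i\<le>Suc n. continuous_on {0<..} (W i)"
       "\<forall>i<Suc n. \<forall>y>0. (W i has_vector_derivative W (Suc i) y) (at y)" by blast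
    have "Cj n (W 1)" unfolding Suc.IH
      by (intro exI[of _ "\<lambda>i. W (Suc i)"]) (use W in auto)
    moreover have "\<forall>y>0. (g has_vector_derivative W 1 y) (at y)"
    proof (intro allI impI)
      fix y :: real assume y: "y > 0"
      have "(W 0 has_vector_derivative W 1 y) (at y)" using W(3) y by auto
      then show "(g has_vector_derivative W 1 y) (at y)"
        using has_vector_derivative_cong_pos[of "W 0" g y] W(1) y by auto
    qed
    ultimately show "Cj (Suc n) g" by auto
  qed
qed

lemma isCont_iff_norm: "isCont f y \<longleftrightarrow> ((\<lambda>z. norm (f z - f y)) \<longlongrightarrow> 0) (at y)" for f :: "real \<Rightarrow> 'b::real_normed_vector"
  unfolding isCont_def by (subst LIM_zero_iff[symmetric], subst tendsto_norm_zero_iff[symmetric]) (rule refl)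

lemma has_vector_derivative_iff_norm:
  "(f has_vector_derivative d) (at y) \<longleftrightarrow> ((\<lambda>z. norm ((f z - f y) /\<^sub>R (z - y) - d)) \<longlongrightarrow> 0) (at y)"
  unfolding has_vector_derivative_iff_quotient
  by (subst LIM_zero_iff[symmetric], subst tendsto_norm_zero_iff[symmetric]) (rule refl)

lemma at_within_pos: "y \<in> {0<..} \<Longrightarrow> at y within {0<..} = at (y::real)"
  by (rule at_within_open) auto

lemma Cn_into_UNIV_iff: "Cn_into n {0<..} UNIV norm V \<longleftrightarrow> Cj n V"
  unfolding Cn_into_def Cj_iff_seq
  by (simp add: at_within_pos Ball_def has_vector_derivative_iff_norm isCont_iff_norm[symmetric] continuous_on_eq_continuous_at)

context bounded_semigroup
begin

section \<open>Domains of powers as ranges of powers of the inverse\<close>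

text \<open>The inverse of \<open>L\<close> itself: with this sign the powers of \<open>J\<close>
  invert those of \<open>L\<close> without factors \<open>(-1) ^ k\<close>.\<close>

definition J :: "'a \<Rightarrow> 'a" where "J x = - B x"

lemma J_linear: "bounded_linear J"
  unfolding J_def by (rule bounded_linear_minus[OF B_linear])

lemma Jk_linear: "bounded_linear (J ^^ k)"
  by (rule bounded_linear_funpow[OF J_linear])

lemmas J_simps = linear_add[OF bounded_linear.linear[OF J_linear]]
  linear_diff[OF bounded_linear.linear[OF J_linear]] linear_neg[OF bounded_linear.linear[OF J_linear]]
  linear_scale[OF bounded_linear.linear[OF J_linear]] linear_0[OF bounded_linear.linear[OF J_linear]]

lemmas Jk_simps = linear_add[OF bounded_linear.linear[OF Jk_linear]]
  linear_diff[OF bounded_linear.linear[OF Jk_linear]] linear_neg[OF bounded_linear.linear[OF Jk_linear]]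
  linear_scale[OF bounded_linear.linear[OF Jk_linear]] linear_0[OF bounded_linear.linear[OF Jk_linear]]

lemma L_J: "L (J x) = x"
  using L_eqI[of "J x" "- x"] by (simp add: J_def B_simps)

lemma J_in_D: "J x \<in> D"
  unfolding in_D_iff J_def by (intro exI[of _ "- x"]) (simp add: B_simps)

lemma J_L: "x \<in> D \<Longrightarrow> J (L x) = x"
  by (simp add: J_def B_L)

lemma J_inj: "J x = J y \<Longrightarrow> x = y"
  using B_inj[of x y] by (simp add: J_def)

lemma Lk_Jk: "(L ^^ k) ((J ^^ k) x) = x"
proof (induction k)
  case (Suc k)
  have "(L ^^ Suc k) ((J ^^ Suc k) x) = (L ^^ k) (L (J ((J ^^ k) x)))"
    by (simp only: funpow_Suc_right[of k L] o_apply) simp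
  then show ?case using Suc by (simp only: L_J)
qed simp

lemma Jk_inj: assumes "(J ^^ k) x = (J ^^ k) y" shows "x = y"
proof -
  have "x = (L ^^ k) ((J ^^ k) x)" by (rule Lk_Jk[symmetric])
  also have "\<dots> = y" unfolding assms by (rule Lk_Jk)
  finally show ?thesis .
qed

lemma Jk_Suc: "(J ^^ Suc k) x = (J ^^ k) (J x)"
  by (simp only: funpow_Suc_right o_apply)

lemma pow_dom_iff: "x \<in> pow_dom D L k \<longleftrightarrow> (\<exists>w. x = (J ^^ k) w)"
proof (induction k arbitrary: x)
  case (Suc k)
  show ?case
  proof
    assume "x \<in> pow_dom D L (Suc k)"
    then have x: "x \<in> pow_dom D L k" "(L ^^ k) x \<in> D" by auto
    then obtain w where w: "x = (J ^^ k) w" using Suc by auto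
    then have "w \<in> D" using x Lk_Jk by simp
    then have "w = J (L w)" by (simp add: J_L)
    then have "x = (J ^^ Suc k) (L w)" using w by (simp only: Jk_Suc)
    then show "\<exists>w. x = (J ^^ Suc k) w" ..
  next
    assume "\<exists>w. x = (J ^^ Suc k) w"
    then obtain w where w: "x = (J ^^ k) (J w)" by (auto simp only: Jk_Suc)
    then have "x \<in> pow_dom D L k" "(L ^^ k) x \<in> D" using Suc by (auto simp: Lk_Jk J_in_D)
    then show "x \<in> pow_dom D L (Suc k)" by simp
  qed
qed simp

text \<open>\<open>J ^^ k\<close> is an isomorphism of the whole space onto D(L^k) with the graph
  norm: \<open>L ^^ k\<close> recovers the preimage, and \<open>J ^^ k\<close> is bounded.\<close>

lemma graph_norm_Jk_tendsto:
  "((\<lambda>z. graph_norm L k ((J ^^ k) (f z))) \<longlongrightarrow> 0) F \<longleftrightarrow> ((\<lambda>z. norm (f z)) \<longlongrightarrow> 0) F"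
proof
  assume "((\<lambda>z. graph_norm L k ((J ^^ k) (f z))) \<longlongrightarrow> 0) F"
  then show "((\<lambda>z. norm (f z)) \<longlongrightarrow> 0) F"
    by (rule Lim_null_comparison[rotated]) (auto simp: graph_norm_def Lk_Jk)
next
  assume f: "((\<lambda>z. norm (f z)) \<longlongrightarrow> 0) F"
  then have "(f \<longlongrightarrow> 0) F" by (simp add: tendsto_norm_zero_iff)
  from bounded_linear.tendsto[OF Jk_linear this, of k]
  have "((\<lambda>z. (J ^^ k) (f z)) \<longlongrightarrow> 0) F" by (simp add: Jk_simps)
  from tendsto_add[OF tendsto_norm_zero[OF this] f]
  show "((\<lambda>z. graph_norm L k ((J ^^ k) (f z))) \<longlongrightarrow> 0) F" by (simp add: graph_norm_def Lk_Jk)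
qed

text \<open>Transport along the isomorphism \<open>J ^^ k\<close>: differentiability in the graph
  norm is ordinary differentiability of the preimage.\<close>

lemma Cn_pow_dom_iff: "Cn_pow_dom n D L k V \<longleftrightarrow> (\<exists>g. Cj n g \<and> (\<forall>y>0. V y = (J ^^ k) (g y)))"
proof
  assume "Cn_pow_dom n D L k V"
  then obtain W where W: "\<forall>y\<in>{0<..}. W 0 y = V y"
    "\<forall>i\<le>n. \<forall>y\<in>{0<..}. W i y \<in> pow_dom D L k \<and> ((\<lambda>z. graph_norm L k (W i z - W i y)) \<longlongrightarrow> 0) (at y within {0<..})"
    "\<forall>i<n. \<forall>y\<in>{0<..}. ((\<lambda>z. graph_norm L k ((W i z - W i y) /\<^sub>R (z - y) - W (Suc i) y)) \<longlongrightarrow> 0) (at y within {0<..})"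
    unfolding Cn_into_def by blast
  define G where "G i y = (L ^^ k) (W i y)" for i y
  have WG: "W i y = (J ^^ k) (G i y)" if "i \<le> n" "y > 0" for i y
  proof -
    have "W i y \<in> pow_dom D L k" using W(2) that by simp
    then obtain w where "W i y = (J ^^ k) w" by (auto simp: pow_dom_iff)
    then show ?thesis by (simp add: G_def Lk_Jk)
  qed
  have pos: "eventually (\<lambda>z. z > 0) (at y)" if "y > 0" for y :: real
    by (rule order_tendstoD(1)[OF tendsto_ident_at that])
  have "Cj n (G 0)"
    unfolding Cj_iff_seq
  proof (intro exI[of _ G] conjI allI impI)
    fix i assume i: "i \<le> n"
    show "continuous_on {0<..} (G i)"
    proof (rule continuous_at_imp_continuous_on, rule ballI)
      fix y :: real assume y: "y \<in> {0<..}"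
      have "((\<lambda>z. graph_norm L k (W i z - W i y)) \<longlongrightarrow> 0) (at y within {0<..})" using W(2) i y by blast
      then have "((\<lambda>z. graph_norm L k (W i z - W i y)) \<longlongrightarrow> 0) (at y)" by (simp only: at_within_pos[OF y])
      then have "((\<lambda>z. graph_norm L k ((J ^^ k) (G i z - G i y))) \<longlongrightarrow> 0) (at y)"
        by (rule Lim_transform_eventually) (use pos[of y] y i in \<open>auto elim!: eventually_mono simp: WG Jk_simps\<close>)
      then show "isCont (G i) y" unfolding graph_norm_Jk_tendsto isCont_iff_norm .
    qed
  next
    fix i and y :: real assume i: "i < n" and y: "y > 0"
    have y': "y \<in> {0<..}" using y by simp
    have "((\<lambda>z. graph_norm L k ((W i z - W i y) /\<^sub>R (z - y) - W (Suc i) y)) \<longlongrightarrow> 0) (at y within {0<..})"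
      using W(3) i y' by blast
    then have "((\<lambda>z. graph_norm L k ((W i z - W i y) /\<^sub>R (z - y) - W (Suc i) y)) \<longlongrightarrow> 0) (at y)"
      by (simp only: at_within_pos[OF y'])
    then have "((\<lambda>z. graph_norm L k ((J ^^ k) ((G i z - G i y) /\<^sub>R (z - y) - G (Suc i) y))) \<longlongrightarrow> 0) (at y)"
      by (rule Lim_transform_eventually) (use pos[of y] y i in \<open>auto elim!: eventually_mono simp: WG Jk_simps\<close>)
    then show "(G i has_vector_derivative G (Suc i) y) (at y)"
      unfolding graph_norm_Jk_tendsto has_vector_derivative_iff_norm .
  qed simp
  moreover have "\<forall>y>0. V y = (J ^^ k) (G 0 y)" using WG[of 0] W(1) by auto
  ultimately show "\<exists>g. Cj n g \<and> (\<forall>y>0. V y = (J ^^ k) (g y))" by blast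
next
  assume "\<exists>g. Cj n g \<and> (\<forall>y>0. V y = (J ^^ k) (g y))"
  then obtain g where g: "Cj n g" "\<forall>y>0. V y = (J ^^ k) (g y)" by blast
  then obtain G where G: "\<forall>y>0. G 0 y = g y" "\<forall>i\<le>n. continuous_on {0<..} (G i)"
     "\<forall>i<n. \<forall>y>0. (G i has_vector_derivative G (Suc i) y) (at y)" unfolding Cj_iff_seq by blast
  show "Cn_pow_dom n D L k V"
    unfolding Cn_into_def
  proof (intro exI[of _ "\<lambda>i y. (J ^^ k) (G i y)"] conjI allI impI ballI)
    fix y :: real assume "y \<in> {0<..}"
    then show "(J ^^ k) (G 0 y) = V y" using G(1) g(2) by simp
  next
    fix i and y :: real assume "i \<le> n" "y \<in> {0<..}"
    show "(J ^^ k) (G i y) \<in> pow_dom D L k" by (auto simp: pow_dom_iff)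
  next
    fix i and y :: real assume i: "i \<le> n" and y: "y \<in> {0<..}"
    have "isCont (G i) y" using G(2) i y by (auto simp: continuous_on_eq_continuous_at)
    then show "((\<lambda>z. graph_norm L k ((J ^^ k) (G i z) - (J ^^ k) (G i y))) \<longlongrightarrow> 0) (at y within {0<..})"
      unfolding at_within_pos[OF y] Jk_simps(2)[symmetric] graph_norm_Jk_tendsto isCont_iff_norm .
  next
    fix i and y :: real assume i: "i < n" and y: "y \<in> {0<..}"
    have "(G i has_vector_derivative G (Suc i) y) (at y)" using G(3) i y by auto
    then show "((\<lambda>z. graph_norm L k (((J ^^ k) (G i z) - (J ^^ k) (G i y)) /\<^sub>R (z - y) - (J ^^ k) (G (Suc i) y))) \<longlongrightarrow> 0) (at y within {0<..})"
      unfolding at_within_pos[OF y] Jk_simps(2)[symmetric] Jk_simps(4)[symmetric] graph_norm_Jk_tendsto has_vector_derivative_iff_norm .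
  qed
qed

section \<open>Closed forms for the iterated operators\<close>

text \<open>Generated inductively so that closure under differentiation, division by
  \<open>J\<close> and powers of \<open>y\<close> has to be checked on the generators only.\<close>

inductive ext_span :: "'a \<Rightarrow> (real \<Rightarrow> 'a) \<Rightarrow> bool" for x where
  base: "q > 0 \<Longrightarrow> ext_span x (\<lambda>y. y powr p *\<^sub>R U q y x)"
| add: "ext_span x f \<Longrightarrow> ext_span x g \<Longrightarrow> ext_span x (\<lambda>y. f y + g y)"
| scale: "ext_span x f \<Longrightarrow> ext_span x (\<lambda>y. c *\<^sub>R f y)"

lemma ext_span_deriv: "ext_span x f \<Longrightarrow> \<exists>f'. ext_span x f' \<and> (\<forall>y>0. (f has_vector_derivative f' y) (at y))"
proof (induction rule: ext_span.induct)
  case (base q p)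
  let ?f' = "\<lambda>y. (2 * q) *\<^sub>R (y powr (p - 1) *\<^sub>R U q y x) + ((- 2 * q) *\<^sub>R (y powr (p - 1) *\<^sub>R U (q + 1) y x) + p *\<^sub>R (y powr (p - 1) *\<^sub>R U q y x))"
  have "ext_span x ?f'" using base by (intro ext_span.intros) auto
  moreover have "((\<lambda>y. y powr p *\<^sub>R U q y x) has_vector_derivative ?f' y) (at y)" if y: "y > 0" for y
  proof -
    have "((\<lambda>y. y powr p *\<^sub>R U q y x) has_vector_derivative y powr p *\<^sub>R DU q y x + (p * y powr (p - 1)) *\<^sub>R U q y x) (at y)"
      by (rule powr_has_vector_derivative_scaleR[OF U_has_deriv[OF base y] y])
    moreover have "y powr p *\<^sub>R DU q y x = (2 * q) *\<^sub>R (y powr (p - 1) *\<^sub>R U q y x) + (- 2 * q) *\<^sub>R (y powr (p - 1) *\<^sub>R U (q + 1) y x)"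
      using y by (simp add: DU_def powr_diff scaleR_diff_right mult_ac)
    ultimately show ?thesis by (simp add: algebra_simps)
  qed
  ultimately show ?case by (intro exI[of _ ?f'] conjI allI impI)
next
  case (add f g)
  then obtain f' g' where *: "ext_span x f'" "ext_span x g'" "\<forall>y>0. (f has_vector_derivative f' y) (at y)" "\<forall>y>0. (g has_vector_derivative g' y) (at y)" by blast
  from *(3,4) have "\<forall>y>0. ((\<lambda>y. f y + g y) has_vector_derivative f' y + g' y) (at y)"
    by (auto intro: has_vector_derivative_add)
  then show ?case using ext_span.add[OF *(1,2)] by (intro exI conjI)
next
  case (scale f c)
  then obtain f' where *: "ext_span x f'" "\<forall>y>0. (f has_vector_derivative f' y) (at y)" by blast
  have "((\<lambda>y. c *\<^sub>R f y) has_vector_derivative c *\<^sub>R f' y) (at y)" if "y > 0" for y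
    by (rule bounded_linear.has_vector_derivative[OF bounded_linear_scaleR_right]) (use *(2) that in simp)
  then have "\<forall>y>0. ((\<lambda>y. c *\<^sub>R f y) has_vector_derivative c *\<^sub>R f' y) (at y)" by simp
  then show ?case using ext_span.scale[OF *(1), of c] by (intro exI conjI)
qed

lemma U_eq_J: "q > 0 \<Longrightarrow> y > 0 \<Longrightarrow> U q y x = J ((4 * q * (q + 1) / y\<^sup>2) *\<^sub>R (U (q + 1) y x - U (q + 2) y x))"
  using U_eq_B[of q y x] by (simp add: J_def B_simps)

lemma ext_span_J: "ext_span x f \<Longrightarrow> \<exists>g. ext_span x g \<and> (\<forall>y>0. f y = J (g y))"
proof (induction rule: ext_span.induct)
  case (base q p)
  let ?g = "\<lambda>y. (4 * q * (q + 1)) *\<^sub>R (y powr (p - 2) *\<^sub>R U (q + 1) y x) + (- (4 * q * (q + 1))) *\<^sub>R (y powr (p - 2) *\<^sub>R U (q + 2) y x)"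
  have "ext_span x ?g" using base by (intro ext_span.intros) auto
  moreover have "y powr p *\<^sub>R U q y x = J (?g y)" if y: "y > 0" for y
  proof -
    have "y powr (p - 2) = y powr p / y\<^sup>2" using y by (simp add: powr_diff)
    then have "?g y = y powr p *\<^sub>R ((4 * q * (q + 1) / y\<^sup>2) *\<^sub>R (U (q + 1) y x - U (q + 2) y x))"
      by (simp add: scaleR_diff_right mult.commute)
    then show ?thesis using U_eq_J[OF base y, of x] by (simp only: J_simps)
  qed
  ultimately show ?case by (intro exI[of _ ?g] conjI allI impI)
next
  case (add f g)
  then obtain f' g' where *: "ext_span x f'" "ext_span x g'" "\<forall>y>0. f y = J (f' y)" "\<forall>y>0. g y = J (g' y)" by blast
  from *(3,4) have "\<forall>y>0. f y + g y = J (f' y + g' y)" by (simp add: J_simps)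
  then show ?case using ext_span.add[OF *(1,2)] by (intro exI conjI)
next
  case (scale f c)
  then obtain f' where *: "ext_span x f'" "\<forall>y>0. f y = J (f' y)" by blast
  from *(2) have "\<forall>y>0. c *\<^sub>R f y = J (c *\<^sub>R f' y)" by (simp add: J_simps)
  then have "\<forall>y>0. c *\<^sub>R f y = J (c *\<^sub>R f' y)" by simp
  then show ?case using ext_span.scale[OF *(1), of c] by (intro exI conjI)
qed

lemma ext_span_Cj: "ext_span x f \<Longrightarrow> Cj n f"
proof (induction n arbitrary: f)
  case 0
  then obtain f' where "\<forall>y>0. (f has_vector_derivative f' y) (at y)" using ext_span_deriv by blast
  then show ?case by (auto intro!: continuous_at_imp_continuous_on has_vector_derivative_continuous)
next
  case (Suc n)
  obtain f' where f': "ext_span x f'" "\<forall>y>0. (f has_vector_derivative f' y) (at y)"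
    using ext_span_deriv[OF Suc.prems] by blast
  show ?case unfolding Cj.simps by (intro exI[of _ f'] conjI f'(2) Suc.IH f'(1))
qed

lemma ext_span_Jk: "ext_span x f \<Longrightarrow> \<exists>g. ext_span x g \<and> (\<forall>y>0. f y = (J ^^ k) (g y))"
proof (induction k)
  case (Suc k)
  then obtain g where g: "ext_span x g" "\<forall>y>0. f y = (J ^^ k) (g y)" by blast
  obtain h where h: "ext_span x h" "\<forall>y>0. g y = J (h y)" using ext_span_J[OF g(1)] by blast
  show ?case by (rule exI[of _ h]) (use g h in \<open>auto simp only: Jk_Suc\<close>)
qed auto

text \<open>Agreement is required for \<open>y > 0\<close> only, because iterated operators have
  uncontrolled values elsewhere.\<close>

definition ext_smooth :: "'a \<Rightarrow> (real \<Rightarrow> 'a) \<Rightarrow> bool" where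
  "ext_smooth x f \<longleftrightarrow> (\<exists>g. ext_span x g \<and> (\<forall>y>0. f y = g y))"

lemma ext_smooth_U: assumes "q > 0" "\<And>y. y > 0 \<Longrightarrow> V y = U q y x" shows "ext_smooth x V"
  unfolding ext_smooth_def using ext_span.base[OF assms(1), of x 0] assms(2)
  by (intro exI[of _ "\<lambda>y. y powr 0 *\<^sub>R U q y x"]) auto

lemma ext_smooth_Cn_pow_dom: "ext_smooth x f \<Longrightarrow> Cn_pow_dom n D L k f"
proof -
  assume "ext_smooth x f"
  then obtain g where g: "ext_span x g" "\<forall>y>0. f y = g y" unfolding ext_smooth_def by blast
  obtain h where h: "ext_span x h" "\<forall>y>0. g y = (J ^^ k) (h y)" using ext_span_Jk[OF g(1)] by blast
  show ?thesis unfolding Cn_pow_dom_iff using ext_span_Cj[OF h(1), of n] g(2) h(2) by auto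
qed

lemma ext_smooth_Cj: "ext_smooth x f \<Longrightarrow> Cj n f"
proof -
  assume "ext_smooth x f"
  then obtain g where g: "ext_span x g" "\<And>y. y > 0 \<Longrightarrow> f y = g y" unfolding ext_smooth_def by blast
  have "Cj n f \<longleftrightarrow> Cj n g" by (rule Cj_cong) (rule g(2))
  then show ?thesis using ext_span_Cj[OF g(1)] by simp
qed

lemma ext_smooth_in_D: "ext_smooth x f \<Longrightarrow> y > 0 \<Longrightarrow> f y \<in> D"
proof -
  assume "ext_smooth x f" and y: "y > 0"
  then obtain g where g: "ext_span x g" "\<forall>y>0. f y = g y" unfolding ext_smooth_def by blast
  obtain h where "\<forall>y>0. g y = J (h y)" using ext_span_J[OF g(1)] by blast
  then show ?thesis using g(2) y J_in_D by simp
qed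

lemma ext_smooth_dy:
  assumes "ext_smooth x f"
  shows "ext_smooth x (dy f)" "y > 0 \<Longrightarrow> (f has_vector_derivative dy f y) (at y)"
proof -
  obtain g where g: "ext_span x g" "\<forall>y>0. f y = g y" using assms unfolding ext_smooth_def by blast
  obtain g' where g': "ext_span x g'" "\<forall>y>0. (g has_vector_derivative g' y) (at y)" using ext_span_deriv[OF g(1)] by blast
  have "(f has_vector_derivative g' y) (at y)" if "y > 0" for y
    using has_vector_derivative_cong_pos[of f g y] g(2) g'(2) that by auto
  then have f: "(f has_vector_derivative g' y) (at y)" "dy f y = g' y" if "y > 0" for y
    using that dy_eq by blast+
  then show "y > 0 \<Longrightarrow> (f has_vector_derivative dy f y) (at y)" by simp
  show "ext_smooth x (dy f)" unfolding ext_smooth_def using g'(1) f(2) by (intro exI[of _ g']) simp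
qed

lemma ext_smooth_add: "ext_smooth x f \<Longrightarrow> ext_smooth x g \<Longrightarrow> ext_smooth x (\<lambda>y. f y + g y)"
proof -
  assume "ext_smooth x f" "ext_smooth x g"
  then obtain f' g' where "ext_span x f'" "\<forall>y>0. f y = f' y" "ext_span x g'" "\<forall>y>0. g y = g' y"
    unfolding ext_smooth_def by blast
  then have "\<forall>y>0. f y + g y = f' y + g' y" "ext_span x (\<lambda>y. f' y + g' y)" by (simp_all add: ext_span.add)
  then show ?thesis unfolding ext_smooth_def by (intro exI conjI)
qed

lemma ext_span_powr: "ext_span x f \<Longrightarrow> \<exists>g. ext_span x g \<and> (\<forall>y>0. y powr r *\<^sub>R f y = g y)"
proof (induction rule: ext_span.induct)
  case (base q p)
  have "\<forall>y>0. y powr r *\<^sub>R (y powr p *\<^sub>R U q y x) = y powr (r + p) *\<^sub>R U q y x" by (simp add: powr_add)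
  then show ?case using ext_span.base[OF base, of x "r + p"] by (intro exI conjI)
next
  case (add f g)
  then obtain f' g' where *: "ext_span x f'" "ext_span x g'" "\<forall>y>0. y powr r *\<^sub>R f y = f' y" "\<forall>y>0. y powr r *\<^sub>R g y = g' y" by blast
  from *(3,4) have "\<forall>y>0. y powr r *\<^sub>R (f y + g y) = f' y + g' y" by (simp add: scaleR_add_right)
  then show ?case using ext_span.add[OF *(1,2)] by (intro exI conjI)
next
  case (scale f c)
  then obtain f' where *: "ext_span x f'" "\<forall>y>0. y powr r *\<^sub>R f y = f' y" by blast
  have "y powr r *\<^sub>R (c *\<^sub>R f y) = c *\<^sub>R f' y" if "y > 0" for y
    unfolding scaleR_left_commute[of _ c] using *(2) that by simp
  then have "\<forall>y>0. y powr r *\<^sub>R (c *\<^sub>R f y) = c *\<^sub>R f' y" by simp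
  then show ?case using ext_span.scale[OF *(1), of c] by (intro exI conjI)
qed

lemma ext_smooth_div: assumes "ext_smooth x f" shows "ext_smooth x (\<lambda>y. (c / y) *\<^sub>R f y)"
proof -
  obtain g where g: "ext_span x g" "\<forall>y>0. f y = g y" using assms unfolding ext_smooth_def by blast
  obtain h where h: "ext_span x h" "\<forall>y>0. y powr (- 1) *\<^sub>R g y = h y" using ext_span_powr[OF g(1)] by blast
  have "(c / y) *\<^sub>R f y = c *\<^sub>R h y" if "y > 0" for y
  proof -
    have "h y = (1 / y) *\<^sub>R f y" using h(2) g(2) that by (simp add: powr_minus_divide)
    then show ?thesis by simp
  qed
  then have "\<forall>y>0. (c / y) *\<^sub>R f y = c *\<^sub>R h y" by simp
  then show ?thesis unfolding ext_smooth_def using ext_span.scale[OF h(1), of c] by (intro exI conjI)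
qed

lemma ext_smooth_L: assumes "ext_smooth x f" shows "ext_smooth x (\<lambda>y. L (f y))"
proof -
  obtain g where g: "ext_span x g" "\<forall>y>0. f y = g y" using assms unfolding ext_smooth_def by blast
  obtain h where h: "ext_span x h" "\<forall>y>0. g y = J (h y)" using ext_span_J[OF g(1)] by blast
  have "L (f y) = h y" if "y > 0" for y using g(2) h(2) that by (simp add: L_J)
  then show ?thesis unfolding ext_smooth_def using h(1) by (intro exI[of _ h]) simp
qed

lemma ext_smooth_ops:
  assumes "ext_smooth x f"
  shows "ext_smooth x (two_over_y_dy f)" "ext_smooth x (ext_op L a f)"
proof -
  show "ext_smooth x (two_over_y_dy f)"
    using ext_smooth_div[OF ext_smooth_dy(1)[OF assms], of 2] by (simp add: two_over_y_dy_def[abs_def])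
  show "ext_smooth x (ext_op L a f)"
    using ext_smooth_add[OF ext_smooth_add[OF ext_smooth_L[OF assms] ext_smooth_div[OF ext_smooth_dy(1)[OF assms], of a]]
        ext_smooth_dy(1)[OF ext_smooth_dy(1)[OF assms]]] by (simp add: ext_op_def[abs_def])
qed

lemma ext_smooth_iter:
  assumes "ext_smooth x f"
  shows "ext_smooth x ((two_over_y_dy ^^ m) f)" "ext_smooth x ((ext_op L a ^^ m) f)"
  by (induction m) (simp_all only: funpow.simps o_apply id_apply assms ext_smooth_ops)

lemma dy_linear:
  assumes "\<And>y. y > 0 \<Longrightarrow> (f has_vector_derivative dy f y) (at y)" "bounded_linear h" "y > 0"
  shows "dy (\<lambda>y. h (f y)) y = h (dy f y)"
  by (rule dy_eq[OF bounded_linear.has_vector_derivative[OF assms(2) assms(1)[OF assms(3)]]])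

lemma two_over_linear:
  assumes "ext_smooth x f" "bounded_linear h" "y > 0"
  shows "two_over_y_dy (\<lambda>y. h (f y)) y = h (two_over_y_dy f y)"
proof -
  have "dy (\<lambda>y. h (f y)) y = h (dy f y)"
    by (rule dy_linear[OF _ assms(2,3)]) (rule ext_smooth_dy(2)[OF assms(1)])
  then show ?thesis
    unfolding two_over_y_dy_def by (simp add: linear_scale[OF bounded_linear.linear[OF assms(2)]])
qed

text \<open>The condition on \<open>h\<close> says that \<open>h\<close> commutes with
  \<open>L\<close> on \<open>D\<close>; it is met by powers of \<open>J\<close> and by
  scalars.\<close>

lemma ext_op_linear:
  assumes f: "ext_smooth x f" and h: "bounded_linear h" "\<And>v. L (h (J v)) = h v" and y: "y > 0"
  shows "ext_op L a (\<lambda>y. h (f y)) y = h (ext_op L a f y)"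
proof -
  interpret bounded_linear h by fact
  have 1: "dy (\<lambda>y. h (f y)) y = h (dy f y)" if "y > 0" for y
    by (rule dy_linear[OF ext_smooth_dy(2)[OF f] h(1) that])
  have 2: "dy (dy (\<lambda>y. h (f y))) y = h (dy (dy f) y)"
    using dy_cong[of "dy (\<lambda>y. h (f y))" "\<lambda>y. h (dy f y)" y] 1 y
      dy_linear[OF ext_smooth_dy(2)[OF ext_smooth_dy(1)[OF f]] h(1) y] by simp
  have 3: "L (h (f y)) = h (L (f y))"
    using h(2)[of "L (f y)"] J_L[OF ext_smooth_in_D[OF f y]] by simp
  show ?thesis unfolding ext_op_def 2 3 using 1[OF y] by (simp add: add scaleR)
qed

lemma Jk_commutes: "L ((J ^^ m) (J v)) = (J ^^ m) v"
  using L_J[of "(J ^^ m) v"] Jk_Suc[of m v] by simp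

lemma ext_op_cong: "(\<And>z. z > 0 \<Longrightarrow> f z = g z) \<Longrightarrow> y > 0 \<Longrightarrow> ext_op L a f y = ext_op L a g y"
  unfolding ext_op_def using dy_cong[of f g] dy_cong[of "dy f" "dy g"] by simp

lemma two_over_cong: "(\<And>z. z > 0 \<Longrightarrow> f z = g z) \<Longrightarrow> y > 0 \<Longrightarrow> two_over_y_dy f y = two_over_y_dy g y"
  unfolding two_over_y_dy_def using dy_cong[of f g] by simp

section \<open>Recursions for the iterated operators\<close>

text \<open>This is \<open>U_eq_J\<close> at index \<open>q - 1\<close>: the difference of averages
  occurring there is a multiple of \<open>DU q y x\<close>.\<close>

lemma J_DU: assumes "q > 1" "y > 0" shows "J ((2 / y) *\<^sub>R DU q y x) = (1 / (q - 1)) *\<^sub>R U (q - 1) y x"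
proof -
  have "U (q - 1) y x = J ((4 * (q - 1) * q / y\<^sup>2) *\<^sub>R (U q y x - U (q + 1) y x))"
    using U_eq_J[of "q - 1" y x] assms by (simp add: add.commute)
  also have "(4 * (q - 1) * q / y\<^sup>2) *\<^sub>R (U q y x - U (q + 1) y x) = (q - 1) *\<^sub>R ((2 / y) *\<^sub>R DU q y x)"
    by (simp add: DU_def power2_eq_square mult_ac)
  finally have "U (q - 1) y x = (q - 1) *\<^sub>R J ((2 / y) *\<^sub>R DU q y x)" by (simp only: J_simps(4)[of "q - 1"])
  then show ?thesis using assms by simp
qed

text \<open>\<open>U q\<close> solves the equation whose coefficient is \<open>1 - 2 * q\<close>;
  with another coefficient \<open>a\<close> only the difference of the first order terms survives.
  The \<open>J\<close> in front moves the argument into \<open>D\<close>, where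
  \<open>DU_has_deriv\<close> gives the second derivative.\<close>

lemma ext_op_U:
  assumes "q > 0" "y > 0"
  shows "J (ext_op L a (\<lambda>y. U q y x) y) = ((a - 1 + 2 * q) / 2) *\<^sub>R J ((2 / y) *\<^sub>R DU q y x)"
proof -
  have sm: "ext_smooth x (\<lambda>y. U q y x)" by (rule ext_smooth_U[OF assms(1)]) simp
  have UJ: "U q y (J x) = J (U q y x)" "DU q y (J x) = J (DU q y x)" if "y > 0" for y
    using U_B[of q y "- x"] DU_B[of q y "- x"] assms(1) that U_scaleR[of q y "-1" x] DU_scaleR[of q y "-1" x]
    by (simp_all add: J_def B_simps)
  have "J (ext_op L a (\<lambda>y. U q y x) y) = ext_op L a (\<lambda>y. J (U q y x)) y"
    by (rule ext_op_linear[OF sm J_linear L_J assms(2), symmetric])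
  also have "\<dots> = ext_op L a (\<lambda>y. U q y (J x)) y"
    by (rule ext_op_cong) (simp_all add: UJ assms)
  also have "\<dots> = L (U q y (J x)) + (a / y) *\<^sub>R DU q y (J x) + (- U q y x - ((1 - 2 * q) / y) *\<^sub>R DU q y (J x))"
  proof -
    have d1: "dy (\<lambda>y. U q y (J x)) z = DU q z (J x)" if "z > 0" for z
      by (rule dy_eq[OF U_has_deriv[OF assms(1) that]])
    have "DU q z (J x) = DU q z (B (- x))" if "z > 0" for z by (simp add: J_def B_simps)
    then have "((\<lambda>y. DU q y (J x)) has_vector_derivative U q y (- x) - ((1 - 2 * q) / y) *\<^sub>R DU q y (J x)) (at y)"
      using has_vector_derivative_cong_pos[of "\<lambda>y. DU q y (J x)" "\<lambda>y. DU q y (B (- x))" y] DU_has_deriv[OF assms, of "- x"] assms by simp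
    moreover have "U q y (- x) = - U q y x" using U_scaleR[of q y "-1" x] assms by simp
    ultimately have "dy (\<lambda>y. DU q y (J x)) y = - U q y x - ((1 - 2 * q) / y) *\<^sub>R DU q y (J x)"
      by (simp add: dy_eq)
    moreover have "dy (dy (\<lambda>y. U q y (J x))) y = dy (\<lambda>y. DU q y (J x)) y"
      by (rule dy_cong[OF d1 assms(2)])
    ultimately show ?thesis unfolding ext_op_def using d1[OF assms(2)] by simp
  qed
  also have "\<dots> = (a / y - (1 - 2 * q) / y) *\<^sub>R J (DU q y x)"
    by (simp add: UJ assms L_J scaleR_diff_left)
  also have "a / y - (1 - 2 * q) / y = (a - 1 + 2 * q) / 2 * (2 / y)" using assms by (simp add: field_simps)
  finally show ?thesis by (simp add: J_simps)
qed

lemma Gamma_ratio_step: "Gamma q = (q - 1) * Gamma (q - 1)" if "q > 1" for q :: real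
proof -
  have "q - 1 \<notin> \<int>\<^sub>\<le>\<^sub>0" using nonpos_Ints_nonpos[of "q - 1"] that by auto
  from Gamma_plus1[OF this] show ?thesis by simp
qed

text \<open>Apply \<open>J_DU\<close> repeatedly; the factors 1/(s-1), 1/(s-2), ... form the Gamma
  quotient. With \<open>J ^^ m\<close> in front the formula holds for every \<open>u\<close>, not
  only for those in D(L^m).\<close>

lemma two_over_iter:
  assumes V: "\<And>y. y > 0 \<Longrightarrow> V y = U s y u" and "s > real m" "y > 0"
  shows "(J ^^ m) ((two_over_y_dy ^^ m) V y) = (Gamma (s - real m) / Gamma s) *\<^sub>R U (s - real m) y u"
  using assms(2,3)
proof (induction m arbitrary: y)
  case 0
  have "Gamma s > 0" by (rule Gamma_real_pos) (use 0 in simp)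
  then have "Gamma s \<noteq> 0" by (rule less_imp_neq[THEN not_sym])
  then show ?case using V 0 by simp
next
  case (Suc m)
  have s: "s > real m" "s - real m > 1" using Suc.prems by auto
  have "ext_smooth u V" by (rule ext_smooth_U[OF _ V]) (use s in auto)
  then have sm: "ext_smooth u ((two_over_y_dy ^^ m) V)" by (rule ext_smooth_iter)
  have smU: "ext_smooth u (\<lambda>y. U (s - real m) y u)" by (rule ext_smooth_U[of "s - real m"]) (use s in auto)
  have "(J ^^ Suc m) ((two_over_y_dy ^^ Suc m) V y) = J ((J ^^ m) (two_over_y_dy ((two_over_y_dy ^^ m) V) y))" by simp
  also have "(J ^^ m) (two_over_y_dy ((two_over_y_dy ^^ m) V) y) = two_over_y_dy (\<lambda>y. (J ^^ m) ((two_over_y_dy ^^ m) V y)) y"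
    by (rule two_over_linear[OF sm Jk_linear Suc.prems(2), symmetric])
  also have "\<dots> = two_over_y_dy (\<lambda>y. (Gamma (s - real m) / Gamma s) *\<^sub>R U (s - real m) y u) y"
    by (rule two_over_cong[OF Suc.IH[OF s(1)] Suc.prems(2)])
  also have "\<dots> = (Gamma (s - real m) / Gamma s) *\<^sub>R two_over_y_dy (\<lambda>y. U (s - real m) y u) y"
    by (rule two_over_linear[OF smU bounded_linear_scaleR_right Suc.prems(2)])
  also have "two_over_y_dy (\<lambda>y. U (s - real m) y u) y = (2 / y) *\<^sub>R DU (s - real m) y u"
    unfolding two_over_y_dy_def using dy_eq[OF U_has_deriv[of "s - real m" y u]] s Suc.prems by simp
  also have "J ((Gamma (s - real m) / Gamma s) *\<^sub>R ((2 / y) *\<^sub>R DU (s - real m) y u)) =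
      (Gamma (s - real m) / Gamma s) *\<^sub>R ((1 / (s - real m - 1)) *\<^sub>R U (s - real m - 1) y u)"
    by (simp only: J_simps(4)[of "Gamma (s - real m) / Gamma s"] J_DU[OF s(2) Suc.prems(2)])
  also have "\<dots> = (Gamma (s - real (Suc m)) / Gamma s) *\<^sub>R U (s - real (Suc m)) y u"
  proof -
    define r where "r = s - real (Suc m)"
    have e: "s - real m - 1 = r" "r > 0" using s by (simp_all add: r_def)
    show ?thesis using Gamma_ratio_step[OF s(2)] e(2) unfolding r_def[symmetric] e(1) by simp
  qed
  finally show ?case .
qed

text \<open>For this \<open>a\<close> and the index \<open>s - m\<close> the coefficient in
  \<open>ext_op_U\<close> is \<open>n - m\<close>. The product of these numbers is
  \<open>fact n / fact (n - m)\<close>, and the next one, at \<open>m = n\<close>, is 0; this is why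
  the power \<open>n + 1\<close> of the operator annihilates \<open>V\<close>.\<close>

lemma ext_op_iter:
  assumes V: "\<And>y. y > 0 \<Longrightarrow> V y = U s y u" and s: "s > real n" and a: "a = 1 - 2 * (s - real n)"
    and "m \<le> n" "y > 0"
  shows "(J ^^ m) ((ext_op L a ^^ m) V y) = (fact n / fact (n - m) * (Gamma (s - real m) / Gamma s)) *\<^sub>R U (s - real m) y u"
  using assms(4,5)
proof (induction m arbitrary: y)
  case 0
  have "Gamma s > 0" by (rule Gamma_real_pos) (use s in linarith)
  then have "Gamma s \<noteq> 0" by (rule less_imp_neq[THEN not_sym])
  then show ?case using V 0 by simp
next
  case (Suc m)
  have m: "m \<le> n" "s - real m > 1" "s - real m > 0" using Suc.prems s by auto
  have "ext_smooth u V" by (rule ext_smooth_U[OF _ V]) (use s in auto)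
  then have sm: "ext_smooth u ((ext_op L a ^^ m) V)" by (rule ext_smooth_iter)
  have smU: "ext_smooth u (\<lambda>y. U (s - real m) y u)" by (rule ext_smooth_U[of "s - real m"]) (use m in auto)
  define d where "d = fact n / fact (n - m) * (Gamma (s - real m) / Gamma s)"
  have "(J ^^ Suc m) ((ext_op L a ^^ Suc m) V y) = J ((J ^^ m) (ext_op L a ((ext_op L a ^^ m) V) y))" by simp
  also have "(J ^^ m) (ext_op L a ((ext_op L a ^^ m) V) y) = ext_op L a (\<lambda>y. (J ^^ m) ((ext_op L a ^^ m) V y)) y"
    by (rule ext_op_linear[OF sm Jk_linear Jk_commutes Suc.prems(2), symmetric])
  also have "\<dots> = ext_op L a (\<lambda>y. d *\<^sub>R U (s - real m) y u) y"
    unfolding d_def by (rule ext_op_cong[OF Suc.IH[OF m(1)] Suc.prems(2)])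
  also have "\<dots> = d *\<^sub>R ext_op L a (\<lambda>y. U (s - real m) y u) y"
    by (rule ext_op_linear[OF smU bounded_linear_scaleR_right _ Suc.prems(2)]) (simp add: J_simps(4)[symmetric] L_J)
  also have "J \<dots> = d *\<^sub>R (((a - 1 + 2 * (s - real m)) / 2) *\<^sub>R ((1 / (s - real m - 1)) *\<^sub>R U (s - real m - 1) y u))"
    by (simp only: J_simps(4)[of d] ext_op_U[OF m(3) Suc.prems(2)] J_DU[OF m(2) Suc.prems(2)])
  also have "(a - 1 + 2 * (s - real m)) / 2 = real (n - m)" using a m by (simp add: field_simps of_nat_diff)
  also have "d *\<^sub>R (real (n - m) *\<^sub>R ((1 / (s - real m - 1)) *\<^sub>R U (s - real m - 1) y u)) =
     (fact n / fact (n - Suc m) * (Gamma (s - real (Suc m)) / Gamma s)) *\<^sub>R U (s - real (Suc m)) y u"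
  proof -
    define r where "r = s - real (Suc m)"
    have e: "s - real m - 1 = r" "r > 0" using m by (simp_all add: r_def)
    have "fact (n - m) = real (n - m) * (fact (n - Suc m) :: real)"
      using Suc.prems(1) by (subst fact_reduce) (auto simp: Suc_diff_le)
    moreover have "real (n - m) \<noteq> 0" using Suc.prems(1) by simp
    ultimately show ?thesis using Gamma_ratio_step[OF m(2)] e(2) unfolding r_def[symmetric] e(1) d_def by simp
  qed
  finally show ?case .
qed

lemma ext_op_iter_0:
  assumes V: "\<And>y. y > 0 \<Longrightarrow> V y = U s y u" and s: "s > real n" and a: "a = 1 - 2 * (s - real n)" and y: "y > 0"
  shows "(ext_op L a ^^ (n + 1)) V y = 0"
proof -
  have "ext_smooth u V" by (rule ext_smooth_U[OF _ V]) (use s in auto)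
  then have sm: "ext_smooth u ((ext_op L a ^^ n) V)" by (rule ext_smooth_iter)
  have smU: "ext_smooth u (\<lambda>y. U (s - real n) y u)" by (rule ext_smooth_U[of "s - real n"]) (use s in auto)
  define d where "d = fact n / fact (n - n) * (Gamma (s - real n) / Gamma s)"
  have "(J ^^ n) (ext_op L a ((ext_op L a ^^ n) V) y) = ext_op L a (\<lambda>y. (J ^^ n) ((ext_op L a ^^ n) V y)) y"
    by (rule ext_op_linear[OF sm Jk_linear Jk_commutes y, symmetric])
  also have "\<dots> = ext_op L a (\<lambda>y. d *\<^sub>R U (s - real n) y u) y"
    unfolding d_def by (rule ext_op_cong[OF ext_op_iter[OF V s a order_refl] y])
  also have "\<dots> = d *\<^sub>R ext_op L a (\<lambda>y. U (s - real n) y u) y"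
    by (rule ext_op_linear[OF smU bounded_linear_scaleR_right _ y]) (simp add: J_simps(4)[symmetric] L_J)
  also have "ext_op L a (\<lambda>y. U (s - real n) y u) y = 0"
  proof (rule J_inj)
    have "a - 1 + 2 * (s - real n) = 0" using a by simp
    then show "J (ext_op L a (\<lambda>y. U (s - real n) y u) y) = J 0"
      using ext_op_U[of "s - real n" y a u] s y by (simp add: J_simps)
  qed
  finally have "(J ^^ n) (ext_op L a ((ext_op L a ^^ n) V) y) = (J ^^ n) 0" by (simp add: Jk_simps)
  from Jk_inj[OF this] show ?thesis by simp
qed

end

section \<open>Uniqueness of the initial value extension problems\<close>

text \<open>Integration from 0 gains one power of \<open>y\<close>: a derivative that is o(y^p) has
  an antiderivative that is o(y^(p+1)).\<close>

lemma weighted_tendsto_from_deriv: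
  fixes F :: "real \<Rightarrow> 'a::real_normed_vector"
  assumes F: "\<And>t. t > 0 \<Longrightarrow> (F has_vector_derivative f t) (at t)" "(F \<longlongrightarrow> 0) (at_right 0)"
    and f: "((\<lambda>y. y powr (- p) *\<^sub>R f y) \<longlongrightarrow> 0) (at_right 0)" and p: "p > -1"
  shows "((\<lambda>y. y powr (- (p + 1)) *\<^sub>R F y) \<longlongrightarrow> 0) (at_right 0)"
proof (rule tendstoI)
  fix e :: real assume e: "e > 0"
  \<comment> \<open>With this \<open>c\<close> the integrated bound has the constant
    \<open>c / (p + 1) = e / 2\<close>.\<close>
  define c where "c = e * (p + 1) / 2"
  have c: "c > 0" using e p by (simp add: c_def)
  have "eventually (\<lambda>y. dist (y powr (- p) *\<^sub>R f y) 0 < c) (at_right 0)" by (rule tendstoD[OF f c])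
  then obtain d where d: "d > 0" "\<And>y. 0 < y \<Longrightarrow> y < d \<Longrightarrow> norm (y powr (- p) *\<^sub>R f y) < c"
    unfolding eventually_at_right_field by auto
  have bd: "norm (f t) \<le> c * t powr p" if t: "0 < t" "t \<le> d / 2" for t
  proof -
    have "t powr p * t powr (- p) = 1" using t by (simp flip: powr_add)
    then have "norm (f t) = t powr p * (t powr (- p) * norm (f t))" by (simp only: mult.assoc[symmetric] mult_1_left)
    also have "\<dots> \<le> t powr p * c"
      using d(2)[of t] t d(1) by (intro mult_left_mono) auto
    finally show ?thesis by (simp only: mult.commute)
  qed
  show "eventually (\<lambda>y. dist (y powr (- (p + 1)) *\<^sub>R F y) 0 < e) (at_right 0)"
    unfolding eventually_at_right_field
  proof (intro exI[of _ "d / 2"] conjI allI impI)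
    show "0 < d / 2" using d(1) by simp
    fix y assume y: "0 < y" "y < d / 2"
    have "norm (F y) \<le> c * y powr (p + 1) / (p + 1)"
      by (rule norm_le_from_0[OF F bd p y(1)]) (use y in auto)
    then have "y powr (- (p + 1)) * norm (F y) \<le> y powr (- (p + 1)) * (c * y powr (p + 1) / (p + 1))"
      by (intro mult_left_mono) auto
    also have "\<dots> = (y powr (- (p + 1)) * y powr (p + 1)) * (c / (p + 1))" by simp
    also have "y powr (- (p + 1)) * y powr (p + 1) = 1" using y by (simp flip: powr_add)
    also have "1 * (c / (p + 1)) < e"
    proof -
      have "p + 1 \<noteq> 0" using p by simp
      then have "c / (p + 1) = e / 2" by (simp add: c_def field_simps)
      then show ?thesis using e by simp
    qed
    finally show "dist (y powr (- (p + 1)) *\<^sub>R F y) 0 < e" by simp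
  qed
qed

lemma Cj_two_over:
  assumes "Cj (Suc k) f" shows "Cj k (two_over_y_dy f)"
proof -
  have "Cj k (\<lambda>y. 2 *\<^sub>R (y powr (- 1) *\<^sub>R dy f y))"
    by (rule Cj_linear[OF bounded_linear_scaleR_right Cj_powr[OF Cj_dy(1)[OF assms]]])
  moreover have "Cj k (two_over_y_dy f) \<longleftrightarrow> Cj k (\<lambda>y. 2 *\<^sub>R (y powr (- 1) *\<^sub>R dy f y))"
    by (rule Cj_cong) (simp add: two_over_y_dy_def powr_minus_divide)
  ultimately show ?thesis by simp
qed

context bounded_semigroup
begin

text \<open>Formulated for two functions with equal images instead of one difference with image 0:
  \<open>L\<close> is additive only on \<open>D\<close>, and derivatives only where they exist, so
  the subtraction must be justified here.\<close>

lemma ext_op_diff_unique: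
  assumes q: "q > 0"
    and V1: "\<And>y. y > 0 \<Longrightarrow> V1 y \<in> D" "\<And>y. y > 0 \<Longrightarrow> (V1 has_vector_derivative dy V1 y) (at y)"
      "\<And>y. y > 0 \<Longrightarrow> (dy V1 has_vector_derivative dy (dy V1) y) (at y)"
    and V2: "\<And>y. y > 0 \<Longrightarrow> V2 y \<in> D" "\<And>y. y > 0 \<Longrightarrow> (V2 has_vector_derivative dy V2 y) (at y)"
      "\<And>y. y > 0 \<Longrightarrow> (dy V2 has_vector_derivative dy (dy V2) y) (at y)"
    and eq: "\<And>y. y > 0 \<Longrightarrow> ext_op L (1 - 2 * q) V1 y = ext_op L (1 - 2 * q) V2 y"
    and lim: "((\<lambda>y. V1 y - V2 y) \<longlongrightarrow> 0) (at_right 0)"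
      "((\<lambda>y. y powr (1 - 2 * q) *\<^sub>R (dy V1 y - dy V2 y)) \<longlongrightarrow> 0) (at_right 0)"
    and y: "y > 0"
  shows "V1 y = V2 y"
proof -
  have "V1 y - V2 y = 0"
  proof (rule singular_ivp_unique[OF q, where W="\<lambda>y. V1 y - V2 y" and W'="\<lambda>y. dy V1 y - dy V2 y" and W''="\<lambda>y. dy (dy V1) y - dy (dy V2) y"])
    fix y :: real assume y: "y > 0"
    show "V1 y - V2 y \<in> D" by (rule L_linear(3)[OF V1(1)[OF y] V2(1)[OF y]])
    show "((\<lambda>y. V1 y - V2 y) has_vector_derivative dy V1 y - dy V2 y) (at y)"
      by (rule has_vector_derivative_diff[OF V1(2)[OF y] V2(2)[OF y]])
    show "((\<lambda>y. dy V1 y - dy V2 y) has_vector_derivative dy (dy V1) y - dy (dy V2) y) (at y)"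
      by (rule has_vector_derivative_diff[OF V1(3)[OF y] V2(3)[OF y]])
    have "L (V1 y - V2 y) = L (V1 y) - L (V2 y)" by (rule L_linear(4)[OF V1(1)[OF y] V2(1)[OF y]])
    then show "L (V1 y - V2 y) + ((1 - 2 * q) / y) *\<^sub>R (dy V1 y - dy V2 y) + (dy (dy V1) y - dy (dy V2) y) = 0"
      using eq[OF y] unfolding ext_op_def by (simp add: scaleR_diff_right) (simp add: algebra_simps)
  qed (fact lim y)+
  then show ?thesis by simp
qed

text \<open>The regularity part of \<open>classical_eq\<close>, isolated because each application of
  the operator lowers \<open>N\<close> by exactly one.\<close>

definition Hcls :: "nat \<Rightarrow> (real \<Rightarrow> 'a) \<Rightarrow> bool" where
  "Hcls N V \<longleftrightarrow> (\<forall>k\<le>N. Cn_pow_dom (2 * (N - k)) D L k V)"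

lemma Hcls_obtain:
  assumes "Hcls N V" "k \<le> N"
  obtains g where "Cj (2 * (N - k)) g" "\<forall>y>0. V y = (J ^^ k) (g y)"
proof -
  have "Cn_pow_dom (2 * (N - k)) D L k V" using assms unfolding Hcls_def by blast
  then show thesis using that unfolding Cn_pow_dom_iff by (elim exE conjE)
qed

lemma Hcls_D:
  assumes "Hcls (Suc N) V" "y > 0"
  shows "V y \<in> D" "(V has_vector_derivative dy V y) (at y)" "(dy V has_vector_derivative dy (dy V) y) (at y)"
proof -
  obtain g where g: "Cj (2 * (Suc N - 0)) g" "\<forall>y>0. V y = (J ^^ 0) (g y)"
    by (rule Hcls_obtain[OF assms(1), of 0]) auto
  have "Cj (2 * Suc N) V \<longleftrightarrow> Cj (2 * Suc N) g" by (rule Cj_cong) (use g(2) in simp)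
  then have "Cj (Suc (Suc 0)) V" using g(1) Cj_mono[of "Suc (Suc 0)" "2 * Suc N" V] by simp
  note C = Cj_dy[OF this]
  show "(V has_vector_derivative dy V y) (at y)" by (rule C(2)[OF assms(2)])
  show "(dy V has_vector_derivative dy (dy V) y) (at y)" by (rule Cj_dy(2)[OF C(1) assms(2)])
  obtain h where h: "Cj (2 * (Suc N - 1)) h" "\<forall>y>0. V y = (J ^^ 1) (h y)"
    by (rule Hcls_obtain[OF assms(1), of 1]) auto
  show "V y \<in> D" using h(2) assms(2) J_in_D by simp
qed

text \<open>Write \<open>V\<close> as \<open>J ^^ k\<close> of some \<open>g\<close> and as
  \<open>J ^^ Suc k\<close> of some \<open>h\<close>. The derivatives come from \<open>g\<close>, at
  a cost of two orders, and \<open>L (V y)\<close> is \<open>(J ^^ k) (h y)\<close>.\<close>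

lemma Hcls_ext_op:
  assumes "Hcls (Suc N) V" shows "Hcls N (ext_op L a V)"
  unfolding Hcls_def
proof (intro allI impI)
  fix k assume k: "k \<le> N"
  obtain g where g: "Cj (2 * (Suc N - k)) g" "\<forall>y>0. V y = (J ^^ k) (g y)"
    by (rule Hcls_obtain[OF assms, of k]) (use k in auto)
  obtain h where h: "Cj (2 * (Suc N - Suc k)) h" "\<forall>y>0. V y = (J ^^ Suc k) (h y)"
    by (rule Hcls_obtain[OF assms, of "Suc k"]) (use k in auto)
  have "2 * (Suc N - k) = Suc (Suc (2 * (N - k)))" using k by simp
  then have g2: "Cj (Suc (Suc (2 * (N - k)))) g" using g(1) by (simp only:)
  have h2: "Cj (2 * (N - k)) h" using h(1) by simp
  note g1 = Cj_dy(1)[OF g2]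
  let ?G = "\<lambda>y. h y + a *\<^sub>R (y powr (- 1) *\<^sub>R dy g y) + dy (dy g) y"
  have "Cj (2 * (N - k)) ?G"
    by (rule Cj_add[OF Cj_add[OF h2 Cj_linear[OF bounded_linear_scaleR_right Cj_powr[OF Cj_Suc_imp[OF g1]]]] Cj_dy(1)[OF g1]])
  moreover have "\<forall>y>0. ext_op L a V y = (J ^^ k) (?G y)"
  proof (intro allI impI)
    fix y :: real assume y: "y > 0"
    have d1: "dy V z = (J ^^ k) (dy g z)" if z: "z > 0" for z
    proof -
      have "dy V z = dy (\<lambda>y. (J ^^ k) (g y)) z" by (rule dy_cong[OF _ z]) (use g(2) in simp)
      also have "\<dots> = (J ^^ k) (dy g z)" by (rule dy_linear[OF Cj_dy(2)[OF g2] Jk_linear z])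
      finally show ?thesis .
    qed
    have "dy (dy V) y = dy (\<lambda>y. (J ^^ k) (dy g y)) y" by (rule dy_cong[OF d1 y])
    also have "\<dots> = (J ^^ k) (dy (dy g) y)" by (rule dy_linear[OF Cj_dy(2)[OF g1] Jk_linear y])
    finally have d2: "dy (dy V) y = (J ^^ k) (dy (dy g) y)" .
    have "V y = (J ^^ k) (J (h y))" using h(2) y by (simp only: Jk_Suc)
    then have l: "L (V y) = (J ^^ k) (h y)" by (simp only: Jk_commutes)
    show "ext_op L a V y = (J ^^ k) (?G y)"
      unfolding ext_op_def d1[OF y] d2 l using y by (simp add: Jk_simps powr_minus_divide)
  qed
  ultimately show "Cn_pow_dom (2 * (N - k)) D L k (ext_op L a V)"
    unfolding Cn_pow_dom_iff by (intro exI conjI)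
qed

lemma Hcls_iter: "Hcls (N + m) V \<Longrightarrow> Hcls N ((ext_op L a ^^ m) V)"
proof (induction m arbitrary: N)
  case (Suc m)
  have "Hcls (Suc N) ((ext_op L a ^^ m) V)" by (rule Suc.IH) (use Suc.prems in simp)
  from Hcls_ext_op[OF this, of a] show ?case by simp
qed simp

text \<open>Downward induction on the iterates. Those of order \<open>n + 1\<close> vanish for both
  solutions. If the iterates of order \<open>m + 1\<close> agree, those of order \<open>m\<close>
  solve the same second order equation with parameter \<open>s - n\<close> and have the same initial
  data.\<close>

lemma higher_order_ivp_unique:
  assumes s: "s > 0" "s \<notin> \<int>" and V: "higher_order_ivp D L s u V1" "higher_order_ivp D L s u V2" and y: "y > 0"
  shows "V1 y = V2 y"
proof -
  define n where "n = nat \<lfloor>s\<rfloor>"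
  define a where "a = 1 - 2 * (s - real n)"
  have fl: "real n = of_int \<lfloor>s\<rfloor>" using s by (simp add: n_def)
  have "of_int \<lfloor>s\<rfloor> \<noteq> s" using s(2) Ints_of_int by metis
  with of_int_floor_le[of s] have "of_int \<lfloor>s\<rfloor> < s" by linarith
  then have q: "s - real n > 0" by (simp add: fl)
  have V': "Hcls (n + 1) W" "\<And>y. y > 0 \<Longrightarrow> (ext_op L a ^^ (n + 1)) W y = 0"
    "\<And>m. m \<le> n \<Longrightarrow> ((ext_op L a ^^ m) W \<longlongrightarrow> (fact n * Gamma (s - real m) / (fact (n - m) * Gamma s)) *\<^sub>R (L ^^ m) u) (at_right 0)"
    "\<And>m. m \<le> n \<Longrightarrow> ((\<lambda>y. y powr a *\<^sub>R dy ((ext_op L a ^^ m) W) y) \<longlongrightarrow>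
        (if m < n then 0 else (c_const s * fact n) *\<^sub>R neg_frac_power D L s u)) (at_right 0)"
    if W: "higher_order_ivp D L s u W" for W
  proof -
    note W' = W[unfolded higher_order_ivp_def Let_def, folded n_def, folded a_def]
    show "Hcls (n + 1) W" using W' unfolding classical_eq_def Hcls_def by blast
    show "(ext_op L a ^^ (n + 1)) W y = 0" if "y > 0" for y using W' that unfolding classical_eq_def by blast
    show "((ext_op L a ^^ m) W \<longlongrightarrow> (fact n * Gamma (s - real m) / (fact (n - m) * Gamma s)) *\<^sub>R (L ^^ m) u) (at_right 0)"
      if "m \<le> n" for m using W' that by blast
    show "((\<lambda>y. y powr a *\<^sub>R dy ((ext_op L a ^^ m) W) y) \<longlongrightarrow>
        (if m < n then 0 else (c_const s * fact n) *\<^sub>R neg_frac_power D L s u)) (at_right 0)" if "m \<le> n" for m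
    proof (cases "m < n")
      case True
      then show ?thesis using W' by simp
    next
      case False
      then have "m = n" using that by simp
      then show ?thesis using W' by simp
    qed
  qed
  have claim: "\<forall>y>0. (ext_op L a ^^ (n + 1 - j)) V1 y = (ext_op L a ^^ (n + 1 - j)) V2 y" if "j \<le> n + 1" for j
    using that
  proof (induction j)
    case 0
    then show ?case using V'(2)[OF V(1)] V'(2)[OF V(2)] by simp
  next
    case (Suc j)
    define m where "m = n - j"
    have m: "m \<le> n" "n + 1 - Suc j = m" "n + 1 - j = Suc m" "Suc 0 + (n - m) + m = n + 1"
      using Suc.prems by (auto simp: m_def)
    have H: "Hcls (Suc (n - m)) ((ext_op L a ^^ m) W)" if "higher_order_ivp D L s u W" for W
      by (rule Hcls_iter) (use V'(1)[OF that] m in simp)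
    have "(ext_op L a ^^ m) V1 y = (ext_op L a ^^ m) V2 y" if y: "y > 0" for y
    proof (rule ext_op_diff_unique[OF q _ _ _ _ _ _ _ _ _ y])
      fix y :: real assume y: "y > 0"
      show "(ext_op L a ^^ m) V1 y \<in> D" "((ext_op L a ^^ m) V1 has_vector_derivative dy ((ext_op L a ^^ m) V1) y) (at y)"
        "(dy ((ext_op L a ^^ m) V1) has_vector_derivative dy (dy ((ext_op L a ^^ m) V1)) y) (at y)"
        by (rule Hcls_D[OF H[OF V(1)] y])+
      show "(ext_op L a ^^ m) V2 y \<in> D" "((ext_op L a ^^ m) V2 has_vector_derivative dy ((ext_op L a ^^ m) V2) y) (at y)"
        "(dy ((ext_op L a ^^ m) V2) has_vector_derivative dy (dy ((ext_op L a ^^ m) V2)) y) (at y)"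
        by (rule Hcls_D[OF H[OF V(2)] y])+
      have "(ext_op L a ^^ Suc m) V1 y = (ext_op L a ^^ Suc m) V2 y"
        using Suc.IH[OF Suc_leD[OF Suc.prems]] y unfolding m(3) by blast
      then show "ext_op L (1 - 2 * (s - real n)) ((ext_op L a ^^ m) V1) y = ext_op L (1 - 2 * (s - real n)) ((ext_op L a ^^ m) V2) y"
        by (simp add: a_def)
    next
      show "((\<lambda>y. (ext_op L a ^^ m) V1 y - (ext_op L a ^^ m) V2 y) \<longlongrightarrow> 0) (at_right 0)"
        using tendsto_diff[OF V'(3)[OF V(1) m(1)] V'(3)[OF V(2) m(1)]] by simp
      show "((\<lambda>y. y powr (1 - 2 * (s - real n)) *\<^sub>R (dy ((ext_op L a ^^ m) V1) y - dy ((ext_op L a ^^ m) V2) y)) \<longlongrightarrow> 0) (at_right 0)"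
        using tendsto_diff[OF V'(4)[OF V(1) m(1)] V'(4)[OF V(2) m(1)]]
        by (simp only: a_def[symmetric] scaleR_diff_right diff_self)
    qed
    then show ?case unfolding m(2) by blast
  qed
  from claim[of "n + 1"] y show ?thesis by simp
qed

text \<open>Uniqueness at parameter \<open>s\<close> needs the derivative of the difference to
  vanish against the weight \<open>y powr (1 - 2 * s)\<close>. Starting from the prescribed limit at
  \<open>m = n\<close>, each integration lowers the exponent of the weight by 2, until
  \<open>m = 0\<close> is reached.\<close>

lemma second_order_ivp_unique:
  assumes s: "s > 0" "s \<notin> \<int>" and V: "second_order_ivp D L s u V1" "second_order_ivp D L s u V2" and y: "y > 0"
  shows "V1 y = V2 y"
proof -
  define n where "n = nat \<lfloor>s\<rfloor>"
  define a where "a = 1 - 2 * (s - real n)"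
  have fl: "real n = of_int \<lfloor>s\<rfloor>" using s by (simp add: n_def)
  have "of_int \<lfloor>s\<rfloor> \<noteq> s" using s(2) Ints_of_int by metis
  with of_int_floor_le[of s] have "of_int \<lfloor>s\<rfloor> < s" by linarith
  then have q: "s - real n > 0" by (simp add: fl)
  have V': "Hcls 1 W" "Cj (n + 1) W" "\<And>y. y > 0 \<Longrightarrow> ext_op L (1 - 2 * s) W y = 0"
    "\<And>m. m \<le> n \<Longrightarrow> ((two_over_y_dy ^^ m) W \<longlongrightarrow> (Gamma (s - real m) / Gamma s) *\<^sub>R (L ^^ m) u) (at_right 0)"
    "((\<lambda>y. y powr a *\<^sub>R dy ((two_over_y_dy ^^ n) W) y) \<longlongrightarrow> c_const s *\<^sub>R neg_frac_power D L s u) (at_right 0)"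
    if W: "second_order_ivp D L s u W" for W
  proof -
    note W' = W[unfolded second_order_ivp_def Let_def, folded n_def, folded a_def]
    show "Hcls 1 W" using W' unfolding classical_eq_def Hcls_def by blast
    show "Cj (n + 1) W" using W' unfolding classical_eq_def Cn_into_UNIV_iff by blast
    show "ext_op L (1 - 2 * s) W y = 0" if "y > 0" for y using W' that unfolding classical_eq_def by simp
    show "((two_over_y_dy ^^ m) W \<longlongrightarrow> (Gamma (s - real m) / Gamma s) *\<^sub>R (L ^^ m) u) (at_right 0)"
      if "m \<le> n" for m using W' that by blast
    show "((\<lambda>y. y powr a *\<^sub>R dy ((two_over_y_dy ^^ n) W) y) \<longlongrightarrow> c_const s *\<^sub>R neg_frac_power D L s u) (at_right 0)"
      using W' by blast
  qed
  have Cm: "Cj (Suc (n - m)) ((two_over_y_dy ^^ m) W)" if "second_order_ivp D L s u W" "m \<le> n" for W m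
    using that(2)
  proof (induction m)
    case 0
    then show ?case using V'(2)[OF that(1)] by simp
  next
    case (Suc m)
    then have "Cj (Suc (n - m)) ((two_over_y_dy ^^ m) W)" by simp
    moreover have "n - m = Suc (n - Suc m)" using Suc.prems by simp
    ultimately have "Cj (Suc (Suc (n - Suc m))) ((two_over_y_dy ^^ m) W)" by (simp only:)
    from Cj_two_over[OF this] show ?case by simp
  qed
  let ?d = "\<lambda>m y. dy ((two_over_y_dy ^^ m) V1) y - dy ((two_over_y_dy ^^ m) V2) y"
  let ?W = "\<lambda>m y. (two_over_y_dy ^^ m) V1 y - (two_over_y_dy ^^ m) V2 y"
  have claim: "((\<lambda>y. y powr (1 - 2 * (s - real (n - j))) *\<^sub>R ?d (n - j) y) \<longlongrightarrow> 0) (at_right 0)" if "j \<le> n" for j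
    using that
  proof (induction j)
    case 0
    show ?case
      using tendsto_diff[OF V'(5)[OF V(1)] V'(5)[OF V(2)]] unfolding a_def by (simp add: scaleR_diff_right)
  next
    case (Suc j)
    define m where "m = n - Suc j"
    have m: "n - j = Suc m" "Suc m \<le> n" using Suc.prems by (auto simp: m_def)
    \<comment> \<open>By induction \<open>?d (Suc m)\<close> is o(y^p), so \<open>?W (Suc m)\<close>
      is o(y^(p+1)). As \<open>?W (Suc m) y\<close> is \<open>2 / y\<close> times
      \<open>?d m y\<close>, the latter is o(y^(p+2)), and
      \<open>p + 2 = 2 * (s - real m) - 1\<close>.\<close>
    define p where "p = 2 * (s - real (Suc m)) - 1"
    have p: "p > -1" using q m(2) by (simp add: p_def)
    have "((\<lambda>y. y powr (- (p + 1)) *\<^sub>R ?W (Suc m) y) \<longlongrightarrow> 0) (at_right 0)"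
    proof (rule weighted_tendsto_from_deriv[OF _ _ _ p])
      show "((\<lambda>y. ?W (Suc m) y) has_vector_derivative ?d (Suc m) t) (at t)" if "t > 0" for t
        by (rule has_vector_derivative_diff[OF Cj_dy(2)[OF Cm[OF V(1) m(2)] that] Cj_dy(2)[OF Cm[OF V(2) m(2)] that]])
      show "((\<lambda>y. ?W (Suc m) y) \<longlongrightarrow> 0) (at_right 0)"
        using tendsto_diff[OF V'(4)[OF V(1) m(2)] V'(4)[OF V(2) m(2)]] by simp
      have "- p = 1 - 2 * (s - real (n - j))" by (simp add: p_def m(1))
      then show "((\<lambda>y. y powr (- p) *\<^sub>R ?d (Suc m) y) \<longlongrightarrow> 0) (at_right 0)"
        using Suc unfolding m(1) by simp
    qed
    from tendsto_scaleR[OF tendsto_const[of "1/2"] this]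
    have "((\<lambda>y. (1/2) *\<^sub>R (y powr (- (p + 1)) *\<^sub>R ?W (Suc m) y)) \<longlongrightarrow> 0) (at_right 0)" by simp
    moreover have "\<forall>\<^sub>F y in at_right 0. (1/2) *\<^sub>R (y powr (- (p + 1)) *\<^sub>R ?W (Suc m) y) = y powr (1 - 2 * (s - real m)) *\<^sub>R ?d m y"
    proof -
      have "(1/2) *\<^sub>R (y powr (- (p + 1)) *\<^sub>R ?W (Suc m) y) = y powr (1 - 2 * (s - real m)) *\<^sub>R ?d m y" if y: "y > 0" for y
      proof -
        have e: "- (p + 1) = 1 - 2 * (s - real m) + 1" by (simp add: p_def)
        have "y powr (- (p + 1)) = y powr (1 - 2 * (s - real m)) * y" unfolding e using y by (subst powr_add) simp
        moreover have "?W (Suc m) y = (2 / y) *\<^sub>R ?d m y" by (simp add: two_over_y_dy_def scaleR_diff_right)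
        ultimately show ?thesis using y by simp
      qed
      then show ?thesis by (simp add: eventually_at_filter)
    qed
    ultimately have "((\<lambda>y. y powr (1 - 2 * (s - real m)) *\<^sub>R ?d m y) \<longlongrightarrow> 0) (at_right 0)"
      by (rule Lim_transform_eventually)
    then show ?case by (simp only: m_def)
  qed
  show ?thesis
  proof (rule ext_op_diff_unique[OF s(1) _ _ _ _ _ _ _ _ _ y])
    fix y :: real assume y: "y > 0"
    have H: "Hcls (Suc 0) V1" "Hcls (Suc 0) V2" using V'(1)[OF V(1)] V'(1)[OF V(2)] by simp_all
    show "V1 y \<in> D" "(V1 has_vector_derivative dy V1 y) (at y)" "(dy V1 has_vector_derivative dy (dy V1) y) (at y)"
      by (rule Hcls_D[OF H(1) y])+
    show "V2 y \<in> D" "(V2 has_vector_derivative dy V2 y) (at y)" "(dy V2 has_vector_derivative dy (dy V2) y) (at y)"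
      by (rule Hcls_D[OF H(2) y])+
    show "ext_op L (1 - 2 * s) V1 y = ext_op L (1 - 2 * s) V2 y" using V'(3)[OF V(1) y] V'(3)[OF V(2) y] by simp
  next
    show "((\<lambda>y. V1 y - V2 y) \<longlongrightarrow> 0) (at_right 0)"
      using tendsto_diff[OF V'(4)[OF V(1), of 0] V'(4)[OF V(2), of 0]] by simp
    show "((\<lambda>y. y powr (1 - 2 * s) *\<^sub>R (dy V1 y - dy V2 y)) \<longlongrightarrow> 0) (at_right 0)"
      using claim[of n] by simp
  qed
qed

end

section \<open>The expansion in terms of the fractional power\<close>

lemma eq_limit_at_0:
  fixes F :: "real \<Rightarrow> 'a::real_normed_vector"
  assumes F: "\<And>t. t > 0 \<Longrightarrow> (F has_vector_derivative 0) (at t)" and l: "(F \<longlongrightarrow> l) (at_right 0)" and y: "y > 0"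
  shows "F y = l"
proof -
  have "\<forall>\<^sub>F z in at_right 0. F z = F y"
    using constant_on_pos[OF F _ y] by (simp add: eventually_at_filter)
  then have "(F \<longlongrightarrow> F y) (at_right 0)" by (rule tendsto_eventually)
  from tendsto_unique[OF _ this l] show ?thesis by simp
qed

section \<open>Taylor remainders of the exponential\<close>

definition exp_rem :: "nat \<Rightarrow> real \<Rightarrow> real" where
  "exp_rem n z = exp (- z) - (\<Sum>k=0..n. (- z) ^ k / fact k)"

lemma exp_rem_deriv:
  "(exp_rem (Suc n) has_real_derivative - exp_rem n z) (at z)"
  "(exp_rem 0 has_real_derivative - exp (- z)) (at z)"
proof -
  have d: "((\<lambda>z. (- z) ^ Suc k / fact (Suc k)) has_real_derivative - ((- z) ^ k / fact k)) (at z)" for k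
  proof -
    have "((\<lambda>z. (- z) ^ Suc k) has_real_derivative - (real (Suc k) * (- z) ^ k)) (at z)"
      by (auto intro!: derivative_eq_intros simp del: power_Suc)
    from DERIV_cdivide[OF this, of "fact (Suc k)"]
    show ?thesis by (rule DERIV_cong) (simp add: divide_simps del: of_nat_Suc)
  qed
  have "((\<lambda>z. exp (- z) - (\<Sum>k=0..n. (- z) ^ Suc k / fact (Suc k)) - 1) has_real_derivative
      - exp (- z) - (\<Sum>k=0..n. - ((- z) ^ k / fact k)) - 0) (at z)"
    by (intro DERIV_diff DERIV_sum d) (auto intro!: derivative_eq_intros)
  moreover have "exp_rem (Suc n) = (\<lambda>z. exp (- z) - (\<Sum>k=0..n. (- z) ^ Suc k / fact (Suc k)) - 1)"
    unfolding exp_rem_def by (rule ext) (subst sum.atLeast0_atMost_Suc_shift, simp)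
  moreover have "- exp (- z) - (\<Sum>k=0..n. - ((- z) ^ k / fact k)) - 0 = - exp_rem n z"
    by (simp add: exp_rem_def sum_negf)
  ultimately show "(exp_rem (Suc n) has_real_derivative - exp_rem n z) (at z)" by simp
  have "((\<lambda>z. exp (- z) - 1) has_real_derivative - exp (- z)) (at z)" by (auto intro!: derivative_eq_intros)
  moreover have "exp_rem 0 = (\<lambda>z. exp (- z) - 1)" unfolding exp_rem_def by (rule ext) simp
  ultimately show "(exp_rem 0 has_real_derivative - exp (- z)) (at z)" by simp
qed

lemma exp_rem_cont: "continuous_on S (exp_rem n)"
  unfolding exp_rem_def by (intro continuous_intros) auto

lemma exp_rem_0: "exp_rem n 0 = 0"
  unfolding exp_rem_def by (subst sum.atLeast_Suc_atMost) (auto simp: power_0_left)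

text \<open>The bound for \<open>n\<close> is integrated from 0, where every remainder vanishes; the
  factorials are given away, as only the power matters.\<close>

lemma exp_rem_bound1: "z \<ge> 0 \<Longrightarrow> \<bar>exp_rem n z\<bar> \<le> z ^ Suc n"
proof (induction n arbitrary: z)
  case 0
  have "1 - z \<le> exp (- z)" "exp (- z) \<le> 1" using exp_ge_add_one_self[of "- z"] 0 by auto
  then show ?case by (simp add: exp_rem_def)
next
  case (Suc n)
  show ?case
  proof (cases "z = 0")
    case False
    then have z: "0 < z" using Suc.prems by simp
    have "norm (exp_rem (Suc n) z - exp_rem (Suc n) 0) \<le> (z ^ Suc n) * z - (z ^ Suc n) * 0"
    proof (rule differentiable_bound_general[OF z exp_rem_cont])
      show "continuous_on {0..z} (\<lambda>x. (z ^ Suc n) * x)" by (intro continuous_intros)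
      fix x assume x: "0 < x" "x < z"
      show "(exp_rem (Suc n) has_vector_derivative - exp_rem n x) (at x)"
        using exp_rem_deriv(1) by (simp add: has_real_derivative_iff_has_vector_derivative)
      show "((*) (z ^ Suc n) has_vector_derivative (z ^ Suc n)) (at x)"
        unfolding has_real_derivative_iff_has_vector_derivative[symmetric] by (auto intro!: derivative_eq_intros)
      have "\<bar>exp_rem n x\<bar> \<le> x ^ Suc n" using Suc.IH x by simp
      also have "\<dots> \<le> z ^ Suc n" using x by (intro power_mono) auto
      finally show "norm (- exp_rem n x) \<le> z ^ Suc n" by simp
    qed
    then show ?thesis by (simp add: exp_rem_0 mult.commute)
  qed (simp add: exp_rem_0)
qed

text \<open>Moving the last Taylor term out of the remainder costs one power less than
  \<open>exp_rem_bound1\<close>, which is the better estimate for large \<open>z\<close>.\<close>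

lemma exp_rem_bound2: "z \<ge> 0 \<Longrightarrow> \<bar>exp_rem n z\<bar> \<le> 2 * z ^ n"
proof (cases n)
  case 0
  assume "z \<ge> 0"
  then have "0 \<le> exp (- z)" "exp (- z) \<le> 1" by auto
  then have "\<bar>exp (- z) - 1\<bar> \<le> 2" by linarith
  then show ?thesis using 0 by (simp add: exp_rem_def)
next
  case (Suc m)
  assume z: "z \<ge> 0"
  have "exp_rem (Suc m) z = exp_rem m z - (- z) ^ Suc m / fact (Suc m)"
    by (simp add: exp_rem_def)
  then have "\<bar>exp_rem (Suc m) z\<bar> \<le> \<bar>exp_rem m z\<bar> + \<bar>(- z) ^ Suc m / fact (Suc m)\<bar>"
    using abs_triangle_ineq4[of "exp_rem m z" "(- z) ^ Suc m / fact (Suc m)"] by (simp only:)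
  also have "\<bar>(- z) ^ Suc m / fact (Suc m)\<bar> = z ^ Suc m / fact (Suc m)"
    using z by (simp add: abs_divide power_abs del: fact_Suc power_Suc)
  also have "\<dots> \<le> z ^ Suc m / 1" using z by (intro divide_left_mono) (auto simp: fact_ge_1 simp del: fact_Suc)
  finally show ?thesis using exp_rem_bound1[OF z, of m] Suc by simp
qed

definition rem_kernel :: "nat \<Rightarrow> real \<Rightarrow> real \<Rightarrow> real \<Rightarrow> real" where
  "rem_kernel n s y t = exp_rem n (y\<^sup>2 / (4 * t)) * t powr (s - 1)"

lemma rem_kernel_eq:
  "rem_kernel n s y t = (exp (- y\<^sup>2 / (4 * t)) - (\<Sum>k=0..n. (-1) ^ k * y ^ (2 * k) / (fact k * (4 * t) ^ k))) / t powr (1 - s)"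
proof -
  have "(- (y\<^sup>2 / (4 * t))) ^ k / fact k = (-1) ^ k * y ^ (2 * k) / (fact k * (4 * t) ^ k)" for k
  proof -
    have e: "(y\<^sup>2) ^ k = y ^ (2 * k)" by (simp only: power_mult)
    show ?thesis
      by (subst power_minus) (simp only: power_divide e times_divide_eq_right divide_divide_eq_left mult.commute[of "fact k :: real"])
  qed
  moreover have "t powr (s - 1) = 1 / t powr (1 - s)" by (simp flip: powr_minus_divide)
  ultimately show ?thesis by (simp add: rem_kernel_def exp_rem_def)
qed

lemma rem_kernel_cont: "continuous_on {0<..} (rem_kernel n s y)"
proof -
  have "continuous_on {0<..} (\<lambda>t. exp_rem n (y\<^sup>2 / (4 * t)))"
    by (rule continuous_on_compose2[OF exp_rem_cont[of UNIV]]) (auto intro!: continuous_intros)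
  then show ?thesis unfolding rem_kernel_def by (intro continuous_intros) auto
qed

text \<open>Small \<open>t\<close> means large \<open>z\<close>, and conversely; so the second
  remainder bound serves near \<open>t = 0\<close> and the first near infinity. For
  \<open>0 < \<sigma> < 1\<close> the resulting powers are integrable at these ends, which is why
  the Taylor sum stops exactly at \<open>n\<close>. The parameter \<open>Y\<close> makes the bounds
  uniform in \<open>y\<close>.\<close>

lemma rem_kernel_bounds:
  assumes "t > 0" "0 \<le> y" "y \<le> Y" "s = \<sigma> + real n"
  shows "\<bar>rem_kernel n s y t\<bar> \<le> (2 * (Y\<^sup>2 / 4) ^ n) * t powr (\<sigma> - 1)"
    "\<bar>rem_kernel n s y t\<bar> \<le> ((Y\<^sup>2 / 4) ^ Suc n) * t powr (\<sigma> - 2)"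
proof -
  define z Z where "z = y\<^sup>2 / (4 * t)" and "Z = Y\<^sup>2 / (4 * t)"
  have zZ: "0 \<le> z" "z \<le> Z"
    unfolding z_def Z_def using assms by (auto intro!: divide_right_mono power_mono)
  have p: "t powr (s - 1) = t ^ n * t powr (\<sigma> - 1)"
  proof -
    have "s - 1 = real n + (\<sigma> - 1)" using assms by simp
    then show ?thesis using assms(1) by (simp only: powr_add powr_realpow)
  qed
  have "\<bar>exp_rem n z\<bar> * t powr (s - 1) \<le> (2 * Z ^ n) * t powr (s - 1)"
    by (intro mult_right_mono order_trans[OF exp_rem_bound2[OF zZ(1)]] mult_left_mono power_mono zZ) auto
  also have "\<dots> = (2 * (Y\<^sup>2 / 4) ^ n) * t powr (\<sigma> - 1)"
    unfolding p Z_def using assms(1) by (simp add: power_divide power_mult_distrib)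
  finally show "\<bar>rem_kernel n s y t\<bar> \<le> (2 * (Y\<^sup>2 / 4) ^ n) * t powr (\<sigma> - 1)"
    by (simp add: rem_kernel_def abs_mult z_def)
  have p2: "t powr (\<sigma> - 1) = t * t powr (\<sigma> - 2)" using powr_mult_base[of t "\<sigma> - 2"] assms(1) by simp
  have "\<bar>exp_rem n z\<bar> * t powr (s - 1) \<le> (Z ^ Suc n) * t powr (s - 1)"
    by (intro mult_right_mono order_trans[OF exp_rem_bound1[OF zZ(1)]] power_mono zZ) auto
  also have "\<dots> = ((Y\<^sup>2 / 4) ^ Suc n) * t powr (\<sigma> - 2)"
    unfolding p p2 Z_def using assms(1) by (simp add: power_divide power_mult_distrib)
  finally show "\<bar>rem_kernel n s y t\<bar> \<le> ((Y\<^sup>2 / 4) ^ Suc n) * t powr (\<sigma> - 2)"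
    by (simp add: rem_kernel_def abs_mult z_def)
qed

lemma rem_kernel_absint:
  assumes "0 < \<sigma>" "\<sigma> < 1" "s = \<sigma> + real n" "y > 0"
  shows "hl_absint (rem_kernel n s y)"
proof (rule hl_absint_powr_bound[OF rem_kernel_cont])
  show "norm (rem_kernel n s y t) \<le> (2 * (y\<^sup>2 / 4) ^ n) * t powr (\<sigma> - 1)" if "0 < t" for t
    using rem_kernel_bounds(1)[OF that _ order_refl assms(3)] assms by simp
  show "norm (rem_kernel n s y t) \<le> ((y\<^sup>2 / 4) ^ Suc n) * t powr (\<sigma> - 2)" if "t \<ge> 1" for t
    using rem_kernel_bounds(2)[OF _ _ order_refl assms(3), of t y] assms that by simp
qed (use assms in auto)

text \<open>Differentiation in \<open>y\<close> lowers the order and \<open>s\<close> together, so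
  \<open>s - n\<close> is preserved; this drives the induction for the expansion. At order 0 the
  full exponential appears.\<close>

lemma rem_kernel_deriv:
  assumes "t > 0"
  shows "((\<lambda>y. rem_kernel (Suc n) s y t) has_real_derivative - (y / 2) * rem_kernel n (s - 1) y t) (at y)"
    "((\<lambda>y. rem_kernel 0 s y t) has_real_derivative - (y / 2) * (exp (- (y\<^sup>2 / (4 * t))) * t powr (s - 2))) (at y)"
proof -
  have d: "((\<lambda>y. y\<^sup>2 / (4 * t)) has_real_derivative y / (2 * t)) (at y)"
    using assms by (auto intro!: derivative_eq_intros)
  have p: "t powr (s - 1) = t * t powr (s - 2)" using powr_mult_base[of t "s - 2"] assms by simp
  have "((\<lambda>y. rem_kernel (Suc n) s y t) has_real_derivative (- exp_rem n (y\<^sup>2 / (4 * t)) * (y / (2 * t))) * t powr (s - 1)) (at y)"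
    unfolding rem_kernel_def by (intro DERIV_cmult_right DERIV_chain2[OF exp_rem_deriv(1) d])
  moreover have "(- exp_rem n (y\<^sup>2 / (4 * t)) * (y / (2 * t))) * t powr (s - 1) = - (y / 2) * rem_kernel n (s - 1) y t"
    unfolding rem_kernel_def p using assms by simp
  ultimately show "((\<lambda>y. rem_kernel (Suc n) s y t) has_real_derivative - (y / 2) * rem_kernel n (s - 1) y t) (at y)" by (simp only:)
  have "((\<lambda>y. rem_kernel 0 s y t) has_real_derivative (- exp (- (y\<^sup>2 / (4 * t))) * (y / (2 * t))) * t powr (s - 1)) (at y)"
    unfolding rem_kernel_def by (intro DERIV_cmult_right DERIV_chain2[OF exp_rem_deriv(2) d])
  moreover have "(- exp (- (y\<^sup>2 / (4 * t))) * (y / (2 * t))) * t powr (s - 1) = - (y / 2) * (exp (- (y\<^sup>2 / (4 * t))) * t powr (s - 2))"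
    unfolding p using assms by simp
  ultimately show "((\<lambda>y. rem_kernel 0 s y t) has_real_derivative - (y / 2) * (exp (- (y\<^sup>2 / (4 * t))) * t powr (s - 2))) (at y)" by (simp only:)
qed

lemma exp_rem_weight_absint:
  assumes "0 < \<sigma>" "\<sigma> < 1" "s = \<sigma> + real n"
  shows "hl_absint (\<lambda>r. exp_rem n r / r powr (1 + s))"
proof (rule hl_absint_powr_bound[where a="- \<sigma>" and b="- 1 - \<sigma>" and C=1 and K=2])
  show "continuous_on {0<..} (\<lambda>r. exp_rem n r / r powr (1 + s))"
    by (intro continuous_intros exp_rem_cont) auto
  have p: "r powr (1 + s) = r ^ Suc n * r powr \<sigma>" if "r > 0" for r :: real
  proof -
    have "1 + s = real (Suc n) + \<sigma>" using assms by simp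
    then show ?thesis using that by (simp only: powr_add powr_realpow)
  qed
  show "norm (exp_rem n r / r powr (1 + s)) \<le> 1 * r powr (- \<sigma>)" if "0 < r" "r < 1" for r
  proof -
    have "\<bar>exp_rem n r\<bar> / r powr (1 + s) \<le> r ^ Suc n / r powr (1 + s)"
      using exp_rem_bound1[of r n] that by (intro divide_right_mono) auto
    also have "\<dots> = r powr (- \<sigma>)" unfolding p[OF that(1)] using that by (simp add: powr_minus_divide)
    finally show ?thesis by simp
  qed
  show "norm (exp_rem n r / r powr (1 + s)) \<le> 2 * r powr (- 1 - \<sigma>)" if "1 \<le> r" for r
  proof -
    have r: "r > 0" using that by simp
    have "\<bar>exp_rem n r\<bar> / r powr (1 + s) \<le> (2 * r ^ n) / r powr (1 + s)"
      using exp_rem_bound2[of r n] that by (intro divide_right_mono) auto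
    also have "\<dots> = 2 * (1 / (r * r powr \<sigma>))" unfolding p[OF r] using r by simp
    also have "1 / (r * r powr \<sigma>) = r powr (- 1 - \<sigma>)"
    proof -
      have "r powr (- 1 - \<sigma>) = 1 / r powr (1 + \<sigma>)" by (simp flip: powr_minus_divide)
      then show ?thesis using r by (simp add: powr_add)
    qed
    finally show ?thesis by simp
  qed
qed (use assms in auto)

context bounded_semigroup
begin

section \<open>The remainder integral and the expansion\<close>

definition RI :: "nat \<Rightarrow> real \<Rightarrow> real \<Rightarrow> 'a \<Rightarrow> 'a" where
  "RI n s y f = hl_integral (\<lambda>t. rem_kernel n s y t *\<^sub>R T t f)"

text \<open>The substitution \<open>r = y\<^sup>2 / (4 * t)\<close> moves \<open>y\<close> into the
  prefactor \<open>y powr (2 * s)\<close> and into the argument of \<open>T\<close>. This gives the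
  second form of the expansion and also the smallness of the remainder at 0.\<close>

lemma RI_substitution:
  assumes \<sigma>: "0 < \<sigma>" "\<sigma> < 1" "s = \<sigma> + real n" and y: "y > 0"
  shows "hl_absint (\<lambda>r. (exp_rem n r / r powr (1 + s)) *\<^sub>R T (y\<^sup>2 / (4 * r)) f)"
    "RI n s y f = (y powr (2 * s) / 4 powr s) *\<^sub>R hl_integral (\<lambda>r. (exp_rem n r / r powr (1 + s)) *\<^sub>R T (y\<^sup>2 / (4 * r)) f)"
    "norm (RI n s y f) \<le> y powr (2 * s) / 4 powr s * (M * norm f * hl_integral (\<lambda>r. \<bar>exp_rem n r / r powr (1 + s)\<bar>))"
proof -
  let ?h = "\<lambda>r. (exp_rem n r / r powr (1 + s)) *\<^sub>R T (y\<^sup>2 / (4 * r)) f"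
  note ai = exp_rem_weight_absint[OF \<sigma>]
  have cT: "continuous_on {0<..} (\<lambda>r. T (y\<^sup>2 / (4 * r)) f)"
    by (rule continuous_on_compose2[OF T_continuous]) (auto intro!: continuous_intros)
  have hb: "norm (?h r) \<le> (M * norm f) * \<bar>exp_rem n r / r powr (1 + s)\<bar>" if "r > 0" for r
    using mult_left_mono[OF T_norm[of "y\<^sup>2 / (4 * r)" f], of "\<bar>exp_rem n r / r powr (1 + s)\<bar>"] that
    by (simp add: mult.commute)
  have ai': "hl_absint (\<lambda>r. (M * norm f) *\<^sub>R \<bar>exp_rem n r / r powr (1 + s)\<bar>)"
    using hl_absint_scaleR[OF hl_absint_norm[OF ai]] by (simp only: real_norm_def)
  show h: "hl_absint ?h"
  proof (rule hl_absint_bound[of _ "\<lambda>r. (M * norm f) * \<bar>exp_rem n r / r powr (1 + s)\<bar>"])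
    show "continuous_on {0<..} ?h" by (intro continuous_on_scaleR hl_absint_cont[OF ai] cT)
    show "set_integrable lborel {0<..} (\<lambda>r. (M * norm f) * \<bar>exp_rem n r / r powr (1 + s)\<bar>)"
      using ai unfolding hl_absint_def by (intro set_integrable_mult_right) (simp only: real_norm_def)
  qed (rule hb)
  have "hl_has_integral (\<lambda>t. rem_kernel n s y t *\<^sub>R T t f) (RI n s y f)"
    unfolding RI_def by (rule hl_absint_exists(1)[OF kernel_T_absint[OF rem_kernel_absint[OF \<sigma> y]]])
  then have "hl_has_integral (\<lambda>r. - (- y\<^sup>2 / (4 * r\<^sup>2)) *\<^sub>R (rem_kernel n s y (y\<^sup>2 / (4 * r)) *\<^sub>R T (y\<^sup>2 / (4 * r)) f)) (RI n s y f)"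
  proof (rule hl_has_integral_substitution)
    show "y\<^sup>2 / (4 * t) > 0" if "t > 0" for t using y that by simp
    show "((\<lambda>t. y\<^sup>2 / (4 * t)) has_real_derivative - y\<^sup>2 / (4 * t\<^sup>2)) (at t)" if "t > 0" for t
      using that by (auto intro!: derivative_eq_intros simp: field_simps power2_eq_square)
    show "filterlim (\<lambda>t. y\<^sup>2 / (4 * t)) at_top (at_right 0)" "((\<lambda>t. y\<^sup>2 / (4 * t)) \<longlongrightarrow> 0) at_top"
      using y by real_asymp+
  qed
  also have "?this \<longleftrightarrow> hl_has_integral (\<lambda>r. (y powr (2 * s) / 4 powr s) *\<^sub>R ?h r) (RI n s y f)"
  proof (rule hl_has_integral_cong)
    fix r :: real assume r: "r > 0"
    have "y\<^sup>2 / (4 * (y\<^sup>2 / (4 * r))) = r" using y r by simp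
    then have k: "rem_kernel n s y (y\<^sup>2 / (4 * r)) = exp_rem n r * (y\<^sup>2 / (4 * r)) powr (s - 1)"
      by (simp only: rem_kernel_def)
    have "(y\<^sup>2 / (4 * r)) powr (s - 1) = (y\<^sup>2) powr s / (4 powr s * r powr s) * (4 * r / y\<^sup>2)"
      using y r by (simp add: powr_diff powr_divide powr_mult)
    moreover have "(y\<^sup>2) powr s = y powr (2 * s)" using y by (simp add: powr_powr flip: powr_numeral)
    moreover have "r powr (1 + s) = r * r powr s" using r by (simp add: powr_add)
    ultimately have "(y\<^sup>2 / (4 * r\<^sup>2)) * (exp_rem n r * (y\<^sup>2 / (4 * r)) powr (s - 1)) = (y powr (2 * s) / 4 powr s) * (exp_rem n r / r powr (1 + s))"
      using y r by (simp add: power2_eq_square) (simp add: mult_ac)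
    then show "- (- y\<^sup>2 / (4 * r\<^sup>2)) *\<^sub>R (rem_kernel n s y (y\<^sup>2 / (4 * r)) *\<^sub>R T (y\<^sup>2 / (4 * r)) f) = (y powr (2 * s) / 4 powr s) *\<^sub>R ?h r"
      unfolding k by (simp only: scaleR_scaleR minus_divide_left minus_minus)
  qed
  finally have 1: "hl_has_integral (\<lambda>r. (y powr (2 * s) / 4 powr s) *\<^sub>R ?h r) (RI n s y f)" .
  have 2: "hl_has_integral (\<lambda>r. (y powr (2 * s) / 4 powr s) *\<^sub>R ?h r) ((y powr (2 * s) / 4 powr s) *\<^sub>R hl_integral ?h)"
    by (rule hl_has_integral_scaleR[OF hl_absint_exists(1)[OF h]])
  show eq: "RI n s y f = (y powr (2 * s) / 4 powr s) *\<^sub>R hl_integral ?h" by (rule hl_has_integral_unique[OF 1 2])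
  have "norm (hl_integral ?h) \<le> hl_integral (\<lambda>r. (M * norm f) *\<^sub>R \<bar>exp_rem n r / r powr (1 + s)\<bar>)"
    by (rule hl_integral_norm_bound[OF h ai']) (use hb in simp)
  also have "\<dots> = M * norm f * hl_integral (\<lambda>r. \<bar>exp_rem n r / r powr (1 + s)\<bar>)"
    using hl_integral_scaleR[OF hl_absint_norm[OF ai], of "M * norm f"] by (simp only: real_norm_def real_scaleR_def)
  finally have "norm (hl_integral ?h) \<le> M * norm f * hl_integral (\<lambda>r. \<bar>exp_rem n r / r powr (1 + s)\<bar>)" .
  from mult_left_mono[OF this, of "y powr (2 * s) / 4 powr s"]
  show "norm (RI n s y f) \<le> y powr (2 * s) / 4 powr s * (M * norm f * hl_integral (\<lambda>r. \<bar>exp_rem n r / r powr (1 + s)\<bar>))"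
    unfolding eq norm_scaleR by simp
qed

lemma RI_tendsto:
  assumes \<sigma>: "0 < \<sigma>" "\<sigma> < 1" "s = \<sigma> + real n"
  shows "((\<lambda>y. RI n s y f) \<longlongrightarrow> 0) (at_right 0)"
proof (rule Lim_null_comparison)
  let ?K = "M * norm f * hl_integral (\<lambda>r. \<bar>exp_rem n r / r powr (1 + s)\<bar>)"
  show "\<forall>\<^sub>F y in at_right 0. norm (RI n s y f) \<le> y powr (2 * s) / 4 powr s * ?K"
    using RI_substitution(3)[OF \<sigma>] by (simp add: eventually_at_filter)
  have "s > 0" using \<sigma> by simp
  then have "((\<lambda>y. y powr (2 * s)) \<longlongrightarrow> 0) (at_right 0)" by real_asymp
  then have "((\<lambda>y. y powr (2 * s) / 4 powr s * ?K) \<longlongrightarrow> 0 / 4 powr s * ?K) (at_right 0)"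
    by (intro tendsto_intros) auto
  then show "((\<lambda>y. y powr (2 * s) / 4 powr s * ?K) \<longlongrightarrow> 0) (at_right 0)" by simp
qed

lemma RI_deriv_Suc:
  assumes \<sigma>: "0 < \<sigma>" "\<sigma> < 1" "s = \<sigma> + real (Suc n)" and y: "y > 0"
  shows "((\<lambda>y. RI (Suc n) s y f) has_vector_derivative - (y / 2) *\<^sub>R RI n (s - 1) y f) (at y)"
proof -
  have s1: "s - 1 = \<sigma> + real n" using \<sigma> by simp
  \<comment> \<open>Covers both estimates of \<open>rem_kernel_bounds\<close> for all
    \<open>z\<close> up to \<open>2 * y\<close>.\<close>
  define K where "K = max (2 * ((2 * y)\<^sup>2 / 4) ^ n) (((2 * y)\<^sup>2 / 4) ^ Suc n)"
  have K: "2 * ((2 * y)\<^sup>2 / 4) ^ n \<le> K" "((2 * y)\<^sup>2 / 4) ^ Suc n \<le> K" unfolding K_def by (rule max.cobounded1 max.cobounded2)+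
  let ?g = "\<lambda>t. (y * K * (M * norm f)) * (t powr (\<sigma> - 2) * min t 1)"
  have "((\<lambda>y. RI (Suc n) s y f) has_vector_derivative hl_integral (\<lambda>t. (- (y / 2) * rem_kernel n (s - 1) y t) *\<^sub>R T t f)) (at y)"
    unfolding RI_def
  proof (rule hl_integral_derivative[where d=y and g="?g"])
    fix z assume "z \<in> ball y y"
    then have z: "0 < z" "z \<le> 2 * y" unfolding mem_ball dist_real_def by linarith+
    show "hl_absint (\<lambda>t. rem_kernel (Suc n) s z t *\<^sub>R T t f)"
      by (intro kernel_T_absint rem_kernel_absint[OF \<sigma>] z)
    fix t :: real assume t: "t > 0"
    show "((\<lambda>y. rem_kernel (Suc n) s y t *\<^sub>R T t f) has_vector_derivative (- (z / 2) * rem_kernel n (s - 1) z t) *\<^sub>R T t f) (at z)"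
      by (rule bounded_linear.has_vector_derivative[OF bounded_linear_scaleR_left
            rem_kernel_deriv(1)[OF t, unfolded has_real_derivative_iff_has_vector_derivative]])
    have b: "\<bar>rem_kernel n (s - 1) z t\<bar> \<le> K * (t powr (\<sigma> - 2) * min t 1)"
    proof (cases "t \<le> 1")
      case True
      have "\<bar>rem_kernel n (s - 1) z t\<bar> \<le> (2 * ((2 * y)\<^sup>2 / 4) ^ n) * t powr (\<sigma> - 1)"
        by (rule rem_kernel_bounds(1)[OF t less_imp_le[OF z(1)] z(2) s1])
      also have "\<dots> \<le> K * t powr (\<sigma> - 1)" by (intro mult_right_mono K) simp
      also have "t powr (\<sigma> - 1) = t powr (\<sigma> - 2) * min t 1"
        using powr_mult_base[of t "\<sigma> - 2"] t True by (simp add: mult.commute)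
      finally show ?thesis .
    next
      case False
      have "\<bar>rem_kernel n (s - 1) z t\<bar> \<le> (((2 * y)\<^sup>2 / 4) ^ Suc n) * t powr (\<sigma> - 2)"
        by (rule rem_kernel_bounds(2)[OF t less_imp_le[OF z(1)] z(2) s1])
      also have "\<dots> \<le> K * t powr (\<sigma> - 2)" by (intro mult_right_mono K) simp
      finally show ?thesis using False by simp
    qed
    have "norm ((- (z / 2) * rem_kernel n (s - 1) z t) *\<^sub>R T t f) = (z / 2) * \<bar>rem_kernel n (s - 1) z t\<bar> * norm (T t f)"
      using z by (simp add: abs_mult)
    also have "\<dots> \<le> y * (K * (t powr (\<sigma> - 2) * min t 1)) * (M * norm f)"
      using order_trans[OF abs_ge_zero b] z t y
      by (intro mult_mono b T_norm mult_nonneg_nonneg[OF less_imp_le[OF y]]) auto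
    finally show "norm ((- (z / 2) * rem_kernel n (s - 1) z t) *\<^sub>R T t f) \<le> ?g t" by (simp only: mult_ac)
  next
    show "set_integrable lborel {0<..} ?g"
      using min_powr_absint[OF \<sigma>(1,2)] unfolding hl_absint_def
      by (intro set_integrable_mult_right) (subst (asm) set_integrable_cong[OF refl refl], auto simp: abs_mult)
    show "continuous_on {0<..} (\<lambda>t. (- (y / 2) * rem_kernel n (s - 1) y t) *\<^sub>R T t f)"
      by (intro continuous_intros rem_kernel_cont T_continuous_pos)
  qed (rule y)
  also have "hl_integral (\<lambda>t. (- (y / 2) * rem_kernel n (s - 1) y t) *\<^sub>R T t f) = - (y / 2) *\<^sub>R RI n (s - 1) y f"
    unfolding RI_def scaleR_scaleR[symmetric]
    by (rule hl_integral_scaleR[OF kernel_T_absint[OF rem_kernel_absint[OF \<sigma>(1,2) s1 y]]])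
  finally show ?thesis .
qed

text \<open>At order 0 the derivative of the kernel is a multiple of the density of index
  \<open>1 - \<sigma>\<close>. By \<open>QU_bal\<close> the result is \<open>Gamma \<sigma>\<close>
  times the derivative of \<open>U \<sigma> y (bal \<sigma> f)\<close>.\<close>

lemma RI_deriv_0:
  assumes \<sigma>: "0 < \<sigma>" "\<sigma> < 1" and y: "y > 0"
  shows "((\<lambda>y. RI 0 \<sigma> y f) has_vector_derivative
    (Gamma \<sigma> * neumann_const \<sigma> * y powr (2 * \<sigma> - 1)) *\<^sub>R U (1 - \<sigma>) y f) (at y)"
proof -
  let ?h = "\<lambda>z t. exp (- (z\<^sup>2 / (4 * t))) * t powr (\<sigma> - 2)"
  define \<kappa> where "\<kappa> z = 4 powr (1 - \<sigma>) * Gamma (1 - \<sigma>) / z powr (2 - 2 * \<sigma>)" for z :: real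
  have G: "Gamma (1 - \<sigma>) > 0" "Gamma \<sigma> > 0" using \<sigma> by (auto intro: Gamma_real_pos)
  note G0 = G[THEN less_imp_neq, THEN not_sym]
  have h: "?h z t = \<kappa> z * ext_kernel (1 - \<sigma>) z t" if "z > 0" for z t
  proof -
    have e: "2 * (1 - \<sigma>) = 2 - 2 * \<sigma>" "1 + (1 - \<sigma>) = 2 - \<sigma>" "\<sigma> - 2 = - (2 - \<sigma>)" by simp_all
    have "z powr (2 - 2 * \<sigma>) \<noteq> 0" using that by simp
    moreover have "t powr (- (2 - \<sigma>)) = 1 / t powr (2 - \<sigma>)" by (rule powr_minus_divide)
    ultimately show ?thesis unfolding \<kappa>_def ext_kernel_def e using G0 by simp
  qed
  have \<kappa>0: "\<kappa> z \<ge> 0" for z unfolding \<kappa>_def using G by simp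
  have h_int: "hl_absint (?h z)" if "z > 0" for z
  proof -
    have "hl_absint (\<lambda>t. \<kappa> z *\<^sub>R ext_kernel (1 - \<sigma>) z t)"
      by (rule hl_absint_scaleR[OF ext_kernel_absint]) (use \<sigma> that in auto)
    then show ?thesis using h[OF that] by simp
  qed
  have s0: "\<sigma> = \<sigma> + real 0" by simp
  let ?g = "\<lambda>t. (y * (M * norm f)) * ?h (y / 2) t"
  have "((\<lambda>y. RI 0 \<sigma> y f) has_vector_derivative hl_integral (\<lambda>t. (- (y / 2) * ?h y t) *\<^sub>R T t f)) (at y)"
    unfolding RI_def
  proof (rule hl_integral_derivative[where d="y / 2" and g="?g"])
    fix z assume "z \<in> ball y (y / 2)"
    then have z: "0 < z" "z \<le> 2 * y" "y / 2 \<le> z" unfolding mem_ball dist_real_def by linarith+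
    show "hl_absint (\<lambda>t. rem_kernel 0 \<sigma> z t *\<^sub>R T t f)"
      by (intro kernel_T_absint rem_kernel_absint[OF \<sigma> s0] z)
    fix t :: real assume t: "t > 0"
    show "((\<lambda>y. rem_kernel 0 \<sigma> y t *\<^sub>R T t f) has_vector_derivative (- (z / 2) * ?h z t) *\<^sub>R T t f) (at z)"
      by (rule bounded_linear.has_vector_derivative[OF bounded_linear_scaleR_left
            rem_kernel_deriv(2)[OF t, unfolded has_real_derivative_iff_has_vector_derivative]])
    have "(y / 2)\<^sup>2 / (4 * t) \<le> z\<^sup>2 / (4 * t)" using z y t by (intro divide_right_mono power_mono) auto
    then have "?h z t \<le> ?h (y / 2) t" by (intro mult_right_mono) auto
    then have "(z / 2) * ?h z t * norm (T t f) \<le> y * ?h (y / 2) t * (M * norm f)"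
      using z y t by (intro mult_mono T_norm) auto
    moreover have "norm ((- (z / 2) * ?h z t) *\<^sub>R T t f) = (z / 2) * ?h z t * norm (T t f)"
      using z by (simp add: abs_mult)
    ultimately show "norm ((- (z / 2) * ?h z t) *\<^sub>R T t f) \<le> ?g t" by (simp only: mult_ac)
  next
    have y2: "y / 2 > 0" using y by simp
    show "set_integrable lborel {0<..} ?g"
      using h_int[OF y2] unfolding hl_absint_def
      by (intro set_integrable_mult_right) (subst (asm) set_integrable_cong[OF refl refl], auto simp: abs_mult)
    show "continuous_on {0<..} (\<lambda>t. (- (y / 2) * ?h y t) *\<^sub>R T t f)"
      by (intro continuous_on_scaleR continuous_on_mult continuous_on_const hl_absint_cont[OF h_int[OF y], unfolded] T_continuous_pos)
  qed (use y in simp)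
  also have "hl_integral (\<lambda>t. (- (y / 2) * ?h y t) *\<^sub>R T t f) = hl_integral (\<lambda>t. (- (y / 2) * \<kappa> y) *\<^sub>R (ext_kernel (1 - \<sigma>) y t *\<^sub>R T t f))"
    by (simp only: h[OF y] scaleR_scaleR mult.assoc)
  also have "\<dots> = (- (y / 2) * \<kappa> y) *\<^sub>R U (1 - \<sigma>) y f"
    unfolding U_def by (rule hl_integral_scaleR[OF U_absint]) (use \<sigma> y in auto)
  also have "- (y / 2) * \<kappa> y = Gamma \<sigma> * neumann_const \<sigma> * y powr (2 * \<sigma> - 1)"
  proof -
    have "y powr (2 * \<sigma> - 1) = y powr (1 - (2 - 2 * \<sigma>))" by (rule arg_cong[of _ _ "(powr) y"]) simp
    also have "\<dots> = y / y powr (2 - 2 * \<sigma>)" using y by (simp only: powr_diff powr_one)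
    finally have p: "y powr (2 * \<sigma> - 1) = y / y powr (2 - 2 * \<sigma>)" .
    have p4: "4 powr (1 - \<sigma>) = 4 / 4 powr \<sigma>" by (simp add: powr_diff)
    show ?thesis unfolding \<kappa>_def neumann_const_def p p4 using G0 by simp
  qed
  finally show ?thesis .
qed

lemma RI_uminus:
  assumes \<sigma>: "0 < \<sigma>" "\<sigma> < 1" "s = \<sigma> + real n" and y: "y > 0"
  shows "RI n s y (- f) = - RI n s y f"
  using hl_integral_scaleR[OF kernel_T_absint[OF rem_kernel_absint[OF \<sigma> y]], of "- 1" f]
  by (simp add: RI_def blinfun.minus_right)

text \<open>Both sides have the same limit at 0 and the same derivative. For \<open>n = 0\<close>
  the derivatives are compared by \<open>QU_bal\<close> and \<open>RI_deriv_0\<close>; in the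
  induction step both are \<open>y / (2 * (s - 1))\<close> times the two sides of the expansion for
  \<open>s - 1\<close>.\<close>

lemma U_expansion:
  assumes \<sigma>: "0 < \<sigma>" "\<sigma> < 1" and s: "s = \<sigma> + real n" and y: "y > 0"
  shows "U s y (bal \<sigma> ((B ^^ n) f)) =
    (\<Sum>k=0..n. (y ^ (2 * k) * Gamma (s - real k) / (4 ^ k * fact k * Gamma s)) *\<^sub>R (L ^^ k) (bal \<sigma> ((B ^^ n) f)))
    + (1 / Gamma s) *\<^sub>R RI n s y f"
  using s y
proof (induction n arbitrary: s y f)
  case 0
  define u where "u = bal \<sigma> f"
  have s: "s = \<sigma>" "\<sigma> = \<sigma> + real 0" using 0 by simp_all
  have "Gamma \<sigma> > 0" using \<sigma> by (auto intro: Gamma_real_pos)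
  then have G: "Gamma \<sigma> \<noteq> 0" by (rule less_imp_neq[THEN not_sym])
  have "U \<sigma> y u - (1 / Gamma \<sigma>) *\<^sub>R RI 0 \<sigma> y f = u"
  proof (rule eq_limit_at_0[where F="\<lambda>y. U \<sigma> y u - (1 / Gamma \<sigma>) *\<^sub>R RI 0 \<sigma> y f"])
    fix t :: real assume t: "t > 0"
    have "QU \<sigma> t u = neumann_const \<sigma> *\<^sub>R U (1 - \<sigma>) t f" unfolding u_def by (rule QU_bal[OF \<sigma> t])
    then have "t powr (2 * \<sigma> - 1) *\<^sub>R (t powr (1 - 2 * \<sigma>) *\<^sub>R DU \<sigma> t u) = t powr (2 * \<sigma> - 1) *\<^sub>R (neumann_const \<sigma> *\<^sub>R U (1 - \<sigma>) t f)"
      by (simp only: QU_def)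
    moreover have "t powr (2 * \<sigma> - 1) * t powr (1 - 2 * \<sigma>) = 1" using t by (simp flip: powr_add)
    ultimately have D: "DU \<sigma> t u = (t powr (2 * \<sigma> - 1) * neumann_const \<sigma>) *\<^sub>R U (1 - \<sigma>) t f" by simp
    have "((\<lambda>y. U \<sigma> y u - (1 / Gamma \<sigma>) *\<^sub>R RI 0 \<sigma> y f) has_vector_derivative
      DU \<sigma> t u - (1 / Gamma \<sigma>) *\<^sub>R ((Gamma \<sigma> * neumann_const \<sigma> * t powr (2 * \<sigma> - 1)) *\<^sub>R U (1 - \<sigma>) t f)) (at t)"
      by (rule has_vector_derivative_diff[OF U_has_deriv[OF \<sigma>(1) t]
            bounded_linear.has_vector_derivative[OF bounded_linear_scaleR_right RI_deriv_0[OF \<sigma> t]]])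
    moreover have "DU \<sigma> t u - (1 / Gamma \<sigma>) *\<^sub>R ((Gamma \<sigma> * neumann_const \<sigma> * t powr (2 * \<sigma> - 1)) *\<^sub>R U (1 - \<sigma>) t f) = 0"
      unfolding D using G by (simp add: mult.commute)
    ultimately show "((\<lambda>y. U \<sigma> y u - (1 / Gamma \<sigma>) *\<^sub>R RI 0 \<sigma> y f) has_vector_derivative 0) (at t)" by simp
  next
    show "((\<lambda>y. U \<sigma> y u - (1 / Gamma \<sigma>) *\<^sub>R RI 0 \<sigma> y f) \<longlongrightarrow> u) (at_right 0)"
      using tendsto_diff[OF U_tendsto[OF \<sigma>(1), of u] tendsto_scaleR[OF tendsto_const RI_tendsto[OF \<sigma> s(2), of f]], of "1 / Gamma \<sigma>"]
      by simp
  qed (rule 0)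
  then have "U \<sigma> y u = u + (1 / Gamma \<sigma>) *\<^sub>R RI 0 \<sigma> y f" by (simp add: algebra_simps)
  then show ?case using G by (simp add: s(1) u_def)
next
  case (Suc n)
  \<comment> \<open>The data \<open>- f\<close> compensate for \<open>B\<close> being
    \<open>- J\<close>: thus \<open>u = J w\<close>, and \<open>L ^^ Suc k\<close> at
    \<open>u\<close> is \<open>L ^^ k\<close> at \<open>w\<close>, as the expansion for
    \<open>s - 1\<close> requires.\<close>
  define u w where "u = bal \<sigma> ((B ^^ Suc n) f)" and "w = bal \<sigma> ((B ^^ n) (- f))"
  have Bn: "bounded_linear (B ^^ n)" by (rule bounded_linear_funpow[OF B_linear])
  have w: "w = - bal \<sigma> ((B ^^ n) f)"
    unfolding w_def by (simp only: bounded_linear.linear[OF Bn, THEN linear_neg] bounded_linear.linear[OF bal_linear[OF \<sigma>], THEN linear_neg])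
  have "u = J w" unfolding u_def w using bal_B[OF \<sigma>, of "(B ^^ n) f"] by (simp add: J_def B_simps)
  then have uw: "u = J w" .
  have s1: "s - 1 = \<sigma> + real n" using Suc.prems by simp
  have sgt: "s > 1" "s > 0" using Suc.prems \<sigma> by auto
  have "Gamma s > 0" "Gamma (s - 1) > 0" using sgt by (auto intro: Gamma_real_pos)
  note G = this[THEN less_imp_neq, THEN not_sym]
  define c where "c k = Gamma (s - real k) / (4 ^ k * fact k * Gamma s)" for k
  define S where "S y = (\<Sum>k=0..Suc n. (c k * y ^ (2 * k)) *\<^sub>R (L ^^ k) u)" for y :: real
  define S' where "S' y = (\<Sum>k=0..n. (y ^ (2 * k) * Gamma (s - 1 - real k) / (4 ^ k * fact k * Gamma (s - 1))) *\<^sub>R (L ^^ k) w)" for y :: real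
  have dS: "(S has_vector_derivative (t / (2 * (s - 1))) *\<^sub>R S' t) (at t)" for t
  proof -
    have 1: "((\<lambda>y. (c k * y ^ (2 * k)) *\<^sub>R (L ^^ k) u) has_vector_derivative (c k * (real (2 * k) * t ^ (2 * k - 1))) *\<^sub>R (L ^^ k) u) (at t)" for k
    proof -
      have "((\<lambda>y. c k * y ^ (2 * k)) has_real_derivative c k * (real (2 * k) * t ^ (2 * k - 1))) (at t)"
        using DERIV_cmult[OF DERIV_pow[of "2 * k" t], of "c k"] by (simp only: One_nat_def)
      then show ?thesis
        unfolding has_real_derivative_iff_has_vector_derivative
        by (rule bounded_linear.has_vector_derivative[OF bounded_linear_scaleR_left])
    qed
    have "(S has_vector_derivative (\<Sum>k=0..Suc n. (c k * (real (2 * k) * t ^ (2 * k - 1))) *\<^sub>R (L ^^ k) u)) (at t)"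
      unfolding S_def by (rule has_vector_derivative_sum) (rule 1)
    also have "(\<Sum>k=0..Suc n. (c k * (real (2 * k) * t ^ (2 * k - 1))) *\<^sub>R (L ^^ k) u)
        = (\<Sum>k=0..n. (c (Suc k) * (real (2 * Suc k) * t ^ (2 * Suc k - 1))) *\<^sub>R (L ^^ Suc k) u)"
      by (subst sum.atLeast0_atMost_Suc_shift) simp
    also have "\<dots> = (\<Sum>k=0..n. (t / (2 * (s - 1))) *\<^sub>R ((t ^ (2 * k) * Gamma (s - 1 - real k) / (4 ^ k * fact k * Gamma (s - 1))) *\<^sub>R (L ^^ k) w))"
    proof (rule sum.cong[OF refl])
      fix k
      have l: "(L ^^ Suc k) u = (L ^^ k) w" by (simp only: uw funpow_Suc_right o_def L_J)
      have e: "s - real (Suc k) = s - 1 - real k" by simp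
      have "c (Suc k) * (real (2 * Suc k) * t ^ (2 * Suc k - 1)) =
        t / (2 * (s - 1)) * (t ^ (2 * k) * Gamma (s - 1 - real k) / (4 ^ k * fact k * Gamma (s - 1)))"
        unfolding c_def e Gamma_ratio_step[OF sgt(1)] using sgt G
        by (simp add: divide_simps del: of_nat_Suc) (simp add: algebra_simps)
      then show "(c (Suc k) * (real (2 * Suc k) * t ^ (2 * Suc k - 1))) *\<^sub>R (L ^^ Suc k) u =
        (t / (2 * (s - 1))) *\<^sub>R ((t ^ (2 * k) * Gamma (s - 1 - real k) / (4 ^ k * fact k * Gamma (s - 1))) *\<^sub>R (L ^^ k) w)"
        unfolding l by (simp only: scaleR_scaleR)
    qed
    also have "\<dots> = (t / (2 * (s - 1))) *\<^sub>R S' t" unfolding S'_def by (simp only: scaleR_sum_right)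
    finally show ?thesis .
  qed
  have lS: "(S \<longlongrightarrow> u) (at_right 0)"
  proof -
    have "(S \<longlongrightarrow> (\<Sum>k=0..Suc n. (c k * 0 ^ (2 * k)) *\<^sub>R (L ^^ k) u)) (at_right 0)"
      unfolding S_def by (intro tendsto_intros)
    also have "(\<Sum>k=0..Suc n. (c k * 0 ^ (2 * k)) *\<^sub>R (L ^^ k) u) = (c 0 * 0 ^ (2 * 0)) *\<^sub>R (L ^^ 0) u
        + (\<Sum>k=0..n. (c (Suc k) * 0 ^ (2 * Suc k)) *\<^sub>R (L ^^ Suc k) u)"
      by (simp only: sum.atLeast0_atMost_Suc_shift o_def)
    also have "\<dots> = u" using G by (simp add: c_def)
    finally show ?thesis .
  qed
  have DUu: "DU s t u = (t / (2 * (s - 1))) *\<^sub>R U (s - 1) t w" if t: "t > 0" for t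
  proof -
    have "DU s t (J w) = - DU s t (B w)"
      unfolding J_def using DU_scaleR[OF sgt(2) t, of "- 1" "B w"] by simp
    then have "DU s t u = J (DU s t w)" unfolding uw by (simp only: DU_B[OF sgt(2) t] J_def)
    moreover have "J ((2 / t) *\<^sub>R DU s t w) = (2 / t) *\<^sub>R J (DU s t w)" by (rule J_simps)
    ultimately have "(2 / t) *\<^sub>R DU s t u = (1 / (s - 1)) *\<^sub>R U (s - 1) t w"
      using J_DU[OF sgt(1) t, of w] by (simp only:)
    then have "(t / 2) *\<^sub>R ((2 / t) *\<^sub>R DU s t u) = (t / 2) *\<^sub>R ((1 / (s - 1)) *\<^sub>R U (s - 1) t w)" by (simp only:)
    then show ?thesis using t by simp
  qed
  have "U s y u - S y - (1 / Gamma s) *\<^sub>R RI (Suc n) s y f = 0"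
  proof (rule eq_limit_at_0[where F="\<lambda>y. U s y u - S y - (1 / Gamma s) *\<^sub>R RI (Suc n) s y f"])
    fix t :: real assume t: "t > 0"
    have IH: "U (s - 1) t w = S' t + (1 / Gamma (s - 1)) *\<^sub>R RI n (s - 1) t (- f)"
      unfolding w_def S'_def by (rule Suc.IH[OF s1 t])
    have "((\<lambda>y. U s y u - S y - (1 / Gamma s) *\<^sub>R RI (Suc n) s y f) has_vector_derivative
      DU s t u - (t / (2 * (s - 1))) *\<^sub>R S' t - (1 / Gamma s) *\<^sub>R (- (t / 2) *\<^sub>R RI n (s - 1) t f)) (at t)"
      by (intro has_vector_derivative_diff[OF has_vector_derivative_diff[OF U_has_deriv[OF sgt(2) t] dS]]
            bounded_linear.has_vector_derivative[OF bounded_linear_scaleR_right RI_deriv_Suc[OF \<sigma> Suc.prems(1) t]])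
    moreover have "DU s t u - (t / (2 * (s - 1))) *\<^sub>R S' t - (1 / Gamma s) *\<^sub>R (- (t / 2) *\<^sub>R RI n (s - 1) t f) = 0"
    proof -
      have "(1 / Gamma s) * (t / 2) = t / (2 * (s - 1)) * (1 / Gamma (s - 1))"
        unfolding Gamma_ratio_step[OF sgt(1)] by simp
      then have "(1 / Gamma s) *\<^sub>R (- (t / 2) *\<^sub>R RI n (s - 1) t f) = - ((t / (2 * (s - 1))) *\<^sub>R ((1 / Gamma (s - 1)) *\<^sub>R RI n (s - 1) t f))"
        by (simp only: scaleR_scaleR scaleR_minus_left scaleR_minus_right)
      then show ?thesis
        unfolding DUu[OF t] IH RI_uminus[OF \<sigma> s1 t] by (simp only: scaleR_minus_right scaleR_add_right) simp
    qed
    ultimately show "((\<lambda>y. U s y u - S y - (1 / Gamma s) *\<^sub>R RI (Suc n) s y f) has_vector_derivative 0) (at t)" by simp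
  next
    show "((\<lambda>y. U s y u - S y - (1 / Gamma s) *\<^sub>R RI (Suc n) s y f) \<longlongrightarrow> 0) (at_right 0)"
      using tendsto_diff[OF tendsto_diff[OF U_tendsto[OF sgt(2), of u] lS]
          tendsto_scaleR[OF tendsto_const RI_tendsto[OF \<sigma> Suc.prems(1), of f]], of "1 / Gamma s"]
      by simp
  qed (rule Suc.prems)
  then have "U s y u = S y + (1 / Gamma s) *\<^sub>R RI (Suc n) s y f" by (simp add: algebra_simps)
  moreover have "S y = (\<Sum>k=0..Suc n. (y ^ (2 * k) * Gamma (s - real k) / (4 ^ k * fact k * Gamma s)) *\<^sub>R (L ^^ k) u)"
    unfolding S_def c_def by (intro sum.cong refl) (simp add: mult.commute)
  ultimately show ?case unfolding u_def by (simp only:)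
qed

end

section \<open>Boundary behaviour and the extension theorem\<close>

lemma nat_floor_eq:
  assumes "0 < \<sigma>" "\<sigma> < 1" "s = \<sigma> + real n"
  shows "nat \<lfloor>s\<rfloor> = n" "of_int \<lfloor>s\<rfloor> = real n"
proof -
  have fl: "\<lfloor>s\<rfloor> = int n" using assms by (intro floor_unique) auto
  then show "nat \<lfloor>s\<rfloor> = n" "of_int \<lfloor>s\<rfloor> = real n" by simp_all
qed

text \<open>The three sources of the constant: the Gamma quotient from lowering the index from
  \<open>s\<close> to \<open>\<sigma>\<close>, \<open>neumann_const\<close> from the boundary
  derivative at index \<open>\<sigma>\<close>, and the sign from passing between
  \<open>B ^^ n\<close> and \<open>J ^^ n\<close>.\<close>

lemma c_const_eq:
  assumes "0 < \<sigma>" "\<sigma> < 1" "s = \<sigma> + real n"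
  shows "c_const s = (Gamma \<sigma> / Gamma s) * (neumann_const \<sigma> * (-1) ^ n)"
proof -
  have e: "real n + 1 - s = 1 - \<sigma>" "s - (real n + 1/2) = \<sigma> - 1/2" using assms by simp_all
  have "(4::real) powr (1/2) = 2" using powr_half_sqrt[of 4] by simp
  then have p: "4 powr (\<sigma> - 1/2) = 4 powr \<sigma> / 2" by (simp add: powr_diff)
  have "Gamma \<sigma> > 0" using assms by (auto intro: Gamma_real_pos)
  then have "Gamma \<sigma> \<noteq> 0" by (rule less_imp_neq[THEN not_sym])
  then show ?thesis
    unfolding c_const_def Let_def nat_floor_eq(1)[OF assms] e p neumann_const_def by (simp add: mult_ac)
qed

context bounded_semigroup
begin

lemma integral_formula:
  assumes q: "q > 0" and y: "y > 0"
  shows "bochner_integrable_on (\<lambda>t. (exp (- y\<^sup>2 / (4 * t)) / t powr (1 + q)) *\<^sub>R T t x) {0<..}"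
    "(y powr (2 * q) / (4 powr q * Gamma q)) *\<^sub>R
      bochner_integral_on {0<..} (\<lambda>t. (exp (- y\<^sup>2 / (4 * t)) / t powr (1 + q)) *\<^sub>R T t x) = U q y x"
proof -
  define c where "c = y powr (2 * q) / (4 powr q * Gamma q)"
  let ?g = "\<lambda>t. (exp (- y\<^sup>2 / (4 * t)) / t powr (1 + q)) *\<^sub>R T t x"
  have "c > 0" unfolding c_def using q y by simp
  then have c: "c \<noteq> 0" by (rule less_imp_neq[THEN not_sym])
  have k: "ext_kernel q y t *\<^sub>R T t x = c *\<^sub>R ?g t" for t by (simp add: ext_kernel_def c_def)
  have "hl_absint (\<lambda>t. (1 / c) *\<^sub>R (c *\<^sub>R ?g t))"
    using hl_absint_scaleR[OF U_absint[OF q y, of x], of "1 / c"] unfolding k .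
  then have g: "hl_absint ?g" using c by simp
  from bochner_integral_on_pos(1)[OF g] show "bochner_integrable_on ?g {0<..}" .
  have "U q y x = hl_integral (\<lambda>t. c *\<^sub>R ?g t)" unfolding U_def k ..
  also have "\<dots> = c *\<^sub>R hl_integral ?g" by (rule hl_integral_scaleR[OF g])
  also have "hl_integral ?g = bochner_integral_on {0<..} ?g" by (rule bochner_integral_on_pos(2)[OF g, symmetric])
  finally show "(y powr (2 * q) / (4 powr q * Gamma q)) *\<^sub>R bochner_integral_on {0<..} ?g = U q y x"
    unfolding c_def by (rule sym)
qed

lemma bounded_frac_power_eq:
  assumes "0 < \<sigma>" "\<sigma> < 1" "s = \<sigma> + real n"
  shows "bounded_frac_power B s f = bal \<sigma> ((B ^^ n) f)"
proof -
  have "s - of_int \<lfloor>s\<rfloor> = \<sigma>" unfolding nat_floor_eq(2)[OF assms] using assms(3) by simp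
  then show ?thesis
    unfolding bounded_frac_power_def nat_floor_eq(1)[OF assms] by (simp only: balakrishnan_eq_bal[OF assms(1,2)])
qed

lemma Bn_inj: "(B ^^ n) x = (B ^^ n) y \<Longrightarrow> x = y"
proof (induction n)
  case (Suc n)
  then have "B ((B ^^ n) x) = B ((B ^^ n) y)" by (simp only: funpow.simps o_apply)
  from Suc.IH[OF B_inj[OF this]] show ?case .
qed simp

lemma neg_frac_dom_iff:
  assumes "0 < \<sigma>" "\<sigma> < 1" "s = \<sigma> + real n"
  shows "u \<in> neg_frac_dom D L s \<longleftrightarrow> (\<exists>f. u = bal \<sigma> ((B ^^ n) f))"
  unfolding neg_frac_dom_def image_iff bounded_frac_power_eq[OF assms] by blast

lemma neg_frac_power_eq:
  assumes "0 < \<sigma>" "\<sigma> < 1" "s = \<sigma> + real n"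
  shows "neg_frac_power D L s (bal \<sigma> ((B ^^ n) f)) = f"
proof -
  have "inj (bounded_frac_power B s)"
  proof (rule injI)
    fix x y assume "bounded_frac_power B s x = bounded_frac_power B s y"
    then have "bal \<sigma> ((B ^^ n) x) = bal \<sigma> ((B ^^ n) y)" by (simp only: bounded_frac_power_eq[OF assms])
    from Bn_inj[OF bal_inj[OF assms(1,2) this]] show "x = y" .
  qed
  from inv_f_f[OF this, of f] show ?thesis
    unfolding neg_frac_power_def bounded_frac_power_eq[OF assms] .
qed

lemma Bn_eq_Jn: "(B ^^ n) x = (J ^^ n) ((-1) ^ n *\<^sub>R x)"
proof (induction n arbitrary: x)
  case (Suc n)
  have "(B ^^ Suc n) x = (B ^^ n) (B x)" by (simp only: funpow_Suc_right o_apply)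
  also have "\<dots> = (J ^^ n) ((-1) ^ n *\<^sub>R B x)" by (rule Suc.IH)
  also have "(-1) ^ n *\<^sub>R B x = J ((-1) ^ Suc n *\<^sub>R x)" by (simp add: J_def B_simps)
  finally show ?case by (simp only: Jk_Suc)
qed simp

lemma bal_Bn: "0 < \<sigma> \<Longrightarrow> \<sigma> < 1 \<Longrightarrow> bal \<sigma> ((B ^^ n) x) = (B ^^ n) (bal \<sigma> x)"
  by (induction n) (simp_all only: funpow.simps o_apply id_apply bal_B)

lemma bal_scaleR: "0 < \<sigma> \<Longrightarrow> \<sigma> < 1 \<Longrightarrow> bal \<sigma> (c *\<^sub>R x) = c *\<^sub>R bal \<sigma> x"
  by (rule linear_scale[OF bounded_linear.linear[OF bal_linear]])

text \<open>Exhibits every vector in the domain of the fractional power as an element of D(L^n),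
  with its image under \<open>L ^^ n\<close>.\<close>

lemma bal_Bn_eq_Jn:
  assumes "0 < \<sigma>" "\<sigma> < 1"
  shows "bal \<sigma> ((B ^^ n) f) = (J ^^ n) (bal \<sigma> ((-1) ^ n *\<^sub>R f))"
  unfolding bal_Bn[OF assms] bal_scaleR[OF assms] by (rule Bn_eq_Jn)

lemma U_Jk:
  assumes "q > 0" "y > 0" shows "U q y ((J ^^ k) x) = (J ^^ k) (U q y x)"
proof (induction k)
  case (Suc k)
  have "U q y (J z) = J (U q y z)" for z
    using U_B[OF assms, of z] U_scaleR[OF assms, of "-1" "B z"] by (simp add: J_def)
  then show ?case using Suc by (simp only: funpow.simps o_apply)
qed simp

section \<open>Boundary limits of the iterated operators\<close>

lemma two_over_iter_Jk:
  assumes V: "\<And>y. y > 0 \<Longrightarrow> V y = U s y ((J ^^ m) w)" and s: "s > real m" and y: "y > 0"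
  shows "(two_over_y_dy ^^ m) V y = (Gamma (s - real m) / Gamma s) *\<^sub>R U (s - real m) y w"
proof (rule Jk_inj)
  have sm: "s - real m > 0" using s by simp
  have "(J ^^ m) ((two_over_y_dy ^^ m) V y) = (Gamma (s - real m) / Gamma s) *\<^sub>R U (s - real m) y ((J ^^ m) w)"
    by (rule two_over_iter[OF V s y])
  also have "\<dots> = (J ^^ m) ((Gamma (s - real m) / Gamma s) *\<^sub>R U (s - real m) y w)"
    by (simp only: U_Jk[OF sm y] Jk_simps)
  finally show "(J ^^ m) ((two_over_y_dy ^^ m) V y) = (J ^^ m) ((Gamma (s - real m) / Gamma s) *\<^sub>R U (s - real m) y w)" .
qed

text \<open>After \<open>J ^^ m\<close> both iterates are multiples of the same
  \<open>U (s - real m) y u\<close>. Hence limits found for one operator transfer to the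
  other.\<close>

lemma ext_op_iter_eq:
  assumes V: "\<And>y. y > 0 \<Longrightarrow> V y = U s y u" and s: "s > real n" and a: "a = 1 - 2 * (s - real n)"
    and m: "m \<le> n" and y: "y > 0"
  shows "(ext_op L a ^^ m) V y = (fact n / fact (n - m)) *\<^sub>R (two_over_y_dy ^^ m) V y"
proof (rule Jk_inj)
  have sm: "s > real m" using s m by simp
  have "(J ^^ m) ((ext_op L a ^^ m) V y) = (fact n / fact (n - m)) *\<^sub>R ((Gamma (s - real m) / Gamma s) *\<^sub>R U (s - real m) y u)"
    unfolding scaleR_scaleR by (rule ext_op_iter[OF V s a m y])
  also have "\<dots> = (fact n / fact (n - m)) *\<^sub>R (J ^^ m) ((two_over_y_dy ^^ m) V y)"
    by (simp only: two_over_iter[OF V sm y])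
  also have "\<dots> = (J ^^ m) ((fact n / fact (n - m)) *\<^sub>R (two_over_y_dy ^^ m) V y)"
    by (simp only: Jk_simps)
  finally show "(J ^^ m) ((ext_op L a ^^ m) V y) = (J ^^ m) ((fact n / fact (n - m)) *\<^sub>R (two_over_y_dy ^^ m) V y)" .
qed

lemma ext_op_iter_dy_eq:
  assumes V: "\<And>y. y > 0 \<Longrightarrow> V y = U s y u" and s: "s > real n" and a: "a = 1 - 2 * (s - real n)"
    and m: "m \<le> n" and y: "y > 0"
  shows "dy ((ext_op L a ^^ m) V) y = (fact n / fact (n - m)) *\<^sub>R dy ((two_over_y_dy ^^ m) V) y"
proof -
  have "ext_smooth u V" by (rule ext_smooth_U[OF _ V]) (use s in auto)
  then have sm: "ext_smooth u ((two_over_y_dy ^^ m) V)" by (rule ext_smooth_iter)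
  have "dy ((ext_op L a ^^ m) V) y = dy (\<lambda>y. (fact n / fact (n - m)) *\<^sub>R (two_over_y_dy ^^ m) V y) y"
    by (rule dy_cong[OF ext_op_iter_eq[OF V s a m] y])
  also have "\<dots> = (fact n / fact (n - m)) *\<^sub>R dy ((two_over_y_dy ^^ m) V) y"
    by (rule dy_linear[OF ext_smooth_dy(2)[OF sm] bounded_linear_scaleR_right y])
  finally show ?thesis .
qed

lemma tendsto_cong_pos:
  assumes "\<And>y::real. y > 0 \<Longrightarrow> f y = g y"
  shows "(f \<longlongrightarrow> l) (at_right 0) \<longleftrightarrow> (g \<longlongrightarrow> l) (at_right 0)"
  by (rule tendsto_cong) (use assms in \<open>simp add: eventually_at_filter\<close>)

lemma two_over_iter_tendsto:
  assumes V: "\<And>y. y > 0 \<Longrightarrow> V y = U s y u" and \<sigma>: "0 < \<sigma>" "\<sigma> < 1" "s = \<sigma> + real n" and m: "m \<le> n"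
    and u: "u = bal \<sigma> ((B ^^ n) f)"
  shows "((two_over_y_dy ^^ m) V \<longlongrightarrow> (Gamma (s - real m) / Gamma s) *\<^sub>R (L ^^ m) u) (at_right 0)"
proof -
  have sm: "s > real m" using \<sigma> m by simp
  \<comment> \<open>This is \<open>(L ^^ m) u\<close>; writing \<open>u = (J ^^ m) w\<close> removes
    \<open>J ^^ m\<close> from the closed form.\<close>
  define w where "w = (J ^^ (n - m)) (bal \<sigma> ((-1) ^ n *\<^sub>R f))"
  have uw: "u = (J ^^ m) w"
  proof -
    have "J ^^ n = J ^^ m \<circ> J ^^ (n - m)" using funpow_add[of m "n - m" J] m by simp
    then show ?thesis unfolding u w_def bal_Bn_eq_Jn[OF \<sigma>(1,2)] by (simp only: o_apply)
  qed
  have "((\<lambda>y. (Gamma (s - real m) / Gamma s) *\<^sub>R U (s - real m) y w) \<longlongrightarrow> (Gamma (s - real m) / Gamma s) *\<^sub>R (L ^^ m) u) (at_right 0)"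
    unfolding uw Lk_Jk by (intro tendsto_intros U_tendsto) (use sm in simp)
  then show ?thesis
    using two_over_iter_Jk[OF V[unfolded uw] sm] by (subst tendsto_cong_pos)
qed

text \<open>For \<open>m < n\<close> the expression is \<open>y powr (a + 1) / 2\<close> times the
  next iterate; that iterate converges, and \<open>a + 1 = 2 * (1 - \<sigma>)\<close> is positive.
  For \<open>m = n\<close>, \<open>QU_bal\<close> identifies it with a multiple of
  \<open>U (1 - \<sigma>)\<close>, which has a limit at 0.\<close>

lemma two_over_iter_dy_tendsto:
  assumes V: "\<And>y. y > 0 \<Longrightarrow> V y = U s y u" and \<sigma>: "0 < \<sigma>" "\<sigma> < 1" "s = \<sigma> + real n"
    and a: "a = 1 - 2 * (s - real n)" and u: "u = bal \<sigma> ((B ^^ n) f)"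
  shows "m < n \<Longrightarrow> ((\<lambda>y. y powr a *\<^sub>R dy ((two_over_y_dy ^^ m) V) y) \<longlongrightarrow> 0) (at_right 0)"
    "((\<lambda>y. y powr a *\<^sub>R dy ((two_over_y_dy ^^ n) V) y) \<longlongrightarrow> c_const s *\<^sub>R f) (at_right 0)"
proof -
  have a': "a = 1 - 2 * \<sigma>" using a \<sigma>(3) by simp
  {
    assume "m < n"
    then have m: "Suc m \<le> n" by simp
    have "0 < a + 1" unfolding a' using \<sigma> by simp
    then have "((\<lambda>y. y powr (a + 1) / 2) \<longlongrightarrow> 0) (at_right 0)" by real_asymp
    from tendsto_scaleR[OF this two_over_iter_tendsto[OF V \<sigma> m u]]
    have "((\<lambda>y. (y powr (a + 1) / 2) *\<^sub>R (two_over_y_dy ^^ Suc m) V y) \<longlongrightarrow> 0) (at_right 0)"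
      by (simp only: scaleR_zero_left)
    moreover have "(y powr (a + 1) / 2) *\<^sub>R (two_over_y_dy ^^ Suc m) V y = y powr a *\<^sub>R dy ((two_over_y_dy ^^ m) V) y"
      if y: "y > 0" for y
    proof -
      have "y powr (a + 1) = y powr a * y" using y by (simp add: powr_add)
      moreover have "(two_over_y_dy ^^ Suc m) V y = (2 / y) *\<^sub>R dy ((two_over_y_dy ^^ m) V) y"
        by (simp add: two_over_y_dy_def)
      ultimately show ?thesis using y by simp
    qed
    ultimately show "((\<lambda>y. y powr a *\<^sub>R dy ((two_over_y_dy ^^ m) V) y) \<longlongrightarrow> 0) (at_right 0)"
      by (subst (asm) tendsto_cong_pos)
  }
  define w where "w = bal \<sigma> ((-1) ^ n *\<^sub>R f)"
  have uw: "u = (J ^^ n) w" unfolding u w_def by (rule bal_Bn_eq_Jn[OF \<sigma>(1,2)])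
  have sn: "s > real n" "s - real n = \<sigma>" using \<sigma> by simp_all
  have "y powr a *\<^sub>R dy ((two_over_y_dy ^^ n) V) y
      = (Gamma \<sigma> / Gamma s) *\<^sub>R (neumann_const \<sigma> *\<^sub>R U (1 - \<sigma>) y ((-1) ^ n *\<^sub>R f))" if y: "y > 0" for y
  proof -
    have "dy ((two_over_y_dy ^^ n) V) y = dy (\<lambda>y. (Gamma \<sigma> / Gamma s) *\<^sub>R U \<sigma> y w) y"
      by (rule dy_cong[OF _ y]) (use two_over_iter_Jk[OF V[unfolded uw] sn(1), unfolded sn(2)] in simp)
    also have "\<dots> = (Gamma \<sigma> / Gamma s) *\<^sub>R DU \<sigma> y w"
      by (rule dy_eq[OF bounded_linear.has_vector_derivative[OF bounded_linear_scaleR_right U_has_deriv[OF \<sigma>(1) y]]])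
    finally have "y powr a *\<^sub>R dy ((two_over_y_dy ^^ n) V) y = (Gamma \<sigma> / Gamma s) *\<^sub>R QU \<sigma> y w"
      by (simp only: QU_def a' scaleR_scaleR mult.commute)
    then show ?thesis unfolding w_def QU_bal[OF \<sigma>(1,2) y] .
  qed
  note eq = this
  have "((\<lambda>y. (Gamma \<sigma> / Gamma s) *\<^sub>R (neumann_const \<sigma> *\<^sub>R U (1 - \<sigma>) y ((-1) ^ n *\<^sub>R f))) \<longlongrightarrow>
      (Gamma \<sigma> / Gamma s) *\<^sub>R (neumann_const \<sigma> *\<^sub>R ((-1) ^ n *\<^sub>R f))) (at_right 0)"
    by (intro tendsto_intros U_tendsto) (use \<sigma> in simp)
  also have "(Gamma \<sigma> / Gamma s) *\<^sub>R (neumann_const \<sigma> *\<^sub>R ((-1) ^ n *\<^sub>R f)) = c_const s *\<^sub>R f"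
    by (simp only: scaleR_scaleR c_const_eq[OF \<sigma>])
  finally show "((\<lambda>y. y powr a *\<^sub>R dy ((two_over_y_dy ^^ n) V) y) \<longlongrightarrow> c_const s *\<^sub>R f) (at_right 0)"
    using eq by (subst tendsto_cong_pos)
qed

text \<open>Under \<open>B\<close> and \<open>J ^^ n\<close> the weighted derivative becomes
  \<open>QU \<sigma> y (B u)\<close> up to a factor, whose limit is a multiple of
  \<open>bal (1 - \<sigma>) u\<close> for every \<open>u\<close>. The assumed limit \<open>l\<close>
  places it in the range of \<open>B\<close> composed with \<open>J ^^ n\<close>; applying
  \<open>bal \<sigma>\<close> and using \<open>bal_bal\<close> then cancels one
  \<open>B\<close>.\<close>

lemma neg_frac_dom_if_tendsto:
  assumes V: "\<And>y. y > 0 \<Longrightarrow> V y = U s y u" and \<sigma>: "0 < \<sigma>" "\<sigma> < 1" "s = \<sigma> + real n"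
    and a: "a = 1 - 2 * (s - real n)"
    and l: "((\<lambda>y. y powr a *\<^sub>R dy ((two_over_y_dy ^^ n) V) y) \<longlongrightarrow> l) (at_right 0)"
  shows "u \<in> neg_frac_dom D L s"
proof -
  have a': "a = 1 - 2 * \<sigma>" using a \<sigma>(3) by simp
  have sn: "s > real n" "s - real n = \<sigma>" "s > 0" using \<sigma> by simp_all
  have "Gamma \<sigma> > 0" "Gamma s > 0" "Gamma (1 - \<sigma>) > 0" using \<sigma> sn by (auto intro: Gamma_real_pos)
  note G = this[THEN less_imp_neq, THEN not_sym]
  define g where "g = Gamma s / Gamma \<sigma>"
  define c where "c = neumann_const \<sigma>"
  have c: "c \<noteq> 0" using G by (simp add: c_def neumann_const_def)
  have "ext_smooth u V" by (rule ext_smooth_U[OF sn(3) V])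
  then have sm: "ext_smooth u ((two_over_y_dy ^^ n) V)" by (rule ext_smooth_iter)
  have eq: "B (g *\<^sub>R (J ^^ n) (y powr a *\<^sub>R dy ((two_over_y_dy ^^ n) V) y)) = QU \<sigma> y (B u)" if y: "y > 0" for y
  proof -
    have "(J ^^ n) (dy ((two_over_y_dy ^^ n) V) y) = dy (\<lambda>y. (J ^^ n) ((two_over_y_dy ^^ n) V y)) y"
      by (rule dy_linear[OF ext_smooth_dy(2)[OF sm] Jk_linear y, symmetric])
    also have "\<dots> = dy (\<lambda>y. (Gamma \<sigma> / Gamma s) *\<^sub>R U \<sigma> y u) y"
      by (rule dy_cong[OF _ y]) (use two_over_iter[OF V sn(1), unfolded sn(2)] in simp)
    also have "\<dots> = (Gamma \<sigma> / Gamma s) *\<^sub>R DU \<sigma> y u"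
      by (rule dy_eq[OF bounded_linear.has_vector_derivative[OF bounded_linear_scaleR_right U_has_deriv[OF \<sigma>(1) y]]])
    finally have "g *\<^sub>R (J ^^ n) (y powr a *\<^sub>R dy ((two_over_y_dy ^^ n) V) y) = QU \<sigma> y u"
      unfolding Jk_simps QU_def a' g_def using G by simp
    then show ?thesis by (simp only: QU_B[OF \<sigma>(1) y])
  qed
  define x where "x = g *\<^sub>R (J ^^ n) l"
  have lim: "((\<lambda>y. B (g *\<^sub>R (J ^^ n) (y powr a *\<^sub>R dy ((two_over_y_dy ^^ n) V) y))) \<longlongrightarrow> B x) (at_right 0)"
    unfolding x_def
    by (rule bounded_linear.tendsto[OF B_linear tendsto_scaleR[OF tendsto_const bounded_linear.tendsto[OF Jk_linear l]]])
  have "((\<lambda>y. QU \<sigma> y (B u)) \<longlongrightarrow> B x) (at_right 0)"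
    using lim eq by (subst (asm) tendsto_cong_pos)
  from tendsto_unique[OF _ QU_tendsto[OF \<sigma>(1,2)] this]
  have "c *\<^sub>R bal (1 - \<sigma>) u = B x" by (simp add: c_def)
  then have "(1 / c) *\<^sub>R (c *\<^sub>R bal (1 - \<sigma>) u) = (1 / c) *\<^sub>R B x" by (rule arg_cong)
  then have "bal (1 - \<sigma>) u = B ((1 / c) *\<^sub>R x)" using c by (simp add: B_simps)
  then have "bal \<sigma> (bal (1 - \<sigma>) u) = bal \<sigma> (B ((1 / c) *\<^sub>R x))" by (rule arg_cong)
  then have "B u = B (bal \<sigma> ((1 / c) *\<^sub>R x))" unfolding bal_bal[OF \<sigma>(1,2)] bal_B[OF \<sigma>(1,2)] .
  then have "u = bal \<sigma> ((1 / c) *\<^sub>R x)" by (rule B_inj)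
  also have "(1 / c) *\<^sub>R x = (J ^^ n) ((1 / c * g) *\<^sub>R l)" unfolding x_def by (simp only: Jk_simps scaleR_scaleR)
  also have "\<dots> = (B ^^ n) (((-1) ^ n * (1 / c * g)) *\<^sub>R l)"
    unfolding Bn_eq_Jn scaleR_scaleR mult.assoc[symmetric] by (simp add: power_mult_distrib[symmetric] flip: power_add)
  finally have "u = bal \<sigma> ((B ^^ n) (((-1) ^ n * (1 / c * g)) *\<^sub>R l))" .
  then show ?thesis unfolding neg_frac_dom_iff[OF \<sigma>] by (rule exI)
qed

lemma extension_regularity:
  assumes V: "\<And>y. y > 0 \<Longrightarrow> V y = U s y u" and \<sigma>: "0 < \<sigma>" "\<sigma> < 1" "s = \<sigma> + real n"
    and a: "a = 1 - 2 * (s - real n)"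
  shows "Cn_pow_dom j D L k V" "continuous_on {0..} (extend0 V)" "bounded (V ` {0<..})"
    "(V \<longlongrightarrow> u) (at_right 0)" "classical_eq D L a (n + 1) j V" "classical_eq D L (1 - 2 * s) 1 j V"
proof -
  have s: "s > 0" "s > real n" using \<sigma> by simp_all
  have sm: "ext_smooth u V" by (rule ext_smooth_U[OF s(1) V])
  show C: "Cn_pow_dom j D L k V" for j k by (rule ext_smooth_Cn_pow_dom[OF sm])
  show "bounded (V ` {0<..})"
    unfolding bounded_iff using U_norm[OF s(1)] V by (intro exI[of _ "M * norm u"]) auto
  show lim: "(V \<longlongrightarrow> u) (at_right 0)"
    using U_tendsto[OF s(1), of u] V by (subst tendsto_cong_pos)
  have cl: "Cn_into j {0<..} UNIV norm V" unfolding Cn_into_UNIV_iff by (rule ext_smooth_Cj[OF sm])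
  show "classical_eq D L a (n + 1) j V"
    unfolding classical_eq_def using C cl ext_op_iter_0[OF V s(2) a] by blast
  \<comment> \<open>The second order equation is the case \<open>n = 0\<close> of the iterated
    one.\<close>
  have "(ext_op L (1 - 2 * s) ^^ (0 + 1)) V y = 0" if "y > 0" for y
    by (rule ext_op_iter_0[OF V _ _ that]) (use s in auto)
  then show "classical_eq D L (1 - 2 * s) 1 j V"
    unfolding classical_eq_def using C cl by (simp only: add_0_left) blast
  show "continuous_on {0..} (extend0 V)"
    unfolding continuous_on_eq_continuous_within
  proof
    fix y :: real assume y: "y \<in> {0..}"
    show "continuous (at y within {0..}) (extend0 V)"
    proof (cases "y = 0")
      case True
      have "extend0 V 0 = u" using tendsto_Lim[OF _ lim] by (simp add: extend0_def)
      moreover have "(extend0 V \<longlongrightarrow> u) (at_right 0)"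
        using lim by (subst tendsto_cong_pos[of _ V]) (simp_all add: extend0_def)
      moreover have "at (0::real) within {0..} = at_right 0" by (rule at_within_Ici_at_right)
      ultimately show ?thesis unfolding continuous_within True by (simp only:)
    next
      case False
      then have y: "y > 0" using y by simp
      have "isCont V y" by (rule has_vector_derivative_continuous[OF ext_smooth_dy(2)[OF sm y]])
      moreover have "\<forall>\<^sub>F z in nhds y. extend0 V z = V z"
        by (rule eventually_mono[OF eventually_nhds_in_open[of "{0<..}" y]]) (use y in \<open>auto simp: extend0_def\<close>)
      ultimately have "isCont (extend0 V) y" using isCont_cong by blast
      then show ?thesis by (rule continuous_at_imp_continuous_at_within)
    qed
  qed
qed

lemma extension_ivp:
  assumes V: "\<And>y. y > 0 \<Longrightarrow> V y = U s y u" and \<sigma>: "0 < \<sigma>" "\<sigma> < 1" "s = \<sigma> + real n"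
    and a: "a = 1 - 2 * (s - real n)" and u: "u = bal \<sigma> ((B ^^ n) f)"
  shows "((\<lambda>y. y powr a *\<^sub>R dy ((ext_op L a ^^ n) V) y) \<longlongrightarrow> (c_const s * fact n) *\<^sub>R f) (at_right 0)"
    "higher_order_ivp D L s u V" "second_order_ivp D L s u V"
proof -
  have s: "s > real n" using \<sigma> by simp
  have f: "neg_frac_power D L s u = f" unfolding u by (rule neg_frac_power_eq[OF \<sigma>])
  have Lm: "((ext_op L a ^^ m) V \<longlongrightarrow> (fact n * Gamma (s - real m) / (fact (n - m) * Gamma s)) *\<^sub>R (L ^^ m) u) (at_right 0)"
    if m: "m \<le> n" for m
  proof -
    have "((\<lambda>y. (fact n / fact (n - m)) *\<^sub>R (two_over_y_dy ^^ m) V y) \<longlongrightarrow>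
        (fact n / fact (n - m)) *\<^sub>R ((Gamma (s - real m) / Gamma s) *\<^sub>R (L ^^ m) u)) (at_right 0)"
      by (intro tendsto_intros two_over_iter_tendsto[OF V \<sigma> m u])
    then have "((ext_op L a ^^ m) V \<longlongrightarrow> (fact n / fact (n - m)) *\<^sub>R ((Gamma (s - real m) / Gamma s) *\<^sub>R (L ^^ m) u)) (at_right 0)"
      using ext_op_iter_eq[OF V s a m] by (subst tendsto_cong_pos)
    then show ?thesis by (simp only: scaleR_scaleR times_divide_times_eq)
  qed
  have Dm: "((\<lambda>y. y powr a *\<^sub>R dy ((ext_op L a ^^ m) V) y) \<longlongrightarrow> (fact n / fact (n - m)) *\<^sub>R l) (at_right 0)"
    if l: "((\<lambda>y. y powr a *\<^sub>R dy ((two_over_y_dy ^^ m) V) y) \<longlongrightarrow> l) (at_right 0)" and m: "m \<le> n" for m l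
  proof -
    have "((\<lambda>y. (fact n / fact (n - m)) *\<^sub>R (y powr a *\<^sub>R dy ((two_over_y_dy ^^ m) V) y)) \<longlongrightarrow> (fact n / fact (n - m)) *\<^sub>R l) (at_right 0)"
      by (intro tendsto_intros l)
    then show ?thesis
      using ext_op_iter_dy_eq[OF V s a m] by (subst tendsto_cong_pos) (simp_all add: mult.commute)
  qed
  have two: "m < n \<Longrightarrow> ((\<lambda>y. y powr a *\<^sub>R dy ((two_over_y_dy ^^ m) V) y) \<longlongrightarrow> 0) (at_right 0)"
    "((\<lambda>y. y powr a *\<^sub>R dy ((two_over_y_dy ^^ n) V) y) \<longlongrightarrow> c_const s *\<^sub>R f) (at_right 0)" for m
    by (rule two_over_iter_dy_tendsto[OF V \<sigma> a u]; assumption)+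
  have D0: "((\<lambda>y. y powr a *\<^sub>R dy ((ext_op L a ^^ m) V) y) \<longlongrightarrow> 0) (at_right 0)" if "m < n" for m
    using Dm[OF two(1)[OF that]] that by simp
  show Dn: "((\<lambda>y. y powr a *\<^sub>R dy ((ext_op L a ^^ n) V) y) \<longlongrightarrow> (c_const s * fact n) *\<^sub>R f) (at_right 0)"
    using Dm[OF two(2) order_refl] by (simp add: mult.commute)
  note cl = extension_regularity(5,6)[OF V \<sigma> a]
  show "higher_order_ivp D L s u V"
    unfolding higher_order_ivp_def Let_def nat_floor_eq(1)[OF \<sigma>] a[symmetric] f
    by (intro conjI allI impI cl Lm D0 Dn)
  show "second_order_ivp D L s u V"
    unfolding second_order_ivp_def Let_def nat_floor_eq(1)[OF \<sigma>] a[symmetric] f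
    by (intro conjI allI impI cl two two_over_iter_tendsto[OF V \<sigma> _ u])
qed

text \<open>Membership in the domain yields both limits; the limit for \<open>ext_op\<close> yields
  the one for \<open>two_over_y_dy\<close> after division by \<open>fact n\<close>; and the latter
  yields membership.\<close>

lemma neg_frac_dom_iff_tendsto:
  assumes V: "\<And>y. y > 0 \<Longrightarrow> V y = U s y u" and \<sigma>: "0 < \<sigma>" "\<sigma> < 1" "s = \<sigma> + real n"
    and a: "a = 1 - 2 * (s - real n)"
  shows "u \<in> neg_frac_dom D L s \<longleftrightarrow> (\<exists>l. ((\<lambda>y. y powr a *\<^sub>R dy ((ext_op L a ^^ n) V) y) \<longlongrightarrow> l) (at_right 0))" (is "?P \<longleftrightarrow> ?E")
    "u \<in> neg_frac_dom D L s \<longleftrightarrow> (\<exists>l. ((\<lambda>y. y powr a *\<^sub>R dy ((two_over_y_dy ^^ n) V) y) \<longlongrightarrow> l) (at_right 0))" (is "?P \<longleftrightarrow> ?T")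
proof -
  have s: "s > real n" using \<sigma> by simp
  have TP: ?P if ?T using that neg_frac_dom_if_tendsto[OF V \<sigma> a] by (elim exE)
  have ET: ?T if E: ?E
  proof -
    obtain l where "((\<lambda>y. y powr a *\<^sub>R dy ((ext_op L a ^^ n) V) y) \<longlongrightarrow> l) (at_right 0)" using E by (elim exE)
    then have "((\<lambda>y. (1 / fact n) *\<^sub>R (y powr a *\<^sub>R dy ((ext_op L a ^^ n) V) y)) \<longlongrightarrow> (1 / fact n) *\<^sub>R l) (at_right 0)"
      by (intro tendsto_intros)
    then have "((\<lambda>y. y powr a *\<^sub>R dy ((two_over_y_dy ^^ n) V) y) \<longlongrightarrow> (1 / fact n) *\<^sub>R l) (at_right 0)"
      by (subst (asm) tendsto_cong_pos[where g="\<lambda>y. y powr a *\<^sub>R dy ((two_over_y_dy ^^ n) V) y"])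
        (simp_all add: ext_op_iter_dy_eq[OF V s a order_refl])
    then show ?T by (rule exI)
  qed
  have PE: ?E ?T if P: ?P
  proof -
    obtain f where u: "u = bal \<sigma> ((B ^^ n) f)" by (rule exE[OF neg_frac_dom_iff[OF \<sigma>, THEN iffD1, OF P]])
    show ?E by (rule exI) (rule extension_ivp(1)[OF V \<sigma> a u])
    show ?T by (rule exI) (rule two_over_iter_dy_tendsto(2)[OF V \<sigma> a u])
  qed
  show "?P \<longleftrightarrow> ?E" using PE(1) TP ET by blast
  show "?P \<longleftrightarrow> ?T" using PE(2) TP by blast
qed

lemma extension_expansion:
  assumes V: "\<And>y. y > 0 \<Longrightarrow> V y = U s y u" and \<sigma>: "0 < \<sigma>" "\<sigma> < 1" "s = \<sigma> + real n"
    and u: "u = bal \<sigma> ((B ^^ n) f)" and y: "y > 0"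
  shows "bochner_integrable_on (\<lambda>t. ((exp (- y\<^sup>2 / (4 * t))
              - (\<Sum>k=0..n. (-1) ^ k * y ^ (2 * k) / (fact k * (4 * t) ^ k))) / t powr (1 - s)) *\<^sub>R T t f) {0<..}"
    "V y = (\<Sum>k=0..n. (y ^ (2 * k) * Gamma (s - real k) / (4 ^ k * fact k * Gamma s)) *\<^sub>R (L ^^ k) u)
      + (1 / Gamma s) *\<^sub>R bochner_integral_on {0<..} (\<lambda>t. ((exp (- y\<^sup>2 / (4 * t))
              - (\<Sum>k=0..n. (-1) ^ k * y ^ (2 * k) / (fact k * (4 * t) ^ k))) / t powr (1 - s)) *\<^sub>R T t f)"
    "bochner_integrable_on (\<lambda>r. ((exp (- r) - (\<Sum>k=0..n. (- r) ^ k / fact k)) / r powr (1 + s)) *\<^sub>R T (y\<^sup>2 / (4 * r)) f) {0<..}"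
    "V y = (\<Sum>k=0..n. (y ^ (2 * k) * Gamma (s - real k) / (4 ^ k * fact k * Gamma s)) *\<^sub>R (L ^^ k) u)
      + (y powr (2 * s) / (4 powr s * Gamma s)) *\<^sub>R bochner_integral_on {0<..}
          (\<lambda>r. ((exp (- r) - (\<Sum>k=0..n. (- r) ^ k / fact k)) / r powr (1 + s)) *\<^sub>R T (y\<^sup>2 / (4 * r)) f)"
proof -
  note ex = U_expansion[OF \<sigma> y, of f, folded u, folded V[OF y]]
  note 1 = bochner_integral_on_pos[OF kernel_T_absint[OF rem_kernel_absint[OF \<sigma> y], of f]]
  note 2 = bochner_integral_on_pos[OF RI_substitution(1)[OF \<sigma> y, of f]]
  show "bochner_integrable_on (\<lambda>t. ((exp (- y\<^sup>2 / (4 * t))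
              - (\<Sum>k=0..n. (-1) ^ k * y ^ (2 * k) / (fact k * (4 * t) ^ k))) / t powr (1 - s)) *\<^sub>R T t f) {0<..}"
    by (rule 1(1)[unfolded rem_kernel_eq])
  show "V y = (\<Sum>k=0..n. (y ^ (2 * k) * Gamma (s - real k) / (4 ^ k * fact k * Gamma s)) *\<^sub>R (L ^^ k) u)
      + (1 / Gamma s) *\<^sub>R bochner_integral_on {0<..} (\<lambda>t. ((exp (- y\<^sup>2 / (4 * t))
              - (\<Sum>k=0..n. (-1) ^ k * y ^ (2 * k) / (fact k * (4 * t) ^ k))) / t powr (1 - s)) *\<^sub>R T t f)"
    by (rule ex[unfolded RI_def 1(2)[symmetric], unfolded rem_kernel_eq])
  show "bochner_integrable_on (\<lambda>r. ((exp (- r) - (\<Sum>k=0..n. (- r) ^ k / fact k)) / r powr (1 + s)) *\<^sub>R T (y\<^sup>2 / (4 * r)) f) {0<..}"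
    by (rule 2(1)[unfolded exp_rem_def])
  have RI: "(1 / Gamma s) *\<^sub>R RI n s y f = (y powr (2 * s) / (4 powr s * Gamma s)) *\<^sub>R
      bochner_integral_on {0<..} (\<lambda>r. (exp_rem n r / r powr (1 + s)) *\<^sub>R T (y\<^sup>2 / (4 * r)) f)"
    unfolding RI_substitution(2)[OF \<sigma> y] 2(2) scaleR_scaleR by simp
  show "V y = (\<Sum>k=0..n. (y ^ (2 * k) * Gamma (s - real k) / (4 ^ k * fact k * Gamma s)) *\<^sub>R (L ^^ k) u)
      + (y powr (2 * s) / (4 powr s * Gamma s)) *\<^sub>R bochner_integral_on {0<..}
          (\<lambda>r. ((exp (- r) - (\<Sum>k=0..n. (- r) ^ k / fact k)) / r powr (1 + s)) *\<^sub>R T (y\<^sup>2 / (4 * r)) f)"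
    by (rule ex[unfolded RI, unfolded exp_rem_def])
qed

end

theorem theorem1p1:
  fixes T :: "real \<Rightarrow> 'a::banach \<Rightarrow>\<^sub>L 'a"
    and D :: "'a set" and L :: "'a \<Rightarrow> 'a"
    and s a :: real and n :: nat
    and u :: 'a and U :: "real \<Rightarrow> 'a"
  assumes semigroup: "C0_semigroup T"
    and bounded: "uniformly_bounded_semigroup T"
    and generator: "infinitesimal_generator T D L"
    and resolvent: "0 \<in> resolvent_set D L"
    and s: "s > 0" "s \<notin> \<int>"
    and n: "n = nat \<lfloor>s\<rfloor>"
    and a: "a = 1 - 2 * (s - real n)"
    and U: "\<And>y. y > 0 \<Longrightarrow> U y =
      (y powr (2 * s) / (4 powr s * Gamma s)) *\<^sub>R
        bochner_integral_on {0<..} (\<lambda>t. (exp (- y\<^sup>2 / (4 * t)) / t powr (1 + s)) *\<^sub>R T t u)"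
  shows "\<comment> \<open>(a)\<close>
    ((\<forall>y>0. bochner_integrable_on
          (\<lambda>t. (exp (- y\<^sup>2 / (4 * t)) / t powr (1 + s)) *\<^sub>R T t u) {0<..}) \<and>
     (\<forall>k j. Cn_pow_dom j D L k U) \<and>
     continuous_on {0..} (extend0 U) \<and>
     bounded (U ` {0<..}) \<and>
     extension_problem D L a (n + 1) u U \<and>
     extension_problem D L (1 - 2 * s) 1 u U) \<and>
    \<comment> \<open>(b)\<close>
    (\<forall>f. (\<exists>!v. v \<in> neg_frac_dom D L s \<and> neg_frac_power D L s v = f) \<and>
      (u \<in> neg_frac_dom D L s \<and> neg_frac_power D L s u = f \<longrightarrow>
        u \<in> pow_dom D L n \<and>
        (\<forall>y>0.
          bochner_integrable_on (\<lambda>t. ((exp (- y\<^sup>2 / (4 * t))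
              - (\<Sum>k=0..n. (-1) ^ k * y ^ (2 * k) / (fact k * (4 * t) ^ k)))
              / t powr (1 - s)) *\<^sub>R T t f) {0<..} \<and>
          U y = (\<Sum>k=0..n. (y ^ (2 * k) * Gamma (s - real k) / (4 ^ k * fact k * Gamma s))
                    *\<^sub>R (L ^^ k) u)
              + (1 / Gamma s) *\<^sub>R bochner_integral_on {0<..}
                  (\<lambda>t. ((exp (- y\<^sup>2 / (4 * t))
                    - (\<Sum>k=0..n. (-1) ^ k * y ^ (2 * k) / (fact k * (4 * t) ^ k)))
                    / t powr (1 - s)) *\<^sub>R T t f) \<and>
          bochner_integrable_on (\<lambda>r. ((exp (- r) - (\<Sum>k=0..n. (- r) ^ k / fact k))
              / r powr (1 + s)) *\<^sub>R T (y\<^sup>2 / (4 * r)) f) {0<..} \<and>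
          U y = (\<Sum>k=0..n. (y ^ (2 * k) * Gamma (s - real k) / (4 ^ k * fact k * Gamma s))
                    *\<^sub>R (L ^^ k) u)
              + (y powr (2 * s) / (4 powr s * Gamma s)) *\<^sub>R bochner_integral_on {0<..}
                  (\<lambda>r. ((exp (- r) - (\<Sum>k=0..n. (- r) ^ k / fact k))
                    / r powr (1 + s)) *\<^sub>R T (y\<^sup>2 / (4 * r)) f)))) \<and>
    \<comment> \<open>(c)\<close>
    ((u \<in> neg_frac_dom D L s \<longleftrightarrow>
       (\<exists>l. ((\<lambda>y. y powr a *\<^sub>R dy ((ext_op L a ^^ n) U) y) \<longlongrightarrow> l) (at_right 0))) \<and>
     (u \<in> neg_frac_dom D L s \<longleftrightarrow>
       (\<exists>l. ((\<lambda>y. y powr a *\<^sub>R dy ((two_over_y_dy ^^ n) U) y) \<longlongrightarrow> l) (at_right 0))) \<and>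
     (u \<in> neg_frac_dom D L s \<longrightarrow>
       ((\<lambda>y. y powr a *\<^sub>R dy ((ext_op L a ^^ n) U) y) \<longlongrightarrow>
          (c_const s * fact n) *\<^sub>R neg_frac_power D L s u) (at_right 0) \<and>
       ((\<lambda>y. y powr a *\<^sub>R dy ((two_over_y_dy ^^ n) U) y) \<longlongrightarrow>
          c_const s *\<^sub>R neg_frac_power D L s u) (at_right 0))) \<and>
    \<comment> \<open>(d)\<close>
    (u \<in> neg_frac_dom D L s \<longrightarrow>
       higher_order_ivp D L s u U \<and>
       (\<forall>V. higher_order_ivp D L s u V \<longrightarrow> (\<forall>y>0. V y = U y)) \<and>
       second_order_ivp D L s u U \<and>
       (\<forall>V. second_order_ivp D L s u V \<longrightarrow> (\<forall>y>0. V y = U y)))"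
proof -
  from bounded obtain M where "M \<ge> 1" "\<And>t. t \<ge> 0 \<Longrightarrow> norm (T t) \<le> M"
    unfolding uniformly_bounded_semigroup_def by blast
  then have "bounded_semigroup T D L M"
    by (intro bounded_semigroup.intro semigroup generator resolvent)
  then interpret S: bounded_semigroup T D L M .
  define \<sigma> where "\<sigma> = s - real n"
  have fl: "real n = of_int \<lfloor>s\<rfloor>" using s n by simp
  have "of_int \<lfloor>s\<rfloor> \<noteq> s" using s(2) Ints_of_int by metis
  with of_int_floor_le[of s] have "of_int \<lfloor>s\<rfloor> < s" by linarith
  then have \<sigma>: "0 < \<sigma>" "\<sigma> < 1" "s = \<sigma> + real n" unfolding \<sigma>_def fl by linarith+
  have V: "U y = S.U s y u" if "y > 0" for y
    using U[OF that] S.integral_formula(2)[OF s(1) that, of u] by (simp only:)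
  note dom = S.neg_frac_dom_iff[OF \<sigma>] and pow = S.neg_frac_power_eq[OF \<sigma>]
  \<comment> \<open>The preimage under the power of \<open>B\<close> is forced to be
    \<open>neg_frac_power D L s u\<close>, so results stated for a preimage \<open>f\<close> can be
    quoted with this value.\<close>
  have u_eq: "u = S.bal \<sigma> ((S.B ^^ n) (neg_frac_power D L s u))" if uD: "u \<in> neg_frac_dom D L s"
  proof -
    obtain f where f: "u = S.bal \<sigma> ((S.B ^^ n) f)" by (rule exE[OF dom[THEN iffD1, OF uD]])
    show ?thesis unfolding f pow by (rule refl)
  qed
  have partA: "(\<forall>y>0. bochner_integrable_on
          (\<lambda>t. (exp (- y\<^sup>2 / (4 * t)) / t powr (1 + s)) *\<^sub>R T t u) {0<..}) \<and>
     (\<forall>k j. Cn_pow_dom j D L k U) \<and>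
     continuous_on {0..} (extend0 U) \<and>
     bounded (U ` {0<..}) \<and>
     extension_problem D L a (n + 1) u U \<and>
     extension_problem D L (1 - 2 * s) 1 u U"
    unfolding extension_problem_def
    by (intro conjI allI impI S.integral_formula(1)[OF s(1)] S.extension_regularity[OF V \<sigma> a])
  have partB: "(\<exists>!v. v \<in> neg_frac_dom D L s \<and> neg_frac_power D L s v = f)" for f
  proof (rule ex1I)
    show "S.bal \<sigma> ((S.B ^^ n) f) \<in> neg_frac_dom D L s \<and> neg_frac_power D L s (S.bal \<sigma> ((S.B ^^ n) f)) = f"
      unfolding dom pow by (intro conjI refl) (rule exI, rule refl)
    fix v assume v: "v \<in> neg_frac_dom D L s \<and> neg_frac_power D L s v = f"
    obtain g where g: "v = S.bal \<sigma> ((S.B ^^ n) g)" by (rule exE[OF dom[THEN iffD1, OF conjunct1[OF v]]])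
    have "g = f" using conjunct2[OF v] unfolding g pow .
    then show "v = S.bal \<sigma> ((S.B ^^ n) f)" using g by (simp only:)
  qed
  have partB': "u \<in> pow_dom D L n" "u = S.bal \<sigma> ((S.B ^^ n) f)"
    if "u \<in> neg_frac_dom D L s \<and> neg_frac_power D L s u = f" for f
  proof -
    show u: "u = S.bal \<sigma> ((S.B ^^ n) f)" using u_eq[OF conjunct1[OF that]] unfolding conjunct2[OF that] .
    have "u = (S.J ^^ n) (S.bal \<sigma> ((-1) ^ n *\<^sub>R f))" using u S.bal_Bn_eq_Jn[OF \<sigma>(1,2)] by (rule trans)
    then show "u \<in> pow_dom D L n" unfolding S.pow_dom_iff by (rule exI)
  qed
  note lims = S.extension_ivp[OF V \<sigma> a u_eq] S.two_over_iter_dy_tendsto(2)[OF V \<sigma> a u_eq]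
  have hu: "V y = U y" if "u \<in> neg_frac_dom D L s" "higher_order_ivp D L s u V" "y > 0" for V y
    by (rule S.higher_order_ivp_unique[OF s that(2) lims(2)[OF _ that(1)] that(3)])
  have su: "V y = U y" if "u \<in> neg_frac_dom D L s" "second_order_ivp D L s u V" "y > 0" for V y
    by (rule S.second_order_ivp_unique[OF s that(2) lims(3)[OF _ that(1)] that(3)])
  show ?thesis
  proof (rule conjI[OF partA conjI[OF allI conjI]], goal_cases)
    case (1 f)
    show ?case
    proof (rule conjI[OF partB impI], goal_cases)
      case u: 1
      show ?case
        by (intro conjI impI allI partB'(1)[OF u] S.extension_expansion[OF V \<sigma> partB'(2)[OF u]])
    qed
  next
    case 2
    show ?case
      by (intro conjI impI S.neg_frac_dom_iff_tendsto[OF V \<sigma> a] lims; assumption)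
  next
    case 3
    show ?case by (intro conjI impI allI lims hu su; assumption)
  qed
qed

end
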